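(* Let $p$ be a prime. There exists a (3-nilpotent)-by-abelian finitely generated group $\Gamma$, which is a quotient of $A_4(\mathbf{F}_p[t,t^{-1},(t-1)^{-1}])$ by a central subgroup, with at least $2^{\aleph_0}$ pairwise non-bilipschitz homeomorphic, respectively at least $\aleph_0$ pairwise non-homeomorphic, asymptotic cones $\mathrm{Cone}_\omega(\Gamma)$, when $\omega$ ranges over nonprincipal ultrafilters on the set of positive integers.
   Context: $\mathbf{F}_p$ is the field with $p$ elements. For a commutative ring $R$, $A_4(R)$ denotes the group of upper triangular $4\times 4$ matrices over $R$ with diagonal $(1,t_{22},t_{33},1)$, where $t_{22},t_{33}\in R^\times$, and with arbitrary entries $x_{ij}\in R$ for $i<j$. (3-nilpotent)-by-abelian means having a normal subgroup that is nilpotent of class at most $3$ with abelian quotient. A finitely generated group is endowed with a word metric for a finite generating subset. Asymptotic cone: for a metric space $(X,d)$ with base-point $x_0$ and a nonprincipal ultrafilter $\omega$ on the set $\mathbf{N}$ of positive integers, let $\mathrm{Precone}(X)$ be the set of sequences $(x_n)$ in $X$ with $\limsup_n d(x_n,x_0)/n<\infty$, with pseudo-distance $d_\omega(x,y)=\lim_\omega \frac1n d(x_n,y_n)$. Then $\mathrm{Cone}_\omega(X)$ is the metric space obtained by identifying points at pseudo-distance $0$. *)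

theory Defs
  imports
    "HOL-Algebra.Generated_Groups"
    "HOL-Algebra.Coset"
    "HOL-Computational_Algebra.Polynomial_Factorial"
    "HOL-Analysis.Abstract_Metric_Spaces"
    "HOL-Library.Equipollence"
    "HOL-Library.Liminf_Limsup"
    "HOL-Library.Extended_Real"
    "HOL-Library.FuncSet"
    "Jordan_Normal_Form.Matrix"
begin

section \<open>The coefficient ring and the matrix group\<close>

inductive_set generated_subring :: "'a::comm_ring_1 set \<Rightarrow> 'a set" for S where
  gen: "x \<in> S \<Longrightarrow> x \<in> generated_subring S"
| one: "1 \<in> generated_subring S"
| diff: "x \<in> generated_subring S \<Longrightarrow> y \<in> generated_subring S \<Longrightarrow> x - y \<in> generated_subring S"
| mult: "x \<in> generated_subring S \<Longrightarrow> y \<in> generated_subring S \<Longrightarrow> x * y \<in> generated_subring S"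

definition fract_var :: "'k::field poly fract" where
  "fract_var = to_fract [:0, 1:]"

text \<open>The ring $K[t, t^{-1}, (t-1)^{-1}]$, as a subring of the field of fractions $K(t)$.\<close>

definition laurent_ring :: "'k::field poly fract set" where
  "laurent_ring = generated_subring
     (range (\<lambda>c. to_fract [:c:]) \<union> {fract_var, inverse fract_var, inverse (fract_var - 1)})"

text \<open>\<open>A4 R\<close> is the group $A_4(R)$ for a subring \<open>R\<close> of the ambient commutative ring.
  Matrix indices start at 0, so that the diagonal $(1, t_{22}, t_{33}, 1)$ occupies
  the positions $(0,0), \dots, (3,3)$.\<close>

definition A4 :: "'a::comm_ring_1 set \<Rightarrow> 'a mat monoid" where
  "A4 R = \<lparr> carrier = {A \<in> carrier_mat 4 4. upper_triangular A
               \<and> (\<forall>i<4. \<forall>j<4. A $$ (i, j) \<in> R)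
               \<and> A $$ (0, 0) = 1 \<and> A $$ (3, 3) = 1
               \<and> (\<exists>u\<in>R. A $$ (1, 1) * u = 1) \<and> (\<exists>u\<in>R. A $$ (2, 2) * u = 1)},
             monoid.mult = (*), one = 1\<^sub>m 4 \<rparr>"


section \<open>Group-theoretic notions\<close>

definition central_subgroup :: "'a set \<Rightarrow> ('a, 'b) monoid_scheme \<Rightarrow> bool" where
  "central_subgroup Z G \<longleftrightarrow> subgroup Z G
     \<and> (\<forall>z\<in>Z. \<forall>g\<in>carrier G. z \<otimes>\<^bsub>G\<^esub> g = g \<otimes>\<^bsub>G\<^esub> z)"

fun lower_central :: "('a, 'b) monoid_scheme \<Rightarrow> nat \<Rightarrow> 'a set" where
  "lower_central G 0 = carrier G"
| "lower_central G (Suc n) = generate G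
     {x \<otimes>\<^bsub>G\<^esub> y \<otimes>\<^bsub>G\<^esub> inv\<^bsub>G\<^esub> x \<otimes>\<^bsub>G\<^esub> inv\<^bsub>G\<^esub> y | x y. x \<in> carrier G \<and> y \<in> lower_central G n}"

definition nilpotent_of_class_at_most :: "nat \<Rightarrow> ('a, 'b) monoid_scheme \<Rightarrow> bool" where
  "nilpotent_of_class_at_most c G \<longleftrightarrow> group G \<and> lower_central G c = {\<one>\<^bsub>G\<^esub>}"

definition nilpotent_by_abelian :: "nat \<Rightarrow> ('a, 'b) monoid_scheme \<Rightarrow> bool" where
  "nilpotent_by_abelian c G \<longleftrightarrow>
     (\<exists>N. N \<lhd> G \<and> nilpotent_of_class_at_most c (G\<lparr>carrier := N\<rparr>) \<and> comm_group (G Mod N))"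

definition finite_generating_set :: "('a, 'b) monoid_scheme \<Rightarrow> 'a set \<Rightarrow> bool" where
  "finite_generating_set G S \<longleftrightarrow> finite S \<and> S \<subseteq> carrier G \<and> generate G S = carrier G"

definition finitely_generated_group :: "('a, 'b) monoid_scheme \<Rightarrow> bool" where
  "finitely_generated_group G \<longleftrightarrow> group G \<and> (\<exists>S. finite_generating_set G S)"

definition word_length :: "('a, 'b) monoid_scheme \<Rightarrow> 'a set \<Rightarrow> 'a \<Rightarrow> nat" where
  "word_length G S g = (LEAST n. \<exists>w. length w = n \<and> set w \<subseteq> S \<union> m_inv G ` S
     \<and> foldr (\<lambda>x y. x \<otimes>\<^bsub>G\<^esub> y) w \<one>\<^bsub>G\<^esub> = g)"

text \<open>Only meaningful on the carrier; the value 0 elsewhere is there because the locale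
  \<open>Metric_space\<close> demands symmetry and nonnegativity on the whole type.\<close>

definition word_dist :: "('a, 'b) monoid_scheme \<Rightarrow> 'a set \<Rightarrow> 'a \<Rightarrow> 'a \<Rightarrow> real" where
  "word_dist G S x y =
     (if x \<in> carrier G \<and> y \<in> carrier G then real (word_length G S (inv\<^bsub>G\<^esub> x \<otimes>\<^bsub>G\<^esub> y)) else 0)"


section \<open>Asymptotic cones\<close>

text \<open>A nonprincipal ultrafilter on the set \<open>A\<close>: the second conjunct says that \<open>A\<close> itself
  belongs to the ultrafilter.\<close>

definition nonprincipal_ultrafilter_on :: "'a set \<Rightarrow> 'a filter \<Rightarrow> bool" where
  "nonprincipal_ultrafilter_on A \<omega> \<longleftrightarrow>
     \<omega> \<noteq> bot \<and> eventually (\<lambda>n. n \<in> A) \<omega>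
     \<and> (\<forall>P. eventually P \<omega> \<or> eventually (\<lambda>n. \<not> P n) \<omega>)
     \<and> (\<forall>a\<in>A. \<omega> \<noteq> principal {a})"

text \<open>Sequences are indexed by the positive integers; \<open>PiE\<close> pins their irrelevant value at 0.\<close>

definition precone :: "'a set \<Rightarrow> ('a \<Rightarrow> 'a \<Rightarrow> real) \<Rightarrow> 'a \<Rightarrow> (nat \<Rightarrow> 'a) set" where
  "precone M d x0 = {x \<in> {0<..} \<rightarrow>\<^sub>E M. limsup (\<lambda>n. ereal (d (x n) x0 / real n)) < \<infinity>}"

definition omega_dist :: "('a \<Rightarrow> 'a \<Rightarrow> real) \<Rightarrow> nat filter \<Rightarrow> (nat \<Rightarrow> 'a) \<Rightarrow> (nat \<Rightarrow> 'a) \<Rightarrow> real" where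
  "omega_dist d \<omega> x y = Lim \<omega> (\<lambda>n. d (x n) (y n) / real n)"

definition asymptotic_cone :: "'a set \<Rightarrow> ('a \<Rightarrow> 'a \<Rightarrow> real) \<Rightarrow> 'a \<Rightarrow> nat filter \<Rightarrow> (nat \<Rightarrow> 'a) set set" where
  "asymptotic_cone M d x0 \<omega> = precone M d x0 //
     {(x, y). x \<in> precone M d x0 \<and> y \<in> precone M d x0 \<and> omega_dist d \<omega> x y = 0}"

definition asymptotic_cone_dist :: "'a set \<Rightarrow> ('a \<Rightarrow> 'a \<Rightarrow> real) \<Rightarrow> 'a \<Rightarrow> nat filter \<Rightarrow>
    (nat \<Rightarrow> 'a) set \<Rightarrow> (nat \<Rightarrow> 'a) set \<Rightarrow> real" where
  "asymptotic_cone_dist M d x0 \<omega> X Y =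
     (if X \<in> asymptotic_cone M d x0 \<omega> \<and> Y \<in> asymptotic_cone M d x0 \<omega>
      then THE r. \<forall>x\<in>X. \<forall>y\<in>Y. omega_dist d \<omega> x y = r else 0)"

lemma ultrafilter_bounded_convergent:
  fixes f :: "nat \<Rightarrow> real"
  assumes u: "nonprincipal_ultrafilter_on A \<omega>" and b: "eventually (\<lambda>n. \<bar>f n\<bar> \<le> C) \<omega>"
  shows "\<exists>l. (f \<longlongrightarrow> l) \<omega>"
proof -
  have nb: "\<omega> \<noteq> bot" and uf: "\<And>P. eventually P \<omega> \<or> eventually (\<lambda>n. \<not> P n) \<omega>"
    using u by (auto simp: nonprincipal_ultrafilter_on_def)
  let ?F = "filtermap f \<omega>"
  have "eventually (\<lambda>x. x \<in> {-C..C}) ?F"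
    using b by (simp add: eventually_filtermap abs_le_iff minus_le_iff conj_commute)
  moreover have "?F \<noteq> bot" using nb by (simp add: filtermap_bot_iff)
  ultimately obtain l where l: "inf (nhds l) ?F \<noteq> bot"
    using compact_filter[of "{-C..C}"] compact_Icc[of "-C" C] unfolding le_principal by blast
  have "eventually P ?F" if P: "eventually P (nhds l)" for P
  proof (rule ccontr)
    assume "\<not> eventually P ?F"
    then have "eventually (\<lambda>y. \<not> P y) ?F" using uf by (auto simp: eventually_filtermap)
    with P have "eventually (\<lambda>_. False) (inf (nhds l) ?F)" unfolding eventually_inf by blast
    with l show False by (simp add: trivial_limit_def)
  qed
  then have "?F \<le> nhds l" by (simp add: filter_leI)
  then show ?thesis by (auto simp: filterlim_def)
qed

lemma ultrafilter_le_sequentially: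
  assumes u: "nonprincipal_ultrafilter_on {0::nat<..} \<omega>"
  shows "\<omega> \<le> sequentially"
proof -
  have nb: "\<omega> \<noteq> bot" and pos: "eventually (\<lambda>n. n > 0) \<omega>"
    and uf: "\<And>P. eventually P \<omega> \<or> eventually (\<lambda>n. \<not> P n) \<omega>"
    and np: "\<And>a. a > 0 \<Longrightarrow> \<omega> \<noteq> principal {a}"
    using u by (auto simp: nonprincipal_ultrafilter_on_def)
  have ne: "eventually (\<lambda>n. n \<noteq> a) \<omega>" for a
  proof (cases "a = 0")
    case True
    with pos show ?thesis by (auto elim: eventually_mono)
  next
    case False
    show ?thesis
    proof (rule ccontr)
      assume "\<not> ?thesis"
      then have e: "eventually (\<lambda>n. n = a) \<omega>" using uf[of "\<lambda>n. n = a"] by blast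
      have "\<omega> = principal {a}"
      proof (rule antisym)
        show "\<omega> \<le> principal {a}" using e by (simp add: le_principal)
        show "principal {a} \<le> \<omega>"
        proof (rule filter_leI)
          fix P assume "eventually P \<omega>"
          with e have "eventually (\<lambda>n. P a) \<omega>" by eventually_elim simp
          then have "P a" using nb by (cases "P a") (simp_all add: trivial_limit_def)
          then show "eventually P (principal {a})" by (simp add: eventually_principal)
        qed
      qed
      with np[of a] False show False by simp
    qed
  qed
  have "eventually (\<lambda>n. N \<le> n) \<omega>" for N
  proof (induction N)
    case (Suc N)
    from Suc ne[of N] show ?case by eventually_elim simp
  qed simp
  then show ?thesis
    unfolding le_filter_def eventually_sequentially by (blast intro: eventually_mono)
qed

lemma Metric_space_asymptotic_cone:
  assumes "Metric_space M d" "x0 \<in> M" and u: "nonprincipal_ultrafilter_on {0<..} \<omega>"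
  shows "Metric_space (asymptotic_cone M d x0 \<omega>) (asymptotic_cone_dist M d x0 \<omega>)"
proof -
  interpret Metric_space M d by fact
  have le: "\<omega> \<le> sequentially" by (rule ultrafilter_le_sequentially[OF u])
  have nb: "\<omega> \<noteq> bot" and pos: "eventually (\<lambda>n. n > 0) \<omega>"
    using u by (auto simp: nonprincipal_ultrafilter_on_def)
  let ?P = "precone M d x0" and ?D = "omega_dist d \<omega>"
  have mem: "x n \<in> M" if "x \<in> ?P" "n > 0" for x n
    using that by (auto simp: precone_def PiE_iff)
  have bdd: "\<exists>C. eventually (\<lambda>n. d (x n) x0 / real n \<le> C) \<omega>" if "x \<in> ?P" for x
  proof -
    have "limsup (\<lambda>n. ereal (d (x n) x0 / real n)) < \<infinity>" using that by (simp add: precone_def)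
    then obtain C where "limsup (\<lambda>n. ereal (d (x n) x0 / real n)) < ereal C"
      using less_PInf_Ex_of_nat by fastforce
    then have "eventually (\<lambda>n. ereal (d (x n) x0 / real n) < ereal C) sequentially"
      by (rule Limsup_lessD)
    then have "eventually (\<lambda>n. d (x n) x0 / real n \<le> C) sequentially"
      by eventually_elim simp
    with le show ?thesis using filter_leD by blast
  qed
  have lim: "((\<lambda>n. d (x n) (y n) / real n) \<longlongrightarrow> ?D x y) \<omega>" if xy: "x \<in> ?P" "y \<in> ?P" for x y
  proof -
    obtain C E where "eventually (\<lambda>n. d (x n) x0 / real n \<le> C) \<omega>"
      "eventually (\<lambda>n. d (y n) x0 / real n \<le> E) \<omega>" using bdd xy by blast
    with pos have "eventually (\<lambda>n. \<bar>d (x n) (y n) / real n\<bar> \<le> C + E) \<omega>"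
    proof eventually_elim
      case (elim n)
      have "d (x n) (y n) \<le> d (x n) x0 + d (y n) x0"
        using triangle[of "x n" x0 "y n"] mem[OF xy(1)] mem[OF xy(2)] elim assms(2)
        by (simp add: commute)
      then have "d (x n) (y n) / real n \<le> (d (x n) x0 + d (y n) x0) / real n"
        by (rule divide_right_mono) simp
      with elim show ?case by (simp add: add_divide_distrib)
    qed
    from ultrafilter_bounded_convergent[OF u this] obtain l
      where l: "((\<lambda>n. d (x n) (y n) / real n) \<longlongrightarrow> l) \<omega>" by blast
    then show ?thesis using tendsto_Lim[OF nb l] by (simp add: omega_dist_def)
  qed
  have D0: "?D x x = 0" if "x \<in> ?P" for x
  proof -
    have "eventually (\<lambda>n. d (x n) (x n) / real n = 0) \<omega>"
      using pos by eventually_elim (simp add: mem that)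
    then have "((\<lambda>n. d (x n) (x n) / real n) \<longlongrightarrow> 0) \<omega>" by (rule tendsto_eventually)
    then show ?thesis using lim[OF that that] nb tendsto_unique by blast
  qed
  have Dc: "?D x y = ?D y x" for x y by (simp add: omega_dist_def commute)
  have Dn: "0 \<le> ?D x y" if "x \<in> ?P" "y \<in> ?P" for x y
    by (rule tendsto_lowerbound[OF lim[OF that] _ nb]) (simp add: eventually_mono)
  have Dt: "?D x z \<le> ?D x y + ?D y z" if p: "x \<in> ?P" "y \<in> ?P" "z \<in> ?P" for x y z
  proof (rule tendsto_le[OF nb tendsto_add[OF lim lim] lim])
    show "eventually (\<lambda>n. d (x n) (z n) / real n \<le> d (x n) (y n) / real n + d (y n) (z n) / real n) \<omega>"
      using pos
    proof eventually_elim
      case (elim n)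
      have "d (x n) (z n) \<le> d (x n) (y n) + d (y n) (z n)"
        using triangle mem p elim by simp
      then show ?case by (simp add: divide_right_mono flip: add_divide_distrib)
    qed
  qed (use p in auto)
  define R where "R = {(x, y). x \<in> ?P \<and> y \<in> ?P \<and> ?D x y = 0}"
  have equiv: "equiv ?P R"
  proof (rule equivI)
    show "R \<subseteq> ?P \<times> ?P" by (auto simp: R_def)
    show "refl_on ?P R" by (auto simp: refl_on_def R_def D0)
    show "sym R" by (auto simp: sym_def R_def Dc)
    show "trans R"
    proof (rule transI)
      fix x y z assume "(x, y) \<in> R" "(y, z) \<in> R"
      then show "(x, z) \<in> R" using Dt[of x y z] Dn[of x z] by (auto simp: R_def)
    qed
  qed
  have cn: "asymptotic_cone M d x0 \<omega> = ?P // R" by (simp add: asymptotic_cone_def R_def)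
  have memP: "x \<in> ?P" if "X \<in> ?P // R" "x \<in> X" for x X
    using in_quotient_imp_subset[OF equiv that(1)] that(2) by blast
  have cong: "?D x y = ?D x' y'" if "(x, x') \<in> R" "(y, y') \<in> R" for x x' y y'
  proof -
    have p: "x \<in> ?P" "x' \<in> ?P" "y \<in> ?P" "y' \<in> ?P" and z: "?D x x' = 0" "?D y y' = 0"
      using that by (auto simp: R_def)
    show ?thesis
      using Dt[of x x' y] Dt[of x' y' y] Dt[of x' x y'] Dt[of x y y'] p z Dc[of x x'] Dc[of y y']
      by simp
  qed
  have ex: "\<exists>x. x \<in> X" if "X \<in> ?P // R" for X
    using in_quotient_imp_non_empty[OF equiv that] by blast
  have cd: "asymptotic_cone_dist M d x0 \<omega> X Y = ?D x y"
    if "X \<in> ?P // R" "Y \<in> ?P // R" "x \<in> X" "y \<in> Y" for X Y x y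
  proof -
    have "(THE r. \<forall>x\<in>X. \<forall>y\<in>Y. ?D x y = r) = ?D x y"
    proof (rule the_equality)
      show "\<forall>x'\<in>X. \<forall>y'\<in>Y. ?D x' y' = ?D x y"
      proof (intro ballI)
        fix x' y' assume "x' \<in> X" "y' \<in> Y"
        then show "?D x' y' = ?D x y"
          using cong[of x' x y' y] in_quotient_imp_in_rel[OF equiv, of X x' x]
            in_quotient_imp_in_rel[OF equiv, of Y y' y] that by simp
      qed
    next
      fix r assume "\<forall>x\<in>X. \<forall>y\<in>Y. ?D x y = r"
      then have "?D x y = r" using that(3,4) by blast
      then show "r = ?D x y" by (rule sym)
    qed
    then show ?thesis using that by (simp add: asymptotic_cone_dist_def cn)
  qed
  show ?thesis unfolding cn
  proof (unfold_locales)
    fix X Y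
    show "0 \<le> asymptotic_cone_dist M d x0 \<omega> X Y"
    proof (cases "X \<in> ?P // R \<and> Y \<in> ?P // R")
      case True
      then obtain x y where "x \<in> X" "y \<in> Y" using ex by blast
      then show ?thesis using True cd[of X Y x y] Dn[of x y] memP[of X x] memP[of Y y] by simp
    qed (auto simp: asymptotic_cone_dist_def cn)
    show "asymptotic_cone_dist M d x0 \<omega> X Y = asymptotic_cone_dist M d x0 \<omega> Y X"
    proof (cases "X \<in> ?P // R \<and> Y \<in> ?P // R")
      case True
      then obtain x y where "x \<in> X" "y \<in> Y" using ex by blast
      then show ?thesis using True cd[of X Y x y] cd[of Y X y x] Dc[of x y] by simp
    qed (auto simp: asymptotic_cone_dist_def cn)
  next
    fix X Y assume XY: "X \<in> ?P // R" "Y \<in> ?P // R"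
    obtain x y where xy: "x \<in> X" "y \<in> Y" using ex[OF XY(1)] ex[OF XY(2)] by blast
    have "X = Y \<longleftrightarrow> (x, y) \<in> R" using quotient_eq_iff[OF equiv XY xy] .
    also have "\<dots> \<longleftrightarrow> ?D x y = 0" using memP[OF XY(1) xy(1)] memP[OF XY(2) xy(2)] by (simp add: R_def)
    finally show "asymptotic_cone_dist M d x0 \<omega> X Y = 0 \<longleftrightarrow> X = Y"
      unfolding cd[OF XY xy] by (rule sym)
  next
    fix X Y Z assume h: "X \<in> ?P // R" "Y \<in> ?P // R" "Z \<in> ?P // R"
    obtain x y z where m: "x \<in> X" "y \<in> Y" "z \<in> Z" using ex[OF h(1)] ex[OF h(2)] ex[OF h(3)] by blast
    show "asymptotic_cone_dist M d x0 \<omega> X Z \<le> asymptotic_cone_dist M d x0 \<omega> X Y + asymptotic_cone_dist M d x0 \<omega> Y Z"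
      using Dt[of x y z] memP[OF h(1) m(1)] memP[OF h(2) m(2)] memP[OF h(3) m(3)]
        cd[OF h(1,3) m(1,3)] cd[OF h(1,2) m(1,2)] cd[OF h(2,3) m(2,3)] by simp
  qed
qed

definition bilipschitz_homeomorphic ::
    "'a set \<Rightarrow> ('a \<Rightarrow> 'a \<Rightarrow> real) \<Rightarrow> 'b set \<Rightarrow> ('b \<Rightarrow> 'b \<Rightarrow> real) \<Rightarrow> bool" where
  "bilipschitz_homeomorphic M d M' d' \<longleftrightarrow>
     (\<exists>f C. bij_betw f M M' \<and> C \<ge> 1
        \<and> (\<forall>x\<in>M. \<forall>y\<in>M. d x y / C \<le> d' (f x) (f y) \<and> d' (f x) (f y) \<le> C * d x y))"

text \<open>The asymptotic cone of a group with respect to the word metric of a generating set \<open>S\<close>.\<close>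

definition group_cone :: "('a, 'b) monoid_scheme \<Rightarrow> 'a set \<Rightarrow> nat filter \<Rightarrow> (nat \<Rightarrow> 'a) set set" where
  "group_cone G S = asymptotic_cone (carrier G) (word_dist G S) \<one>\<^bsub>G\<^esub>"

definition group_cone_dist :: "('a, 'b) monoid_scheme \<Rightarrow> 'a set \<Rightarrow> nat filter \<Rightarrow>
    (nat \<Rightarrow> 'a) set \<Rightarrow> (nat \<Rightarrow> 'a) set \<Rightarrow> real" where
  "group_cone_dist G S = asymptotic_cone_dist (carrier G) (word_dist G S) \<one>\<^bsub>G\<^esub>"

definition group_cones_bilipschitz ::
    "('a, 'b) monoid_scheme \<Rightarrow> 'a set \<Rightarrow> nat filter \<Rightarrow> nat filter \<Rightarrow> bool" where
  "group_cones_bilipschitz G S \<omega> \<omega>' \<longleftrightarrow>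
     bilipschitz_homeomorphic (group_cone G S \<omega>) (group_cone_dist G S \<omega>)
       (group_cone G S \<omega>') (group_cone_dist G S \<omega>')"

definition group_cones_homeomorphic ::
    "('a, 'b) monoid_scheme \<Rightarrow> 'a set \<Rightarrow> nat filter \<Rightarrow> nat filter \<Rightarrow> bool" where
  "group_cones_homeomorphic G S \<omega> \<omega>' \<longleftrightarrow>
     Metric_space.mtopology (group_cone G S \<omega>) (group_cone_dist G S \<omega>) homeomorphic_space
     Metric_space.mtopology (group_cone G S \<omega>') (group_cone_dist G S \<omega>')"

end

theory Submission
  imports Defs "HOL-Library.Function_Algebras" "HOL-Library.Nat_Bijection"
begin

text \<open>The group is the quotient of $A_4(R)$, $R = K[t,t^{-1},(t-1)^{-1}]$, by the central elements
  whose $(1,4)$ entry is a polynomial with exponents in a very sparse set; the asymptotic cones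
  are told apart by a locally defined cohomology that stands in for their fundamental groups.

The field $K(t)$ has three places $0, 1, \infty$ at which elements of $R$ may have poles, and a
  Horner scheme shows that word length is, up to constants, the largest pole order of the matrix
  entries (\<open>word_length_estimates\<close>). A point of a cone is therefore described by a
  rescaled diagonal part $v \in \mathbf{R}^4$, giving the rates of growth of $P$ and $Q$ in
  $\mathrm{diag}(1,P,Q,1)$ at the places, and by a triple $u = (u_w)$ of unipotent matrices over
  rings of sequences, one per place: strong approximation turns $(u, v)$ into a sequence of
  group elements. Two pairs give the same point if they differ by a unipotent triple that grows
  no faster than $v$ allows, or by a sequence of elements of the central subgroup. The locale
  \<open>cone_model\<close> records exactly this description, and \<open>quotient_cone\<close>
  proves it.

A local cocycle assigns coefficients $c(x,y)$ to pairs of points so that $c$ is additive on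
  small sets; it is exact on a ball if there it is locally a difference $g(y) - g(x)$. On each
  flat $v \mapsto (u,v)$ it is exact. At each place the unipotent group is, by an argument of
  Abels, the amalgam of its subgroups contracted by torus elements, and elements at different
  places commute inside a common flat; hence the potentials on the flats can be matched to one
  potential on all pairs $(u,v)$ (\<open>potential_exists\<close>, \<open>Pot_exists\<close>).
  It is not invariant under the central sequences, but changes by a character \<open>chi\<close>
  of that group. The cocycle is exact on balls of radius $r$ when the character is trivial on
  central sequences of norm up to a multiple of $r$, and only when it is trivial up to a smaller
  multiple (\<open>exact_on_ball\<close>, \<open>chi_zero_if_exact\<close>); every character
  that is trivial near $0$ occurs (\<open>cocycle_from_character\<close>).

The exponents are the numbers $S_j (i+1)!$ with $i$ in the finite set coded by $j$, where $S_j$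
  increases very fast. Along an ultrafilter that sees only those $n = S_j$ whose code is an
  initial part of a set $A$, the central sequences modulo those of norm $0$ have the basis $n
  \mapsto t^{n (i+1)!}$, $i \in A$, of norms $(i+1)!$. Counting cocycles modulo exact ones on
  balls of radius $r$ gives $p$ to the number of $i \in A$ with $(i+1)!$ at most a constant
  times $r$. A bilipschitz map changes only the constants, and as factorials grow faster than
  any geometric sequence, $A$ is recovered up to a finite set; sets of pairs with a prescribed
  first component give $2^{\aleph_0}$ cones. For a finite $A$ one takes whole cones instead of
  balls: homeomorphic cones then have sets $A$ of the same size, which gives $\aleph_0$ cones.\<close>

section \<open>Unipotent matrices of size four\<close>

text \<open>Upper unitriangular matrices, by their entries above the diagonal. Their group is written
  additively, although it is not commutative, so that \<open>sum_list\<close> and the class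
  \<open>group_add\<close> are available.\<close>

datatype 'r ut = UT (u12: 'r) (u13: 'r) (u14: 'r) (u23: 'r) (u24: 'r) (u34: 'r)

instantiation ut :: (comm_ring_1) group_add
begin

definition zero_ut :: "'a ut" where "zero_ut = UT 0 0 0 0 0 0"

definition plus_ut :: "'a ut \<Rightarrow> 'a ut \<Rightarrow> 'a ut" where
  "plus_ut u v = UT (u12 u + u12 v) (u13 u + u13 v + u12 u * u23 v)
     (u14 u + u14 v + u12 u * u24 v + u13 u * u34 v)
     (u23 u + u23 v) (u24 u + u24 v + u23 u * u34 v) (u34 u + u34 v)"

definition uminus_ut :: "'a ut \<Rightarrow> 'a ut" where
  "uminus_ut u = UT (- u12 u) (- u13 u + u12 u * u23 u)
     (- u14 u + u12 u * u24 u + u13 u * u34 u - u12 u * u23 u * u34 u)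
     (- u23 u) (- u24 u + u23 u * u34 u) (- u34 u)"

definition minus_ut :: "'a ut \<Rightarrow> 'a ut \<Rightarrow> 'a ut" where
  "minus_ut u v = u + (- v)"

instance
  by standard (simp_all add: zero_ut_def plus_ut_def uminus_ut_def minus_ut_def algebra_simps)

end

lemma ut_zero_sel [simp]:
  "u12 0 = 0" "u13 0 = 0" "u14 0 = 0" "u23 0 = 0" "u24 0 = 0" "u34 0 = 0"
  by (simp_all add: zero_ut_def)

lemma ut_plus_sel [simp]:
  "u12 (u + v) = u12 u + u12 v"
  "u13 (u + v) = u13 u + u13 v + u12 u * u23 v"
  "u14 (u + v) = u14 u + u14 v + u12 u * u24 v + u13 u * u34 v"
  "u23 (u + v) = u23 u + u23 v"
  "u24 (u + v) = u24 u + u24 v + u23 u * u34 v"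
  "u34 (u + v) = u34 u + u34 v"
  by (simp_all add: plus_ut_def)

lemma ut_uminus_sel [simp]:
  "u12 (- u) = - u12 u"
  "u13 (- u) = - u13 u + u12 u * u23 u"
  "u14 (- u) = - u14 u + u12 u * u24 u + u13 u * u34 u - u12 u * u23 u * u34 u"
  "u23 (- u) = - u23 u"
  "u24 (- u) = - u24 u + u23 u * u34 u"
  "u34 (- u) = - u34 u"
  by (simp_all add: uminus_ut_def)

lemma ut_eqI:
  "u12 u = u12 v \<Longrightarrow> u13 u = u13 v \<Longrightarrow> u14 u = u14 v \<Longrightarrow> u23 u = u23 v \<Longrightarrow> u24 u = u24 v
    \<Longrightarrow> u34 u = u34 v \<Longrightarrow> u = v"
  by (rule ut.expand) simp

abbreviation "E12 x \<equiv> UT x 0 0 0 0 0"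
abbreviation "E13 x \<equiv> UT 0 x 0 0 0 0"
abbreviation "E14 x \<equiv> UT 0 0 x 0 0 0"
abbreviation "E23 x \<equiv> UT 0 0 0 x 0 0"
abbreviation "E24 x \<equiv> UT 0 0 0 0 x 0"
abbreviation "E34 x \<equiv> UT 0 0 0 0 0 x"

text \<open>The last three factors form the first row and the first three the lower block, which is why the
  extension of homomorphisms below splits in the same way.\<close>

lemma ut_elementary_decomposition:
  fixes u :: "'r::comm_ring_1 ut"
  shows "u = E34 (u34 u) + E23 (u23 u) + E24 (u24 u) + E12 (u12 u) + E13 (u13 u) + E14 (u14 u)"
  by (rule ut_eqI) simp_all

section \<open>The amalgam at one place\<close>

text \<open>The set \<open>Lam r\<close> models the sequences whose pole orders grow at rate at most $r$.\<close>

locale ring_filtration =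
  fixes Lam :: "real \<Rightarrow> 'r::comm_ring_1 set"
  assumes Lam_zero: "0 \<in> Lam r"
    and Lam_add: "x \<in> Lam r \<Longrightarrow> y \<in> Lam r \<Longrightarrow> x + y \<in> Lam r"
    and Lam_neg: "x \<in> Lam r \<Longrightarrow> - x \<in> Lam r"
    and Lam_mono: "r \<le> s \<Longrightarrow> x \<in> Lam r \<Longrightarrow> x \<in> Lam s"
    and Lam_mult: "x \<in> Lam r \<Longrightarrow> y \<in> Lam s \<Longrightarrow> x * y \<in> Lam (r + s)"
    and Lam_one: "1 \<in> Lam 0"
begin

definition "A = (\<Union>r. Lam r)"

lemma A_I: "x \<in> Lam r \<Longrightarrow> x \<in> A" by (auto simp: A_def)

lemma A_zero: "0 \<in> A" using Lam_zero by (auto simp: A_def)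
lemma A_one: "1 \<in> A" using Lam_one by (auto simp: A_def)

lemma A_add: "x \<in> A \<Longrightarrow> y \<in> A \<Longrightarrow> x + y \<in> A"
proof -
  assume "x \<in> A" "y \<in> A"
  then obtain r s where "x \<in> Lam r" "y \<in> Lam s" by (auto simp: A_def)
  hence "x \<in> Lam (max r s)" "y \<in> Lam (max r s)"
    by (meson Lam_mono max.cobounded1 max.cobounded2)+
  thus ?thesis using Lam_add A_I by blast
qed

lemma A_mult: "x \<in> A \<Longrightarrow> y \<in> A \<Longrightarrow> x * y \<in> A"
  unfolding A_def using Lam_mult by blast

lemma A_neg: "x \<in> A \<Longrightarrow> - x \<in> A"
  using Lam_neg by (auto simp: A_def)

definition UA :: "'r ut set" where
  "UA = {u. u12 u \<in> A \<and> u13 u \<in> A \<and> u14 u \<in> A \<and> u23 u \<in> A \<and> u24 u \<in> A \<and> u34 u \<in> A}"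

text \<open>Unipotent matrices that the torus element with growth rates $(a, b)$ contracts into norm at most
  $s$: the weight of the $(i,j)$ entry is $d_j - d_i$ for $d = (0, a, b, 0)$.\<close>

definition Ub :: "real \<Rightarrow> real \<Rightarrow> real \<Rightarrow> 'r ut set" where
  "Ub a b s = {u. u12 u \<in> Lam (a + s) \<and> u13 u \<in> Lam (b + s) \<and> u14 u \<in> Lam s
     \<and> u23 u \<in> Lam (b - a + s) \<and> u24 u \<in> Lam (- a + s) \<and> u34 u \<in> Lam (- b + s)}"

lemma Lam_mult': "x \<in> Lam r \<Longrightarrow> y \<in> Lam s \<Longrightarrow> r + s \<le> t \<Longrightarrow> x * y \<in> Lam t"
  using Lam_mult Lam_mono by blast

lemma Ub_subset_UA: "Ub a b s \<subseteq> UA"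
  by (auto simp: Ub_def UA_def intro: A_I)

lemma Ub_zero: "0 \<in> Ub a b s"
  by (simp add: Ub_def Lam_zero)

lemma Lam_mono': "x \<in> Lam r \<Longrightarrow> r \<le> s \<Longrightarrow> x \<in> Lam s"
  using Lam_mono by blast

lemma Ub_add:
  assumes "0 \<le> s" "0 \<le> t" "u \<in> Ub a b s" "v \<in> Ub a b t"
  shows "u + v \<in> Ub a b (s + t)"
  unfolding Ub_def mem_Collect_eq ut_plus_sel
  using assms unfolding Ub_def mem_Collect_eq
  by (elim conjE, intro conjI Lam_add)
     ((erule Lam_mono', simp) | (erule (1) Lam_mult', simp))+

lemma Ub_add0: "u \<in> Ub a b 0 \<Longrightarrow> v \<in> Ub a b 0 \<Longrightarrow> u + v \<in> Ub a b 0"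
  using Ub_add[of 0 0 u a b v] by simp

lemma Lam_diff: "x \<in> Lam r \<Longrightarrow> y \<in> Lam r \<Longrightarrow> x - y \<in> Lam r"
  using Lam_add[OF _ Lam_neg] by fastforce

lemma Ub_neg:
  assumes "0 \<le> s" "u \<in> Ub a b s"
  shows "- u \<in> Ub a b (3 * s)"
proof -
  have "u12 u * u23 u \<in> Lam (b + 2 * s)" using assms(2) by (auto simp: Ub_def elim!: Lam_mult')
  moreover have "u34 u \<in> Lam (- b + s)" using assms(2) by (auto simp: Ub_def)
  ultimately have "u12 u * u23 u * u34 u \<in> Lam (3 * s)" by (rule Lam_mult') simp
  thus ?thesis
    using assms unfolding Ub_def mem_Collect_eq ut_uminus_sel
    by (elim conjE, intro conjI Lam_add Lam_diff Lam_neg)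
       ((erule Lam_mono', simp) | (erule (1) Lam_mult', simp))+
qed

lemma UA_add: "u \<in> UA \<Longrightarrow> v \<in> UA \<Longrightarrow> u + v \<in> UA"
  by (auto simp: UA_def intro!: A_add A_mult)

lemma UA_neg: "u \<in> UA \<Longrightarrow> - u \<in> UA"
  by (auto simp: UA_def diff_conv_add_uminus simp del: add_uminus_conv_diff intro!: A_add A_mult A_neg)

lemma UA_zero: "0 \<in> UA" by (simp add: UA_def A_zero)

end

text \<open>The minus signs are those of a noncommutative group: these are the commutator and the conjugate.\<close>

definition commut :: "'h::group_add \<Rightarrow> 'h \<Rightarrow> 'h" where
  "commut a b = a + b - a - b"

definition conj_by :: "'h::group_add \<Rightarrow> 'h \<Rightarrow> 'h" where
  "conj_by g a = g + a - g"

lemma conj_by_add: "conj_by g (a + b) = conj_by g a + conj_by g b"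
  by (simp add: conj_by_def diff_conv_add_uminus add.assoc del: add_uminus_conv_diff)

lemma conj_by_uminus: "conj_by g (- a) = - conj_by g a"
  by (simp add: conj_by_def diff_conv_add_uminus add.assoc minus_add del: add_uminus_conv_diff)

lemma conj_by_commut: "conj_by g (commut a b) = commut (conj_by g a) (conj_by g b)"
  by (simp add: commut_def diff_conv_add_uminus conj_by_add conj_by_uminus del: add_uminus_conv_diff)

lemma conj_by_fixed: "conj_by g a = a \<longleftrightarrow> g + a = a + g"
  by (simp add: conj_by_def diff_eq_eq)

lemma commut_cancel:
  fixes a b :: "'h::group_add"
  shows "a + b = commut a b + b + a"
  by (simp add: commut_def diff_conv_add_uminus add.assoc del: add_uminus_conv_diff)

lemma commut_add_left:
  assumes "q + r = r + q"
  shows "commut (p + q) r = commut p r"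
proof -
  have "p + q + r = p + r + q" by (simp add: add.assoc assms)
  thus ?thesis
    by (simp add: commut_def diff_conv_add_uminus add.assoc minus_add del: add_uminus_conv_diff)
qed

lemma commut_add_right':
  "commut r (p + q) = commut r p + conj_by p (commut r q)"
  by (simp add: commut_def conj_by_def diff_conv_add_uminus add.assoc minus_add del: add_uminus_conv_diff)

lemma commut_swap: "commut b a = - commut a b"
  by (simp add: commut_def diff_conv_add_uminus add.assoc minus_add del: add_uminus_conv_diff)

lemma fixed_commut:
  assumes "g + a = a + g" "g + b = b + g"
  shows "g + commut a b = commut a b + g"
  using assms by (simp add: conj_by_fixed[symmetric] conj_by_commut)

text \<open>Abels' observation: the full unipotent group is the colimit of the contracted subgroups
  \<open>Ub a b 0\<close>, so that compatible homomorphisms on these extend to the whole group.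
  Every elementary matrix except \<open>E14\<close> is contracted by a suitable torus element,
  and every Steinberg relation between two of them that do not produce \<open>E14\<close> holds
  in one contracted subgroup. The relations for the \<open>(1,4)\<close> entry have to be
  deduced.\<close>

locale abels_amalgam = ring_filtration Lam for Lam :: "real \<Rightarrow> 'r::comm_ring_1 set" +
  fixes rho :: "real \<Rightarrow> real \<Rightarrow> 'r ut \<Rightarrow> 'h::group_add"
  assumes rho_add: "u \<in> Ub a b 0 \<Longrightarrow> v \<in> Ub a b 0 \<Longrightarrow> rho a b (u + v) = rho a b u + rho a b v"
    and rho_compat: "u \<in> Ub a b 0 \<Longrightarrow> u \<in> Ub a' b' 0 \<Longrightarrow> rho a b u = rho a' b' u"
begin

definition lev :: "'r \<Rightarrow> real" where "lev x = (SOME r. x \<in> Lam r)"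

lemma lev: "x \<in> A \<Longrightarrow> x \<in> Lam (lev x)"
  unfolding lev_def A_def by (auto intro: someI)

text \<open>Images of elementary matrices, defined by any torus element that contracts them; by
  \<open>e_eq\<close> the choice does not matter.\<close>

definition "e12 x = rho (lev x) 0 (E12 x)"
definition "e13 x = rho 0 (lev x) (E13 x)"
definition "e23 x = rho 0 (lev x) (E23 x)"
definition "e24 x = rho (- lev x) 0 (E24 x)"
definition "e34 x = rho 0 (- lev x) (E34 x)"

lemma e_eq:
  "x \<in> Lam a \<Longrightarrow> e12 x = rho a b (E12 x)"
  "x \<in> Lam b \<Longrightarrow> e13 x = rho a b (E13 x)"
  "x \<in> Lam (b - a) \<Longrightarrow> e23 x = rho a b (E23 x)"
  "x \<in> Lam (- a) \<Longrightarrow> e24 x = rho a b (E24 x)"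
  "x \<in> Lam (- b) \<Longrightarrow> e34 x = rho a b (E34 x)"
  using lev[OF A_I, of x a] lev[OF A_I, of x b] lev[OF A_I, of x "b - a"]
    lev[OF A_I, of x "- a"] lev[OF A_I, of x "- b"]
  by (auto simp: e12_def e13_def e23_def e24_def e34_def Ub_def Lam_zero intro!: rho_compat)

lemma mem_E:
  "x \<in> Lam a \<Longrightarrow> E12 x \<in> Ub a b 0"
  "x \<in> Lam b \<Longrightarrow> E13 x \<in> Ub a b 0"
  "x \<in> Lam (b - a) \<Longrightarrow> E23 x \<in> Ub a b 0"
  "x \<in> Lam (- a) \<Longrightarrow> E24 x \<in> Ub a b 0"
  "x \<in> Lam (- b) \<Longrightarrow> E34 x \<in> Ub a b 0"
  "x \<in> Lam 0 \<Longrightarrow> E14 x \<in> Ub a b 0"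
  by (auto simp: Ub_def Lam_zero)

lemma A_common:
  assumes "x \<in> A" "y \<in> A"
  obtains r where "x \<in> Lam r" "y \<in> Lam r"
  using Lam_mono[OF max.cobounded1 lev[OF assms(1)]] Lam_mono[OF max.cobounded2 lev[OF assms(2)]]
  by blast

lemma e_add:
  assumes "x \<in> A" "y \<in> A"
  shows "e12 (x + y) = e12 x + e12 y" "e13 (x + y) = e13 x + e13 y" "e23 (x + y) = e23 x + e23 y"
    "e24 (x + y) = e24 x + e24 y" "e34 (x + y) = e34 x + e34 y"
proof -
  obtain r where r: "x \<in> Lam r" "y \<in> Lam r" using A_common[OF assms] .
  have s: "E12 (x + y) = E12 x + E12 y" "E13 (x + y) = E13 x + E13 y" "E23 (x + y) = E23 x + E23 y"
    "E24 (x + y) = E24 x + E24 y" "E34 (x + y) = E34 x + E34 y"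
    by (simp_all add: plus_ut_def)
  show "e12 (x + y) = e12 x + e12 y"
    using r Lam_add[OF r] by (simp add: e_eq(1)[where a = r and b = 0] s rho_add mem_E)
  show "e13 (x + y) = e13 x + e13 y"
    using r Lam_add[OF r] by (simp add: e_eq(2)[where a = 0 and b = r] s rho_add mem_E)
  show "e23 (x + y) = e23 x + e23 y"
    using r Lam_add[OF r] by (simp add: e_eq(3)[where a = 0 and b = r] s rho_add mem_E)
  show "e24 (x + y) = e24 x + e24 y"
    using r Lam_add[OF r] by (simp add: e_eq(4)[where a = "- r" and b = 0] s rho_add mem_E)
  show "e34 (x + y) = e34 x + e34 y"
    using r Lam_add[OF r] by (simp add: e_eq(5)[where a = 0 and b = "- r"] s rho_add mem_E)
qed

lemma e_zero: "e12 0 = 0" "e13 0 = 0" "e23 0 = 0" "e24 0 = 0" "e34 0 = 0"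
  using e_add[OF A_zero A_zero] by (metis add.right_neutral add_left_cancel)+

lemma e_neg:
  assumes "x \<in> A"
  shows "e12 (- x) = - e12 x" "e13 (- x) = - e13 x" "e23 (- x) = - e23 x"
    "e24 (- x) = - e24 x" "e34 (- x) = - e34 x"
  using e_add[OF assms A_neg[OF assms]] by (simp_all add: e_zero minus_unique)

text \<open>For given $x$ and $y$ each pair of roots lies in a half plane on which both entries can be
  contracted at once.\<close>

lemma e_relations:
  assumes x: "x \<in> A" and y: "y \<in> A"
  shows e12_e23: "e12 x + e23 y = e23 y + e12 x + e13 (x * y)"
    and e23_e34: "e23 x + e34 y = e34 y + e23 x + e24 (x * y)"
    and e12_e13: "e12 x + e13 y = e13 y + e12 x"
    and e12_e34: "e12 x + e34 y = e34 y + e12 x"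
    and e13_e23: "e13 x + e23 y = e23 y + e13 x"
    and e13_e24: "e13 x + e24 y = e24 y + e13 x"
    and e24_e34: "e24 x + e34 y = e34 y + e24 x"
    and e23_e24: "e23 x + e24 y = e24 y + e23 x"
proof -
  let ?r = "lev x" and ?s = "lev y"
  have rs: "x \<in> Lam ?r" "y \<in> Lam ?s" using x y by (auto intro: lev)
  have xy: "x * y \<in> Lam (?r + ?s)" using Lam_mult rs .
  have com: "rho a b u + rho a b v = rho a b v + rho a b u"
    if "u \<in> Ub a b 0" "v \<in> Ub a b 0" "u + v = v + u" for a b u v
    using that by (metis rho_add)
  have com3: "rho a b u + rho a b v = rho a b v + rho a b u + rho a b w"
    if "u \<in> Ub a b 0" "v \<in> Ub a b 0" "w \<in> Ub a b 0" "u + v = v + u + w" for a b u v w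
    using that by (metis rho_add Ub_add0)
  show "e12 x + e23 y = e23 y + e12 x + e13 (x * y)"
    using rs xy e_eq(1)[of x ?r "?r + ?s"] e_eq(3)[of y "?r + ?s" ?r] e_eq(2)[of "x * y" "?r + ?s" ?r]
    by (auto simp: plus_ut_def intro!: com3 mem_E)
  show "e23 x + e34 y = e34 y + e23 x + e24 (x * y)"
    using rs xy e_eq(3)[of x "- ?s" "- ?r - ?s"] e_eq(5)[of y "- ?s" "- ?r - ?s"]
       e_eq(4)[of "x * y" "- ?r - ?s" "- ?s"]
    by (auto simp: plus_ut_def add.commute intro!: com3 mem_E)
  show "e12 x + e13 y = e13 y + e12 x"
    using rs e_eq(1)[of x ?r ?s] e_eq(2)[of y ?s ?r]
    by (auto simp: plus_ut_def intro!: com mem_E)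
  show "e12 x + e34 y = e34 y + e12 x"
    using rs e_eq(1)[of x ?r "- ?s"] e_eq(5)[of y "- ?s" ?r]
    by (auto simp: plus_ut_def intro!: com mem_E)
  show "e13 x + e23 y = e23 y + e13 x"
    using rs e_eq(2)[of x ?r "?r - ?s"] e_eq(3)[of y ?r "?r - ?s"]
    by (auto simp: plus_ut_def intro!: com mem_E)
  show "e13 x + e24 y = e24 y + e13 x"
    using rs e_eq(2)[of x ?r "- ?s"] e_eq(4)[of y "- ?s" ?r]
    by (auto simp: plus_ut_def intro!: com mem_E)
  show "e24 x + e34 y = e34 y + e24 x"
    using rs e_eq(4)[of x "- ?r" "- ?s"] e_eq(5)[of y "- ?s" "- ?r"]
    by (auto simp: plus_ut_def intro!: com mem_E)
  show "e23 x + e24 y = e24 y + e23 x"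
    using rs e_eq(3)[of x "?r - ?s" "- ?s"] e_eq(4)[of y "- ?s" "?r - ?s"]
    by (auto simp: plus_ut_def intro!: com mem_E)
qed

text \<open>The two commutators that should both be the elementary matrix with $(1,4)$ entry $xy$.\<close>

definition "c x y = commut (e12 x) (e24 y)"
definition "d x y = commut (e13 x) (e34 y)"

lemma conj_e23_e12:
  assumes "x \<in> A" "z \<in> A"
  shows "conj_by (e23 z) (e12 x) = e12 x + e13 (- (x * z))"
proof -
  have m: "x * z \<in> A" using A_mult assms by blast
  have "e23 z + e12 x = e12 x + e23 z - e13 (x * z)"
    using e12_e23[OF assms] by (simp add: eq_diff_eq)
  also have "\<dots> = e12 x + e13 (- (x * z)) + e23 z"
    using e13_e23[OF A_neg[OF m] assms(2)]
    by (simp add: e_neg m diff_conv_add_uminus add.assoc del: add_uminus_conv_diff)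
  finally show ?thesis by (simp add: conj_by_def diff_eq_eq)
qed

lemma conj_e34_e23:
  assumes "y \<in> A" "z \<in> A"
  shows "conj_by (e34 z) (e23 y) = e23 y + e24 (- (y * z))"
proof -
  have m: "y * z \<in> A" using A_mult assms by blast
  have "e34 z + e23 y = e23 y + e34 z - e24 (y * z)"
    using e23_e34[OF assms] by (simp add: eq_diff_eq)
  also have "\<dots> = e23 y + e24 (- (y * z)) + e34 z"
    using e24_e34[OF A_neg[OF m] assms(2)]
    by (simp add: e_neg m diff_conv_add_uminus add.assoc del: add_uminus_conv_diff)
  finally show ?thesis by (simp add: conj_by_def diff_eq_eq)
qed

lemma c_e23:
  assumes "x \<in> A" "y \<in> A" "z \<in> A"
  shows "conj_by (e23 z) (c x y) = c x y"
proof -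
  have m: "- (x * z) \<in> A" using A_mult A_neg assms by blast
  have "conj_by (e23 z) (e24 y) = e24 y" using e23_e24 assms by (simp add: conj_by_fixed)
  thus ?thesis
    using assms commut_add_left[OF e13_e24[OF m assms(2)]]
    by (simp add: c_def conj_by_commut conj_e23_e12)
qed

lemma e13_as_commut:
  assumes "x \<in> A" "y \<in> A"
  shows "e13 (x * y) = commut (e12 x) (e23 y)"
proof -
  have m: "x * y \<in> A" using A_mult assms by blast
  have "commut (e12 x) (e23 y) + e23 y + e12 x = e12 x + e23 y"
    by (rule commut_cancel[symmetric])
  also have "\<dots> = e23 y + (e12 x + e13 (x * y))" using e12_e23[OF assms] by (simp only: add.assoc)
  also have "\<dots> = (e23 y + e13 (x * y)) + e12 x" unfolding e12_e13[OF assms(1) m] by (simp only: add.assoc)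
  also have "\<dots> = e13 (x * y) + e23 y + e12 x" unfolding e13_e23[OF m assms(2)] ..
  finally show ?thesis by (simp only: add_right_cancel)
qed

text \<open>Conjugating $e_{13}(xy) = [e_{12}(x), e_{23}(y)]$ by $e_{34}(z)$ gives $d(xy, z)$ on the left,
  and on the right it only changes $e_{23}(y)$ by $e_{24}(-yz)$, which contributes $c(x, yz)$.\<close>

lemma c_eq_d:
  assumes "x \<in> A" "y \<in> A" "z \<in> A"
  shows "c x (y * z) = d (x * y) z"
proof -
  have m: "y * z \<in> A" "x * y \<in> A" using A_mult assms by auto
  have "conj_by (e34 z) (e13 (x * y)) = commut (e12 x) (e23 y + e24 (- (y * z)))"
    using assms e12_e34[OF assms(1,3)] conj_by_fixed[of "e34 z" "e12 x"]
    by (simp add: e13_as_commut conj_by_commut conj_e34_e23)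
  also have "\<dots> = e13 (x * y) + c x (- (y * z))"
    using c_e23[OF assms(1) A_neg[OF m(1)] assms(2)] assms
    by (simp add: commut_add_right' c_def e13_as_commut)
  finally have 1: "commut (e34 z) (e13 (x * y)) = e13 (x * y) + c x (- (y * z)) - e13 (x * y)"
    by (simp add: commut_def conj_by_def)
  have "conj_by (e13 (x * y)) (c x (- (y * z))) = c x (- (y * z))"
    unfolding c_def conj_by_fixed
    using e12_e13[OF assms(1) m(2)] e13_e24[OF m(2) A_neg[OF m(1)]] by (intro fixed_commut) auto
  hence "commut (e34 z) (e13 (x * y)) = c x (- (y * z))"
    using 1 by (simp add: conj_by_def)
  hence 2: "d (x * y) z = - c x (- (y * z))"
    by (simp add: d_def commut_swap[of "e13 (x * y)"])
  have "c x (y * z) + conj_by (e24 (y * z)) (c x (- (y * z))) = 0"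
    unfolding c_def commut_add_right'[symmetric]
    using e_add(4)[OF m(1) A_neg[OF m(1)]] by (simp add: e_zero commut_def)
  moreover have "conj_by (e24 (y * z)) (c x (- (y * z))) = conj_by (e24 (y * z)) (- d (x * y) z)"
    using 2 by simp
  moreover have "conj_by (e24 (y * z)) (d (x * y) z) = d (x * y) z"
    unfolding d_def conj_by_fixed
    using e13_e24[OF m(2) m(1)] e24_e34[OF m(1) assms(3)] by (intro fixed_commut) auto
  ultimately have "c x (y * z) + - d (x * y) z = 0" by (simp add: conj_by_uminus)
  thus ?thesis by (simp add: diff_conv_add_uminus[symmetric])
qed

text \<open>With one argument equal to $1$ the previous identity shows that both commutators depend only on
  the product of their arguments.\<close>

definition "e14 x = c x 1"

lemma c_e14: "x \<in> A \<Longrightarrow> y \<in> A \<Longrightarrow> c x y = e14 (x * y)"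
  using c_eq_d[of x y 1] c_eq_d[of "x * y" 1 1] A_one A_mult by (simp add: e14_def)

lemma d_e14: "x \<in> A \<Longrightarrow> y \<in> A \<Longrightarrow> d x y = e14 (x * y)"
  using c_eq_d[of x 1 y] A_one by (simp add: c_e14)

lemma e14_central:
  assumes "x \<in> A" "y \<in> A"
  shows "e12 y + e14 x = e14 x + e12 y" "e13 y + e14 x = e14 x + e13 y" "e23 y + e14 x = e14 x + e23 y"
    "e24 y + e14 x = e14 x + e24 y" "e34 y + e14 x = e14 x + e34 y"
proof -
  have d: "e14 x = d x 1" using d_e14[OF assms(1) A_one] by simp
  note [simp] = e12_e13[OF assms(2) assms(1)] e12_e34[OF assms(2) A_one] e13_e24[OF assms(1,2)]
    e24_e34[OF assms(2) A_one] e12_e13[OF assms] e13_e24[OF assms(2) A_one] e12_e34[OF assms]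
    e24_e34[OF A_one assms(2)]
  show "e12 y + e14 x = e14 x + e12 y" unfolding d d_def by (intro fixed_commut) simp_all
  show "e24 y + e14 x = e14 x + e24 y" unfolding d d_def by (intro fixed_commut) simp_all
  show "e13 y + e14 x = e14 x + e13 y" unfolding e14_def c_def by (intro fixed_commut) simp_all
  show "e34 y + e14 x = e14 x + e34 y" unfolding e14_def c_def by (intro fixed_commut) simp_all
  show "e23 y + e14 x = e14 x + e23 y"
    using c_e23[OF assms(1) A_one assms(2)] by (simp add: e14_def conj_by_fixed)
qed

lemma e14_add:
  assumes "x \<in> A" "y \<in> A"
  shows "e14 (x + y) = e14 x + e14 y"
proof -
  have "e14 (x + y) = c 1 (x + y)" using c_e14[OF A_one A_add[OF assms]] by simp
  also have "\<dots> = c 1 x + conj_by (e24 x) (c 1 y)"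
    by (simp add: c_def e_add assms commut_add_right')
  also have "\<dots> = e14 x + e14 y"
    using e14_central(4)[OF assms(2,1)] c_e14[OF A_one assms(1)] c_e14[OF A_one assms(2)]
    by (simp add: conj_by_fixed)
  finally show ?thesis .
qed

lemma swap_left: "a + b = b + a \<Longrightarrow> a + (b + z) = b + (a + z)" for a b z :: 'h
  by (metis add.assoc)

lemma e14_right:
  assumes "x \<in> A" "y \<in> A"
  shows "e14 x + e12 y = e12 y + e14 x" "e14 x + e13 y = e13 y + e14 x" "e14 x + e23 y = e23 y + e14 x"
    "e14 x + e24 y = e24 y + e14 x" "e14 x + e34 y = e34 y + e14 x"
    "e14 x + (e12 y + z) = e12 y + (e14 x + z)" "e14 x + (e13 y + z) = e13 y + (e14 x + z)"
    "e14 x + (e23 y + z) = e23 y + (e14 x + z)" "e14 x + (e24 y + z) = e24 y + (e14 x + z)"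
    "e14 x + (e34 y + z) = e34 y + (e14 x + z)"
  using e14_central[OF assms] by (auto intro!: swap_left)

text \<open>Normal form: lower block times first row. Moving a row past a block is the only nontrivial
  rewriting needed.\<close>

definition row :: "'r \<Rightarrow> 'r \<Rightarrow> 'r \<Rightarrow> 'h" where "row a b k = e12 a + e13 b + e14 k"
definition blk :: "'r \<Rightarrow> 'r \<Rightarrow> 'r \<Rightarrow> 'h" where "blk f g h = e34 f + e23 g + e24 h"

definition ext :: "'r ut \<Rightarrow> 'h" where
  "ext u = blk (u34 u) (u23 u) (u24 u) + row (u12 u) (u13 u) (u14 u)"

lemma row_e34:
  assumes "a \<in> A" "b \<in> A" "k \<in> A" "f \<in> A"
  shows "row a b k + e34 f = e34 f + row a b (k + b * f)"
proof -
  have m: "b * f \<in> A" using A_mult assms by blast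
  have "row a b k + e34 f = e12 a + (e13 b + e34 f) + e14 k"
    by (simp add: row_def add.assoc e14_right assms)
  also have "e13 b + e34 f = e34 f + e13 b + e14 (b * f)"
    using commut_cancel[of "e13 b" "e34 f"] d_e14[OF assms(2,4)] 
    by (simp add: d_def add.assoc e14_right m assms)
  also have "e12 a + (e34 f + e13 b + e14 (b * f)) + e14 k = (e12 a + e34 f) + e13 b + e14 (b * f + k)"
    by (simp add: add.assoc e14_add m assms)
  finally show ?thesis by (simp add: e12_e34 assms row_def add.assoc add.commute[of k])
qed

lemma row_e23:
  assumes "a \<in> A" "b \<in> A" "k \<in> A" "g \<in> A"
  shows "row a b k + e23 g = e23 g + row a (b + a * g) k"
proof -
  have m: "a * g \<in> A" using A_mult assms by blast
  have "row a b k + e23 g = (e12 a + e23 g) + e13 b + e14 k"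
    using e13_e23[OF assms(2,4)] swap_left[OF e13_e23[OF assms(2,4)]]
    by (simp add: row_def add.assoc e14_right assms)
  also have "\<dots> = e23 g + e12 a + (e13 (a * g) + e13 b) + e14 k"
    by (simp add: e12_e23 assms add.assoc)
  also have "e13 (a * g) + e13 b = e13 (b + a * g)"
    by (simp add: e_add(2)[OF m assms(2), symmetric] add.commute)
  finally show ?thesis by (simp add: row_def add.assoc)
qed

lemma row_e24:
  assumes "a \<in> A" "b \<in> A" "k \<in> A" "h \<in> A"
  shows "row a b k + e24 h = e24 h + row a b (k + a * h)"
proof -
  have m: "a * h \<in> A" using A_mult assms by blast
  have "row a b k + e24 h = (e12 a + e24 h) + e13 b + e14 k"
    using e13_e24[OF assms(2,4)] swap_left[OF e13_e24[OF assms(2,4)]]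
    by (simp add: row_def add.assoc e14_right assms)
  also have "e12 a + e24 h = e24 h + e12 a + e14 (a * h)"
    using commut_cancel[of "e12 a" "e24 h"] c_e14[OF assms(1,4)] 
    by (simp add: c_def add.assoc e14_right m assms)
  also have "e24 h + e12 a + e14 (a * h) + e13 b + e14 k = e24 h + e12 a + e13 b + (e14 k + e14 (a * h))"
    using e14_add[OF assms(3) m] e14_add[OF m assms(3)]
    by (simp add: add.assoc e14_right m assms add.commute[of k])
  finally show ?thesis by (simp add: row_def add.assoc e14_add assms m)
qed

lemma row_row:
  assumes "a \<in> A" "b \<in> A" "k \<in> A" "a' \<in> A" "b' \<in> A" "k' \<in> A"
  shows "row a b k + row a' b' k' = row (a + a') (b + b') (k + k')"
proof -
  have "row a b k + row a' b' k' = e12 a + e13 b + (e14 k + (e12 a' + e13 b')) + e14 k'"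
    by (simp add: row_def add.assoc)
  also have "e14 k + (e12 a' + e13 b') = e12 a' + e13 b' + e14 k"
    by (simp add: add.assoc e14_right assms)
  also have "e12 a + e13 b + (e12 a' + e13 b' + e14 k) + e14 k'
      = e12 a + (e13 b + e12 a') + e13 b' + (e14 k + e14 k')" by (simp add: add.assoc)
  also have "e13 b + e12 a' = e12 a' + e13 b" using e12_e13[OF assms(4,2)] by simp
  finally show ?thesis by (simp add: row_def add.assoc e_add e14_add assms)
qed

lemma blk_blk:
  assumes "f \<in> A" "g \<in> A" "h \<in> A" "f' \<in> A" "g' \<in> A" "h' \<in> A"
  shows "blk f g h + blk f' g' h' = blk (f + f') (g + g') (h + h' + g * f')"
proof -
  have m: "g * f' \<in> A" using A_mult assms by blast
  have "blk f g h + blk f' g' h' = e34 f + e23 g + (e24 h + e34 f') + e23 g' + e24 h'"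
    by (simp add: blk_def add.assoc)
  also have "e24 h + e34 f' = e34 f' + e24 h" using e24_e34 assms by simp
  also have "e34 f + e23 g + (e34 f' + e24 h) + e23 g' + e24 h'
     = e34 f + (e23 g + e34 f') + (e24 h + e23 g') + e24 h'" by (simp add: add.assoc)
  also have "e23 g + e34 f' = e34 f' + e23 g + e24 (g * f')" using e23_e34 assms by simp
  also have "e24 h + e23 g' = e23 g' + e24 h" using e23_e24 assms by simp
  also have "e34 f + (e34 f' + e23 g + e24 (g * f')) + (e23 g' + e24 h) + e24 h'
     = e34 f + e34 f' + e23 g + (e24 (g * f') + e23 g') + (e24 h + e24 h')" by (simp add: add.assoc)
  also have "e24 (g * f') + e23 g' = e23 g' + e24 (g * f')" using e23_e24[OF assms(5) m] by simp
  also have "e34 f + e34 f' + e23 g + (e23 g' + e24 (g * f')) + (e24 h + e24 h')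
     = (e34 f + e34 f') + (e23 g + e23 g') + (e24 (g * f') + (e24 h + e24 h'))" by (simp add: add.assoc)
  also have "e24 (g * f') + (e24 h + e24 h') = e24 (h + h' + g * f')"
    by (simp add: e_add[symmetric] m assms A_add add_ac)
  finally show ?thesis by (simp add: blk_def e_add assms)
qed

lemma row_blk:
  assumes "a \<in> A" "b \<in> A" "k \<in> A" "f \<in> A" "g \<in> A" "h \<in> A"
  shows "row a b k + blk f g h = blk f g h + row a (b + a * g) (k + b * f + a * h)"
proof -
  have m: "b * f \<in> A" "a * g \<in> A" using A_mult assms by auto
  have "row a b k + blk f g h = (row a b k + e34 f) + e23 g + e24 h"
    by (simp add: blk_def add.assoc)
  also have "\<dots> = e34 f + (row a b (k + b * f) + e23 g) + e24 h"
    by (simp add: row_e34 assms add.assoc)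
  also have "\<dots> = e34 f + e23 g + (row a (b + a * g) (k + b * f) + e24 h)"
    using assms m by (simp add: row_e23 A_add add.assoc)
  finally show ?thesis using assms m by (simp add: row_e24 A_add add.assoc blk_def)
qed

text \<open>The product rule of matrices, read in normal form.\<close>

lemma ext_add:
  assumes "u \<in> UA" "v \<in> UA"
  shows "ext (u + v) = ext u + ext v"
proof -
  note [simp] = A_add A_mult
  have A: "u12 u \<in> A" "u13 u \<in> A" "u14 u \<in> A" "u23 u \<in> A" "u24 u \<in> A" "u34 u \<in> A"
    "u12 v \<in> A" "u13 v \<in> A" "u14 v \<in> A" "u23 v \<in> A" "u24 v \<in> A" "u34 v \<in> A"
    using assms by (auto simp: UA_def)
  have "ext u + ext v = blk (u34 u) (u23 u) (u24 u)
      + (row (u12 u) (u13 u) (u14 u) + blk (u34 v) (u23 v) (u24 v)) + row (u12 v) (u13 v) (u14 v)"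
    by (simp add: ext_def add.assoc)
  also have "\<dots> = (blk (u34 u) (u23 u) (u24 u) + blk (u34 v) (u23 v) (u24 v))
      + (row (u12 u) (u13 u + u12 u * u23 v) (u14 u + u13 u * u34 v + u12 u * u24 v)
         + row (u12 v) (u13 v) (u14 v))"
    by (simp add: row_blk A add.assoc)
  also have "\<dots> = ext (u + v)"
    by (simp add: blk_blk row_row A ext_def add_ac)
  finally show ?thesis by simp
qed

text \<open>The entry $1$ lies in \<open>Lam 0\<close>, so the commutator defining \<open>e14\<close> can be
  computed in one contracted subgroup.\<close>

lemma rho_E14: "x \<in> Lam 0 \<Longrightarrow> rho a b (E14 x) = e14 x"
proof -
  assume x: "x \<in> Lam 0"
  have m: "E12 x \<in> Ub 0 0 0" "E24 1 \<in> Ub 0 0 0" "E14 x \<in> Ub 0 0 0" "E14 x \<in> Ub a b 0"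
    using x Lam_one by (auto intro: mem_E)
  have "E12 x + E24 1 = E14 x + E24 1 + E12 x" by (simp add: plus_ut_def)
  hence "rho 0 0 (E12 x) + rho 0 0 (E24 1) = rho 0 0 (E14 x) + rho 0 0 (E24 1) + rho 0 0 (E12 x)"
    using m by (metis rho_add Ub_add0)
  hence "e12 x + e24 1 = rho 0 0 (E14 x) + e24 1 + e12 x"
    using x Lam_one e_eq(1)[of x 0 0] e_eq(4)[of 1 0 0] by simp
  hence "rho 0 0 (E14 x) = commut (e12 x) (e24 1)"
    using commut_cancel[of "e12 x" "e24 1"] by (metis add_right_cancel)
  thus ?thesis using rho_compat[OF m(3,4)] by (simp add: e14_def c_def)
qed

lemma ext_rho:
  assumes "u \<in> Ub a b 0"
  shows "ext u = rho a b u"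
proof -
  have L: "u12 u \<in> Lam a" "u13 u \<in> Lam b" "u14 u \<in> Lam 0" "u23 u \<in> Lam (b - a)"
    "u24 u \<in> Lam (- a)" "u34 u \<in> Lam (- b)" using assms by (auto simp: Ub_def)
  note M = mem_E(1)[OF L(1), of b] mem_E(2)[OF L(2), of a] mem_E(6)[OF L(3), of a b]
    mem_E(3)[OF L(4)] mem_E(4)[OF L(5), of b] mem_E(5)[OF L(6), of a]
  have "rho a b u = rho a b (E34 (u34 u) + E23 (u23 u) + E24 (u24 u) + E12 (u12 u) + E13 (u13 u) + E14 (u14 u))"
    using ut_elementary_decomposition[of u] by simp
  also have "\<dots> = rho a b (E34 (u34 u)) + rho a b (E23 (u23 u)) + rho a b (E24 (u24 u))
      + rho a b (E12 (u12 u)) + rho a b (E13 (u13 u)) + rho a b (E14 (u14 u))"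
    using M by (simp add: rho_add Ub_add0)
  also have "\<dots> = ext u"
    using L by (simp add: ext_def blk_def row_def add.assoc rho_E14 e_eq(1)[where a = a and b = b]
      e_eq(2)[where a = a and b = b] e_eq(3)[where a = a and b = b]
      e_eq(4)[where a = a and b = b] e_eq(5)[where a = a and b = b])
  finally show ?thesis by simp
qed

end

section \<open>Three places with a common torus\<close>

datatype place = Place0 | Place1 | PlaceInf

type_synonym flat = "(real \<times> real) \<times> (real \<times> real)"

text \<open>The rates at which $P$ and $Q$ vanish at the places. By the product formula they add up to $0$,
  so the rates at $0$ and $1$ are free parameters.\<close>

fun cA :: "place \<Rightarrow> flat \<Rightarrow> real" where
  "cA Place0 v = fst (fst v)"
| "cA Place1 v = snd (fst v)"
| "cA PlaceInf v = - fst (fst v) - snd (fst v)"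

fun cB :: "place \<Rightarrow> flat \<Rightarrow> real" where
  "cB Place0 v = fst (snd v)"
| "cB Place1 v = snd (snd v)"
| "cB PlaceInf v = - fst (snd v) - snd (snd v)"

fun unitA :: "place \<Rightarrow> flat" where
  "unitA Place0 = ((1, 0), 0)" | "unitA Place1 = ((0, 1), 0)" | "unitA PlaceInf = ((-1, 0), 0)"

fun unitB :: "place \<Rightarrow> flat" where
  "unitB Place0 = (0, (1, 0))" | "unitB Place1 = (0, (0, 1))" | "unitB PlaceInf = (0, (-1, 0))"

lemma cA_linear: "cA w (v + v') = cA w v + cA w v'" "cA w (t *\<^sub>R v) = t * cA w v"
  "cA w (v - v') = cA w v - cA w v'"
  by (cases w; simp add: algebra_simps)+

lemma cB_linear: "cB w (v + v') = cB w v + cB w v'" "cB w (t *\<^sub>R v) = t * cB w v"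
  "cB w (v - v') = cB w v - cB w v'"
  by (cases w; simp add: algebra_simps)+

lemma cA_unit [simp]: "cA w (unitA w) = 1" "cA w (unitB w) = 0"
  by (cases w; simp)+

lemma cB_unit [simp]: "cB w (unitB w) = 1" "cB w (unitA w) = 0"
  by (cases w; simp)+

lemma norm_unit [simp]: "norm (unitA w) = 1" "norm (unitB w) = 1"
  by (cases w; simp add: norm_Pair)+

lemma abs_cA_le: "\<bar>cA w v\<bar> \<le> 2 * norm v"
proof -
  have "norm (fst v) \<le> norm v" "norm (fst (fst v)) \<le> norm (fst v)" "norm (snd (fst v)) \<le> norm (fst v)"
    using norm_fst_le[of "fst v" "snd v"] norm_fst_le[of "fst (fst v)" "snd (fst v)"]
      norm_snd_le[of "snd (fst v)" "fst (fst v)"] by auto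
  thus ?thesis by (cases w) auto
qed

lemma abs_cB_le: "\<bar>cB w v\<bar> \<le> 2 * norm v"
proof -
  have "norm (snd v) \<le> norm v" "norm (fst (snd v)) \<le> norm (snd v)" "norm (snd (snd v)) \<le> norm (snd v)"
    using norm_snd_le[of "snd v" "fst v"] norm_fst_le[of "fst (snd v)" "snd (snd v)"]
      norm_snd_le[of "snd (snd v)" "fst (snd v)"] by auto
  thus ?thesis by (cases w) auto
qed

text \<open>This is where three places are needed: rates at two places are independent, so contracted
  elements at two different places lie in a common contracted subgroup and commute there.\<close>

lemma flat_prescribe_two_places:
  assumes "w \<noteq> w'"
  obtains v where "cA w v = a" "cB w v = b" "cA w' v = a'" "cB w' v = b'"
proof (cases w)
  case Place0
  thus ?thesis using assms that[of "((a, a'), (b, b'))"] that[of "((a, - a - a'), (b, - b - b'))"]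
    by (cases w') auto
next
  case Place1
  thus ?thesis using assms that[of "((a', a), (b', b))"] that[of "((- a - a', a), (- b - b', b))"]
    by (cases w') auto
next
  case PlaceInf
  thus ?thesis using assms that[of "((a', - a - a'), (b', - b - b'))"] that[of "((- a - a', a'), (- b - b', b'))"]
    by (cases w') auto
qed

definition at_place :: "place \<Rightarrow> 'g::zero \<Rightarrow> place \<Rightarrow> 'g" where
  "at_place w k = (\<lambda>w'. if w' = w then k else 0)"

lemma at_place_add: "at_place w (k + l) = at_place w k + at_place w (l::'g::group_add)"
  by (auto simp: at_place_def fun_eq_iff)

lemma at_place_minus: "at_place w (- k) = - at_place w (k::'g::group_add)"
  by (auto simp: at_place_def fun_eq_iff)

lemma at_place_commute:
  "w \<noteq> w' \<Longrightarrow> at_place w k + at_place w' l = at_place w' l + at_place w (k::'g::group_add)"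
  by (auto simp: at_place_def fun_eq_iff)

lemma at_place_sum:
  "u = at_place Place0 (u Place0) + at_place Place1 (u Place1) + at_place PlaceInf (u PlaceInf :: 'g::group_add)"
proof
  fix w show "u w = (at_place Place0 (u Place0) + at_place Place1 (u Place1) + at_place PlaceInf (u PlaceInf)) w"
    by (cases w) (simp_all add: at_place_def)
qed

text \<open>The unit of the filtration in \<open>Lam_unit\<close> is a power of a uniformizer; it lets the
  $(1,4)$ entry be written as a commutator of short elements.\<close>

locale three_places =
  fixes Lam :: "place \<Rightarrow> real \<Rightarrow> 'r::comm_ring_1 set"
  assumes filtration: "ring_filtration (Lam w)"
    and Lam_unit: "\<exists>t\<in>Lam w (- a). \<exists>t'\<in>Lam w a. t * t' = 1"
begin

definition UAw where "UAw w = ring_filtration.UA (Lam w)"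
definition Ubw where "Ubw w = ring_filtration.Ub (Lam w)"

definition Uhat :: "(place \<Rightarrow> 'r ut) set" where
  "Uhat = {u. \<forall>w. u w \<in> UAw w}"

text \<open>Triples that the torus element $v$ contracts into norm at most $s$.\<close>

definition Uv :: "flat \<Rightarrow> real \<Rightarrow> (place \<Rightarrow> 'r ut) set" where
  "Uv v s = {u. \<forall>w. u w \<in> Ubw w (cA w v) (cB w v) s}"

lemma Uv_subset: "Uv v s \<subseteq> Uhat"
  using ring_filtration.Ub_subset_UA[OF filtration] unfolding Uv_def Uhat_def UAw_def Ubw_def by blast

lemma Uv_zero: "0 \<in> Uv v s"
  using ring_filtration.Ub_zero[OF filtration] by (auto simp: Uv_def Ubw_def)

lemma Uv_add: "0 \<le> s \<Longrightarrow> 0 \<le> t \<Longrightarrow> k \<in> Uv v s \<Longrightarrow> l \<in> Uv v t \<Longrightarrow> k + l \<in> Uv v (s + t)"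
  using ring_filtration.Ub_add[OF filtration] by (auto simp: Uv_def Ubw_def)

lemma Uv_add0: "k \<in> Uv v 0 \<Longrightarrow> l \<in> Uv v 0 \<Longrightarrow> k + l \<in> Uv v 0"
  using Uv_add[of 0 0 k v l] by simp

lemma Uv_neg: "0 \<le> s \<Longrightarrow> k \<in> Uv v s \<Longrightarrow> - k \<in> Uv v (3 * s)"
  using ring_filtration.Ub_neg[OF filtration] by (auto simp: Uv_def Ubw_def)

lemma Uv_neg0: "k \<in> Uv v 0 \<Longrightarrow> - k \<in> Uv v 0"
  using Uv_neg[of 0 k v] by simp

lemma Uhat_add: "k \<in> Uhat \<Longrightarrow> l \<in> Uhat \<Longrightarrow> k + l \<in> Uhat"
  using ring_filtration.UA_add[OF filtration] by (auto simp: Uhat_def UAw_def)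

lemma Uhat_neg: "k \<in> Uhat \<Longrightarrow> - k \<in> Uhat"
  using ring_filtration.UA_neg[OF filtration] by (auto simp: Uhat_def UAw_def)

lemma Uhat_diff: "k \<in> Uhat \<Longrightarrow> l \<in> Uhat \<Longrightarrow> k - l \<in> Uhat"
  using Uhat_add[OF _ Uhat_neg] by (metis add_uminus_conv_diff)

lemma Uhat_zero: "0 \<in> Uhat"
  using ring_filtration.UA_zero[OF filtration] by (auto simp: Uhat_def UAw_def)

text \<open>The defining inequalities are linear in $v$.\<close>

lemma Uv_convex:
  assumes "k \<in> Uv v 0" "k \<in> Uv v' 0" "0 \<le> t" "t \<le> 1"
  shows "k \<in> Uv ((1 - t) *\<^sub>R v + t *\<^sub>R v') 0"
proof -
  have le: "min x y \<le> (1 - t) * x + t * y" for x y :: real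
  proof -
    have "(1 - t) * min x y \<le> (1 - t) * x" "t * min x y \<le> t * y"
      using assms(3,4) by (auto intro!: mult_left_mono)
    thus ?thesis by (simp add: algebra_simps)
  qed
  have m: "z \<in> Lam w r" if "z \<in> Lam w x" "z \<in> Lam w y" "r = (1 - t) * x + t * y" for w z x y r
    using ring_filtration.Lam_mono[OF filtration, of "min x y" r z w] le[of x y] that
    by (auto simp: min_def split: if_splits)
  show ?thesis unfolding Uv_def mem_Collect_eq
  proof
    fix w
    have "k w \<in> Ubw w (cA w v) (cB w v) 0" "k w \<in> Ubw w (cA w v') (cB w v') 0"
      using assms(1,2) by (auto simp: Uv_def)
    thus "k w \<in> Ubw w (cA w ((1 - t) *\<^sub>R v + t *\<^sub>R v')) (cB w ((1 - t) *\<^sub>R v + t *\<^sub>R v')) 0"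
      unfolding Ubw_def ring_filtration.Ub_def[OF filtration] mem_Collect_eq
      by (elim conjE, intro conjI) (erule (1) m, simp add: cA_linear cB_linear algebra_simps)+
  qed
qed

lemma Uv_change_base:
  assumes "k \<in> Uv v s" "norm (v' - v) \<le> r"
  shows "k \<in> Uv v' (s + 4 * r)"
proof -
  have a: "\<bar>cA w v' - cA w v\<bar> \<le> 2 * r" "\<bar>cB w v' - cB w v\<bar> \<le> 2 * r" for w
    using abs_cA_le[of w "v' - v"] abs_cB_le[of w "v' - v"] assms(2) by (auto simp: cA_linear cB_linear)
  have r: "0 \<le> r" using assms(2) norm_ge_zero order_trans by blast
  have m: "z \<in> Lam w y" if "z \<in> Lam w x" "x \<le> y" for w z x y
    using ring_filtration.Lam_mono[OF filtration] that by blast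
  show ?thesis unfolding Uv_def mem_Collect_eq
  proof
    fix w
    have "k w \<in> Ubw w (cA w v) (cB w v) s" using assms(1) by (auto simp: Uv_def)
    thus "k w \<in> Ubw w (cA w v') (cB w v') (s + 4 * r)"
      unfolding Ubw_def ring_filtration.Ub_def[OF filtration] mem_Collect_eq
      using a[of w] r by (elim conjE, intro conjI) (erule m, linarith)+
  qed
qed

lemma Uv_mono: "k \<in> Uv v s \<Longrightarrow> s \<le> t \<Longrightarrow> k \<in> Uv v t"
  unfolding Uv_def Ubw_def ring_filtration.Ub_def[OF filtration] mem_Collect_eq
  by (meson ring_filtration.Lam_mono[OF filtration] add_left_mono)

lemma Uhat_in_Uv:
  assumes "k \<in> Uhat"
  shows "\<exists>s\<ge>0. k \<in> Uv v s"
proof -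
  define P where "P w s \<longleftrightarrow> k w \<in> Ubw w (cA w v) (cB w v) s" for w s
  have mono: "P w t" if "P w s" "s \<le> t" for w s t
    using that unfolding P_def Ubw_def ring_filtration.Ub_def[OF filtration] mem_Collect_eq
    by (meson ring_filtration.Lam_mono[OF filtration] add_left_mono)
  have "\<exists>s. P w s" for w
  proof -
    have "k w \<in> ring_filtration.UA (Lam w)" using assms by (auto simp: Uhat_def UAw_def)
    then obtain r1 r2 r3 r4 r5 r6 where r: "u12 (k w) \<in> Lam w r1" "u13 (k w) \<in> Lam w r2" "u14 (k w) \<in> Lam w r3"
      "u23 (k w) \<in> Lam w r4" "u24 (k w) \<in> Lam w r5" "u34 (k w) \<in> Lam w r6"
      unfolding ring_filtration.UA_def[OF filtration] ring_filtration.A_def[OF filtration] by blast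
    let ?s = "Max {r1 - cA w v, r2 - cB w v, r3, r4 - (cB w v - cA w v), r5 + cA w v, r6 + cB w v}"
    have "P w ?s" unfolding P_def Ubw_def ring_filtration.Ub_def[OF filtration] mem_Collect_eq
      using r by (intro conjI) (erule ring_filtration.Lam_mono[OF filtration, rotated], simp)+
    thus ?thesis ..
  qed
  then obtain s where s: "P w (s w)" for w by metis
  let ?s = "max 0 (max (s Place0) (max (s Place1) (s PlaceInf)))"
  have "P w ?s" for w by (rule mono[OF s]) (cases w; simp)
  hence "k \<in> Uv v ?s" by (simp add: Uv_def P_def)
  thus ?thesis by (intro exI[of _ ?s]) auto
qed

text \<open>Elements that are contracted at some point within $s$ of $v$. Moving by such an element can be
  done along a flat: go to that point, where nothing happens, and come back.\<close>

definition Unear :: "flat \<Rightarrow> real \<Rightarrow> (place \<Rightarrow> 'r ut) set" where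
  "Unear v s = (\<Union>v'\<in>{v'. norm (v' - v) \<le> s}. Uv v' 0)"

lemma at_place_Uv:
  assumes "k \<in> Ubw w (cA w v) (cB w v) s"
  shows "at_place w k \<in> Uv v s"
  using assms ring_filtration.Ub_zero[OF filtration] by (auto simp: Uv_def at_place_def Ubw_def)

lemma elementary_near:
  assumes "0 \<le> s"
  shows "x \<in> Lam w (cA w v + s) \<Longrightarrow> at_place w (E12 x) \<in> Unear v s"
    and "x \<in> Lam w (cB w v + s) \<Longrightarrow> at_place w (E13 x) \<in> Unear v s"
    and "x \<in> Lam w (cB w v - cA w v + s) \<Longrightarrow> at_place w (E23 x) \<in> Unear v s"
    and "x \<in> Lam w (- cA w v + s) \<Longrightarrow> at_place w (E24 x) \<in> Unear v s"
    and "x \<in> Lam w (- cB w v + s) \<Longrightarrow> at_place w (E34 x) \<in> Unear v s"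
proof -
  have U: "at_place w k \<in> Unear v s"
    if "k \<in> Ubw w (cA w (v + h)) (cB w (v + h)) 0" "norm h \<le> s" for k h
    unfolding Unear_def using at_place_Uv[OF that(1)] that(2) by (intro UN_I[of "v + h"]) simp_all
  note [simp] = Ubw_def ring_filtration.Ub_def[OF filtration] ring_filtration.Lam_zero[OF filtration]
    cA_linear cB_linear assms
  show "x \<in> Lam w (cA w v + s) \<Longrightarrow> at_place w (E12 x) \<in> Unear v s"
    by (rule U[of _ "s *\<^sub>R unitA w"]) simp_all
  show "x \<in> Lam w (cB w v + s) \<Longrightarrow> at_place w (E13 x) \<in> Unear v s"
    by (rule U[of _ "s *\<^sub>R unitB w"]) simp_all
  show "x \<in> Lam w (cB w v - cA w v + s) \<Longrightarrow> at_place w (E23 x) \<in> Unear v s"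
    by (rule U[of _ "s *\<^sub>R unitB w"]) (simp_all add: algebra_simps)
  show "x \<in> Lam w (- cA w v + s) \<Longrightarrow> at_place w (E24 x) \<in> Unear v s"
    by (rule U[of _ "(- s) *\<^sub>R unitA w"]) simp_all
  show "x \<in> Lam w (- cB w v + s) \<Longrightarrow> at_place w (E34 x) \<in> Unear v s"
    by (rule U[of _ "(- s) *\<^sub>R unitB w"]) simp_all
qed

lemma Unear_neg: "k \<in> Unear v s \<Longrightarrow> - k \<in> Unear v s"
  unfolding Unear_def using Uv_neg0 by blast

text \<open>Each root group element of norm $s$ becomes contracted after moving by $s$ in the direction of
  its root. The $(1,4)$ entry, whose weight is zero, is a commutator of two others; this is the
  source of the number nine.\<close>

lemma place_decomposition:
  assumes s: "0 \<le> s" and k: "k \<in> Ubw w (cA w v) (cB w v) s"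
  shows "\<exists>ks. sum_list ks = at_place w k \<and> length ks = 9 \<and> set ks \<subseteq> Unear v s"
proof -
  obtain t t' where t: "t \<in> Lam w (- cA w v)" "t' \<in> Lam w (cA w v)" "t * t' = 1"
    using Lam_unit by blast
  have k: "u12 k \<in> Lam w (cA w v + s)" "u13 k \<in> Lam w (cB w v + s)" "u14 k \<in> Lam w s"
    "u23 k \<in> Lam w (cB w v - cA w v + s)" "u24 k \<in> Lam w (- cA w v + s)" "u34 k \<in> Lam w (- cB w v + s)"
    using k by (auto simp: Ubw_def ring_filtration.Ub_def[OF filtration])
  \<comment> \<open>The commutator of \<open>E12 (x t')\<close> and \<open>E24 t\<close> is \<open>E14 x\<close>.\<close>
  let ?x = "u14 k * t'"
  have x: "?x \<in> Lam w (cA w v + s)"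
    using ring_filtration.Lam_mult[OF filtration k(3) t(2)] by (simp add: add.commute)
  have tt: "t \<in> Lam w (- cA w v + s)"
    using ring_filtration.Lam_mono[OF filtration _ t(1), of "- cA w v + s"] s by simp
  let ?ks = "map (at_place w) [E34 (u34 k), E23 (u23 k), E24 (u24 k), E12 (u12 k), E13 (u13 k),
     E12 ?x, E24 t, - E12 ?x, - E24 t]"
  have e: "E12 ?x + E24 t + - E12 ?x + - E24 t = E14 (u14 k)"
    using t(3) by (simp add: plus_ut_def uminus_ut_def mult.assoc mult.commute[of t'])
  have "sum_list ?ks = at_place w (E34 (u34 k) + (E23 (u23 k) + (E24 (u24 k) + (E12 (u12 k) + (E13 (u13 k)
     + (E12 ?x + E24 t + - E12 ?x + - E24 t))))))"
    by (simp add: at_place_add add.assoc del: add_uminus_conv_diff)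
  also have "\<dots> = at_place w k"
    unfolding e by (subst (7) ut_elementary_decomposition) (simp only: add.assoc)
  finally have "sum_list ?ks = at_place w k" .
  moreover have "set ?ks \<subseteq> Unear v s"
    using elementary_near(5)[OF s k(6)] elementary_near(3)[OF s k(4)] elementary_near(4)[OF s k(5)]
      elementary_near(1)[OF s k(1)] elementary_near(2)[OF s k(2)] elementary_near(1)[OF s x]
      elementary_near(4)[OF s tt]
    by (auto simp: at_place_minus intro!: Unear_neg)
  ultimately show ?thesis by (intro exI[of _ ?ks]) simp
qed

lemma Uv_decomposition:
  assumes s: "0 \<le> s" and k: "k \<in> Uv v s"
  shows "\<exists>ks. sum_list ks = k \<and> length ks = 27 \<and> set ks \<subseteq> Unear v s"
proof -
  have "\<exists>ks. sum_list ks = at_place w (k w) \<and> length ks = 9 \<and> set ks \<subseteq> Unear v s" for w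
    using place_decomposition[OF s] k by (auto simp: Uv_def)
  then obtain ks where ks: "sum_list (ks w) = at_place w (k w)" "length (ks w) = 9" "set (ks w) \<subseteq> Unear v s" for w
    by metis
  have "sum_list (ks Place0 @ ks Place1 @ ks PlaceInf) = k"
    using at_place_sum[of k] by (simp add: ks add.assoc)
  thus ?thesis using ks by (intro exI[of _ "ks Place0 @ ks Place1 @ ks PlaceInf"]) auto
qed

lemma Uhat_induct [consumes 1, case_names zero add]:
  assumes u: "u \<in> Uhat" and z: "P 0"
    and add: "\<And>u k v. u \<in> Uhat \<Longrightarrow> P u \<Longrightarrow> k \<in> Uv v 0 \<Longrightarrow> P (u + k)"
  shows "P u"
proof -
  obtain s where s: "0 \<le> s" "u \<in> Uv 0 s" using Uhat_in_Uv[OF u, of 0] by blast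
  then obtain ks where ks: "sum_list ks = u" "set ks \<subseteq> Unear 0 s" using Uv_decomposition by blast
  have "sum_list ks \<in> Uhat \<and> P (sum_list ks)" using ks(2)
  proof (induction ks rule: rev_induct)
    case Nil thus ?case using z Uhat_zero by (simp del: zero_fun_apply)
  next
    case (snoc k ks)
    then obtain v where v: "k \<in> Uv v 0" unfolding Unear_def by auto
    moreover have "sum_list (ks @ [k]) = sum_list ks + k" by (simp del: plus_fun_apply)
    ultimately show ?case using snoc add[OF _ _ v] Uhat_add[of "sum_list ks" k] Uv_subset[of v 0]
      by (auto simp del: plus_fun_apply)
  qed
  thus ?thesis using ks by simp
qed

end

text \<open>The full unipotent group over the three places is the amalgam of the groups contracted at the
  points of the flat.\<close>

locale three_places_amalgam = three_places Lam for Lam :: "place \<Rightarrow> real \<Rightarrow> 'r::comm_ring_1 set" +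
  fixes rho :: "flat \<Rightarrow> (place \<Rightarrow> 'r ut) \<Rightarrow> 'h::group_add"
  assumes rho_add: "k \<in> Uv v 0 \<Longrightarrow> l \<in> Uv v 0 \<Longrightarrow> rho v (k + l) = rho v k + rho v l"
    and rho_compat: "k \<in> Uv v 0 \<Longrightarrow> k \<in> Uv v' 0 \<Longrightarrow> rho v k = rho v' k"
begin

definition flat_through :: "place \<Rightarrow> real \<Rightarrow> real \<Rightarrow> flat" where
  "flat_through w a b = a *\<^sub>R unitA w + b *\<^sub>R unitB w"

lemma flat_through [simp]: "cA w (flat_through w a b) = a" "cB w (flat_through w a b) = b"
  by (simp_all add: flat_through_def cA_linear cB_linear)

definition rho_place :: "place \<Rightarrow> real \<Rightarrow> real \<Rightarrow> 'r ut \<Rightarrow> 'h" where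
  "rho_place w a b k = rho (flat_through w a b) (at_place w k)"

lemma rho_place_eq:
  assumes "k \<in> Ubw w (cA w v) (cB w v) 0"
  shows "rho_place w (cA w v) (cB w v) k = rho v (at_place w k)"
  unfolding rho_place_def by (rule rho_compat) (rule at_place_Uv, simp add: assms)+

sublocale pl: abels_amalgam "Lam w" "rho_place w" for w
proof (rule abels_amalgam.intro)
  show "ring_filtration (Lam w)" by (rule filtration)
  show "abels_amalgam_axioms (Lam w) (rho_place w)"
  proof
    fix u v a b
    assume uv: "u \<in> ring_filtration.Ub (Lam w) a b 0" "v \<in> ring_filtration.Ub (Lam w) a b 0"
    hence "at_place w u \<in> Uv (flat_through w a b) 0" "at_place w v \<in> Uv (flat_through w a b) 0"
      by (auto intro!: at_place_Uv simp: Ubw_def)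
    thus "rho_place w a b (u + v) = rho_place w a b u + rho_place w a b v"
      by (simp add: rho_place_def at_place_add rho_add)
  next
    fix u a b a' b'
    assume "u \<in> ring_filtration.Ub (Lam w) a b 0" "u \<in> ring_filtration.Ub (Lam w) a' b' 0"
    thus "rho_place w a b u = rho_place w a' b' u"
      unfolding rho_place_def by (intro rho_compat at_place_Uv) (auto simp: Ubw_def)
  qed
qed

text \<open>The images commute because both elements are contracted at a common point.\<close>

lemma commute_basic:
  assumes "w \<noteq> w'" "k \<in> Ubw w a b 0" "l \<in> Ubw w' a' b' 0"
  shows "rho_place w a b k + rho_place w' a' b' l = rho_place w' a' b' l + rho_place w a b k"
proof -
  obtain v where v: "cA w v = a" "cB w v = b" "cA w' v = a'" "cB w' v = b'"
    using flat_prescribe_two_places[OF assms(1)] by blast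
  have m: "at_place w k \<in> Uv v 0" "at_place w' l \<in> Uv v 0" using assms v by (auto intro: at_place_Uv)
  have "rho v (at_place w k) + rho v (at_place w' l) = rho v (at_place w' l) + rho v (at_place w k)"
    using m at_place_commute[OF assms(1)] by (metis rho_add)
  thus ?thesis using rho_place_eq[of k w v] rho_place_eq[of l w' v] assms v by simp
qed

definition extw where "extw = (\<lambda>w. pl.ext w)"

lemma extw_add: "u \<in> UAw w \<Longrightarrow> v \<in> UAw w \<Longrightarrow> extw w (u + v) = extw w u + extw w v"
  using pl.ext_add[of u w v] by (simp add: extw_def UAw_def)

lemma extw_rho: "u \<in> Ubw w a b 0 \<Longrightarrow> extw w u = rho_place w a b u"
  using pl.ext_rho[of u w a b] by (simp add: extw_def Ubw_def)

lemma UAw_induct [consumes 1, case_names zero add]: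
  assumes u: "u \<in> UAw w" and z: "P 0"
    and add: "\<And>u k a b. u \<in> UAw w \<Longrightarrow> P u \<Longrightarrow> k \<in> Ubw w a b 0 \<Longrightarrow> P (u + k)"
  shows "P u"
proof -
  have "at_place w u \<in> Uhat"
    using u ring_filtration.UA_zero[OF filtration] by (auto simp: Uhat_def at_place_def UAw_def)
  hence "P ((at_place w u) w)"
  proof (induction rule: Uhat_induct)
    case zero thus ?case using z by simp
  next
    case (add u k v)
    thus ?case using assms(3)[of "u w" "k w"] by (auto simp: Uhat_def Uv_def)
  qed
  thus ?thesis by (simp add: at_place_def)
qed

lemma UAw_zero: "0 \<in> UAw w"
  using ring_filtration.UA_zero[OF filtration] by (simp add: UAw_def)

lemma Ubw_UAw: "k \<in> Ubw w a b 0 \<Longrightarrow> k \<in> UAw w"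
  using ring_filtration.Ub_subset_UA[OF filtration] unfolding UAw_def Ubw_def by blast

lemma extw_zero: "extw w 0 = 0"
  using extw_add[OF UAw_zero UAw_zero] by (metis add.right_neutral add_left_cancel)

lemma extw_commute:
  assumes "w \<noteq> w'" "u \<in> UAw w" "v \<in> UAw w'"
  shows "extw w u + extw w' v = extw w' v + extw w u"
  using assms(2)
proof (induction rule: UAw_induct)
  case zero thus ?case by (simp add: extw_zero)
next
  case step: (add u k a b)
  have "extw w k + extw w' v = extw w' v + extw w k" using assms(3)
  proof (induction rule: UAw_induct)
    case zero thus ?case by (simp add: extw_zero)
  next
    case (add v l a' b')
    thus ?case using commute_basic[OF assms(1) \<open>k \<in> Ubw w a b 0\<close>, of l a' b'] \<open>k \<in> Ubw w a b 0\<close>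
      by (simp add: extw_add Ubw_UAw extw_rho) (metis add.assoc)
  qed
  thus ?case using step Ubw_UAw[OF \<open>k \<in> Ubw w a b 0\<close>]
    by (simp add: extw_add) (metis add.assoc)
qed

definition ext3 :: "(place \<Rightarrow> 'r ut) \<Rightarrow> 'h" where
  "ext3 u = extw Place0 (u Place0) + extw Place1 (u Place1) + extw PlaceInf (u PlaceInf)"

lemma ext3_add:
  assumes "u \<in> Uhat" "v \<in> Uhat"
  shows "ext3 (u + v) = ext3 u + ext3 v"
proof -
  have m: "u w \<in> UAw w" "v w \<in> UAw w" for w using assms by (auto simp: Uhat_def)
  have c: "extw w (u w) + extw w' (v w') = extw w' (v w') + extw w (u w)"
      "extw w (u w) + (extw w' (v w') + z) = extw w' (v w') + (extw w (u w) + z)" if "w \<noteq> w'" for w w' z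
    using extw_commute[OF that m(1) m(2)] by (auto intro: pl.swap_left)
  show ?thesis
    by (simp add: ext3_def extw_add m add.assoc c)
qed

lemma ext3_rho:
  assumes "k \<in> Uv v 0"
  shows "ext3 k = rho v k"
proof -
  have m: "k w \<in> Ubw w (cA w v) (cB w v) 0" for w using assms by (auto simp: Uv_def)
  have "extw w (k w) = rho v (at_place w (k w))" for w
    using extw_rho[OF m] rho_place_eq[OF m] by simp
  hence "ext3 k = rho v (at_place Place0 (k Place0)) + rho v (at_place Place1 (k Place1))
      + rho v (at_place PlaceInf (k PlaceInf))" by (simp add: ext3_def)
  also have "\<dots> = rho v (at_place Place0 (k Place0) + at_place Place1 (k Place1) + at_place PlaceInf (k PlaceInf))"
    using at_place_Uv[OF m] by (simp add: rho_add Uv_add0)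
  finally show ?thesis using at_place_sum[of k] by simp
qed

end

text \<open>The semidirect product of a group with the functions on it. A family of functions whose
  differences along \<open>k\<close> do not depend on the point of the flat becomes a compatible
  family of homomorphisms into this group.\<close>

datatype ('g, 'k) twisted = Twisted (tw_base: 'g) (tw_fun: "'g \<Rightarrow> 'k")

instantiation twisted :: (group_add, ab_group_add) group_add
begin

definition zero_twisted :: "('a, 'b) twisted" where "zero_twisted = Twisted 0 (\<lambda>_. 0)"

definition plus_twisted :: "('a, 'b) twisted \<Rightarrow> ('a, 'b) twisted \<Rightarrow> ('a, 'b) twisted" where
  "plus_twisted x y = Twisted (tw_base x + tw_base y) (\<lambda>g. tw_fun y g + tw_fun x (g - tw_base y))"

definition uminus_twisted :: "('a, 'b) twisted \<Rightarrow> ('a, 'b) twisted" where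
  "uminus_twisted x = Twisted (- tw_base x) (\<lambda>g. - tw_fun x (g + tw_base x))"

definition minus_twisted :: "('a, 'b) twisted \<Rightarrow> ('a, 'b) twisted \<Rightarrow> ('a, 'b) twisted" where
  "minus_twisted x y = x + (- y)"

instance
proof
  fix x y z :: "('a, 'b) twisted"
  have "g - (b + c) = g - c - b" for g b c :: 'a by (simp add: diff_conv_add_uminus minus_add add.assoc del: add_uminus_conv_diff)
  thus "x + y + z = x + (y + z)" by (simp add: plus_twisted_def add.assoc)
qed (simp_all add: plus_twisted_def zero_twisted_def uminus_twisted_def minus_twisted_def)

end

context three_places
begin

text \<open>If $f$ behaves, along contracted elements, like a function that is well defined up to a constant
  on each flat, the constants can be chosen consistently. Sending $k$ to the pair of $k$ and the
  difference of $f$ along $k$ gives homomorphisms into the twisted group that agree on common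
  elements, hence a homomorphism of the amalgam; its second component at $0$ is the required
  correction.\<close>

theorem potential_exists:
  fixes f :: "(place \<Rightarrow> 'r ut) \<Rightarrow> flat \<Rightarrow> 'k::ab_group_add"
  assumes f: "\<And>g k v v'. g \<in> Uhat \<Longrightarrow> k \<in> Uv v 0 \<Longrightarrow> k \<in> Uv v' 0 \<Longrightarrow>
     f (g + k) v - f g v = f (g + k) v' - f g v'"
  obtains F where "\<And>g k v. g \<in> Uhat \<Longrightarrow> k \<in> Uv v 0 \<Longrightarrow> F (g + k) + f (g + k) v = F g + f g v"
proof -
  \<comment> \<open>Translations by contracted elements preserve \<open>Uhat\<close>, so that the default value 0
    outside it is harmless.\<close>
  define f' where "f' g v = (if g \<in> Uhat then f g v else 0)" for g v
  define rho where "rho v k = Twisted k (\<lambda>g. f' g v - f' (g - k) v)" for v k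
  have mem: "g - k \<in> Uhat \<longleftrightarrow> g \<in> Uhat" if "k \<in> Uv v 0" for g k v
    using that Uv_subset[of v 0] Uhat_diff[of g k] Uhat_add[of "g - k" k] by auto
  interpret three_places_amalgam Lam rho
  proof
    fix k l v assume "k \<in> Uv v 0" "l \<in> Uv v 0"
    have "g - (k + l) = g - l - k" for g by (simp add: diff_conv_add_uminus minus_add add.assoc del: add_uminus_conv_diff)
    thus "rho v (k + l) = rho v k + rho v l" by (simp add: rho_def plus_twisted_def)
  next
    fix k v v' assume k: "k \<in> Uv v 0" "k \<in> Uv v' 0"
    have "f' g v - f' (g - k) v = f' g v' - f' (g - k) v'" for g
    proof (cases "g \<in> Uhat")
      case True
      hence "g - k \<in> Uhat" using mem[OF k(1)] by blast
      thus ?thesis using f[of "g - k" k v v'] k True by (simp add: f'_def)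
    qed (use mem[OF k(1), of g] in \<open>simp add: f'_def\<close>)
    thus "rho v k = rho v' k" by (simp add: rho_def)
  qed
  have base: "tw_base (ext3 u) = u" if "u \<in> Uhat" for u
    using that
  proof (induction rule: Uhat_induct)
    case zero
    have "ext3 0 = 0" using ext3_add[OF Uhat_zero Uhat_zero] by (metis add.right_neutral add_left_cancel)
    thus ?case by (simp add: zero_twisted_def del: zero_fun_apply)
  next
    case step: (add u k v)
    hence "k \<in> Uhat" using Uv_subset by blast
    hence "ext3 (u + k) = ext3 u + rho v k" using step by (simp only: ext3_add ext3_rho)
    moreover have "tw_base (x + rho v k) = tw_base x + k" for x by (simp add: rho_def plus_twisted_def)
    ultimately show ?case using step by (simp del: plus_fun_apply)
  qed
  define F where "F g = tw_fun (ext3 (- g)) 0" for g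
  have "F g = F (g + k) + f (g + k) v - f g v" if g: "g \<in> Uhat" and k: "k \<in> Uv v 0" for g k v
  proof -
    have kU: "k \<in> Uhat" using k Uv_subset by blast
    have "- g = k + - (g + k)" by (simp add: minus_add diff_conv_add_uminus del: add_uminus_conv_diff)
    hence "ext3 (- g) = rho v k + ext3 (- (g + k))"
      using ext3_add[OF kU Uhat_neg[OF Uhat_add[OF g kU]]] ext3_rho[OF k] by metis
    hence "F g = F (g + k) + (f' (g + k) v - f' (g + k - k) v)"
      using base[OF Uhat_neg[OF Uhat_add[OF g kU]]] by (simp add: F_def plus_twisted_def rho_def)
    thus ?thesis using g Uhat_add[OF g kU] by (simp add: f'_def)
  qed
  hence "F (g + k) + f (g + k) v = F g + f g v" if g: "g \<in> Uhat" and k: "k \<in> Uv v 0" for g k v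
    using g k by (simp add: algebra_simps)
  thus ?thesis using that by blast
qed

end

section \<open>Local cocycles\<close>

definition cocycle_within :: "('m \<Rightarrow> 'm \<Rightarrow> 'k::ab_group_add) \<Rightarrow> 'm set \<Rightarrow> bool" where
  "cocycle_within c U \<longleftrightarrow> (\<forall>p\<in>U. \<forall>q\<in>U. \<forall>r\<in>U. c p r = c p q + c q r)"

lemma cocycle_withinI:
  "(\<And>p q r. p \<in> U \<Longrightarrow> q \<in> U \<Longrightarrow> r \<in> U \<Longrightarrow> c p r = c p q + c q r) \<Longrightarrow> cocycle_within c U"
  unfolding cocycle_within_def by blast

lemma cocycle_withinD:
  "cocycle_within c U \<Longrightarrow> p \<in> U \<Longrightarrow> q \<in> U \<Longrightarrow> r \<in> U \<Longrightarrow> c p r = c p q + c q r"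
  unfolding cocycle_within_def by blast

lemma cocycle_within_refl: "cocycle_within c U \<Longrightarrow> p \<in> U \<Longrightarrow> c p p = 0"
  using cocycle_withinD[of c U p p p] by (metis add_cancel_right_right)

lemma cocycle_within_diff: "cocycle_within c U \<Longrightarrow> p \<in> U \<Longrightarrow> q \<in> U \<Longrightarrow> r \<in> U \<Longrightarrow> c p r - c p q = c q r"
  using cocycle_withinD[of c U p q r] by (metis add_diff_cancel_left')

lemma cocycle_within_mono: "cocycle_within c U \<Longrightarrow> V \<subseteq> U \<Longrightarrow> cocycle_within c V"
  unfolding cocycle_within_def by blast

text \<open>Alexander-Spanier 1-cocycles with coefficients in \<open>'k\<close>; only the germ near the
  diagonal matters.\<close>

definition local_cocycle :: "'m topology \<Rightarrow> ('m \<Rightarrow> 'm \<Rightarrow> 'k::ab_group_add) \<Rightarrow> bool" where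
  "local_cocycle X c \<longleftrightarrow> (\<forall>x\<in>topspace X. \<exists>U. openin X U \<and> x \<in> U \<and> cocycle_within c U)"

text \<open>The neighbourhoods depend on the point, so that exactness is a topological notion, while the set
  on which it is required may be a metric ball.\<close>

definition exact_on :: "'m topology \<Rightarrow> ('m \<Rightarrow> 'm \<Rightarrow> 'k::ab_group_add) \<Rightarrow> 'm set \<Rightarrow> bool" where
  "exact_on X c S \<longleftrightarrow> (\<exists>g. \<forall>x\<in>S. \<exists>U. openin X U \<and> x \<in> U \<and> (\<forall>y\<in>U \<inter> S. c x y = g y - g x))"

lemma local_cocycle_diff:
  assumes "local_cocycle X c" "local_cocycle X c'"
  shows "local_cocycle X (\<lambda>x y. c x y - c' x y)"
  unfolding local_cocycle_def
proof
  fix x assume x: "x \<in> topspace X"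
  obtain U where U: "openin X U" "x \<in> U" "cocycle_within c U"
    using assms(1) x unfolding local_cocycle_def by blast
  obtain V where V: "openin X V" "x \<in> V" "cocycle_within c' V"
    using assms(2) x unfolding local_cocycle_def by blast
  have "cocycle_within (\<lambda>x y. c x y - c' x y) (U \<inter> V)"
  proof (rule cocycle_withinI)
    fix p q r assume "p \<in> U \<inter> V" "q \<in> U \<inter> V" "r \<in> U \<inter> V"
    hence "c p r = c p q + c q r" "c' p r = c' p q + c' q r"
      using cocycle_withinD[OF U(3)] cocycle_withinD[OF V(3)] by blast+
    thus "c p r - c' p r = c p q - c' p q + (c q r - c' q r)" by (simp only: add_diff_add)
  qed
  thus "\<exists>U. openin X U \<and> x \<in> U \<and> cocycle_within (\<lambda>x y. c x y - c' x y) U"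
    using U V by (intro exI[of _ "U \<inter> V"]) auto
qed

lemma local_cocycle_pullback:
  assumes h: "continuous_map X Y h" and c: "local_cocycle Y c"
  shows "local_cocycle X (\<lambda>x y. c (h x) (h y))"
  unfolding local_cocycle_def
proof
  fix x assume x: "x \<in> topspace X"
  hence "h x \<in> topspace Y" using h by (auto simp: continuous_map_def)
  then obtain U where U: "openin Y U" "h x \<in> U" "cocycle_within c U"
    using c unfolding local_cocycle_def by blast
  have "cocycle_within (\<lambda>x y. c (h x) (h y)) {x \<in> topspace X. h x \<in> U}"
    by (rule cocycle_withinI, rule cocycle_withinD[OF U(3)]) auto
  thus "\<exists>V. openin X V \<and> x \<in> V \<and> cocycle_within (\<lambda>x y. c (h x) (h y)) V"
    using x openin_continuous_map_preimage[OF h U(1)] U(2)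
    by (intro exI[of _ "{x \<in> topspace X. h x \<in> U}"]) simp
qed

lemma exact_on_pullback:
  assumes h: "continuous_map Y X h" and e: "exact_on X c S" and S: "\<And>y. y \<in> T \<Longrightarrow> h y \<in> S"
    and T: "T \<subseteq> topspace Y"
  shows "exact_on Y (\<lambda>x y. c (h x) (h y)) T"
proof -
  obtain g where g: "\<forall>x\<in>S. \<exists>U. openin X U \<and> x \<in> U \<and> (\<forall>y\<in>U \<inter> S. c x y = g y - g x)"
    using e unfolding exact_on_def by blast
  show ?thesis unfolding exact_on_def
  proof (intro exI[of _ "\<lambda>y. g (h y)"] ballI)
    fix x assume x: "x \<in> T"
    then obtain U where U: "openin X U" "h x \<in> U" "\<forall>y\<in>U \<inter> S. c (h x) y = g y - g (h x)"
      using g S[OF x] by blast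
    have "\<forall>y\<in>{x \<in> topspace Y. h x \<in> U} \<inter> T. c (h x) (h y) = g (h y) - g (h x)"
      using U(3) S by blast
    thus "\<exists>V. openin Y V \<and> x \<in> V \<and> (\<forall>y\<in>V \<inter> T. c (h x) (h y) = g (h y) - g (h x))"
      using x T U(2) openin_continuous_map_preimage[OF h U(1)]
      by (intro exI[of _ "{x \<in> topspace Y. h x \<in> U}"]) blast
  qed
qed

lemma diff_transfer:
  fixes b :: "'k::ab_group_add"
  assumes "a - b = p - q" "a - r = p - s"
  shows "r - b = s - q"
proof -
  have "r - b = (a - b) - (a - r)" by simp
  also have "\<dots> = (p - q) - (p - s)" by (simp only: assms)
  finally show ?thesis by simp
qed

lemma diff_join:
  fixes x0 :: "'k::ab_group_add"
  assumes "x1 - x0 = y1 - y0" "x2 - x1 = y2 - y1"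
  shows "x2 - x0 = y2 - y0"
proof -
  have "x2 - x0 = (x2 - x1) + (x1 - x0)" by simp
  also have "\<dots> = (y2 - y1) + (y1 - y0)" by (simp only: assms)
  finally show ?thesis by simp
qed

lemma locally_constant_on_interval:
  fixes D :: "real \<Rightarrow> 'k"
  assumes "\<And>s. 0 \<le> s \<Longrightarrow> s \<le> 1 \<Longrightarrow> \<exists>e>0. \<forall>s'. 0 \<le> s' \<and> s' \<le> 1 \<and> \<bar>s' - s\<bar> < e \<longrightarrow> D s' = D s"
  shows "D 1 = D 0"
proof -
  define P where "P a b \<longleftrightarrow> (0 \<le> a \<and> b \<le> 1 \<and> a \<le> b \<longrightarrow> D a = D b)" for a b
  have "P 0 1"
  proof (rule Bolzano)
    fix x :: real assume "0 \<le> x" "x \<le> 1"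
    then obtain e where e: "e > 0" "\<forall>s'. 0 \<le> s' \<and> s' \<le> 1 \<and> \<bar>s' - x\<bar> < e \<longrightarrow> D s' = D x"
      using assms by blast
    show "\<exists>d>0. \<forall>a b. a \<le> x \<and> x \<le> b \<and> b - a < d \<longrightarrow> P a b"
    proof (intro exI[of _ e] conjI allI impI)
      fix a b assume ab: "a \<le> x \<and> x \<le> b \<and> b - a < e"
      have "D a = D x" "D b = D x" if "0 \<le> a \<and> b \<le> 1 \<and> a \<le> b"
        using e(2)[rule_format, of a] e(2)[rule_format, of b] ab that by auto
      thus "P a b" unfolding P_def by metis
    qed (rule e(1))
  next
    fix a b c :: real assume "P a b" "P b c" "a \<le> b" "b \<le> c"
    thus "P a c" unfolding P_def by (metis order_trans)
  qed simp
  thus ?thesis by (simp add: P_def)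
qed

text \<open>Local potentials are glued from left to right.\<close>

lemma cocycle_on_interval_exact:
  fixes c :: "real \<Rightarrow> real \<Rightarrow> 'k::ab_group_add"
  assumes c: "\<And>x. \<exists>e>0. cocycle_within c (ball x e)"
  shows "\<exists>m. \<forall>s\<in>{0..1}. \<exists>e>0. \<forall>s'\<in>{0..1}. \<bar>s' - s\<bar> < e \<longrightarrow> m s' - m s = c s s'"
proof -
  define P where "P a b \<longleftrightarrow> (\<exists>m. \<forall>s\<in>{a..b}. \<exists>e>0. \<forall>s'\<in>{a..b}. \<bar>s' - s\<bar> < e \<longrightarrow> m s' - m s = c s s')" for a b
  have "P 0 1"
  proof (rule Bolzano)
    fix a b d :: real assume ab: "P a b" "P b d" and le: "a \<le> b" "b \<le> d"
    from ab(1) obtain m1 where m1: "\<And>s. s \<in> {a..b} \<Longrightarrow> \<exists>e>0. \<forall>s'\<in>{a..b}. \<bar>s' - s\<bar> < e \<longrightarrow> m1 s' - m1 s = c s s'"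
      unfolding P_def by metis
    from ab(2) obtain m2 where m2: "\<And>s. s \<in> {b..d} \<Longrightarrow> \<exists>e>0. \<forall>s'\<in>{b..d}. \<bar>s' - s\<bar> < e \<longrightarrow> m2 s' - m2 s = c s s'"
      unfolding P_def by metis
    define m where "m s = (if s \<le> b then m1 s else m2 s - m2 b + m1 b)" for s
    have m_right: "m s = m2 s - m2 b + m1 b" if "b \<le> s" for s using that by (auto simp: m_def)
    have "\<exists>e>0. \<forall>s'\<in>{a..d}. \<bar>s' - s\<bar> < e \<longrightarrow> m s' - m s = c s s'" if s: "s \<in> {a..d}" for s
    proof (cases s b rule: linorder_cases)
      case less
      then obtain e where "e > 0" "\<forall>s'\<in>{a..b}. \<bar>s' - s\<bar> < e \<longrightarrow> m1 s' - m1 s = c s s'" using m1[of s] s by auto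
      thus ?thesis using less by (intro exI[of _ "min e (b - s)"]) (auto simp: m_def)
    next
      case greater
      then obtain e where "e > 0" "\<forall>s'\<in>{b..d}. \<bar>s' - s\<bar> < e \<longrightarrow> m2 s' - m2 s = c s s'" using m2[of s] s by auto
      thus ?thesis using greater by (intro exI[of _ "min e (s - b)"]) (auto simp: m_right)
    next
      case equal
      then obtain e1 e2 where "e1 > 0" "\<forall>s'\<in>{a..b}. \<bar>s' - s\<bar> < e1 \<longrightarrow> m1 s' - m1 s = c s s'"
        "e2 > 0" "\<forall>s'\<in>{b..d}. \<bar>s' - s\<bar> < e2 \<longrightarrow> m2 s' - m2 s = c s s'" using m1[of s] m2[of s] s le by auto
      thus ?thesis using equal by (intro exI[of _ "min e1 e2"]) (auto simp: m_def)
    qed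
    thus "P a d" unfolding P_def by blast
  next
    fix x :: real
    obtain e where e: "e > 0" "cocycle_within c (ball x e)"
      using c by blast
    show "\<exists>d>0. \<forall>a b. a \<le> x \<and> x \<le> b \<and> b - a < d \<longrightarrow> P a b"
    proof (intro exI[of _ e] conjI allI impI)
      fix a b assume ab: "a \<le> x \<and> x \<le> b \<and> b - a < e"
      show "P a b" unfolding P_def
      proof (intro exI[of _ "\<lambda>s. c x s"] ballI exI[of _ 1] conjI impI)
        fix s s' assume "s \<in> {a..b}" "s' \<in> {a..b}"
        thus "c x s' - c x s = c s s'"
          using e(1) ab by (intro cocycle_within_diff[OF e(2)]) (auto simp: dist_real_def)
      qed simp
    qed (rule e(1))
  qed simp
  thus ?thesis by (simp add: P_def)
qed

text \<open>Integrate along rays from the origin. Comparing two nearby rays step by step, in neighbourhoods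
  of uniform size along the compact segment, shows that the resulting function is a local
  potential.\<close>

lemma cocycle_on_vector_space_exact:
  fixes c :: "'e::real_normed_vector \<Rightarrow> 'e \<Rightarrow> 'k::ab_group_add"
  assumes c: "\<And>x. \<exists>e>0. cocycle_within c (ball x e)"
  shows "\<exists>f. \<forall>v. \<exists>e>0. \<forall>v'\<in>ball v e. c v v' = f v' - f v"
proof -
  obtain rad where rad: "\<And>x. rad x > 0"
    "\<And>x. cocycle_within c (ball x (rad x))"
    using c by metis
  have ray: "\<exists>e>0. \<forall>s'. \<bar>s' - s\<bar> < e \<longrightarrow> s' *\<^sub>R v \<in> ball (s *\<^sub>R v) \<epsilon>" if "\<epsilon> > 0" for s \<epsilon> and v :: 'e
  proof (intro exI[of _ "\<epsilon> / (norm v + 1)"] conjI allI impI)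
    have pos: "norm v + 1 > 0" using norm_ge_zero[of v] by linarith
    show "0 < \<epsilon> / (norm v + 1)" using that pos by simp
    fix s' assume "\<bar>s' - s\<bar> < \<epsilon> / (norm v + 1)"
    hence "\<bar>s' - s\<bar> * (norm v + 1) < \<epsilon>" using pos by (simp add: pos_less_divide_eq)
    moreover have "\<bar>s' - s\<bar> * norm v \<le> \<bar>s' - s\<bar> * (norm v + 1)" by (intro mult_left_mono) auto
    moreover have "dist (s *\<^sub>R v) (s' *\<^sub>R v) = \<bar>s' - s\<bar> * norm v"
      by (simp add: dist_norm abs_minus_commute flip: scaleR_diff_left)
    ultimately show "s' *\<^sub>R v \<in> ball (s *\<^sub>R v) \<epsilon>" unfolding mem_ball by linarith
  qed
  have "\<exists>m. \<forall>s\<in>{0..1}. \<exists>e>0. \<forall>s'\<in>{0..1}. \<bar>s' - s\<bar> < e \<longrightarrow> m s' - m s = c (s *\<^sub>R v) (s' *\<^sub>R v)" for v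
  proof (rule cocycle_on_interval_exact)
    fix x
    obtain e where e: "e > 0" "\<And>s. \<bar>s - x\<bar> < e \<Longrightarrow> s *\<^sub>R v \<in> ball (x *\<^sub>R v) (rad (x *\<^sub>R v))"
      using ray[OF rad(1)[of "x *\<^sub>R v"], of x v] by blast
    have "cocycle_within (\<lambda>s s'. c (s *\<^sub>R v) (s' *\<^sub>R v)) (ball x e)"
      by (rule cocycle_withinI, rule cocycle_withinD[OF rad(2)[of "x *\<^sub>R v"]])
         (rule e(2), simp add: dist_real_def abs_minus_commute)+
    thus "\<exists>e>0. cocycle_within (\<lambda>s s'. c (s *\<^sub>R v) (s' *\<^sub>R v)) (ball x e)"
      using e(1) by blast
  qed
  then obtain m where m: "\<And>v s. s \<in> {0..1} \<Longrightarrow>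
      \<exists>e>0. \<forall>s'\<in>{0..1}. \<bar>s' - s\<bar> < e \<longrightarrow> m v s' - m v s = c (s *\<^sub>R v) (s' *\<^sub>R v)"
    by metis
  have c0: "c x x = 0" for x using cocycle_within_refl[OF rad(2), of x x] rad(1)[of x] by simp
  define f where "f v = m v 1 - m v 0" for v
  have "\<exists>e>0. \<forall>v'\<in>ball v e. c v v' = f v' - f v" for v
  proof -
    have "compact ((\<lambda>s. s *\<^sub>R v) ` {0..1::real})"
      by (intro compact_continuous_image continuous_intros) simp
    then obtain e where e: "e > 0" "\<And>y. y \<in> (\<lambda>s. s *\<^sub>R v) ` {0..1} \<Longrightarrow> \<exists>G\<in>range (\<lambda>x. ball x (rad x)). ball y e \<subseteq> G"
    proof (rule Heine_Borel_lemma[of _ "range (\<lambda>x. ball x (rad x))"])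
      show "(\<lambda>s. s *\<^sub>R v) ` {0..1} \<subseteq> \<Union> (range (\<lambda>x. ball x (rad x)))"
        using rad(1) centre_in_ball by blast
    qed auto
    have coc: "cocycle_within c (ball (s *\<^sub>R v) e)" if "s \<in> {0..1}" for s
    proof -
      have "s *\<^sub>R v \<in> (\<lambda>s. s *\<^sub>R v) ` {0..1}" using that by (rule imageI)
      then obtain x where "ball (s *\<^sub>R v) e \<subseteq> ball x (rad x)" using e(2)[of "s *\<^sub>R v"] by blast
      thus ?thesis using cocycle_within_mono[OF rad(2)] by blast
    qed
    have "c v v' = f v' - f v" if v': "v' \<in> ball v (e / 2)" for v'
    proof -
      define D where "D s = m v' s - m v s - c (s *\<^sub>R v) (s *\<^sub>R v')" for s
      have "D 1 = D 0"
      proof (rule locally_constant_on_interval)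
        fix s :: real assume s: "0 \<le> s" "s \<le> 1"
        obtain e1 where e1: "e1 > 0" "\<And>s'. s' \<in> {0..1} \<Longrightarrow> \<bar>s' - s\<bar> < e1 \<Longrightarrow> m v s' - m v s = c (s *\<^sub>R v) (s' *\<^sub>R v)"
          using m[of s v] s by (auto simp: abs_if)
        obtain e2 where e2: "e2 > 0" "\<And>s'. s' \<in> {0..1} \<Longrightarrow> \<bar>s' - s\<bar> < e2 \<Longrightarrow> m v' s' - m v' s = c (s *\<^sub>R v') (s' *\<^sub>R v')"
          using m[of s v'] s by (auto simp: abs_if)
        obtain e3 where e3: "e3 > 0" "\<And>s'. \<bar>s' - s\<bar> < e3 \<Longrightarrow> s' *\<^sub>R v \<in> ball (s *\<^sub>R v) (e/2)"
          using ray[of "e / 2" s v] e(1) by auto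
        show "\<exists>e>0. \<forall>s'. 0 \<le> s' \<and> s' \<le> 1 \<and> \<bar>s' - s\<bar> < e \<longrightarrow> D s' = D s"
        proof (intro exI[of _ "min e1 (min e2 e3)"] conjI allI impI)
          fix s' :: real assume s': "0 \<le> s' \<and> s' \<le> 1 \<and> \<bar>s' - s\<bar> < min e1 (min e2 e3)"
          have near: "\<sigma> *\<^sub>R v' \<in> ball (s *\<^sub>R v) e" if "0 \<le> \<sigma>" "\<sigma> \<le> 1" "\<sigma> *\<^sub>R v \<in> ball (s *\<^sub>R v) (e/2)" for \<sigma>
          proof -
            have "dist (\<sigma> *\<^sub>R v) (\<sigma> *\<^sub>R v') = \<sigma> * dist v v'"
              using that by (simp add: dist_norm flip: scaleR_diff_right)
            also have "\<dots> \<le> 1 * dist v v'" using that by (intro mult_right_mono) auto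
            also have "\<dots> < e / 2" using v' by simp
            finally show ?thesis using that(3) dist_triangle[of "s *\<^sub>R v" "\<sigma> *\<^sub>R v'" "\<sigma> *\<^sub>R v"] by simp
          qed
          have in_ball: "s *\<^sub>R v \<in> ball (s *\<^sub>R v) (e/2)" "s' *\<^sub>R v \<in> ball (s *\<^sub>R v) (e/2)"
            using e3(2)[of s'] s' e(1) by auto
          have b: "s *\<^sub>R v \<in> ball (s *\<^sub>R v) e" "s' *\<^sub>R v \<in> ball (s *\<^sub>R v) e"
            "s *\<^sub>R v' \<in> ball (s *\<^sub>R v) e" "s' *\<^sub>R v' \<in> ball (s *\<^sub>R v) e"
            using in_ball near s s' e(1) by auto
          have "c (s *\<^sub>R v) (s *\<^sub>R v') + c (s *\<^sub>R v') (s' *\<^sub>R v') = c (s *\<^sub>R v) (s' *\<^sub>R v) + c (s' *\<^sub>R v) (s' *\<^sub>R v')"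
            using cocycle_withinD[OF coc[of s] b(1) b(3) b(4)] cocycle_withinD[OF coc[of s] b(1) b(2) b(4)] s by simp
          moreover have "m v s' - m v s = c (s *\<^sub>R v) (s' *\<^sub>R v)" "m v' s' - m v' s = c (s *\<^sub>R v') (s' *\<^sub>R v')"
            using e1(2)[of s'] e2(2)[of s'] s' by auto
          ultimately have "m v' s' - m v' s - (m v s' - m v s) = c (s' *\<^sub>R v) (s' *\<^sub>R v') - c (s *\<^sub>R v) (s *\<^sub>R v')"
            by (simp add: algebra_simps)
          thus "D s' = D s" unfolding D_def by (simp add: algebra_simps)
        qed (use e1 e2 e3 in auto)
      qed
      thus ?thesis by (simp add: D_def f_def c0 algebra_simps)
    qed
    thus ?thesis using e(1) by (intro exI[of _ "e / 2"]) auto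
  qed
  thus ?thesis by blast
qed

section \<open>Models of asymptotic cones\<close>

definition central_elt :: "'r::comm_ring_1 \<Rightarrow> place \<Rightarrow> 'r ut" where
  "central_elt z = (\<lambda>w. E14 z)"

lemma central_elt_add: "central_elt (y + z) = central_elt y + central_elt z"
  by (simp add: central_elt_def fun_eq_iff plus_ut_def)

lemma central_elt_minus: "central_elt (- z) = - central_elt z"
  by (simp add: central_elt_def fun_eq_iff uminus_ut_def)

lemma central_elt_zero: "central_elt 0 = 0"
  by (simp add: central_elt_def fun_eq_iff zero_ut_def)

lemma central_elt_commute: "central_elt z + u = u + central_elt z"
  by (simp add: central_elt_def fun_eq_iff plus_ut_def add_ac)

text \<open>What is used about the asymptotic cones: they are covered by flats $v \mapsto \mathrm{pt}(u,v)$
  indexed by unipotent triples, points of different flats are close exactly when they differ by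
  a short element at $v$ modulo the central subgroup \<open>ZZ\<close>. The constant compares
  the metric with these algebraic norms.\<close>

locale cone_model = three_places Lam + Metric_space M d
  for Lam :: "place \<Rightarrow> real \<Rightarrow> 'r::comm_ring_1 set" and M :: "'m set" and d +
  fixes pt :: "(place \<Rightarrow> 'r ut) \<Rightarrow> flat \<Rightarrow> 'm" and ZZ :: "'r set" and C :: real
  assumes C_pos: "C \<ge> 1"
    and pt_in: "u \<in> Uhat \<Longrightarrow> pt u v \<in> M"
    and pt_surj: "x \<in> M \<Longrightarrow> \<exists>u\<in>Uhat. \<exists>v. x = pt u v"
    and ZZ_zero: "0 \<in> ZZ" and ZZ_add: "y \<in> ZZ \<Longrightarrow> z \<in> ZZ \<Longrightarrow> y + z \<in> ZZ"
    and ZZ_neg: "z \<in> ZZ \<Longrightarrow> - z \<in> ZZ"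
    and ZZ_Uhat: "z \<in> ZZ \<Longrightarrow> central_elt z \<in> Uhat"
    and pt_central: "u \<in> Uhat \<Longrightarrow> z \<in> ZZ \<Longrightarrow> pt (u + central_elt z) v = pt u v"
    and pt_dist: "u \<in> Uhat \<Longrightarrow> 0 \<le> r \<Longrightarrow> k \<in> Uv v r \<Longrightarrow> norm (v' - v) \<le> r \<Longrightarrow>
       d (pt u v) (pt (u + k) v') \<le> C * r"
    and pt_lift: "u \<in> Uhat \<Longrightarrow> u' \<in> Uhat \<Longrightarrow> d (pt u v) (pt u' v') < r \<Longrightarrow>
       \<exists>z\<in>ZZ. - u + (u' + central_elt z) \<in> Uv v (C * r) \<and> norm (v' - v) \<le> C * r"
begin

lemma Uhat_Uv_add: "u \<in> Uhat \<Longrightarrow> k \<in> Uv v s \<Longrightarrow> u + k \<in> Uhat"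
  using Uhat_add Uv_subset by blast

lemma pt_move: "u \<in> Uhat \<Longrightarrow> d (pt u v) (pt u v') \<le> C * norm (v' - v)"
  using pt_dist[of u "norm (v' - v)" 0 v v'] Uv_zero by simp

lemma pt_eq: "u \<in> Uhat \<Longrightarrow> k \<in> Uv v 0 \<Longrightarrow> pt (u + k) v = pt u v"
  using pt_dist[of u 0 k v v] pt_in[of u v] pt_in[OF Uhat_Uv_add, of u k v 0 v]
  by (metis (no_types, lifting) cancel_comm_monoid_add_class.diff_cancel dual_order.refl mult_zero_right
      nonneg norm_zero order_antisym zero)

lemma central_mem: "z \<in> ZZ \<Longrightarrow> central_elt z \<in> Uv v r \<longleftrightarrow> (\<forall>w. z \<in> Lam w r)"
  using ring_filtration.Lam_zero[OF filtration]
  by (auto simp: Uv_def Ubw_def ring_filtration.Ub_def[OF filtration] central_elt_def)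

text \<open>A potential on the pairs $(u,v)$ that is invariant under contracted elements. On the cone itself
  it would be a global primitive; the obstruction is the missing invariance under
  \<open>ZZ\<close>.\<close>

definition Pot :: "('m \<Rightarrow> 'm \<Rightarrow> 'k::ab_group_add) \<Rightarrow> ((place \<Rightarrow> 'r ut) \<Rightarrow> flat \<Rightarrow> 'k) \<Rightarrow> bool" where
  "Pot c \<Psi> \<longleftrightarrow> (\<forall>u\<in>Uhat. \<forall>v. \<forall>k\<in>Uv v 0. \<Psi> (u + k) v = \<Psi> u v)
     \<and> (\<forall>u\<in>Uhat. \<forall>v. \<exists>e>0. \<forall>v'\<in>ball v e. c (pt u v) (pt u v') = \<Psi> u v' - \<Psi> u v)"

lemma Pot_inv: "Pot c \<Psi> \<Longrightarrow> u \<in> Uhat \<Longrightarrow> k \<in> Uv v 0 \<Longrightarrow> \<Psi> (u + k) v = \<Psi> u v"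
  unfolding Pot_def by blast

lemma Pot_flat: "Pot c \<Psi> \<Longrightarrow> u \<in> Uhat \<Longrightarrow>
    \<exists>e>0. \<forall>v'\<in>ball v e. c (pt u v) (pt u v') = \<Psi> u v' - \<Psi> u v"
  unfolding Pot_def by blast

lemma Pot_diff:
  assumes "Pot c \<Psi>" "Pot c' \<Psi>'"
  shows "Pot (\<lambda>x y. c x y - c' x y) (\<lambda>u v. \<Psi> u v - \<Psi>' u v)"
  unfolding Pot_def
proof (intro conjI ballI allI)
  fix u v k assume "u \<in> Uhat" "k \<in> Uv v 0"
  thus "\<Psi> (u + k) v - \<Psi>' (u + k) v = \<Psi> u v - \<Psi>' u v"
    using Pot_inv[OF assms(1)] Pot_inv[OF assms(2)] by simp
next
  fix u v assume u: "u \<in> Uhat"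
  obtain e where e: "e > 0" "\<forall>v'\<in>ball v e. c (pt u v) (pt u v') = \<Psi> u v' - \<Psi> u v"
    using Pot_flat[OF assms(1) u] by blast
  obtain e' where e': "e' > 0" "\<forall>v'\<in>ball v e'. c' (pt u v) (pt u v') = \<Psi>' u v' - \<Psi>' u v"
    using Pot_flat[OF assms(2) u] by blast
  show "\<exists>e>0. \<forall>v'\<in>ball v e. c (pt u v) (pt u v') - c' (pt u v) (pt u v')
      = \<Psi> u v' - \<Psi>' u v' - (\<Psi> u v - \<Psi>' u v)"
    using e e' by (intro exI[of _ "min e e'"]) (auto simp: algebra_simps)
qed

lemma segment_constant:
  assumes loc: "\<And>t. 0 \<le> t \<Longrightarrow> t \<le> 1 \<Longrightarrow> \<exists>e>0. \<forall>t'. 0 \<le> t' \<and> t' \<le> 1 \<and>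
     (1 - t') *\<^sub>R v + t' *\<^sub>R v' \<in> ball ((1 - t) *\<^sub>R v + t *\<^sub>R (v'::flat)) e \<longrightarrow>
     D ((1 - t') *\<^sub>R v + t' *\<^sub>R v') = D ((1 - t) *\<^sub>R v + t *\<^sub>R v')"
  shows "D v' = D v"
proof -
  have "D ((1 - 1) *\<^sub>R v + 1 *\<^sub>R v') = D ((1 - 0) *\<^sub>R v + 0 *\<^sub>R v')"
  proof (rule locally_constant_on_interval[of "\<lambda>t. D ((1 - t) *\<^sub>R v + t *\<^sub>R v')"])
    fix s :: real assume s: "0 \<le> s" "s \<le> 1"
    obtain e where e: "e > 0" "\<And>t'. 0 \<le> t' \<Longrightarrow> t' \<le> 1 \<Longrightarrow>
     (1 - t') *\<^sub>R v + t' *\<^sub>R v' \<in> ball ((1 - s) *\<^sub>R v + s *\<^sub>R v') e \<Longrightarrow>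
     D ((1 - t') *\<^sub>R v + t' *\<^sub>R v') = D ((1 - s) *\<^sub>R v + s *\<^sub>R v')" using loc[OF s] by metis
    have "isCont (\<lambda>t. (1 - t) *\<^sub>R v + t *\<^sub>R v') s" by (intro continuous_intros)
    then obtain e' where "e' > 0" "\<And>t. \<bar>t - s\<bar> < e' \<Longrightarrow> dist ((1 - t) *\<^sub>R v + t *\<^sub>R v') ((1 - s) *\<^sub>R v + s *\<^sub>R v') < e"
      using e(1) unfolding continuous_at_eps_delta dist_real_def by metis
    thus "\<exists>e>0. \<forall>s'. 0 \<le> s' \<and> s' \<le> 1 \<and> \<bar>s' - s\<bar> < e \<longrightarrow>
        D ((1 - s') *\<^sub>R v + s' *\<^sub>R v') = D ((1 - s) *\<^sub>R v + s *\<^sub>R v')"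
      using e(2) by (intro exI[of _ e']) (auto simp: dist_commute)
  qed
  thus ?thesis by simp
qed

lemma flat_constant:
  fixes D :: "flat \<Rightarrow> 'k"
  assumes "\<And>v. \<exists>e>0. \<forall>v'\<in>ball v e. D v' = D v"
  shows "D v' = D v"
  by (rule segment_constant) (use assms in metis)

text \<open>Each flat is a vector space and has its own potential. Where $u$ and $u + k$ give the same
  points, the two potentials differ by a constant, since this region is convex; the amalgam
  makes the constants consistent.\<close>

theorem Pot_exists:
  fixes c :: "'m \<Rightarrow> 'm \<Rightarrow> 'k::ab_group_add"
  assumes c: "local_cocycle mtopology c"
  shows "\<exists>\<Psi>. Pot c \<Psi>"
proof -
  have "\<exists>f. \<forall>v. \<exists>e>0. \<forall>v'\<in>ball v e. c (pt u v) (pt u v') = f v' - f v" if u: "u \<in> Uhat" for u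
  proof (rule cocycle_on_vector_space_exact)
    fix v :: flat
    have "pt u v \<in> topspace mtopology" using pt_in u by simp
    then obtain U where U: "openin mtopology U" "pt u v \<in> U" "cocycle_within c U"
      using c unfolding local_cocycle_def by blast
    then obtain e where e: "e > 0" "mball (pt u v) e \<subseteq> U" unfolding openin_mtopology by blast
    have "pt u v' \<in> U" if "v' \<in> ball v (e / C)" for v'
    proof -
      have "d (pt u v) (pt u v') \<le> C * norm (v' - v)" by (rule pt_move[OF u])
      also have "\<dots> < C * (e / C)" using that C_pos by (intro mult_strict_left_mono) (auto simp: dist_norm norm_minus_commute)
      finally have "d (pt u v) (pt u v') < e" using C_pos by simp
      hence "pt u v' \<in> mball (pt u v) e" using pt_in[OF u, of v] pt_in[OF u, of v'] by (simp add: in_mball)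
      thus ?thesis using e(2) by blast
    qed
    hence "cocycle_within (\<lambda>v v'. c (pt u v) (pt u v')) (ball v (e / C))"
      by (intro cocycle_withinI cocycle_withinD[OF U(3)])
    thus "\<exists>e>0. cocycle_within (\<lambda>v v'. c (pt u v) (pt u v')) (ball v e)"
      using e(1) C_pos by (intro exI[of _ "e / C"]) auto
  qed
  then obtain f where f: "\<And>u v. u \<in> Uhat \<Longrightarrow> \<exists>e>0. \<forall>v'\<in>ball v e. c (pt u v) (pt u v') = f u v' - f u v"
    by metis
  have "f (g + k) v - f g v = f (g + k) v' - f g v'"
    if g: "g \<in> Uhat" and k: "k \<in> Uv v 0" "k \<in> Uv v' 0" for g k v v'
  proof -
    have gk: "g + k \<in> Uhat" using Uhat_Uv_add[OF g k(1)] .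
    have "(\<lambda>v. f (g + k) v - f g v) v' = (\<lambda>v. f (g + k) v - f g v) v"
    proof (rule segment_constant)
      fix t :: real assume t: "0 \<le> t" "t \<le> 1"
      let ?p = "\<lambda>t. (1 - t) *\<^sub>R v + t *\<^sub>R v'"
      have same: "pt (g + k) (?p t') = pt g (?p t')" if "0 \<le> t'" "t' \<le> 1" for t'
        using pt_eq[OF g Uv_convex[OF k that]] .
      obtain e where e: "e > 0" "\<forall>v'\<in>ball (?p t) e. c (pt g (?p t)) (pt g v') = f g v' - f g (?p t)"
        using f[OF g] by meson
      obtain e' where e': "e' > 0" "\<forall>v'\<in>ball (?p t) e'. c (pt (g + k) (?p t)) (pt (g + k) v') = f (g + k) v' - f (g + k) (?p t)"
        using f[OF gk] by meson
      show "\<exists>e>0. \<forall>t'. 0 \<le> t' \<and> t' \<le> 1 \<and> ?p t' \<in> ball (?p t) e \<longrightarrow>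
         f (g + k) (?p t') - f g (?p t') = f (g + k) (?p t) - f g (?p t)"
      proof (intro exI[of _ "min e e'"] conjI allI impI)
        fix t' assume t': "0 \<le> t' \<and> t' \<le> 1 \<and> ?p t' \<in> ball (?p t) (min e e')"
        have "f g (?p t') - f g (?p t) = f (g + k) (?p t') - f (g + k) (?p t)"
          using e(2)[rule_format, of "?p t'"] e'(2)[rule_format, of "?p t'"] t' same[of t] same[of t'] t by auto
        thus "f (g + k) (?p t') - f g (?p t') = f (g + k) (?p t) - f g (?p t)"
          by (simp add: algebra_simps)
      qed (use e e' in auto)
    qed
    thus ?thesis by simp
  qed
  then obtain F where F: "\<And>g k v. g \<in> Uhat \<Longrightarrow> k \<in> Uv v 0 \<Longrightarrow> F (g + k) + f (g + k) v = F g + f g v"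
    using potential_exists[of f] by blast
  have "Pot c (\<lambda>u v. F u + f u v)"
    unfolding Pot_def using F f by simp
  thus ?thesis by blast
qed

text \<open>The jump of the potential along a central element, see \<open>Pot_shift\<close>.\<close>

definition chi :: "((place \<Rightarrow> 'r ut) \<Rightarrow> flat \<Rightarrow> 'k::ab_group_add) \<Rightarrow> 'r \<Rightarrow> 'k" where
  "chi \<Psi> z = \<Psi> (central_elt z) 0 - \<Psi> 0 0"

text \<open>The jump is the same everywhere: it is constant along each flat, and does not change when $u$ is
  multiplied by a contracted element, and such elements generate.\<close>

lemma Pot_shift:
  assumes P: "Pot c \<Psi>" and z: "z \<in> ZZ" and u: "u \<in> Uhat"
  shows "\<Psi> (u + central_elt z) v = \<Psi> u v + chi \<Psi> z"
proof -
  let ?z = "central_elt z"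
  have flat: "\<Psi> (u + ?z) v' - \<Psi> u v' = \<Psi> (u + ?z) v - \<Psi> u v" if u: "u \<in> Uhat" for u v v'
  proof (rule flat_constant[of "\<lambda>v. \<Psi> (u + ?z) v - \<Psi> u v"])
    fix v
    have uz: "u + ?z \<in> Uhat" using Uhat_add[OF u ZZ_Uhat[OF z]] .
    obtain e where e: "e > 0" "\<And>v'. v' \<in> ball v e \<Longrightarrow> c (pt u v) (pt u v') = \<Psi> u v' - \<Psi> u v"
      using Pot_flat[OF P u] by blast
    obtain e' where e': "e' > 0" "\<And>v'. v' \<in> ball v e' \<Longrightarrow> c (pt (u + ?z) v) (pt (u + ?z) v') = \<Psi> (u + ?z) v' - \<Psi> (u + ?z) v"
      using Pot_flat[OF P uz] by blast
    show "\<exists>e>0. \<forall>v'\<in>ball v e. \<Psi> (u + ?z) v' - \<Psi> u v' = \<Psi> (u + ?z) v - \<Psi> u v"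
    proof (intro exI[of _ "min e e'"] conjI ballI)
      fix v' assume "v' \<in> ball v (min e e')"
      hence "\<Psi> u v' - \<Psi> u v = \<Psi> (u + ?z) v' - \<Psi> (u + ?z) v"
        using e(2)[of v'] e'(2)[of v'] pt_central[OF u z] by simp
      thus "\<Psi> (u + ?z) v' - \<Psi> u v' = \<Psi> (u + ?z) v - \<Psi> u v" by (simp add: algebra_simps)
    qed (use e e' in auto)
  qed
  have "\<Psi> (u + ?z) 0 - \<Psi> u 0 = chi \<Psi> z" using u
  proof (induction rule: Uhat_induct)
    case zero thus ?case by (simp add: chi_def del: zero_fun_apply plus_fun_apply flip: zero_fun_def) 
  next
    case (add u k v)
    note step = \<open>u \<in> Uhat\<close> add.IH \<open>k \<in> Uv v 0\<close>
    have e: "u + k + ?z = u + ?z + k" by (simp add: add.assoc central_elt_commute[of z k])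
    have uz: "u + ?z \<in> Uhat" using Uhat_add[OF step(1) ZZ_Uhat[OF z]] .
    have "\<Psi> (u + k + ?z) v - \<Psi> (u + k) v = \<Psi> (u + ?z) v - \<Psi> u v"
      unfolding e Pot_inv[OF P uz step(3)] Pot_inv[OF P step(1,3)] ..
    moreover have "\<Psi> (u + ?z) 0 - \<Psi> u 0 = \<Psi> (u + ?z) v - \<Psi> u v" by (rule flat[OF step(1)])
    moreover have "\<Psi> (u + k + ?z) 0 - \<Psi> (u + k) 0 = \<Psi> (u + k + ?z) v - \<Psi> (u + k) v"
      by (rule flat[OF Uhat_Uv_add[OF step(1,3)]])
    moreover have "\<Psi> (u + ?z) 0 - \<Psi> u 0 = chi \<Psi> z" using step(2) by (simp del: plus_fun_apply)
    ultimately have "\<Psi> (u + k + ?z) 0 - \<Psi> (u + k) 0 = chi \<Psi> z" by (simp only:)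
    thus ?case by (simp del: plus_fun_apply)
  qed
  thus ?thesis using flat[OF u, of v 0] by (simp add: algebra_simps)
qed

lemma chi_add:
  assumes P: "Pot c \<Psi>" and "y \<in> ZZ" "z \<in> ZZ"
  shows "chi \<Psi> (y + z) = chi \<Psi> y + chi \<Psi> z"
  using Pot_shift[OF P assms(3) ZZ_Uhat[OF assms(2)], of 0]
  by (simp add: chi_def central_elt_add algebra_simps del: plus_fun_apply)

lemma segment_potential:
  assumes P: "Pot c \<Psi>" and u: "u \<in> Uhat"
    and g: "\<And>x. x \<in> S \<Longrightarrow> \<exists>e>0. \<forall>y\<in>S. d x y < e \<longrightarrow> c x y = g y - g x"
    and seg: "\<And>t. 0 \<le> t \<Longrightarrow> t \<le> 1 \<Longrightarrow> pt u ((1 - t) *\<^sub>R v + t *\<^sub>R v') \<in> S"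
  shows "\<Psi> u v' - \<Psi> u v = g (pt u v') - g (pt u v)"
proof -
  have "(\<lambda>v. \<Psi> u v - g (pt u v)) v' = (\<lambda>v. \<Psi> u v - g (pt u v)) v"
  proof (rule segment_constant)
    fix t :: real assume t: "0 \<le> t" "t \<le> 1"
    let ?p = "\<lambda>t. (1 - t) *\<^sub>R v + t *\<^sub>R v'"
    obtain e where e: "e > 0" "\<And>v'. v' \<in> ball (?p t) e \<Longrightarrow> c (pt u (?p t)) (pt u v') = \<Psi> u v' - \<Psi> u (?p t)"
      using Pot_flat[OF P u] by blast
    obtain e' where e': "e' > 0" "\<And>y. y \<in> S \<Longrightarrow> d (pt u (?p t)) y < e' \<Longrightarrow> c (pt u (?p t)) y = g y - g (pt u (?p t))"
      using g[OF seg[OF t]] by metis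
    show "\<exists>e>0. \<forall>t'. 0 \<le> t' \<and> t' \<le> 1 \<and> ?p t' \<in> ball (?p t) e \<longrightarrow>
         \<Psi> u (?p t') - g (pt u (?p t')) = \<Psi> u (?p t) - g (pt u (?p t))"
    proof (intro exI[of _ "min e (e' / C)"] conjI allI impI)
      fix t' assume t': "0 \<le> t' \<and> t' \<le> 1 \<and> ?p t' \<in> ball (?p t) (min e (e' / C))"
      have "d (pt u (?p t)) (pt u (?p t')) \<le> C * norm (?p t' - ?p t)" by (rule pt_move[OF u])
      also have "\<dots> < C * (e' / C)"
        using t' C_pos by (intro mult_strict_left_mono) (auto simp: dist_norm norm_minus_commute)
      finally have "d (pt u (?p t)) (pt u (?p t')) < e'" using C_pos by simp
      hence "\<Psi> u (?p t') - \<Psi> u (?p t) = g (pt u (?p t')) - g (pt u (?p t))"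
        using e(2)[of "?p t'"] e'(2)[of "pt u (?p t')"] t' seg by auto
      thus "\<Psi> u (?p t') - g (pt u (?p t')) = \<Psi> u (?p t) - g (pt u (?p t))"
        by (simp add: algebra_simps)
    qed (use e e' C_pos in auto)
  qed
  thus ?thesis by (simp add: algebra_simps)
qed

text \<open>The element \<open>k\<close> is contracted at a point at distance at most $\eta$, which is
  reached along the flat of $u$ and left along the flat of $u + k$; both segments stay within $2
  C \eta$.\<close>

lemma chain_step:
  assumes P: "Pot c \<Psi>" and u: "u \<in> Uhat"
    and g: "\<And>x. x \<in> S \<Longrightarrow> \<exists>e>0. \<forall>y\<in>S. d x y < e \<longrightarrow> c x y = g y - g x"
    and S: "\<And>x. x \<in> M \<Longrightarrow> d (pt u v) x \<le> 2 * C * \<eta> \<Longrightarrow> x \<in> S"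
    and k: "k \<in> Unear v \<eta>"
  shows "\<Psi> (u + k) v - \<Psi> u v = g (pt (u + k) v) - g (pt u v)"
    and "d (pt u v) (pt (u + k) v) \<le> 2 * C * \<eta>"
proof -
  obtain v' where v': "norm (v' - v) \<le> \<eta>" "k \<in> Uv v' 0" using k by (auto simp: Unear_def)
  have uk: "u + k \<in> Uhat" using Uhat_Uv_add[OF u v'(2)] .
  have same: "pt (u + k) v' = pt u v'" using pt_eq[OF u v'(2)] .
  have \<eta>: "0 \<le> \<eta>" using v'(1) norm_ge_zero order_trans by blast
  let ?p = "\<lambda>t. (1 - t) *\<^sub>R v + t *\<^sub>R v'"
  have np: "norm (?p t - v) \<le> \<eta>" "norm (v' - ?p t) \<le> \<eta>" if "0 \<le> t" "t \<le> 1" for t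
  proof -
    have "?p t - v = t *\<^sub>R (v' - v)" "v' - ?p t = (1 - t) *\<^sub>R (v' - v)" by (simp_all add: algebra_simps)
    moreover have "t * norm (v' - v) \<le> 1 * \<eta>" "(1 - t) * norm (v' - v) \<le> 1 * \<eta>"
      using that v'(1) by (intro mult_mono; simp)+
    ultimately show "norm (?p t - v) \<le> \<eta>" "norm (v' - ?p t) \<le> \<eta>" using that by simp_all
  qed
  have mv: "d (pt a b) (pt a b') \<le> C * \<eta>" if "a \<in> Uhat" "norm (b' - b) \<le> \<eta>" for a b b'
    using pt_move[OF that(1), of b b'] mult_left_mono[OF that(2), of C] C_pos by linarith
  have C\<eta>: "C * \<eta> \<le> 2 * C * \<eta>" using \<eta> C_pos by simp
  have in1: "pt u (?p t) \<in> S" if "0 \<le> t" "t \<le> 1" for t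
    using mv[OF u np(1)[OF that]] C\<eta> by (intro S pt_in u) auto
  have far: "d (pt u v) (pt (u + k) (?p t)) \<le> 2 * C * \<eta>" if "0 \<le> t" "t \<le> 1" for t
  proof -
    have "d (pt u v) (pt (u + k) (?p t)) \<le> d (pt u v) (pt u v') + d (pt (u + k) v') (pt (u + k) (?p t))"
      using triangle[of "pt u v" "pt u v'" "pt (u + k) (?p t)"] pt_in u uk same by simp
    moreover have "d (pt (u + k) v') (pt (u + k) (?p t)) \<le> C * \<eta>"
      using mv[OF uk, of "?p t" v'] np(2)[OF that] by (simp add: norm_minus_commute)
    ultimately show ?thesis using mv[OF u v'(1)] by simp
  qed
  have in2: "pt (u + k) (?p t) \<in> S" if "0 \<le> t" "t \<le> 1" for t
    using far[OF that] by (intro S pt_in uk)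
  have 1: "\<Psi> u v' - \<Psi> u v = g (pt u v') - g (pt u v)"
    by (rule segment_potential[OF P u g in1])
  have 2: "\<Psi> (u + k) v' - \<Psi> (u + k) v = g (pt (u + k) v') - g (pt (u + k) v)"
    by (rule segment_potential[OF P uk g in2])
  show "\<Psi> (u + k) v - \<Psi> u v = g (pt (u + k) v) - g (pt u v)"
    by (rule diff_transfer[OF 1 2[unfolded same Pot_inv[OF P u v'(2)]]])
  show "d (pt u v) (pt (u + k) v) \<le> 2 * C * \<eta>" using far[of 0] by simp
qed

lemma chain:
  assumes P: "Pot c \<Psi>" and u: "u \<in> Uhat"
    and g: "\<And>x. x \<in> S \<Longrightarrow> \<exists>e>0. \<forall>y\<in>S. d x y < e \<longrightarrow> c x y = g y - g x"
    and S: "\<And>x. x \<in> M \<Longrightarrow> d x0 x \<le> \<rho> \<Longrightarrow> x \<in> S" and x0: "x0 \<in> M"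
    and ks: "set ks \<subseteq> Unear v \<eta>" and \<eta>: "0 \<le> \<eta>"
    and bound: "d x0 (pt u v) + 2 * C * \<eta> * length ks \<le> \<rho>"
  shows "\<Psi> (u + sum_list ks) v - \<Psi> u v = g (pt (u + sum_list ks) v) - g (pt u v)"
  using u ks bound
proof (induction ks arbitrary: u)
  case Nil
  have "u + sum_list [] = u" by (simp del: plus_fun_apply)
  thus ?case by (simp only: diff_self)
next
  case (Cons k ks)
  have k: "k \<in> Unear v \<eta>" using Cons.prems by simp
  have b: "d x0 (pt u v) + 2 * C * \<eta> + 2 * C * \<eta> * length ks \<le> \<rho>"
    using Cons.prems(3) by (simp add: algebra_simps)
  have nn: "0 \<le> 2 * C * \<eta> * length ks" using \<eta> C_pos by simp
  have S': "x \<in> S" if "x \<in> M" "d (pt u v) x \<le> 2 * C * \<eta>" for x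
  proof (rule S[OF that(1)])
    have "d x0 x \<le> d x0 (pt u v) + d (pt u v) x" by (rule triangle[OF x0 pt_in[OF Cons.prems(1)] that(1)])
    thus "d x0 x \<le> \<rho>" using that(2) b nn by linarith
  qed
  note step = chain_step[OF P Cons.prems(1) g S' k]
  obtain v' where "k \<in> Uv v' 0" using k unfolding Unear_def by blast
  hence uk: "u + k \<in> Uhat" using Uhat_Uv_add Cons.prems(1) by blast
  have "d x0 (pt (u + k) v) \<le> d x0 (pt u v) + 2 * C * \<eta>"
    using triangle[OF x0 pt_in[OF Cons.prems(1), of v] pt_in[OF uk, of v]] step(2) by linarith
  hence b2: "d x0 (pt (u + k) v) + 2 * C * \<eta> * length ks \<le> \<rho>" using b by linarith
  have "set ks \<subseteq> Unear v \<eta>" using Cons.prems(2) by simp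
  hence "\<Psi> (u + k + sum_list ks) v - \<Psi> (u + k) v = g (pt (u + k + sum_list ks) v) - g (pt (u + k) v)"
    using b2 by (rule Cons.IH[OF uk])
  moreover have e: "u + sum_list (k # ks) = u + k + sum_list ks"
    by (simp only: add.assoc sum_list.Cons)
  ultimately show ?case unfolding e by (intro diff_join[OF step(1)])
qed

text \<open>A local primitive \<open>g\<close> on a large enough set computes the potential differences of
  close pairs. The element is a product of 27 factors that are contracted nearby, each of which
  costs $2 C \eta$, and the final move along the flat costs $C \eta$, so that everything happens
  within $60 C \eta$.\<close>

lemma nearby_potential:
  assumes P: "Pot c \<Psi>" and u: "u \<in> Uhat"
    and g: "\<And>x. x \<in> S \<Longrightarrow> \<exists>e>0. \<forall>y\<in>S. d x y < e \<longrightarrow> c x y = g y - g x"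
    and S: "\<And>x. x \<in> M \<Longrightarrow> d (pt u v) x \<le> 60 * C * \<eta> \<Longrightarrow> x \<in> S"
    and k: "k \<in> Uv v \<eta>" and v': "norm (v' - v) \<le> \<eta>"
  shows "\<Psi> (u + k) v' - \<Psi> u v = g (pt (u + k) v') - g (pt u v)"
proof -
  have \<eta>: "0 \<le> \<eta>" using v' norm_ge_zero order_trans by blast
  obtain ks where ks: "sum_list ks = k" "length ks = 27" "set ks \<subseteq> Unear v \<eta>"
    using Uv_decomposition[OF \<eta> k] by blast
  have uk: "u + k \<in> Uhat" using Uhat_Uv_add[OF u k] .
  have uv: "pt u v \<in> M" using pt_in u .
  have z: "d (pt u v) (pt u v) = 0" using zero uv by simp
  have "\<Psi> (u + k) v - \<Psi> u v = g (pt (u + k) v) - g (pt u v)"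
    using chain[OF P u g S uv ks(3) \<eta>] ks(1,2) z \<eta> C_pos by auto
  moreover have "\<Psi> (u + k) v' - \<Psi> (u + k) v = g (pt (u + k) v') - g (pt (u + k) v)"
  proof (rule segment_potential[OF P uk g])
    fix t :: real assume t: "0 \<le> t" "t \<le> 1"
    have "(1 - t) *\<^sub>R v + t *\<^sub>R v' - v = t *\<^sub>R (v' - v)" by (simp add: algebra_simps)
    moreover have "t * norm (v' - v) \<le> 1 * \<eta>" using t v' by (intro mult_mono) auto
    ultimately have "norm ((1 - t) *\<^sub>R v + t *\<^sub>R v' - v) \<le> \<eta>" using t by simp
    hence "d (pt u v) (pt (u + k) ((1 - t) *\<^sub>R v + t *\<^sub>R v')) \<le> C * \<eta>" by (rule pt_dist[OF u \<eta> k])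
    also have "\<dots> \<le> 60 * C * \<eta>" using \<eta> C_pos by simp
    finally show "pt (u + k) ((1 - t) *\<^sub>R v + t *\<^sub>R v') \<in> S" by (intro S pt_in uk)
  qed
  ultimately show ?thesis by (rule diff_join)
qed

end

context cone_model
begin

section \<open>Exactness and characters\<close>

lemma exact_on_metric:
  fixes c :: "'m \<Rightarrow> 'm \<Rightarrow> 'k::ab_group_add"
  assumes "S \<subseteq> M"
  shows "exact_on mtopology c S \<longleftrightarrow>
    (\<exists>g. \<forall>x\<in>S. \<exists>e>0. \<forall>y\<in>S. d x y < e \<longrightarrow> c x y = g y - g x)"
proof -
  have "(\<exists>U. openin mtopology U \<and> x \<in> U \<and> (\<forall>y\<in>U \<inter> S. c x y = g y - g x))
      \<longleftrightarrow> (\<exists>e>0. \<forall>y\<in>S. d x y < e \<longrightarrow> c x y = g y - g x)" if x: "x \<in> S" for x and g :: "'m \<Rightarrow> 'k"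
  proof
    assume "\<exists>U. openin mtopology U \<and> x \<in> U \<and> (\<forall>y\<in>U \<inter> S. c x y = g y - g x)"
    then obtain U where U: "openin mtopology U" "x \<in> U" "\<forall>y\<in>U \<inter> S. c x y = g y - g x" by blast
    then obtain e where e: "e > 0" "mball x e \<subseteq> U" unfolding openin_mtopology by blast
    have "y \<in> U" if "y \<in> S" "d x y < e" for y
      using that assms x e(2) by (auto simp: in_mball subset_iff)
    thus "\<exists>e>0. \<forall>y\<in>S. d x y < e \<longrightarrow> c x y = g y - g x"
      using U(3) e(1) by blast
  next
    assume "\<exists>e>0. \<forall>y\<in>S. d x y < e \<longrightarrow> c x y = g y - g x"
    then obtain e where e: "e > 0" "\<forall>y\<in>S. d x y < e \<longrightarrow> c x y = g y - g x" by blast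
    have "x \<in> mball x e" using e(1) x assms by auto
    moreover have "\<forall>y\<in>mball x e \<inter> S. c x y = g y - g x" using e(2) by (auto simp: in_mball)
    ultimately show "\<exists>U. openin mtopology U \<and> x \<in> U \<and> (\<forall>y\<in>U \<inter> S. c x y = g y - g x)"
      using openin_mball by blast
  qed
  thus ?thesis unfolding exact_on_def by (intro ex_cong1 ball_cong refl)
qed

text \<open>An asymmetric approximate distance on pairs. The constants in the lemmas that follow come from
  inverting a unipotent matrix, which multiplies norms by at most three, and from moving the
  base point, which adds four times the displacement.\<close>

definition near :: "real \<Rightarrow> (place \<Rightarrow> 'r ut) \<Rightarrow> flat \<Rightarrow> (place \<Rightarrow> 'r ut) \<Rightarrow> flat \<Rightarrow> bool" where
  "near \<eta> u v u' v' \<longleftrightarrow> - u + u' \<in> Uv v \<eta> \<and> norm (v' - v) \<le> \<eta>"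

lemma near_nonneg: "near \<eta> u v u' v' \<Longrightarrow> 0 \<le> \<eta>"
  unfolding near_def using norm_ge_zero order_trans by blast

lemma near_sym:
  assumes "near \<eta> u v u' v'"
  shows "near (7 * \<eta>) u' v' u v"
proof -
  have \<eta>: "0 \<le> \<eta>" by (rule near_nonneg[OF assms])
  have "- u' + u = - (- u + u')" by (simp only: minus_add minus_minus)
  hence "- u' + u \<in> Uv v (3 * \<eta>)" using Uv_neg[OF \<eta>, of "- u + u'" v] assms by (simp only: near_def)
  hence "- u' + u \<in> Uv v' (3 * \<eta> + 4 * \<eta>)"
    by (rule Uv_change_base) (use assms in \<open>simp only: near_def\<close>)
  moreover have "norm (v - v') \<le> 7 * \<eta>"
    using assms \<eta> unfolding near_def norm_minus_commute[of v v'] by linarith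
  ultimately show ?thesis by (simp add: near_def)
qed

lemma near_trans:
  assumes "near \<eta> u v u' v'" "near \<theta> u' v' u'' v''"
  shows "near (5 * \<eta> + \<theta>) u v u'' v''"
proof -
  have nn: "0 \<le> \<eta>" "0 \<le> \<theta>" using near_nonneg assms by blast+
  have "- u' + u'' \<in> Uv v (\<theta> + 4 * \<eta>)"
    using assms unfolding near_def by (intro Uv_change_base[of _ v']) (auto simp: norm_minus_commute)
  hence "(- u + u') + (- u' + u'') \<in> Uv v (\<eta> + (\<theta> + 4 * \<eta>))"
    using assms nn unfolding near_def by (intro Uv_add[OF nn(1)]) simp_all
  moreover have "(- u + u') + (- u' + u'') = - u + u''" by (simp only: add.assoc add_minus_cancel)
  moreover have "norm (v'' - v) \<le> 5 * \<eta> + \<theta>"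
    using norm_triangle_ineq[of "v'' - v'" "v' - v"] assms nn by (simp add: near_def)
  ultimately show ?thesis by (simp add: near_def algebra_simps)
qed

lemma near_mono: "near \<eta> u v u' v' \<Longrightarrow> \<eta> \<le> \<theta> \<Longrightarrow> near \<theta> u v u' v'"
  unfolding near_def using Uv_mono by fastforce

lemma near_shift: "near \<eta> (u + central_elt z) v (u' + central_elt z) v' \<longleftrightarrow> near \<eta> u v u' v'"
proof -
  have "- (u + central_elt z) + (u' + central_elt z) = - central_elt z + (- u + u' + central_elt z)"
    by (simp only: minus_add add.assoc)
  also have "\<dots> = - u + u'"
    unfolding central_elt_commute[of z "- u + u'", symmetric] by (simp only: minus_add_cancel)
  finally show ?thesis by (simp only: near_def)
qed

lemma near_central:
  assumes "near \<eta> (u + central_elt y) v (u + central_elt z) v'" "y \<in> ZZ" "z \<in> ZZ"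
  shows "z - y \<in> Lam w \<eta>"
proof -
  have "- (u + central_elt y) + (u + central_elt z) = - central_elt y + central_elt z"
    by (simp only: minus_add add.assoc minus_add_cancel)
  also have "\<dots> = central_elt (z - y)"
    by (simp only: central_elt_minus[symmetric] central_elt_add[symmetric]) simp
  finally have "central_elt (z - y) \<in> Uv v \<eta>" using assms(1) unfolding near_def by simp
  thus ?thesis using central_mem[of "z - y" v \<eta>] ZZ_add[OF assms(3) ZZ_neg[OF assms(2)]] by simp
qed

lemma near_lift:
  assumes "u \<in> Uhat" "u' \<in> Uhat" "d (pt u v) (pt u' v') < r"
  obtains z where "z \<in> ZZ" "near (C * r) u v (u' + central_elt z) v'"
  using pt_lift[OF assms] unfolding near_def by blast

lemma pt_lift_near:
  assumes "u \<in> Uhat" "x \<in> M" "d (pt u v) x < r"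
  obtains u' v' where "u' \<in> Uhat" "x = pt u' v'" "near (C * r) u v u' v'"
proof -
  obtain u' v' where x: "u' \<in> Uhat" "x = pt u' v'" using pt_surj assms(2) by blast
  then obtain z where z: "z \<in> ZZ" "near (C * r) u v (u' + central_elt z) v'"
    using near_lift[OF assms(1) x(1)] assms(3) by blast
  show ?thesis
    by (rule that[OF _ _ z(2)]) (use x z(1) pt_central Uhat_add ZZ_Uhat in auto)
qed

text \<open>Choose a lift of each point of $S$ and use the potential of the lift as primitive. Lifts of
  close points differ by a central element; if the character vanishes on the central elements
  that arise, the choice does not matter.\<close>

theorem exact_if_chi_zero:
  fixes c :: "'m \<Rightarrow> 'm \<Rightarrow> 'k::ab_group_add"
  assumes c: "local_cocycle mtopology c" and P: "Pot c \<Psi>" and S: "S \<subseteq> M"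
    and lift: "\<And>x. x \<in> S \<Longrightarrow> lu x \<in> Uhat \<and> pt (lu x) (lv x) = x"
    and \<epsilon>0: "\<epsilon>0 > 0"
    and chi0: "\<And>x x' z. x \<in> S \<Longrightarrow> x' \<in> S \<Longrightarrow> z \<in> ZZ \<Longrightarrow>
        near (C * \<epsilon>0) (lu x) (lv x) (lu x' + central_elt z) (lv x') \<Longrightarrow> chi \<Psi> z = 0"
  shows "exact_on mtopology c S"
proof -
  define g where "g x = \<Psi> (lu x) (lv x)" for x
  have "\<exists>e>0. \<forall>y\<in>S. d x y < e \<longrightarrow> c x y = g y - g x" if x: "x \<in> S" for x
  proof -
    have xM: "x \<in> M" using x S by blast
    obtain U where U: "openin mtopology U" "x \<in> U" "cocycle_within c U"
      using c xM unfolding local_cocycle_def by auto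
    then obtain e where e: "e > 0" "mball x e \<subseteq> U" unfolding openin_mtopology by blast
    have coc: "cocycle_within c (mball x e)" using cocycle_within_mono[OF U(3) e(2)] .
    have xb: "x \<in> mball x e" using xM e(1) by simp
    define G where "G y = c x y" for y
    have G: "\<exists>\<epsilon>>0. \<forall>q\<in>mball x e. d p q < \<epsilon> \<longrightarrow> c p q = G q - G p" if p: "p \<in> mball x e" for p
      unfolding G_def using cocycle_within_diff[OF coc xb p] by (intro exI[of _ 1]) simp
    \<comment> \<open>Small enough for the chains of \<open>nearby_potential\<close> to stay in the ball where the
      cocycle identity holds.\<close>
    define \<epsilon> where "\<epsilon> = min \<epsilon>0 (e / (61 * C * C))"
    have \<epsilon>: "\<epsilon> > 0" "\<epsilon> \<le> \<epsilon>0" using \<epsilon>0 e(1) C_pos by (auto simp: \<epsilon>_def)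
    have "C * \<epsilon> * (61 * C) \<le> e"
    proof -
      have "\<epsilon> \<le> e / (61 * C * C)" by (simp add: \<epsilon>_def)
      hence "\<epsilon> * (61 * C * C) \<le> e" using C_pos by (simp add: pos_le_divide_eq)
      thus ?thesis by (simp add: mult_ac)
    qed
    moreover have "60 * C * (C * \<epsilon>) < C * \<epsilon> * (61 * C)" using C_pos \<epsilon>(1) by simp
    ultimately have small: "60 * C * (C * \<epsilon>) < e" by linarith
    have "c x y = g y - g x" if y: "y \<in> S" "d x y < \<epsilon>" for y
    proof -
      have lx: "lu x \<in> Uhat" "pt (lu x) (lv x) = x" "lu y \<in> Uhat" "pt (lu y) (lv y) = y" using lift x y by auto
      obtain z where z: "z \<in> ZZ" "near (C * \<epsilon>) (lu x) (lv x) (lu y + central_elt z) (lv y)"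
        using near_lift[OF lx(1,3), of "lv x" "lv y" \<epsilon>] y(2) lx by auto
      have "near (C * \<epsilon>0) (lu x) (lv x) (lu y + central_elt z) (lv y)"
        using near_mono[OF z(2)] \<epsilon>(2) C_pos by simp
      hence "chi \<Psi> z = 0" by (rule chi0[OF x y(1) z(1)])
      hence 1: "\<Psi> (lu y + central_elt z) (lv y) = g y"
        using Pot_shift[OF P z(1) lx(3), of "lv y"] by (simp add: g_def)
      have 2: "\<Psi> (lu x + (- lu x + (lu y + central_elt z))) (lv y) - \<Psi> (lu x) (lv x)
         = G (pt (lu x + (- lu x + (lu y + central_elt z))) (lv y)) - G (pt (lu x) (lv x))"
      proof (rule nearby_potential[OF P lx(1) G, where \<eta> = "C * \<epsilon>"])
        fix q assume "q \<in> M" "d (pt (lu x) (lv x)) q \<le> 60 * C * (C * \<epsilon>)"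
        thus "q \<in> mball x e" using small xM lx(2) by (simp add: in_mball)
      qed (use z(2) in \<open>simp_all only: near_def\<close>)
      have 3: "lu x + (- lu x + (lu y + central_elt z)) = lu y + central_elt z" by (simp only: add_minus_cancel)
      have "g y - g x = G y - G x"
        using 2 unfolding 3 1 pt_central[OF lx(3) z(1)] lx(2,4) by (simp only: g_def)
      moreover have "G x = 0" unfolding G_def by (rule cocycle_within_refl[OF coc xb])
      ultimately show ?thesis by (simp add: G_def)
    qed
    thus ?thesis using \<epsilon>(1) by blast
  qed
  thus ?thesis unfolding exact_on_metric[OF S] by blast
qed

corollary exact_global:
  fixes c :: "'m \<Rightarrow> 'm \<Rightarrow> 'k::ab_group_add"
  assumes c: "local_cocycle mtopology c" and P: "Pot c \<Psi>" and chi0: "\<And>z. z \<in> ZZ \<Longrightarrow> chi \<Psi> z = 0"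
  shows "exact_on mtopology c M"
proof -
  have "\<exists>u v. u \<in> Uhat \<and> pt u v = x" if "x \<in> M" for x using pt_surj[OF that] by blast
  then obtain lu lv where "\<And>x. x \<in> M \<Longrightarrow> lu x \<in> Uhat \<and> pt (lu x) (lv x) = x" by metis
  thus ?thesis by (intro exact_if_chi_zero[OF c P, of M lu lv 1]) (auto intro: chi0)
qed

text \<open>In a ball the lifts can be chosen near one fixed lift of the centre, and then only central
  elements of norm comparable to the radius arise.\<close>

corollary exact_on_ball:
  fixes c :: "'m \<Rightarrow> 'm \<Rightarrow> 'k::ab_group_add"
  assumes c: "local_cocycle mtopology c" and P: "Pot c \<Psi>" and r: "r > 0" and x0: "x0 \<in> M"
    and chi0: "\<And>z. z \<in> ZZ \<Longrightarrow> (\<And>w. z \<in> Lam w (100 * C * r)) \<Longrightarrow> chi \<Psi> z = 0"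
  shows "exact_on mtopology c (mball x0 r)"
proof -
  obtain u0 v0 where u0: "u0 \<in> Uhat" "x0 = pt u0 v0" using pt_surj[OF x0] by blast
  have "\<exists>u v. u \<in> Uhat \<and> pt u v = x \<and> near (C * r) u0 v0 u v" if "x \<in> mball x0 r" for x
  proof -
    have "x \<in> M" "d (pt u0 v0) x < r" using that u0(2) by (simp_all add: in_mball)
    thus ?thesis by (metis pt_lift_near[OF u0(1)])
  qed
  then obtain lu lv where l: "\<And>x. x \<in> mball x0 r \<Longrightarrow>
      lu x \<in> Uhat \<and> pt (lu x) (lv x) = x \<and> near (C * r) u0 v0 (lu x) (lv x)" by metis
  show ?thesis
  proof (rule exact_if_chi_zero[OF c P, of _ lu lv r])
    fix x x' z assume x: "x \<in> mball x0 r" "x' \<in> mball x0 r" and z: "z \<in> ZZ"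
      and n: "near (C * r) (lu x) (lv x) (lu x' + central_elt z) (lv x')"
    have "near (5 * (C * r) + C * r) u0 v0 (lu x' + central_elt z) (lv x')"
      using near_trans[OF _ n] l[OF x(1)] by blast
    moreover have "near (7 * (C * r)) (lu x') (lv x') u0 v0" using near_sym l[OF x(2)] by blast
    ultimately have "near (5 * (7 * (C * r)) + (5 * (C * r) + C * r)) (lu x') (lv x') (lu x' + central_elt z) (lv x')"
      by (rule near_trans[rotated])
    hence "near (100 * C * r) (lu x') (lv x') (lu x' + central_elt z) (lv x')"
      by (rule near_mono) (use C_pos r in simp)
    hence "near (100 * C * r) (lu x' + central_elt 0) (lv x') (lu x' + central_elt z) (lv x')"
      by (simp only: central_elt_zero add_0_right)
    thus "chi \<Psi> z = 0" using near_central[OF _ ZZ_zero z] z by (intro chi0) auto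
  qed (use l r mball_subset_mspace in auto)
qed

text \<open>The pairs $(0,0)$ and $(z,0)$ give the same point, so a primitive on the ball forces equal
  values of the potential, provided that the path from one pair to the other stays in the ball.\<close>

theorem chi_zero_if_exact:
  fixes c :: "'m \<Rightarrow> 'm \<Rightarrow> 'k::ab_group_add"
  assumes P: "Pot c \<Psi>" and ex: "exact_on mtopology c (mball (pt 0 0) r)"
    and z: "z \<in> ZZ" "\<And>w. z \<in> Lam w \<rho>" and \<rho>: "0 \<le> \<rho>" "60 * C * \<rho> < r"
  shows "chi \<Psi> z = 0"
proof -
  have "mball (pt 0 0) r \<subseteq> M" by (rule mball_subset_mspace)
  then obtain g where g: "\<And>x. x \<in> mball (pt 0 0) r \<Longrightarrow>
      \<exists>e>0. \<forall>y\<in>mball (pt 0 0) r. d x y < e \<longrightarrow> c x y = g y - g x"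
    using ex unfolding exact_on_metric[OF mball_subset_mspace] by blast
  have "\<Psi> (0 + central_elt z) 0 - \<Psi> 0 0 = g (pt (0 + central_elt z) 0) - g (pt 0 0)"
  proof (rule nearby_potential[OF P Uhat_zero g, where \<eta> = \<rho>])
    fix q assume "q \<in> M" "d (pt 0 0) q \<le> 60 * C * \<rho>"
    thus "q \<in> mball (pt 0 0) r" using \<rho>(2) pt_in[OF Uhat_zero] by (simp add: in_mball)
  next
    show "central_elt z \<in> Uv 0 \<rho>" using central_mem[OF z(1)] z(2) by simp
  qed (use \<rho> in auto)
  thus ?thesis unfolding pt_central[OF Uhat_zero z(1)] by (simp add: chi_def)
qed

text \<open>Fix a lift of each point. For close points the lifts differ by a central element \<open>\<zeta>
  x y\<close> that is unique up to norm $\delta$, so the character has a well-defined value on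
  it; this is the cocycle. The potential compares an arbitrary pair with the chosen lift of its
  point.\<close>

theorem cocycle_from_character:
  fixes \<kappa> :: "'r \<Rightarrow> 'k::ab_group_add"
  assumes \<delta>: "\<delta> > 0"
    and add: "\<And>y z. y \<in> ZZ \<Longrightarrow> z \<in> ZZ \<Longrightarrow> \<kappa> (y + z) = \<kappa> y + \<kappa> z"
    and small: "\<And>z. z \<in> ZZ \<Longrightarrow> (\<And>w. z \<in> Lam w \<delta>) \<Longrightarrow> \<kappa> z = 0"
  shows "\<exists>c \<Psi>. local_cocycle mtopology c \<and> Pot c \<Psi> \<and> (\<forall>z\<in>ZZ. chi \<Psi> z = \<kappa> z)"
proof -
  have chi_diff: "\<kappa> (z - y) = \<kappa> z - \<kappa> y" if "y \<in> ZZ" "z \<in> ZZ" for y z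
    using add[of "z - y" y] that ZZ_add[OF that(2) ZZ_neg[OF that(1)]] by simp
  have same: "\<kappa> z = \<kappa> y"
    if "near \<eta> (u + central_elt y) v (u + central_elt z) v'" "y \<in> ZZ" "z \<in> ZZ" "\<eta> \<le> \<delta>" for u v v' y z \<eta>
  proof -
    have "z - y \<in> Lam w \<delta>" for w
      using near_central[OF near_mono[OF that(1,4)] that(2,3)] .
    hence "\<kappa> (z - y) = 0" using ZZ_add[OF that(3) ZZ_neg[OF that(2)]] by (intro small) simp_all
    thus ?thesis using chi_diff[OF that(2,3)] by simp
  qed
  have ZZ_Uhat_add: "u \<in> Uhat \<Longrightarrow> z \<in> ZZ \<Longrightarrow> u + central_elt z \<in> Uhat" for u z
    using Uhat_add ZZ_Uhat by blast
  have "\<exists>u v. u \<in> Uhat \<and> pt u v = x" if "x \<in> M" for x using pt_surj[OF that] by blast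
  then obtain su sv where s: "\<And>x. x \<in> M \<Longrightarrow> su x \<in> Uhat \<and> pt (su x) (sv x) = x" by metis
  \<comment> \<open>The composed estimates below lose a factor less than 1000.\<close>
  define \<eta> where "\<eta> = \<delta> / 1000"
  have \<eta>: "\<eta> > 0" using \<delta> by (simp add: \<eta>_def)
  have C0: "C > 0" using C_pos by simp
  have CC: "C * (\<eta> / C) = \<eta>" using C0 by simp
  define \<zeta> where "\<zeta> x y = (SOME z. z \<in> ZZ \<and> near \<eta> (su x) (sv x) (su y + central_elt z) (sv y))" for x y
  have \<zeta>: "\<zeta> x y \<in> ZZ \<and> near \<eta> (su x) (sv x) (su y + central_elt (\<zeta> x y)) (sv y)"
    if "x \<in> M" "y \<in> M" "d x y < \<eta> / C" for x y
  proof -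
    have "d (pt (su x) (sv x)) (pt (su y) (sv y)) < \<eta> / C" using s that by simp
    hence "\<exists>z. z \<in> ZZ \<and> near \<eta> (su x) (sv x) (su y + central_elt z) (sv y)"
      using near_lift[of "su x" "su y" "sv x" "sv y" "\<eta> / C"] s that unfolding CC by blast
    thus ?thesis unfolding \<zeta>_def by (rule someI_ex)
  qed
  define c where "c x y = \<kappa> (\<zeta> x y)" for x y
  have coc: "cocycle_within c (mball x (\<eta> / (2 * C)))" for x
  proof (rule cocycle_withinI)
    fix p q r assume pqr: "p \<in> mball x (\<eta> / (2 * C))" "q \<in> mball x (\<eta> / (2 * C))" "r \<in> mball x (\<eta> / (2 * C))"
    have close: "d y z < \<eta> / C" if "y \<in> mball x (\<eta> / (2 * C))" "z \<in> mball x (\<eta> / (2 * C))" for y z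
    proof -
      have "d y z \<le> d x y + d x z" using that triangle[of y x z] by (simp add: in_mball commute)
      also have "\<dots> < \<eta> / (2 * C) + \<eta> / (2 * C)" using that by (simp add: in_mball)
      also have "\<dots> = \<eta> / C" using C0 by (simp add: field_simps)
      finally show ?thesis .
    qed
    have m: "p \<in> M" "q \<in> M" "r \<in> M" using pqr by (auto simp: in_mball)
    let ?pq = "\<zeta> p q" and ?qr = "\<zeta> q r" and ?pr = "\<zeta> p r"
    have z: "?pq \<in> ZZ" "?qr \<in> ZZ" "?pr \<in> ZZ"
      and n1: "near \<eta> (su p) (sv p) (su q + central_elt ?pq) (sv q)"
      and n2: "near \<eta> (su q) (sv q) (su r + central_elt ?qr) (sv r)"
      and n3: "near \<eta> (su p) (sv p) (su r + central_elt ?pr) (sv r)"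
      using \<zeta> m close pqr by blast+
    have n2': "near \<eta> (su q + central_elt ?pq) (sv q) (su r + central_elt (?qr + ?pq)) (sv r)"
      using n2 near_shift[of \<eta> "su q" ?pq "sv q" "su r + central_elt ?qr" "sv r"]
      by (simp only: central_elt_add add.assoc)
    have "near (5 * (7 * \<eta>) + (5 * \<eta> + \<eta>)) (su r + central_elt ?pr) (sv r) (su r + central_elt (?qr + ?pq)) (sv r)"
      by (rule near_trans[OF near_sym[OF n3] near_trans[OF n1 n2']])
    hence "\<kappa> (?qr + ?pq) = \<kappa> ?pr"
      by (rule same) (use z ZZ_add \<delta> in \<open>auto simp: \<eta>_def\<close>)
    thus "c p r = c p q + c q r" using add[OF z(2,1)] by (simp add: c_def add.commute)
  qed
  have lc: "local_cocycle mtopology c"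
    unfolding local_cocycle_def
  proof
    fix x assume "x \<in> topspace mtopology"
    hence "x \<in> mball x (\<eta> / (2 * C))" using \<eta> C0 by simp
    thus "\<exists>U. openin mtopology U \<and> x \<in> U \<and> cocycle_within c U" using coc openin_mball by blast
  qed
  define \<xi> where "\<xi> u v = (SOME z. z \<in> ZZ \<and> near (7 * \<eta>) (su (pt u v) + central_elt z) (sv (pt u v)) u v)" for u v
  have \<xi>: "\<xi> u v \<in> ZZ \<and> near (7 * \<eta>) (su (pt u v) + central_elt (\<xi> u v)) (sv (pt u v)) u v" if u: "u \<in> Uhat" for u v
  proof -
    let ?x = "pt u v"
    have x: "?x \<in> M" by (rule pt_in[OF u])
    have "d (pt u v) (pt (su ?x) (sv ?x)) < \<eta> / C" using s[OF x] x \<eta> C0 by simp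
    then obtain z where "z \<in> ZZ" "near \<eta> u v (su ?x + central_elt z) (sv ?x)"
      using near_lift[OF u, of "su ?x" v "sv ?x" "\<eta> / C"] s[OF x] unfolding CC by blast
    hence "z \<in> ZZ \<and> near (7 * \<eta>) (su ?x + central_elt z) (sv ?x) u v" using near_sym by blast
    thus ?thesis unfolding \<xi>_def by (rule someI)
  qed
  define \<Psi> where "\<Psi> u v = \<kappa> (\<xi> u v)" for u v
  have compare: "\<Psi> u' v' = \<Psi> u v + \<kappa> z"
    if u: "u \<in> Uhat" "u' \<in> Uhat" and n: "near \<eta> u v u' v'" and z: "z \<in> ZZ"
      and nz: "near \<eta> (su (pt u v)) (sv (pt u v)) (su (pt u' v') + central_elt z) (sv (pt u' v'))" for u v u' v' z
  proof -
    let ?x = "pt u v" and ?x' = "pt u' v'"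
    note a = \<xi>[OF u(1), of v] and b = \<xi>[OF u(2), of v']
    have 1: "near (5 * (7 * \<eta>) + \<eta>) (su ?x + central_elt (\<xi> u v)) (sv ?x) u' v'"
      using near_trans[OF _ n] a by blast
    have 2: "near (7 * (7 * \<eta>)) u' v' (su ?x' + central_elt (\<xi> u' v')) (sv ?x')"
      using near_sym b by blast
    have 3: "near \<eta> (su ?x + central_elt (\<xi> u v)) (sv ?x) (su ?x' + central_elt (z + \<xi> u v)) (sv ?x')"
      using nz near_shift[of \<eta> "su ?x" "\<xi> u v" "sv ?x" "su ?x' + central_elt z" "sv ?x'"]
      by (simp only: central_elt_add add.assoc)
    have "near (5 * (7 * \<eta>) + (5 * (5 * (7 * \<eta>) + \<eta>) + 7 * (7 * \<eta>)))
       (su ?x' + central_elt (z + \<xi> u v)) (sv ?x') (su ?x' + central_elt (\<xi> u' v')) (sv ?x')"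
      by (rule near_trans[OF near_sym[OF 3] near_trans[OF 1 2]])
    hence "\<kappa> (\<xi> u' v') = \<kappa> (z + \<xi> u v)"
      by (rule same) (use a b z ZZ_add \<delta> in \<open>auto simp: \<eta>_def\<close>)
    thus ?thesis using add[OF z, of "\<xi> u v"] a by (simp add: \<Psi>_def add.commute)
  qed
  have refl: "near \<eta> u v (u + central_elt 0) v" for u v
    using Uv_zero \<eta> by (simp add: near_def central_elt_zero)
  have chi_zero: "\<kappa> 0 = 0" using add[OF ZZ_zero ZZ_zero] by simp
  have "Pot c \<Psi>" unfolding Pot_def
  proof (intro conjI ballI allI)
    fix u v k assume u: "u \<in> Uhat" and k: "k \<in> Uv v 0"
    have "near \<eta> u v (u + k) v" using Uv_mono[OF k] \<eta> by (simp add: near_def)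
    thus "\<Psi> (u + k) v = \<Psi> u v"
      using compare[OF u Uhat_Uv_add[OF u k] _ ZZ_zero, of v v] pt_eq[OF u k] refl chi_zero by simp
  next
    fix u v assume u: "u \<in> Uhat"
    show "\<exists>e>0. \<forall>v'\<in>ball v e. c (pt u v) (pt u v') = \<Psi> u v' - \<Psi> u v"
    proof (intro exI[of _ "min \<eta> (\<eta> / (C * C))"] conjI ballI)
      show "0 < min \<eta> (\<eta> / (C * C))" using \<eta> C0 by simp
      fix v' assume "v' \<in> ball v (min \<eta> (\<eta> / (C * C)))"
      hence v': "norm (v' - v) \<le> \<eta>" "norm (v' - v) < \<eta> / (C * C)"
        by (auto simp: dist_norm norm_minus_commute)
      have "d (pt u v) (pt u v') \<le> C * norm (v' - v)" by (rule pt_move[OF u])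
      also have "\<dots> < C * (\<eta> / (C * C))" using v'(2) C0 by (rule mult_strict_left_mono)
      also have "\<dots> = \<eta> / C" using C0 by simp
      finally have "d (pt u v) (pt u v') < \<eta> / C" .
      note z = \<zeta>[OF pt_in[OF u] pt_in[OF u] this]
      have "near \<eta> u v u v'" using v'(1) Uv_zero by (simp add: near_def)
      hence "\<Psi> u v' = \<Psi> u v + \<kappa> (\<zeta> (pt u v) (pt u v'))"
        using compare[OF u u] z by blast
      thus "c (pt u v) (pt u v') = \<Psi> u v' - \<Psi> u v" by (simp add: c_def)
    qed
  qed
  moreover have "chi \<Psi> z = \<kappa> z" if z: "z \<in> ZZ" for z
  proof -
    let ?x = "pt 0 0"
    have cz: "central_elt z \<in> Uhat" by (rule ZZ_Uhat[OF z])
    have p: "pt (central_elt z) 0 = ?x" using pt_central[OF Uhat_zero z, of 0] by (simp only: add_0_left)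
    note a = \<xi>[OF Uhat_zero, of 0] and b = \<xi>[OF cz, of 0, unfolded p]
    have "near (7 * \<eta>) (su ?x + central_elt (\<xi> 0 0) + central_elt z) (sv ?x) (0 + central_elt z) 0"
      using a near_shift by blast
    hence "near (7 * \<eta>) (su ?x + central_elt (\<xi> 0 0 + z)) (sv ?x) (central_elt z) 0"
      by (simp only: central_elt_add add.assoc add_0_left)
    hence "near (5 * (7 * \<eta>) + 7 * (7 * \<eta>)) (su ?x + central_elt (\<xi> 0 0 + z)) (sv ?x)
        (su ?x + central_elt (\<xi> (central_elt z) 0)) (sv ?x)"
      using near_trans near_sym b by blast
    hence "\<kappa> (\<xi> (central_elt z) 0) = \<kappa> (\<xi> 0 0 + z)"
      by (rule same) (use a b z ZZ_add \<delta> in \<open>auto simp: \<eta>_def\<close>)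
    thus ?thesis using add[of "\<xi> 0 0" z] a z by (simp add: chi_def \<Psi>_def)
  qed
  ultimately show ?thesis using lc by blast
qed

lemma chi_diff:
  "chi (\<lambda>u v. \<Psi> u v - \<Psi>' u v) z = chi \<Psi> z - chi \<Psi>' z"
  by (simp add: chi_def)

end

section \<open>Places of the rational function field\<close>

abbreviation cst :: "'k::field \<Rightarrow> 'k poly fract" where "cst a \<equiv> to_fract [:a:]"
abbreviation tt :: "'k::field poly fract" where "tt \<equiv> fract_var"
abbreviation (input) RR :: "'k::field poly fract set" where "RR \<equiv> laurent_ring"

lemma cst_simps [simp]:
  "cst 0 = 0" "cst 1 = 1" "cst (a + b) = cst a + cst b" "cst (a - b) = cst a - cst b"
  "cst (- a) = - cst a" "cst (a * b) = cst a * cst b"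
  unfolding to_fract_add[symmetric] to_fract_diff[symmetric] to_fract_uminus[symmetric] to_fract_mult[symmetric]
  by (simp_all flip: one_pCons)

lemma tt_neq [simp]: "(tt :: 'k::field poly fract) \<noteq> 0" "(tt :: 'k poly fract) \<noteq> 1" "(tt :: 'k poly fract) - 1 \<noteq> 0"
proof -
  have "to_fract [:0, 1::'k:] \<noteq> to_fract 1" unfolding to_fract_eq_iff one_pCons by simp
  thus "(tt :: 'k poly fract) \<noteq> 1" by (simp add: fract_var_def)
  thus "(tt :: 'k poly fract) - 1 \<noteq> 0" by simp
qed (simp add: fract_var_def)

lemma tt_minus_1: "(tt :: 'k::field poly fract) - 1 = to_fract [:-1, 1:]"
  unfolding fract_var_def to_fract_1[symmetric] to_fract_diff[symmetric] by (simp add: one_pCons)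

lemma to_fract_power: "to_fract (p ^ n) = to_fract p ^ n"
  by (induction n) simp_all

lemma to_fract_linear_power:
  "to_fract ([:0,1::'k::field:] ^ n) = tt ^ n" "to_fract ([:-1,1::'k:] ^ n) = (tt - 1) ^ n"
  by (simp_all only: to_fract_power tt_minus_1) (simp add: fract_var_def)

lemma RR_mult: "x \<in> RR \<Longrightarrow> y \<in> RR \<Longrightarrow> x * y \<in> RR"
  unfolding laurent_ring_def by (rule generated_subring.mult)

lemma RR_diff: "x \<in> RR \<Longrightarrow> y \<in> RR \<Longrightarrow> x - y \<in> RR"
  unfolding laurent_ring_def by (rule generated_subring.diff)

lemma RR_one: "1 \<in> RR" unfolding laurent_ring_def by (rule generated_subring.one)
lemma RR_zero: "0 \<in> RR" using RR_diff[OF RR_one RR_one] by simp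
lemma RR_neg: "x \<in> RR \<Longrightarrow> - x \<in> RR" using RR_diff[OF RR_zero, of x] by simp
lemma RR_add: "x \<in> RR \<Longrightarrow> y \<in> RR \<Longrightarrow> x + y \<in> RR" using RR_diff[OF _ RR_neg, of x y] by simp
lemma RR_cst: "cst a \<in> RR" unfolding laurent_ring_def by (rule generated_subring.gen) blast
lemma RR_tt: "tt \<in> RR" "inverse tt \<in> RR" "inverse (tt - 1) \<in> RR" "tt - 1 \<in> RR"
  using RR_diff[OF _ RR_one] by (auto simp: laurent_ring_def intro: generated_subring.gen)

lemma RR_power: "x \<in> RR \<Longrightarrow> x ^ n \<in> RR" by (induction n) (auto intro: RR_one RR_mult)

lemma RR_powi: "tt powi i \<in> RR" "(tt - 1) powi i \<in> RR"
  by (auto simp: power_int_def RR_power RR_tt)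

lemma RR_sum: "(\<And>i. i \<in> I \<Longrightarrow> f i \<in> RR) \<Longrightarrow> sum f I \<in> RR"
  by (induction I rule: infinite_finite_induct) (auto intro: RR_zero RR_add)

lemma RR_poly: "to_fract f \<in> RR"
proof (induction f)
  case 0 thus ?case by (simp add: RR_zero)
next
  case (pCons a f)
  have "to_fract (pCons a f) = cst a + tt * to_fract f"
    unfolding fract_var_def to_fract_add[symmetric] to_fract_mult[symmetric] by simp
  thus ?case using pCons RR_add RR_mult RR_cst RR_tt by metis
qed

text \<open>Elements of the ring have denominators $t^i(t-1)^j$.\<close>

lemma RR_form:
  assumes "(x :: 'k::field poly fract) \<in> RR"
  shows "\<exists>f i j. x * (tt ^ i * (tt - 1) ^ j) = to_fract f"
  using assms unfolding laurent_ring_def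
proof (induction rule: generated_subring.induct)
  case (gen x)
  then consider c where "x = cst c" | "x = tt" | "x = inverse tt" | "x = inverse (tt - 1)" by auto
  thus ?case
  proof cases
    case 1 thus ?thesis by (intro exI[of _ "[:c:]"] exI[of _ 0]) simp
  next
    case 2 thus ?thesis by (intro exI[of _ "[:0,1:]"] exI[of _ 0]) (simp add: fract_var_def)
  next
    case 3 thus ?thesis by (intro exI[of _ "1"] exI[of _ 1] exI[of _ 0]) simp
  next
    case 4 thus ?thesis by (intro exI[of _ "1"] exI[of _ 0] exI[of _ 1]) simp
  qed
next
  case one thus ?case by (intro exI[of _ "1"] exI[of _ 0]) simp
next
  case (diff x y)
  then obtain f i j g k l where f: "x * (tt ^ i * (tt - 1) ^ j) = to_fract f" "y * (tt ^ k * (tt - 1) ^ l) = to_fract g"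
    by blast
  have "(x - y) * (tt ^ (i + k) * (tt - 1) ^ (j + l)) =
     x * (tt ^ i * (tt - 1) ^ j) * (tt ^ k * (tt - 1) ^ l) - y * (tt ^ k * (tt - 1) ^ l) * (tt ^ i * (tt - 1) ^ j)"
    by (simp add: power_add algebra_simps)
  also have "\<dots> = to_fract (f * ([:0,1:] ^ k * [:-1,1:] ^ l) - g * ([:0,1:] ^ i * [:-1,1:] ^ j))"
    unfolding f by (simp only: to_fract_diff to_fract_mult to_fract_linear_power)
  finally show ?case by blast
next
  case (mult x y)
  then obtain f i j g k l where f: "x * (tt ^ i * (tt - 1) ^ j) = to_fract f" "y * (tt ^ k * (tt - 1) ^ l) = to_fract g"
    by blast
  have "x * y * (tt ^ (i + k) * (tt - 1) ^ (j + l)) = x * (tt ^ i * (tt - 1) ^ j) * (y * (tt ^ k * (tt - 1) ^ l))"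
    by (simp add: power_add algebra_simps)
  also have "\<dots> = to_fract (f * g)" unfolding f by simp
  finally show ?case by blast
qed

fun good_den :: "place \<Rightarrow> 'k::field poly \<Rightarrow> 'k poly \<Rightarrow> bool" where
  "good_den Place0 p q \<longleftrightarrow> poly q 0 \<noteq> 0"
| "good_den Place1 p q \<longleftrightarrow> poly q 1 \<noteq> 0"
| "good_den PlaceInf p q \<longleftrightarrow> q \<noteq> 0 \<and> degree p \<le> degree q"

lemma good_den_nonzero: "good_den w p q \<Longrightarrow> q \<noteq> 0"
  by (cases w) auto

text \<open>The local ring at a place, as the fractions without a pole there.\<close>

definition Ow :: "place \<Rightarrow> 'k::field poly fract set" where
  "Ow w = {to_fract p / to_fract q | p q. good_den w p q}"

lemma OO_I:
  assumes "good_den w p q" "x * to_fract q = to_fract p"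
  shows "x \<in> Ow w"
proof -
  have "to_fract q \<noteq> 0" using good_den_nonzero[OF assms(1)] by simp
  hence "x = to_fract p / to_fract q" using assms(2) by (rule eq_divide_imp)
  thus ?thesis using assms(1) unfolding Ow_def by blast
qed

lemma OO_E:
  assumes "x \<in> Ow w" obtains p q where "good_den w p q" "x * to_fract q = to_fract p"
proof -
  obtain p q where pq: "good_den w p q" "x = to_fract p / to_fract q" using assms unfolding Ow_def by blast
  have "x * to_fract q = to_fract p" using good_den_nonzero[OF pq(1)] pq(2) by simp
  thus ?thesis using that pq(1) by blast
qed

lemma OO_cst: "cst a \<in> Ow w"
  by (rule OO_I[of w "[:a:]" 1]) (cases w; simp)+

lemma OO_add:
  assumes "x \<in> Ow w" "y \<in> Ow w" shows "x + y \<in> Ow w"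
proof -
  obtain p q where pq: "good_den w p q" "x * to_fract q = to_fract p" using OO_E[OF assms(1)] .
  obtain a b where ab: "good_den w a b" "y * to_fract b = to_fract a" using OO_E[OF assms(2)] .
  have n: "q \<noteq> 0" "b \<noteq> 0" using good_den_nonzero pq ab by blast+
  show ?thesis
  proof (rule OO_I)
    have "degree (p * b + a * q) \<le> degree q + degree b" if "degree p \<le> degree q" "degree a \<le> degree b"
      using that degree_mult_le[of p b] degree_mult_le[of a q] by (intro degree_add_le) auto
    thus "good_den w (p * b + a * q) (q * b)"
      using pq(1) ab(1) n by (cases w) (auto simp: degree_mult_eq)
    show "(x + y) * to_fract (q * b) = to_fract (p * b + a * q)"
      using pq(2) ab(2) by (simp add: algebra_simps)
  qed
qed

lemma OO_mult:
  assumes "x \<in> Ow w" "y \<in> Ow w" shows "x * y \<in> Ow w"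
proof -
  obtain p q where pq: "good_den w p q" "x * to_fract q = to_fract p" using OO_E[OF assms(1)] .
  obtain a b where ab: "good_den w a b" "y * to_fract b = to_fract a" using OO_E[OF assms(2)] .
  have n: "q \<noteq> 0" "b \<noteq> 0" using good_den_nonzero pq ab by blast+
  show ?thesis
  proof (rule OO_I)
    have "degree (p * a) \<le> degree q + degree b" if "degree p \<le> degree q" "degree a \<le> degree b"
      using that degree_mult_le[of p a] by auto
    thus "good_den w (p * a) (q * b)"
      using pq(1) ab(1) n by (cases w) (auto simp: degree_mult_eq)
    have "x * y * to_fract (q * b) = (x * to_fract q) * (y * to_fract b)" by (simp add: algebra_simps)
    thus "x * y * to_fract (q * b) = to_fract (p * a)" unfolding pq(2) ab(2) by simp
  qed
qed

lemma OO_0: "0 \<in> Ow w" and OO_1: "1 \<in> Ow w"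
  using OO_cst[of 0 w] OO_cst[of 1 w] by simp_all

lemma OO_neg: "x \<in> Ow w \<Longrightarrow> - x \<in> Ow w"
  using OO_mult[OF OO_cst[of "- 1" w], of x] by simp

lemma OO_diff: "x \<in> Ow w \<Longrightarrow> y \<in> Ow w \<Longrightarrow> x - y \<in> Ow w"
  using OO_add[OF _ OO_neg, of x w y] by simp

lemma OO_power: "x \<in> Ow w \<Longrightarrow> x ^ n \<in> Ow w"
  by (induction n) (auto intro: OO_1 OO_mult)

fun unif :: "place \<Rightarrow> 'k::field poly fract" where
  "unif Place0 = tt" | "unif Place1 = tt - 1" | "unif PlaceInf = inverse tt"

lemma unif_nonzero [simp]: "unif w \<noteq> 0" by (cases w) auto

lemma unif_in_RR: "unif w \<in> RR" "inverse (unif w) \<in> RR"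
  by (cases w; simp add: RR_tt)+

lemma to_fract_tt: "to_fract [:0, 1:] = tt" "to_fract [:-1, 1:] = tt - 1"
  unfolding tt_minus_1 by (simp_all only: fract_var_def)

lemma OO_units:
  "tt \<in> Ow Place1" "inverse tt \<in> Ow Place1" "tt - 1 \<in> Ow Place0" "inverse (tt - 1) \<in> Ow Place0"
  "(tt - 1) * inverse tt \<in> Ow PlaceInf" "tt * inverse (tt - 1) \<in> Ow PlaceInf"
  "inverse tt \<in> Ow PlaceInf" "inverse (tt - 1) \<in> Ow PlaceInf" "tt \<in> Ow Place0" "tt - 1 \<in> Ow Place1"
proof -
  show "tt \<in> Ow Place1" by (rule OO_I[of _ "[:0,1:]" 1]) (simp_all add: to_fract_tt)
  show "inverse tt \<in> Ow Place1" by (rule OO_I[of _ 1 "[:0,1:]"]) (simp_all add: to_fract_tt)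
  show "tt - 1 \<in> Ow Place0" by (rule OO_I[of _ "[:-1,1:]" 1]) (simp_all add: to_fract_tt)
  show "inverse (tt - 1) \<in> Ow Place0" by (rule OO_I[of _ 1 "[:-1,1:]"]) (simp_all add: to_fract_tt)
  show "(tt - 1) * inverse tt \<in> Ow PlaceInf"
    by (rule OO_I[of _ "[:-1,1:]" "[:0,1:]"]) (simp_all add: to_fract_tt)
  show "tt * inverse (tt - 1) \<in> Ow PlaceInf"
    by (rule OO_I[of _ "[:0,1:]" "[:-1,1:]"]) (simp_all add: to_fract_tt)
  show "inverse tt \<in> Ow PlaceInf" by (rule OO_I[of _ 1 "[:0,1:]"]) (simp_all add: to_fract_tt)
  show "inverse (tt - 1) \<in> Ow PlaceInf"
    by (rule OO_I[of _ 1 "[:-1,1:]"]) (simp_all add: to_fract_tt)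
  show "tt \<in> Ow Place0" by (rule OO_I[of _ "[:0,1:]" 1]) (simp_all add: to_fract_tt)
  show "tt - 1 \<in> Ow Place1" by (rule OO_I[of _ "[:-1,1:]" 1]) (simp_all add: to_fract_tt)
qed

lemma OO_unif: "unif w \<in> Ow w"
  using OO_units by (cases w) auto

lemma inverse_unif_notin: "inverse (unif w :: 'k::field poly fract) \<notin> Ow w"
proof
  assume "inverse (unif w :: 'k poly fract) \<in> Ow w"
  then obtain p q :: "'k poly" where pq: "good_den w p q" "inverse (unif w) * to_fract q = to_fract p"
    by (rule OO_E)
  have e: "to_fract q = unif w * to_fract p"
    unfolding pq(2)[symmetric] by (simp only: mult.assoc[symmetric]) simp
  show False
  proof (cases w)
    case Place0
    hence "to_fract q = to_fract ([:0,1:] * p)" using e by (simp only: to_fract_mult to_fract_tt unif.simps)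
    hence "q = [:0,1:] * p" by (simp only: to_fract_eq_iff)
    thus False using pq(1) Place0 by simp
  next
    case Place1
    hence "to_fract q = to_fract ([:-1,1:] * p)" using e by (simp only: to_fract_mult to_fract_tt unif.simps)
    hence "q = [:-1,1:] * p" by (simp only: to_fract_eq_iff)
    thus False using pq(1) Place1 by simp
  next
    case PlaceInf
    hence "to_fract p = tt * to_fract q" using pq(2) by (simp only: unif.simps inverse_inverse_eq)
    hence "to_fract p = to_fract ([:0,1:] * q)" by (simp only: to_fract_mult to_fract_tt)
    hence "p = [:0,1:] * q" by (simp only: to_fract_eq_iff)
    hence "degree p = degree q + 1" using pq(1) PlaceInf by simp
    thus False using pq(1) PlaceInf by simp
  qed
qed

lemma unif_powi_in: "(unif w :: 'k::field poly fract) powi k \<in> Ow w \<longleftrightarrow> 0 \<le> k"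
proof (cases "0 \<le> k")
  case True
  then obtain n where "k = int n" using zero_le_imp_eq_int by blast
  thus ?thesis using OO_power[OF OO_unif] by (simp only: power_int_of_nat) simp
next
  case False
  hence n: "k = - int (Suc (nat (- k - 1)))" by simp
  define n where "n = nat (- k - 1)"
  have "(unif w :: 'k poly fract) powi k * unif w ^ n = inverse (unif w)"
    by (subst n) (simp add: power_int_minus n_def[symmetric] del: of_nat_Suc)
  hence "(unif w :: 'k poly fract) powi k \<notin> Ow w"
    using inverse_unif_notin[of w, where 'k = 'k]
      OO_mult[OF _ OO_power[OF OO_unif], of "unif w powi k :: 'k poly fract" w n] by auto
  thus ?thesis using False by blast
qed

text \<open>Poles of order at most $m$; for negative $m$, zeros of order at least $-m$.\<close>

definition BB :: "place \<Rightarrow> int \<Rightarrow> 'k::field poly fract set" where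
  "BB w m = {x. x * unif w powi m \<in> Ow w}"

lemma BB_0 [simp]: "0 \<in> BB w m" by (simp add: BB_def OO_0)

lemma BB_zero: "BB w 0 = Ow w" by (auto simp: BB_def)

lemma BB_add: "x \<in> BB w m \<Longrightarrow> y \<in> BB w m \<Longrightarrow> x + y \<in> BB w m"
  using OO_add by (simp add: BB_def distrib_right)

lemma BB_neg: "x \<in> BB w m \<Longrightarrow> - x \<in> BB w m"
  using OO_neg by (auto simp: BB_def)

lemma BB_diff: "x \<in> BB w m \<Longrightarrow> y \<in> BB w m \<Longrightarrow> x - y \<in> BB w m"
  using BB_add[OF _ BB_neg] by fastforce

lemma BB_mult:
  assumes "x \<in> BB w m" "y \<in> BB w n" shows "x * y \<in> BB w (m + n)"
proof -
  have "x * y * unif w powi (m + n) = (x * unif w powi m) * (y * unif w powi n)"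
    by (simp add: power_int_add)
  thus ?thesis using OO_mult[of "x * unif w powi m" w "y * unif w powi n"] assms
    by (simp only: BB_def mem_Collect_eq)
qed

lemma BB_unif_powi: "(unif w :: 'k::field poly fract) powi k \<in> BB w m \<longleftrightarrow> - k \<le> m"
proof -
  have "(unif w :: 'k poly fract) powi k * unif w powi m = unif w powi (k + m)" by (simp add: power_int_add)
  thus ?thesis by (simp only: BB_def mem_Collect_eq unif_powi_in) linarith
qed

lemma BB_mono: "m \<le> n \<Longrightarrow> x \<in> BB w m \<Longrightarrow> x \<in> BB w n"
proof -
  assume mn: "m \<le> n" and x: "x \<in> BB w m"
  have "1 \<in> BB w (n - m)" using BB_unif_powi[of w 0 "n - m"] mn by simp
  thus ?thesis using BB_mult[OF x, of 1 "n - m"] by simp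
qed

lemma BB_one: "0 \<le> m \<Longrightarrow> 1 \<in> BB w m"
  using BB_unif_powi[of w 0 m] by simp

lemma BB_cst: "0 \<le> m \<Longrightarrow> cst a \<in> BB w m"
  using BB_mono[of 0 m "cst a" w] OO_cst[of a w] by (simp add: BB_zero)

lemma BB_sum: "(\<And>i. i \<in> I \<Longrightarrow> f i \<in> BB w m) \<Longrightarrow> sum f I \<in> BB w m"
  by (induction I rule: infinite_finite_induct) (auto intro: BB_add)

text \<open>The pole orders of $t$ and $t - 1$.\<close>

fun pole_t :: "place \<Rightarrow> int" where
  "pole_t Place0 = -1" | "pole_t Place1 = 0" | "pole_t PlaceInf = 1"

fun pole_s :: "place \<Rightarrow> int" where
  "pole_s Place0 = 0" | "pole_s Place1 = -1" | "pole_s PlaceInf = 1"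

lemma power_int_mem:
  assumes "x \<in> Ow w" "inverse x \<in> Ow w" shows "x powi k \<in> Ow w"
  using assms OO_power by (auto simp: power_int_def)

lemma BB_tt_powi: "tt powi k \<in> BB w (k * pole_t w)"
proof (cases w)
  case Place0 thus ?thesis using BB_unif_powi[of Place0 k "- k"] by simp
next
  case Place1 thus ?thesis using power_int_mem[OF OO_units(1,2)] by (simp add: BB_zero)
next
  case PlaceInf
  thus ?thesis using BB_unif_powi[of PlaceInf "- k" k] by (simp add: power_int_minus power_int_inverse)
qed

lemma BB_ss_powi: "(tt - 1) powi k \<in> BB w (k * pole_s w)"
proof (cases w)
  case Place0 thus ?thesis using power_int_mem[OF OO_units(3,4)] by (simp add: BB_zero)
next
  case Place1 thus ?thesis using BB_unif_powi[of Place1 k "- k"] by simp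
next
  case PlaceInf
  have "(tt - 1) powi k = ((tt - 1) * inverse tt) powi k * (tt :: 'a poly fract) powi k"
    by (simp only: power_int_mult_distrib[symmetric] mult.assoc) simp
  moreover have "((tt - 1) * inverse tt) powi k \<in> BB PlaceInf 0"
    using power_int_mem[OF OO_units(5)] OO_units(6) by (simp add: BB_zero mult.commute)
  ultimately show ?thesis
    using BB_mult[of _ PlaceInf 0 "tt powi k" k] BB_tt_powi[of k PlaceInf] PlaceInf by simp
qed

lemma RR_bounded:
  fixes x :: "'k::field poly fract"
  assumes "x \<in> RR" shows "\<exists>m::nat. \<forall>w. x \<in> BB w (int m)"
proof -
  define P where "P x \<longleftrightarrow> (\<exists>m::nat. \<forall>w. x \<in> BB w (int m))" for x :: "'k poly fract"
  have "P x" using assms unfolding laurent_ring_def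
  proof (induction rule: generated_subring.induct)
    case (gen x)
    then consider c where "x = cst c" | "x = tt" | "x = inverse tt" | "x = inverse (tt - 1)" by auto
    thus ?case
    proof cases
      case 1 thus ?thesis unfolding P_def by (intro exI[of _ 0]) (simp add: BB_cst)
    next
      case 2
      have "(tt :: 'k poly fract) powi 1 \<in> BB w 1" for w :: place
        using BB_mono[OF _ BB_tt_powi[of 1 w], of 1] by (cases w) auto
      thus ?thesis using 2 unfolding P_def by (intro exI[of _ 1]) simp
    next
      case 3
      have "(tt :: 'k poly fract) powi (- 1) \<in> BB w 1" for w :: place
        using BB_mono[OF _ BB_tt_powi[of "- 1" w], of 1] by (cases w) auto
      thus ?thesis using 3 unfolding P_def by (intro exI[of _ 1]) simp
    next
      case 4
      have "(tt - 1 :: 'k poly fract) powi (- 1) \<in> BB w 1" for w :: place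
        using BB_mono[OF _ BB_ss_powi[of "- 1" w], of 1] by (cases w) auto
      thus ?thesis using 4 unfolding P_def by (intro exI[of _ 1]) simp
    qed
  next
    case one show ?case unfolding P_def by (intro exI[of _ 0]) (simp add: BB_one)
  next
    case (diff x y)
    then obtain m n where "\<forall>w. x \<in> BB w (int m)" "\<forall>w. y \<in> BB w (int n)" unfolding P_def by blast
    hence "x \<in> BB w (int (m + n))" "y \<in> BB w (int (m + n))" for w
      using BB_mono[of "int m" "int (m + n)" x w] BB_mono[of "int n" "int (m + n)" y w] by simp_all
    thus ?case unfolding P_def using BB_diff by blast
  next
    case (mult x y)
    then obtain m n where "\<forall>w. x \<in> BB w (int m)" "\<forall>w. y \<in> BB w (int n)" unfolding P_def by blast
    thus ?case unfolding P_def by (intro exI[of _ "m + n"]) (auto intro: BB_mult)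
  qed
  thus ?thesis by (simp add: P_def)
qed

text \<open>All three places are rational, so that the residue fields are the coefficient field.\<close>

lemma residue:
  fixes x :: "'k::field poly fract"
  assumes "x \<in> Ow w" shows "\<exists>a. x - cst a \<in> BB w (- 1)"
proof -
  obtain p q where pq: "good_den w p q" "x * to_fract q = to_fract p" using OO_E[OF assms] .
  have q0: "q \<noteq> 0" using good_den_nonzero pq by blast
  have main: "\<exists>a. x - cst a \<in> BB w (- 1)"
    if z: "poly q z \<noteq> 0" and u: "(unif w :: 'k poly fract) = to_fract [:- z, 1:]" and g: "\<And>p'. good_den w p' q" for z
  proof -
    let ?a = "poly p z / poly q z"
    have "poly (p - [:?a:] * q) z = 0" using z by simp
    then obtain p' where p': "p - [:?a:] * q = [:- z, 1:] * p'" unfolding poly_eq_0_iff_dvd by blast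
    have "(x - cst ?a) * inverse (unif w) \<in> Ow w"
    proof (rule OO_I[OF g])
      have "(x - cst ?a) * to_fract q = to_fract p - cst ?a * to_fract q" using pq(2) by (simp add: algebra_simps)
      also have "\<dots> = to_fract (p - [:?a:] * q)" by (simp only: to_fract_diff to_fract_mult)
      also have "\<dots> = unif w * to_fract p'" unfolding p' u by (simp del: mult_pCons_left)
      finally show "(x - cst ?a) * inverse (unif w) * to_fract q = to_fract p'"
        by (simp add: field_simps)
    qed
    hence "x - cst ?a \<in> BB w (- 1)" unfolding BB_def by simp
    thus ?thesis by blast
  qed
  show ?thesis
  proof (cases w)
    case Place0 thus ?thesis using main[of 0] pq(1) by (simp add: fract_var_def)
  next
    case Place1 thus ?thesis using main[of 1] pq(1) by (simp add: tt_minus_1)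
  next
    case PlaceInf
    let ?a = "coeff p (degree q) / lead_coeff q"
    let ?p = "p - Polynomial.smult ?a q"
    have c: "coeff ?p (degree q) = 0" using q0 by simp
    have d: "degree p \<le> degree q" using pq(1) PlaceInf by simp
    have "degree ([:0,1:] * ?p) \<le> degree q"
    proof (cases "?p = 0")
      case False
      have "degree ?p \<le> degree q" using d by (intro degree_diff_le) auto
      moreover have "degree ?p \<noteq> degree q" using c False by (metis leading_coeff_0_iff)
      ultimately show ?thesis using False by simp
    qed simp
    hence g: "good_den w ([:0,1:] * ?p) q" using q0 PlaceInf by simp
    have "(x - cst ?a) * inverse (unif w) \<in> Ow w"
    proof (rule OO_I[OF g])
      have "(x - cst ?a) * to_fract q = to_fract p - cst ?a * to_fract q" using pq(2) by (simp add: algebra_simps)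
      also have "cst ?a * to_fract q = to_fract (Polynomial.smult ?a q)" unfolding to_fract_mult[symmetric] by simp
      finally have "(x - cst ?a) * to_fract q = to_fract ?p" by simp
      thus "(x - cst ?a) * inverse (unif w) * to_fract q = to_fract ([:0,1:] * ?p)"
        using PlaceInf by (simp add: fract_var_def[symmetric] mult_ac del: mult_pCons_left)
    qed
    hence "x - cst ?a \<in> BB w (- 1)" unfolding BB_def by simp
    thus ?thesis by blast
  qed
qed

lemma principal_part:
  fixes x :: "'k::field poly fract"
  assumes "x \<in> BB w (int m)"
  shows "\<exists>a. x - (\<Sum>i=1..m. cst (a i) * inverse (unif w) ^ i) \<in> Ow w"
  using assms
proof (induction m arbitrary: x)
  case 0 thus ?case by (simp add: BB_zero)
next
  case (Suc m)
  let ?s = "inverse (unif w) :: 'k poly fract"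
  have "x * unif w ^ Suc m \<in> Ow w" using Suc.prems unfolding BB_def by (simp only: power_int_of_nat mem_Collect_eq)
  then obtain b where b: "x * unif w ^ Suc m - cst b \<in> BB w (- 1)" using residue by blast
  have "?s ^ Suc m = unif w powi (- int (Suc m))" by (simp only: power_int_minus power_int_of_nat power_inverse)
  hence "?s ^ Suc m \<in> BB w (int (Suc m))" by (simp only: BB_unif_powi)
  hence "(x * unif w ^ Suc m - cst b) * ?s ^ Suc m \<in> BB w (- 1 + int (Suc m))" by (rule BB_mult[OF b])
  moreover have "(x * unif w ^ Suc m - cst b) * ?s ^ Suc m = x - cst b * ?s ^ Suc m"
  proof -
    have "unif w ^ Suc m * ?s ^ Suc m = 1" unfolding power_mult_distrib[symmetric] by simp
    thus ?thesis by (simp only: left_diff_distrib mult.assoc mult_1_right)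
  qed
  ultimately have "x - cst b * ?s ^ Suc m \<in> BB w (int m)" by simp
  then obtain a where a: "x - cst b * ?s ^ Suc m - (\<Sum>i=1..m. cst (a i) * ?s ^ i) \<in> Ow w"
    using Suc.IH by blast
  have "(\<Sum>i=1..m. cst ((a(Suc m := b)) i) * ?s ^ i) = (\<Sum>i=1..m. cst (a i) * ?s ^ i)"
    by (rule sum.cong) auto
  moreover have "(\<Sum>i=1..Suc m. cst ((a(Suc m := b)) i) * ?s ^ i)
      = (\<Sum>i=1..m. cst ((a(Suc m := b)) i) * ?s ^ i) + cst ((a(Suc m := b)) (Suc m)) * ?s ^ Suc m"
    by (subst sum.cl_ivl_Suc) (simp del: fun_upd_apply power_Suc)
  ultimately have e: "(\<Sum>i=1..Suc m. cst ((a(Suc m := b)) i) * ?s ^ i)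
      = cst b * ?s ^ Suc m + (\<Sum>i=1..m. cst (a i) * ?s ^ i)"
    by (simp only: fun_upd_same add.commute)
  have "x - (\<Sum>i=1..Suc m. cst ((a(Suc m := b)) i) * ?s ^ i) \<in> Ow w"
    unfolding e using a by (simp only: diff_diff_eq)
  thus ?case by blast
qed

lemma inverse_unif_OO: "w' \<noteq> w \<Longrightarrow> inverse (unif w) \<in> Ow w'"
  using OO_units by (cases w; cases w'; simp)

lemma principal_part_RR: "(\<Sum>i=1..m. cst (a i) * inverse (unif w) ^ i) \<in> RR"
  by (intro RR_sum RR_mult RR_cst RR_power unif_in_RR)

lemma OO_sum: "(\<And>i. i \<in> I \<Longrightarrow> f i \<in> Ow w) \<Longrightarrow> sum f I \<in> Ow w"
  by (induction I rule: infinite_finite_induct) (auto intro: OO_0 OO_add)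

lemma principal_part_OO:
  "w' \<noteq> w \<Longrightarrow> (\<Sum>i=1..m. cst (a i) * inverse (unif w) ^ i) \<in> Ow w'"
  by (intro OO_sum OO_mult OO_cst OO_power inverse_unif_OO)

lemma subtract_principal_parts:
  assumes "x - z w \<in> Ow w" "\<And>w'. w' \<noteq> w \<Longrightarrow> z w' \<in> Ow w"
  shows "x - (z Place0 + z Place1 + z PlaceInf) \<in> Ow w"
proof (cases w)
  case Place0
  have "x - (z Place0 + z Place1 + z PlaceInf) = x - z Place0 - (z Place1 + z PlaceInf)" by simp
  moreover have "x - z Place0 - (z Place1 + z PlaceInf) \<in> Ow w"
    using assms unfolding Place0 by (intro OO_diff[of "x - z Place0"] OO_add) auto
  ultimately show ?thesis by (simp only:)
next
  case Place1
  have "x - (z Place0 + z Place1 + z PlaceInf) = x - z Place1 - (z Place0 + z PlaceInf)" by simp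
  moreover have "x - z Place1 - (z Place0 + z PlaceInf) \<in> Ow w"
    using assms unfolding Place1 by (intro OO_diff[of "x - z Place1"] OO_add) auto
  ultimately show ?thesis by (simp only:)
next
  case PlaceInf
  have "x - (z Place0 + z Place1 + z PlaceInf) = x - z PlaceInf - (z Place0 + z Place1)" by simp
  moreover have "x - z PlaceInf - (z Place0 + z Place1) \<in> Ow w"
    using assms unfolding PlaceInf by (intro OO_diff[of "x - z PlaceInf"] OO_add) auto
  ultimately show ?thesis by (simp only:)
qed

text \<open>The principal part at one place has no poles at the others, so the three principal parts can be
  added.\<close>

lemma strong_approximation:
  fixes y :: "place \<Rightarrow> 'k::field poly fract"
  assumes "\<And>w. y w \<in> RR"
  shows "\<exists>x\<in>RR. \<forall>w. y w - x \<in> Ow w"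
proof -
  have "\<exists>z\<in>RR. y w - z \<in> Ow w \<and> (\<forall>w'. w' \<noteq> w \<longrightarrow> z \<in> Ow w')" for w
  proof -
    obtain m where "y w \<in> BB w (int m)" using RR_bounded[OF assms] by blast
    then obtain a where "y w - (\<Sum>i=1..m. cst (a i) * inverse (unif w) ^ i) \<in> Ow w"
      using principal_part by blast
    thus ?thesis using principal_part_RR principal_part_OO by blast
  qed
  then obtain z where z: "\<And>w. z w \<in> RR" "\<And>w. y w - z w \<in> Ow w" "\<And>w w'. w' \<noteq> w \<Longrightarrow> z w \<in> Ow w'" by metis
  let ?x = "z Place0 + z Place1 + z PlaceInf"
  have "y w - ?x \<in> Ow w" for w
    by (rule subtract_principal_parts[OF z(2) z(3)]) auto
  thus ?thesis using z(1) RR_add by blast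
qed

lemma OO_E_places:
  "x \<in> Ow Place0 \<Longrightarrow> \<exists>p q. poly q 0 \<noteq> 0 \<and> x * to_fract q = to_fract p"
  "x \<in> Ow Place1 \<Longrightarrow> \<exists>p q. poly q 1 \<noteq> 0 \<and> x * to_fract q = to_fract p"
  "x \<in> Ow PlaceInf \<Longrightarrow> \<exists>p q. q \<noteq> 0 \<and> degree p \<le> degree q \<and> x * to_fract q = to_fract p"
  by (erule OO_E, simp only: good_den.simps, blast)+

text \<open>Unique factorization excludes denominators, and then the condition at $\infty$ bounds the
  degree.\<close>

lemma RR_OO_const:
  fixes x :: "'k::field poly fract"
  assumes "x \<in> RR" "\<And>w. x \<in> Ow w"
  shows "\<exists>a. x = cst a"
proof -
  have step0: "\<exists>f j. x * (tt - 1) ^ j = to_fract f" if "x * (tt ^ i * (tt - 1) ^ j) = to_fract f" for i j f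
    using that
  proof (induction i arbitrary: f)
    case 0 thus ?case by auto
  next
    case (Suc i)
    obtain p q where pq: "poly q 0 \<noteq> 0" "x * to_fract q = to_fract p"
      using OO_E_places(1)[OF assms(2)] by blast
    have "to_fract (f * q) = x * to_fract q * tt ^ Suc i * (tt - 1) ^ j"
      unfolding to_fract_mult Suc.prems[symmetric] by (simp only: mult_ac)
    also have "\<dots> = to_fract (p * [:0,1:] ^ Suc i * [:-1,1:] ^ j)" unfolding pq(2) to_fract_mult to_fract_linear_power ..
    finally have "f * q = p * [:0,1:] ^ Suc i * [:-1,1:] ^ j" unfolding to_fract_eq_iff .
    hence "poly (f * q) 0 = 0" by simp
    hence "poly f 0 = 0" using pq(1) by simp
    then obtain f' where f': "f = [:0,1:] * f'" unfolding poly_eq_0_iff_dvd by auto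
    have "tt * (x * (tt ^ i * (tt - 1) ^ j)) = x * (tt ^ Suc i * (tt - 1) ^ j)" by (simp add: mult_ac)
    also have "\<dots> = tt * to_fract f'" unfolding Suc.prems f' to_fract_mult to_fract_tt ..
    finally have "x * (tt ^ i * (tt - 1) ^ j) = to_fract f'" by simp
    thus ?case by (rule Suc.IH)
  qed
  have step1: "\<exists>f. x = to_fract f" if "x * (tt - 1) ^ j = to_fract f" for j f
    using that
  proof (induction j arbitrary: f)
    case 0 thus ?case by auto
  next
    case (Suc j)
    obtain p q where pq: "poly q 1 \<noteq> 0" "x * to_fract q = to_fract p"
      using OO_E_places(2)[OF assms(2)] by blast
    have "to_fract (f * q) = x * to_fract q * (tt - 1) ^ Suc j"
      unfolding to_fract_mult Suc.prems[symmetric] by (simp only: mult_ac)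
    also have "\<dots> = to_fract (p * [:-1,1:] ^ Suc j)" unfolding pq(2) to_fract_mult to_fract_linear_power ..
    finally have "f * q = p * [:-1,1:] ^ Suc j" unfolding to_fract_eq_iff .
    hence "poly (f * q) 1 = 0" by simp
    hence "poly f 1 = 0" using pq(1) by simp
    then obtain f' where f': "f = [:-1,1:] * f'" unfolding poly_eq_0_iff_dvd by auto
    have "(tt - 1) * (x * (tt - 1) ^ j) = x * (tt - 1) ^ Suc j" by (simp add: mult_ac)
    also have "\<dots> = (tt - 1) * to_fract f'" unfolding Suc.prems f' to_fract_mult to_fract_tt ..
    finally have "x * (tt - 1) ^ j = to_fract f'" by simp
    thus ?case by (rule Suc.IH)
  qed
  obtain f where f: "x = to_fract f" using RR_form[OF assms(1)] step0 step1 by blast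
  obtain p q where pq: "q \<noteq> 0" "degree p \<le> degree q" "x * to_fract q = to_fract p"
    using OO_E_places(3)[OF assms(2)] by blast
  have "to_fract (f * q) = to_fract p" using pq(3) f by simp
  hence "f * q = p" unfolding to_fract_eq_iff .
  hence "degree f = 0" using pq(1,2) by (cases "f = 0") (auto simp: degree_mult_eq)
  then obtain a where "f = [:a:]" by (rule degree_eq_zeroE)
  thus ?thesis using f by blast
qed

text \<open>The form of an element from which a Horner scheme reads off a short word.\<close>

lemma partial_fractions:
  fixes x :: "'k::field poly fract"
  assumes "x \<in> RR" "\<And>w. x \<in> BB w (int m)"
  shows "\<exists>b a. x = cst b + (\<Sum>i=1..m. cst (a Place0 i) * inverse (unif Place0) ^ i)
     + (\<Sum>i=1..m. cst (a Place1 i) * inverse (unif Place1) ^ i)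
     + (\<Sum>i=1..m. cst (a PlaceInf i) * inverse (unif PlaceInf) ^ i)"
proof -
  let ?z = "\<lambda>a w. \<Sum>i=1..m. cst (a w i) * inverse (unif w) ^ i :: 'k poly fract"
  obtain a where a: "\<And>w. x - ?z a w \<in> Ow w" using principal_part[OF assms(2)] by metis
  let ?y = "x - (?z a Place0 + ?z a Place1 + ?z a PlaceInf)"
  have "?y \<in> RR" using assms(1) by (intro RR_diff RR_add principal_part_RR)
  moreover have "?y \<in> Ow w" for w
    by (rule subtract_principal_parts[OF a principal_part_OO]) auto
  ultimately obtain b where "?y = cst b" using RR_OO_const by blast
  hence "x = cst b + ?z a Place0 + ?z a Place1 + ?z a PlaceInf" by (simp add: algebra_simps)
  thus ?thesis by blast
qed

lemma poly_unit_form: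
  fixes f g :: "'k::field poly"
  assumes "f * g = Polynomial.smult a ([:0,1:] ^ i * [:-1,1:] ^ j)" "a \<noteq> 0"
  shows "\<exists>b k l. b \<noteq> 0 \<and> f = Polynomial.smult b ([:0,1:] ^ k * [:-1,1:] ^ l)"
  using assms
proof (induction "i + j" arbitrary: f g i j)
  case 0
  hence e: "f * g = [:a:]" by simp
  hence "f \<noteq> 0" "g \<noteq> 0" using 0 by auto
  hence "degree f + degree g = 0" using arg_cong[OF e, of degree] by (simp add: degree_mult_eq)
  then obtain b where "f = [:b:]" by (auto elim: degree_eq_zeroE)
  thus ?case using \<open>f \<noteq> 0\<close> by (intro exI[of _ b] exI[of _ 0]) auto
next
  case (Suc n)
  have red: "\<exists>b k l. b \<noteq> 0 \<and> f = Polynomial.smult b ([:0,1:] ^ k * [:-1,1:] ^ l)"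
    if root: "poly f z = 0 \<or> poly g z = 0" and n: "n = i' + j'"
      and rest: "Polynomial.smult a ([:0,1:] ^ i * [:-1,1:] ^ j) = [:- z, 1:] * Polynomial.smult a ([:0,1:] ^ i' * [:-1,1:] ^ j')"
      and z: "\<And>b k l. \<exists>k' l'. [:- z, 1:] * Polynomial.smult b ([:0,1:] ^ k * [:-1,1:] ^ l) = Polynomial.smult b ([:0,1:] ^ k' * [:-1,1:] ^ l')"
    for z i' j'
    using root
  proof
    assume "poly f z = 0"
    then obtain f' where f': "f = [:- z, 1:] * f'" unfolding poly_eq_0_iff_dvd by blast
    have "[:- z, 1:] * (f' * g) = [:- z, 1:] * Polynomial.smult a ([:0,1:] ^ i' * [:-1,1:] ^ j')"
      using Suc.prems(1) unfolding f' rest by (simp only: mult.assoc)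
    hence "f' * g = Polynomial.smult a ([:0,1:] ^ i' * [:-1,1:] ^ j')" by (subst (asm) mult_cancel_left) simp
    from Suc.hyps(1)[OF n this Suc.prems(2)] obtain b k l where "b \<noteq> 0" "f' = Polynomial.smult b ([:0,1:] ^ k * [:-1,1:] ^ l)" by blast
    thus ?thesis using z[of b k l] f' by metis
  next
    assume "poly g z = 0"
    then obtain g' where g': "g = [:- z, 1:] * g'" unfolding poly_eq_0_iff_dvd by blast
    have "[:- z, 1:] * (f * g') = [:- z, 1:] * Polynomial.smult a ([:0,1:] ^ i' * [:-1,1:] ^ j')"
      using Suc.prems(1) unfolding g' rest by (simp only: mult.left_commute)
    hence "f * g' = Polynomial.smult a ([:0,1:] ^ i' * [:-1,1:] ^ j')" by (subst (asm) mult_cancel_left) simp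
    from Suc.hyps(1)[OF n this Suc.prems(2)] show ?thesis .
  qed
  have z0: "[:- 0, 1:] * Polynomial.smult b ([:0,1:] ^ k * [:-1,1:] ^ l) = Polynomial.smult b ([:0,1:] ^ Suc k * [:-1,1:] ^ l)"
    for b :: 'k and k l
    by (simp add: mult.assoc del: mult_pCons_left mult_pCons_right)
  have z1: "[:- 1, 1:] * Polynomial.smult b ([:0,1:] ^ k * [:-1,1:] ^ l) = Polynomial.smult b ([:0,1:] ^ k * [:-1,1:] ^ Suc l)"
    for b :: 'k and k l
    by (simp add: mult.left_commute del: mult_pCons_left mult_pCons_right)
  show ?case
  proof (cases i)
    case (Suc i')
    have "poly (f * g) 0 = 0" using Suc.prems(1) Suc by simp
    hence "poly f 0 = 0 \<or> poly g 0 = 0" by simp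
    moreover have "n = i' + j" using Suc.hyps(2) Suc by simp
    ultimately show ?thesis
      by (rule red) (simp only: z0 Suc, intro exI, rule z0)
  next
    case 0
    then obtain j' where j': "j = Suc j'" using Suc.hyps(2) by (cases j) auto
    have "poly (f * g) 1 = 0" using Suc.prems(1) j' by simp
    hence "poly f 1 = 0 \<or> poly g 1 = 0" by simp
    moreover have "n = 0 + j'" using Suc.hyps(2) 0 j' by simp
    ultimately show ?thesis
      by (rule red) (simp only: z1 0 j', intro exI, rule z1)
  qed
qed

text \<open>A product of two polynomials that divides $t^i(t-1)^j$ has only these two prime factors.\<close>

lemma RR_unit_form:
  fixes u :: "'k::field poly fract"
  assumes "u \<in> RR" "u' \<in> RR" "u * u' = 1"
  shows "\<exists>a i j. a \<noteq> 0 \<and> u = cst a * tt powi i * (tt - 1) powi j"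
proof -
  obtain f i j where f: "u * (tt ^ i * (tt - 1) ^ j) = to_fract f" using RR_form[OF assms(1)] by blast
  obtain g k l where g: "u' * (tt ^ k * (tt - 1) ^ l) = to_fract g" using RR_form[OF assms(2)] by blast
  have "to_fract (f * g) = (u * u') * (tt ^ (i + k) * (tt - 1) ^ (j + l))"
    unfolding to_fract_mult f[symmetric] g[symmetric] by (simp add: power_add mult_ac)
  also have "\<dots> = to_fract (Polynomial.smult 1 ([:0,1:] ^ (i + k) * [:-1,1:] ^ (j + l)))"
    unfolding assms(3) by (simp add: to_fract_linear_power)
  finally have "f * g = Polynomial.smult 1 ([:0,1:] ^ (i + k) * [:-1,1:] ^ (j + l))" unfolding to_fract_eq_iff .
  then obtain b m n where b: "b \<noteq> 0" "f = Polynomial.smult b ([:0,1:] ^ m * [:-1,1:] ^ n)"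
    using poly_unit_form[OF _ one_neq_zero] by blast
  have "to_fract f = cst b * (tt ^ m * (tt - 1) ^ n)"
  proof -
    have "f = [:b:] * ([:0,1:] ^ m * [:-1,1:] ^ n)" unfolding b(2) by simp
    thus ?thesis by (simp only: to_fract_mult to_fract_linear_power)
  qed
  hence "u * (tt ^ i * (tt - 1) ^ j) = cst b * (tt ^ m * (tt - 1) ^ n)" using f by simp
  hence "u = cst b * tt powi (int m - int i) * (tt - 1) powi (int n - int j)"
    by (simp add: power_int_diff field_simps)
  thus ?thesis using b(1) by blast
qed

lemma unit_exponents_bounded:
  fixes u :: "'k::field poly fract"
  assumes u: "u = cst a * tt powi i * (tt - 1) powi j" and a: "a \<noteq> 0"
    and B: "u \<in> BB Place0 m" "inverse u \<in> BB Place0 m" "u \<in> BB Place1 m" "inverse u \<in> BB Place1 m"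
  shows "\<bar>i\<bar> \<le> m" "\<bar>j\<bar> \<le> m"
proof -
  have ca: "cst a * cst (inverse a) = 1" using a by (simp flip: cst_simps(6))
  have ia: "inverse (cst a) = cst (inverse a)" using ca by (simp add: inverse_unique)
  have e1: "tt powi i = u * (cst (inverse a) * (tt - 1) powi (- j))"
    using ca a unfolding u by (simp add: power_int_minus field_simps)
  have "cst (inverse a) * (tt - 1) powi (- j) \<in> BB Place0 (0 + 0)"
    using BB_ss_powi[of "- j" Place0] by (intro BB_mult BB_cst) simp_all
  from BB_mult[OF B(1) this] have 1: "(unif Place0 :: 'k poly fract) powi i \<in> BB Place0 m"
    unfolding e1[symmetric] by simp
  have e2: "tt powi (- i) = inverse u * (cst a * (tt - 1) powi j)"
    using ca a unfolding u by (simp add: power_int_minus field_simps)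
  have "cst a * (tt - 1) powi j \<in> BB Place0 (0 + 0)"
    using BB_ss_powi[of "j" Place0] by (intro BB_mult BB_cst) simp_all
  from BB_mult[OF B(2) this] have 2: "(unif Place0 :: 'k poly fract) powi (- i) \<in> BB Place0 m"
    unfolding e2[symmetric] by simp
  show "\<bar>i\<bar> \<le> m" using 1 2 unfolding BB_unif_powi by linarith
  have e3: "(tt - 1) powi j = u * (cst (inverse a) * tt powi (- i))"
    using ca a unfolding u by (simp add: power_int_minus field_simps)
  have "cst (inverse a) * tt powi (- i) \<in> BB Place1 (0 + 0)"
    using BB_tt_powi[of "- i" Place1] by (intro BB_mult BB_cst) simp_all
  from BB_mult[OF B(3) this] have 3: "(unif Place1 :: 'k poly fract) powi j \<in> BB Place1 m"
    unfolding e3[symmetric] by simp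
  have e4: "(tt - 1) powi (- j) = inverse u * (cst a * tt powi i)"
    using ca a unfolding u by (simp add: power_int_minus field_simps)
  have "cst a * tt powi i \<in> BB Place1 (0 + 0)"
    using BB_tt_powi[of "i" Place1] by (intro BB_mult BB_cst) simp_all
  from BB_mult[OF B(4) this] have 4: "(unif Place1 :: 'k poly fract) powi (- j) \<in> BB Place1 m"
    unfolding e4[symmetric] by simp
  show "\<bar>j\<bar> \<le> m" using 3 4 unfolding BB_unif_powi by linarith
qed

lemma poly_finite_places: "w \<noteq> PlaceInf \<Longrightarrow> to_fract f \<in> Ow w"
  by (rule OO_I[of w f 1]) (cases w; simp)+

lemma poly_at_infinity: "to_fract f \<in> BB PlaceInf (int m) \<longleftrightarrow> f = 0 \<or> degree f \<le> m"
proof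
  assume "to_fract f \<in> BB PlaceInf (int m)"
  hence "to_fract f * inverse tt ^ m \<in> Ow PlaceInf" by (simp add: BB_def)
  then obtain p q where pq: "q \<noteq> 0" "degree p \<le> degree q" "to_fract f * inverse tt ^ m * to_fract q = to_fract p"
    using OO_E_places(3) by blast
  have "to_fract (f * q) = to_fract p * tt ^ m" unfolding pq(3)[symmetric] by (simp add: field_simps)
  also have "\<dots> = to_fract (p * [:0,1:] ^ m)" by (simp add: to_fract_linear_power)
  finally have e: "f * q = p * [:0,1:] ^ m" unfolding to_fract_eq_iff .
  show "f = 0 \<or> degree f \<le> m"
  proof (cases "f = 0")
    case False
    hence "degree f + degree q \<le> degree p + m"
      using degree_mult_le[of p "[:0,1:] ^ m"] arg_cong[OF e, of degree] pq(1)
      by (simp add: degree_mult_eq degree_linear_power)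
    thus ?thesis using pq(2) by simp
  qed simp
next
  assume f: "f = 0 \<or> degree f \<le> m"
  have "to_fract f * inverse tt ^ m \<in> Ow PlaceInf"
  proof (rule OO_I[of _ f "[:0,1:] ^ m"])
    show "good_den PlaceInf f ([:0,1:] ^ m)" using f by (auto simp: degree_linear_power)
    show "to_fract f * inverse tt ^ m * to_fract ([:0, 1:] ^ m) = to_fract f"
      by (simp add: to_fract_linear_power field_simps)
  qed
  thus "to_fract f \<in> BB PlaceInf (int m)" by (simp add: BB_def)
qed

section \<open>The matrix group as a semidirect product\<close>

type_synonym 'a tri = "'a ut \<times> 'a \<times> 'a"

text \<open>Conjugation of a unipotent matrix by $\mathrm{diag}(1,P,Q,1)$.\<close>

definition act :: "'a::field \<Rightarrow> 'a \<Rightarrow> 'a ut \<Rightarrow> 'a ut" where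
  "act P Q u = UT (u12 u / P) (u13 u / Q) (u14 u) (u23 u * P / Q) (u24 u * P) (u34 u * Q)"

lemma act_sel [simp]:
  "u12 (act P Q u) = u12 u / P" "u13 (act P Q u) = u13 u / Q" "u14 (act P Q u) = u14 u"
  "u23 (act P Q u) = u23 u * P / Q" "u24 (act P Q u) = u24 u * P" "u34 (act P Q u) = u34 u * Q"
  by (simp_all add: act_def)

lemma act_add: "P \<noteq> 0 \<Longrightarrow> Q \<noteq> 0 \<Longrightarrow> act P Q (u + v) = act P Q u + act P Q v"
  by (rule ut_eqI) (simp_all add: field_simps)

lemma act_uminus: "P \<noteq> 0 \<Longrightarrow> Q \<noteq> 0 \<Longrightarrow> act P Q (- u) = - act P Q u"
  by (rule ut_eqI) (simp_all add: field_simps)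

lemma act_act: "act P Q (act P' Q' u) = act (P * P') (Q * Q') u"
  by (rule ut_eqI) (simp_all add: field_simps)

lemma act_one [simp]: "act 1 1 u = u" by (rule ut_eqI) simp_all

lemma act_E14 [simp]: "act P Q (E14 z) = E14 z" by (rule ut_eqI) simp_all

fun tmul :: "'a::field tri \<Rightarrow> 'a tri \<Rightarrow> 'a tri" where
  "tmul (u, P, Q) (u', P', Q') = (u + act P Q u', P * P', Q * Q')"

fun tinv :: "'a::field tri \<Rightarrow> 'a tri" where
  "tinv (u, P, Q) = (act (inverse P) (inverse Q) (- u), inverse P, inverse Q)"

abbreviation tone :: "'a::field tri" where "tone \<equiv> (0, 1, 1)"

text \<open>The triple $(u,P,Q)$ stands for the matrix $u \cdot \mathrm{diag}(1,P,Q,1)$.\<close>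

fun tmat :: "'a::field tri \<Rightarrow> 'a mat" where
  "tmat (u, P, Q) = mat 4 4 (\<lambda>(i, j).
     [[1, u12 u * P, u13 u * Q, u14 u], [0, P, u23 u * Q, u24 u], [0, 0, Q, u34 u], [0, 0, 0, 1]] ! i ! j)"

lemma less_4: "(i::nat) < 4 \<longleftrightarrow> i = 0 \<or> i = 1 \<or> i = 2 \<or> i = 3"
  by presburger

lemma tmat_dim [simp]: "dim_row (tmat x) = 4" "dim_col (tmat x) = 4" "tmat x \<in> carrier_mat 4 4"
  by (cases x; simp only: tmat.simps dim_row_mat dim_col_mat mat_carrier)+

lemma tmat_index:
  "i < 4 \<Longrightarrow> j < 4 \<Longrightarrow> tmat (u, P, Q) $$ (i, j) =
     [[1, u12 u * P, u13 u * Q, u14 u], [0, P, u23 u * Q, u24 u], [0, 0, Q, u34 u], [0, 0, 0, 1]] ! i ! j"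
  by (simp only: tmat.simps index_mat split_conv)

lemma tmat_mult:
  fixes x y :: "'a::field tri"
  assumes "fst (snd x) \<noteq> 0" "snd (snd x) \<noteq> 0"
  shows "tmat x * tmat y = tmat (tmul x y)"
proof -
  obtain u P Q where x: "x = (u, P, Q)" by (cases x)
  obtain u' P' Q' where y: "y = (u', P', Q')" by (cases y)
  have nz: "P \<noteq> 0" "Q \<noteq> 0" using assms x by auto
  show ?thesis
  proof (rule eq_matI)
    fix i j assume "i < dim_row (tmat (tmul x y))" "j < dim_col (tmat (tmul x y))"
    hence ij: "i < 4" "j < 4" by simp_all
    have "(tmat x * tmat y) $$ (i, j) = (\<Sum>k<4. tmat x $$ (i, k) * tmat y $$ (k, j))"
      using ij by (simp add: scalar_prod_def atLeast0LessThan)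
    also have "\<dots> = tmat x $$ (i, 0) * tmat y $$ (0, j) + tmat x $$ (i, 1) * tmat y $$ (1, j)
        + tmat x $$ (i, 2) * tmat y $$ (2, j) + tmat x $$ (i, 3) * tmat y $$ (3, j)"
      by (simp add: numeral_eq_Suc)
    also have "\<dots> = tmat (tmul x y) $$ (i, j)"
      using ij nz unfolding x y tmul.simps less_4
      by (elim disjE) (simp_all add: tmat_index field_simps del: tmat.simps)
    finally show "(tmat x * tmat y) $$ (i, j) = tmat (tmul x y) $$ (i, j)" .
  qed simp_all
qed

lemma tmat_one: "tmat (tone :: 'a::field tri) = 1\<^sub>m 4"
proof (rule eq_matI)
  fix i j assume "i < dim_row (1\<^sub>m 4 :: 'a mat)" "j < dim_col (1\<^sub>m 4 :: 'a mat)"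
  hence ij: "i < 4" "j < 4" by simp_all
  thus "tmat (tone :: 'a tri) $$ (i, j) = 1\<^sub>m 4 $$ (i, j)"
    unfolding less_4 by (elim disjE) (simp_all add: tmat_index del: tmat.simps)
qed simp_all

lemma tmat_inj:
  assumes "tmat (u, P, Q) = tmat (u', P', Q')" "P \<noteq> 0" "Q \<noteq> 0"
  shows "u = u' \<and> P = P' \<and> Q = Q'"
proof -
  have e: "tmat (u, P, Q) $$ (i, j) = tmat (u', P', Q') $$ (i, j)" for i j using assms(1) by simp
  have "P = P'" "Q = Q'" using e[of 1 1] e[of 2 2] by (simp_all add: tmat_index del: tmat.simps)
  moreover have "u12 u * P = u12 u' * P'" "u13 u * Q = u13 u' * Q'" "u14 u = u14 u'" "u23 u * Q = u23 u' * Q'"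
    "u24 u = u24 u'" "u34 u = u34 u'"
    using e[of 0 1] e[of 0 2] e[of 0 3] e[of 1 2] e[of 1 3] e[of 2 3]
    by (simp_all add: tmat_index del: tmat.simps)
  ultimately show ?thesis using assms(2,3) by (auto intro: ut_eqI)
qed

definition inRR :: "'k::field poly fract ut \<Rightarrow> bool" where
  "inRR u \<longleftrightarrow> u12 u \<in> RR \<and> u13 u \<in> RR \<and> u14 u \<in> RR \<and> u23 u \<in> RR \<and> u24 u \<in> RR \<and> u34 u \<in> RR"

definition unitRR :: "'k::field poly fract \<Rightarrow> bool" where
  "unitRR P \<longleftrightarrow> P \<in> RR \<and> inverse P \<in> RR \<and> P \<noteq> 0"

fun inG :: "'k::field poly fract tri \<Rightarrow> bool" where
  "inG (u, P, Q) \<longleftrightarrow> inRR u \<and> unitRR P \<and> unitRR Q"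

lemma unitRR_mult: "unitRR P \<Longrightarrow> unitRR Q \<Longrightarrow> unitRR (P * Q)"
  by (auto simp: unitRR_def RR_mult)

lemma unitRR_inverse: "unitRR P \<Longrightarrow> unitRR (inverse P)"
  by (auto simp: unitRR_def)

lemma unitRR_one: "unitRR 1" by (simp add: unitRR_def RR_one)

lemma inRR_add: "inRR u \<Longrightarrow> inRR v \<Longrightarrow> inRR (u + v)"
  by (auto simp: inRR_def intro!: RR_add RR_mult)

lemma inRR_uminus: "inRR u \<Longrightarrow> inRR (- u)"
  by (auto simp: inRR_def intro!: RR_add RR_mult RR_neg RR_diff)

lemma inRR_zero: "inRR 0" by (simp add: inRR_def RR_zero)

lemma inRR_act: "inRR u \<Longrightarrow> unitRR P \<Longrightarrow> unitRR Q \<Longrightarrow> inRR (act P Q u)"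
  by (auto simp: inRR_def unitRR_def divide_inverse intro!: RR_mult)

lemma inG_tmul: "inG x \<Longrightarrow> inG y \<Longrightarrow> inG (tmul x y)"
  by (cases x; cases y) (auto intro: inRR_add inRR_act unitRR_mult)

lemma inG_tinv: "inG x \<Longrightarrow> inG (tinv x)"
  by (cases x) (auto intro: inRR_uminus inRR_act unitRR_inverse)

lemma inG_tone: "inG tone" by (simp add: inRR_zero unitRR_one)

lemma inG_nonzero: "inG x \<Longrightarrow> fst (snd x) \<noteq> 0 \<and> snd (snd x) \<noteq> 0"
  by (cases x) (auto simp: unitRR_def)

lemma tmul_tone [simp]: "tmul tone x = x" "tmul x tone = x"
  by (cases x; auto simp: act_def zero_ut_def plus_ut_def)+

lemma tinv_left:
  assumes "inG x" shows "tmul (tinv x) x = tone" "tmul x (tinv x) = tone"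
proof -
  obtain u P Q where x: "x = (u, P, Q)" by (cases x)
  have nz: "P \<noteq> 0" "Q \<noteq> 0" using inG_nonzero[OF assms] x by auto
  show "tmul (tinv x) x = tone" using nz by (simp add: x act_uminus)
  show "tmul x (tinv x) = tone" using nz by (simp add: x act_act)
qed

lemma tmul_assoc:
  assumes "inG x" "inG y" shows "tmul (tmul x y) z = tmul x (tmul y z)"
  using inG_nonzero[OF assms(1)]
  by (cases x; cases y; cases z) (simp add: act_add act_act add.assoc mult.assoc)

lemma A4_carrier: "carrier (A4 (RR :: 'k::field poly fract set)) = tmat ` {x. inG x}"
proof (intro equalityI subsetI)
  fix A assume "A \<in> carrier (A4 (RR :: 'k poly fract set))"
  hence dim: "dim_row A = 4" "dim_col A = 4" and ut: "upper_triangular A" and R: "\<And>i j. i < 4 \<Longrightarrow> j < 4 \<Longrightarrow> A $$ (i, j) \<in> RR"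
    and d: "A $$ (0, 0) = 1" "A $$ (3, 3) = 1" and P: "\<exists>v\<in>RR. A $$ (1, 1) * v = 1" and Q: "\<exists>v\<in>RR. A $$ (2, 2) * v = 1"
    by (auto simp: A4_def)
  define P Q where "P = A $$ (1, 1)" and "Q = A $$ (2, 2)"
  have units: "unitRR P" "unitRR Q"
  proof -
    obtain v where "v \<in> RR" "P * v = 1" using P by (auto simp: P_def)
    thus "unitRR P" using R[of 1 1] by (auto simp: unitRR_def P_def dest: inverse_unique)
    obtain v where "v \<in> RR" "Q * v = 1" using Q by (auto simp: Q_def)
    thus "unitRR Q" using R[of 2 2] by (auto simp: unitRR_def Q_def dest: inverse_unique)
  qed
  define u where "u = UT (A $$ (0, 1) * inverse P) (A $$ (0, 2) * inverse Q) (A $$ (0, 3)) (A $$ (1, 2) * inverse Q) (A $$ (1, 3)) (A $$ (2, 3))"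
  have "inG (u, P, Q)" using units R by (auto simp: u_def inRR_def unitRR_def intro!: RR_mult)
  moreover have "A = tmat (u, P, Q)"
  proof (rule eq_matI)
    fix i j assume "i < dim_row (tmat (u, P, Q))" "j < dim_col (tmat (u, P, Q))"
    hence ij: "i < 4" "j < 4" by simp_all
    have low: "A $$ (i, j) = 0" if "j < i" "i < 4" for i j using ut that dim by (simp add: upper_triangular_def)
    have nz: "P \<noteq> 0" "Q \<noteq> 0" using units by (auto simp: unitRR_def)
    have e: "A $$ (Suc 0, Suc 0) = P" "A $$ (2, 2) = Q" by (simp_all add: P_def Q_def)
    show "A $$ (i, j) = tmat (u, P, Q) $$ (i, j)"
      using ij nz d e unfolding less_4
      by (elim disjE) (simp_all add: tmat_index low u_def del: tmat.simps)
  qed (use dim in simp_all)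
  ultimately show "A \<in> tmat ` {x. inG x}" by blast
next
  fix A :: "'k poly fract mat" assume "A \<in> tmat ` {x. inG x}"
  then obtain u P Q where A: "A = tmat (u, P, Q)" and G: "inG (u, P, Q)" by auto
  have "tmat (u, P, Q) $$ (i, j) \<in> RR" if "i < 4" "j < 4" for i j
    using that G unfolding less_4
    by (elim disjE) (simp_all add: tmat_index inRR_def unitRR_def RR_mult RR_zero RR_one del: tmat.simps)
  moreover have "upper_triangular (tmat (u, P, Q))"
    unfolding upper_triangular_def
  proof (intro allI impI)
    fix i j assume "i < dim_row (tmat (u, P, Q))" "j < i"
    hence "i < 4" "j < 4" "j < i" by simp_all
    thus "tmat (u, P, Q) $$ (i, j) = 0"
      unfolding less_4 by (elim disjE) (simp_all add: tmat_index del: tmat.simps)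
  qed
  moreover have "\<exists>v\<in>RR. P * v = 1" using G by (intro bexI[of _ "inverse P"]) (auto simp: unitRR_def)
  moreover have "\<exists>v\<in>RR. Q * v = 1" using G by (intro bexI[of _ "inverse Q"]) (auto simp: unitRR_def)
  ultimately show "A \<in> carrier (A4 RR)"
    unfolding A A4_def
    by (simp add: tmat_index del: tmat.simps)
qed

lemma A4_mult:
  fixes x y :: "'k::field poly fract tri"
  shows "inG x \<Longrightarrow> tmat x \<otimes>\<^bsub>A4 RR\<^esub> tmat y = tmat (tmul x y)"
  using tmat_mult[of x y] inG_nonzero[of x] by (simp add: A4_def del: tmat.simps)

lemma A4_one: "\<one>\<^bsub>A4 RR\<^esub> = tmat tone" by (simp add: A4_def tmat_one del: tmat.simps)

lemma A4_E:
  assumes "x \<in> carrier (A4 (RR :: 'k::field poly fract set))"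
  obtains a where "inG a" "x = tmat a"
  using assms unfolding A4_carrier by blast

lemma A4_I: "inG a \<Longrightarrow> tmat a \<in> carrier (A4 (RR :: 'k::field poly fract set))"
  unfolding A4_carrier by blast

lemma A4_group: "group (A4 (RR :: 'k::field poly fract set))"
proof (rule groupI)
  fix x y z assume x: "x \<in> carrier (A4 (RR :: 'k poly fract set))" and y: "y \<in> carrier (A4 (RR :: 'k poly fract set))"
    and z: "z \<in> carrier (A4 (RR :: 'k poly fract set))"
  obtain a where a: "inG a" "x = tmat a" by (rule A4_E[OF x])
  obtain b where b: "inG b" "y = tmat b" by (rule A4_E[OF y])
  obtain c where c: "inG c" "z = tmat c" by (rule A4_E[OF z])
  show "x \<otimes>\<^bsub>A4 RR\<^esub> y \<otimes>\<^bsub>A4 RR\<^esub> z = x \<otimes>\<^bsub>A4 RR\<^esub> (y \<otimes>\<^bsub>A4 RR\<^esub> z)"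
    unfolding a(2) b(2) c(2)
    by (simp only: A4_mult a(1) b(1) inG_tmul tmul_assoc)
next
  fix x y assume x: "x \<in> carrier (A4 (RR :: 'k poly fract set))" and y: "y \<in> carrier (A4 (RR :: 'k poly fract set))"
  obtain a where a: "inG a" "x = tmat a" by (rule A4_E[OF x])
  obtain b where b: "inG b" "y = tmat b" by (rule A4_E[OF y])
  show "x \<otimes>\<^bsub>A4 RR\<^esub> y \<in> carrier (A4 RR)"
    unfolding a(2) b(2) A4_mult[OF a(1)] by (intro A4_I inG_tmul a(1) b(1))
next
  show "\<one>\<^bsub>A4 RR\<^esub> \<in> carrier (A4 (RR :: 'k poly fract set))" unfolding A4_one by (intro A4_I inG_tone)
next
  fix x assume x: "x \<in> carrier (A4 (RR :: 'k poly fract set))"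
  obtain a where a: "inG a" "x = tmat a" by (rule A4_E[OF x])
  show "\<one>\<^bsub>A4 RR\<^esub> \<otimes>\<^bsub>A4 RR\<^esub> x = x" unfolding a(2) A4_one A4_mult[OF inG_tone] tmul_tone ..
  have "tmat (tinv a) \<otimes>\<^bsub>A4 RR\<^esub> x = \<one>\<^bsub>A4 RR\<^esub>"
    unfolding a(2) A4_one A4_mult[OF inG_tinv[OF a(1)]] tinv_left(1)[OF a(1)] ..
  thus "\<exists>y\<in>carrier (A4 RR). y \<otimes>\<^bsub>A4 RR\<^esub> x = \<one>\<^bsub>A4 RR\<^esub>"
    using A4_I[OF inG_tinv[OF a(1)]] by blast
qed

lemma A4_inv:
  assumes "inG x" shows "inv\<^bsub>A4 RR\<^esub> (tmat x) = tmat (tinv x)"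
proof -
  interpret group "A4 RR" by (rule A4_group)
  show ?thesis
  proof (rule inv_equality)
    show "tmat (tinv x) \<otimes>\<^bsub>A4 RR\<^esub> tmat x = \<one>\<^bsub>A4 RR\<^esub>"
      unfolding A4_one A4_mult[OF inG_tinv[OF assms]] tinv_left(1)[OF assms] ..
  qed (intro A4_I inG_tinv assms)+
qed

text \<open>Unlike a bound on \<open>word_length\<close>, which is a least number, this says that a word
  exists.\<close>

definition word_bound :: "('a, 'b) monoid_scheme \<Rightarrow> 'a set \<Rightarrow> nat \<Rightarrow> 'a \<Rightarrow> bool" where
  "word_bound G S n g \<longleftrightarrow> (\<exists>w. length w \<le> n \<and> set w \<subseteq> S \<union> m_inv G ` S
     \<and> foldr (\<lambda>x y. x \<otimes>\<^bsub>G\<^esub> y) w \<one>\<^bsub>G\<^esub> = g)"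

context group
begin

lemma word_carrier:
  assumes "S \<subseteq> carrier G" "set w \<subseteq> S \<union> m_inv G ` S"
  shows "foldr (\<lambda>x y. x \<otimes> y) w \<one> \<in> carrier G"
  using assms(2) by (induction w) (use assms(1) in auto)

lemma word_append:
  assumes "S \<subseteq> carrier G" "set v \<subseteq> S \<union> m_inv G ` S" "set w \<subseteq> S \<union> m_inv G ` S"
  shows "foldr (\<lambda>x y. x \<otimes> y) (v @ w) \<one> = foldr (\<lambda>x y. x \<otimes> y) v \<one> \<otimes> foldr (\<lambda>x y. x \<otimes> y) w \<one>"
  using assms(2)
proof (induction v)
  case Nil thus ?case using word_carrier[OF assms(1,3)] by simp
next
  case (Cons a v)
  have "a \<in> carrier G" using Cons.prems assms(1) by auto
  thus ?case using Cons word_carrier[OF assms(1), of v] word_carrier[OF assms(1,3)] by (simp add: m_assoc)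
qed

lemma word_bound_one: "word_bound G S n \<one>"
  unfolding word_bound_def by (intro exI[of _ "[]"]) simp

lemma word_bound_gen: "S \<subseteq> carrier G \<Longrightarrow> s \<in> S \<Longrightarrow> word_bound G S 1 s"
  unfolding word_bound_def by (intro exI[of _ "[s]"]) auto

lemma word_bound_mono: "word_bound G S m g \<Longrightarrow> m \<le> n \<Longrightarrow> word_bound G S n g"
  unfolding word_bound_def by (blast intro: le_trans)

lemma word_bound_mult:
  assumes "S \<subseteq> carrier G" "word_bound G S m g" "word_bound G S n h"
  shows "word_bound G S (m + n) (g \<otimes> h)"
proof -
  obtain v w where "length v \<le> m" "set v \<subseteq> S \<union> m_inv G ` S" "foldr (\<lambda>x y. x \<otimes> y) v \<one> = g"
     "length w \<le> n" "set w \<subseteq> S \<union> m_inv G ` S" "foldr (\<lambda>x y. x \<otimes> y) w \<one> = h"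
    using assms unfolding word_bound_def by blast
  thus ?thesis unfolding word_bound_def using word_append[OF assms(1), of v w]
    by (intro exI[of _ "v @ w"]) auto
qed

lemma word_bound_inv:
  assumes S: "S \<subseteq> carrier G" and g: "word_bound G S n g"
  shows "word_bound G S n (inv g)"
proof -
  obtain w where w: "length w \<le> n" "set w \<subseteq> S \<union> m_inv G ` S" "foldr (\<lambda>x y. x \<otimes> y) w \<one> = g"
    using g unfolding word_bound_def by blast
  have "word_bound G S (length w) (inv (foldr (\<lambda>x y. x \<otimes> y) w \<one>))" using w(2)
  proof (induction w)
    case Nil thus ?case by (simp add: word_bound_one)
  next
    case (Cons a w)
    have a: "a \<in> carrier G" using Cons.prems S by auto
    have "word_bound G S 1 (inv a)"
    proof (cases "a \<in> S")
      case True thus ?thesis unfolding word_bound_def using a by (intro exI[of _ "[inv a]"]) auto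
    next
      case False
      then obtain s where s: "s \<in> S" "a = inv s" using Cons.prems by auto
      hence "inv a = s" using S by auto
      thus ?thesis using word_bound_gen[OF S s(1)] by simp
    qed
    moreover have "word_bound G S (length w) (inv (foldr (\<lambda>x y. x \<otimes> y) w \<one>))"
      using Cons by simp
    ultimately have "word_bound G S (length w + 1) (inv (foldr (\<lambda>x y. x \<otimes> y) w \<one>) \<otimes> inv a)"
      using word_bound_mult[OF S] by blast
    thus ?case using a word_carrier[OF S, of w] Cons.prems by (simp add: inv_mult_group)
  qed
  thus ?thesis using word_bound_mono w by blast
qed

lemma generate_word_bound:
  assumes "S \<subseteq> carrier G" "g \<in> generate G S"
  shows "\<exists>n. word_bound G S n g"
  using assms(2)
proof (induction rule: generate.induct)
  case one thus ?case using word_bound_one by blast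
next
  case (incl h) thus ?case using word_bound_gen[OF assms(1)] by blast
next
  case (inv h) thus ?case using word_bound_inv[OF assms(1) word_bound_gen[OF assms(1)]] by blast
next
  case (eng h1 h2) thus ?case using word_bound_mult[OF assms(1)] by blast
qed

lemma word_bound_generate:
  assumes "S \<subseteq> carrier G" "word_bound G S n g"
  shows "g \<in> generate G S"
proof -
  obtain w where w: "set w \<subseteq> S \<union> m_inv G ` S" "foldr (\<lambda>x y. x \<otimes> y) w \<one> = g"
    using assms unfolding word_bound_def by blast
  have "foldr (\<lambda>x y. x \<otimes> y) w \<one> \<in> generate G S" using w(1)
    by (induction w) (auto intro: generate.intros)
  thus ?thesis using w by simp
qed

lemma word_length_le: "word_bound G S n g \<Longrightarrow> word_length G S g \<le> n"
proof -
  assume "word_bound G S n g"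
  then obtain w where w: "length w \<le> n" "set w \<subseteq> S \<union> m_inv G ` S" "foldr (\<lambda>x y. x \<otimes> y) w \<one> = g"
    unfolding word_bound_def by blast
  hence "word_length G S g \<le> length w" unfolding word_length_def by (intro Least_le) blast
  thus ?thesis using w(1) by simp
qed

lemma word_length_attained:
  assumes "S \<subseteq> carrier G" "g \<in> generate G S"
  shows "word_bound G S (word_length G S g) g"
proof -
  obtain n where "word_bound G S n g" using generate_word_bound[OF assms] by blast
  hence "\<exists>n. \<exists>w. length w = n \<and> set w \<subseteq> S \<union> m_inv G ` S \<and> foldr (\<lambda>x y. x \<otimes> y) w \<one> = g"
    unfolding word_bound_def by blast
  hence "\<exists>w. length w = word_length G S g \<and> set w \<subseteq> S \<union> m_inv G ` S \<and> foldr (\<lambda>x y. x \<otimes> y) w \<one> = g"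
    unfolding word_length_def by (rule LeastI_ex)
  then obtain w where "length w = word_length G S g" "set w \<subseteq> S \<union> m_inv G ` S" "foldr (\<lambda>x y. x \<otimes> y) w \<one> = g"
    by blast
  thus ?thesis unfolding word_bound_def by (intro exI[of _ w]) simp
qed

lemma Metric_space_word_dist:
  assumes S: "S \<subseteq> carrier G" "generate G S = carrier G"
  shows "Metric_space (carrier G) (word_dist G S)"
proof -
  have att: "word_bound G S (word_length G S g) g" if "g \<in> carrier G" for g
    using word_length_attained[OF S(1)] that S(2) by simp
  have inv_le: "word_length G S (inv g) \<le> word_length G S g" if "g \<in> carrier G" for g
    using word_length_le[OF word_bound_inv[OF S(1) att[OF that]]] .
  show ?thesis
  proof
    fix x y
    show "0 \<le> word_dist G S x y" by (simp add: word_dist_def)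
    show "word_dist G S x y = word_dist G S y x"
    proof (cases "x \<in> carrier G \<and> y \<in> carrier G")
      case True
      hence e: "inv (inv x \<otimes> y) = inv y \<otimes> x" "inv (inv y \<otimes> x) = inv x \<otimes> y" by (simp_all add: inv_mult_group)
      hence "word_length G S (inv x \<otimes> y) = word_length G S (inv y \<otimes> x)"
        using inv_le[of "inv x \<otimes> y"] inv_le[of "inv y \<otimes> x"] True by simp
      thus ?thesis using True by (simp add: word_dist_def)
    qed (auto simp: word_dist_def)
  next
    fix x y assume xy: "x \<in> carrier G" "y \<in> carrier G"
    show "word_dist G S x y = 0 \<longleftrightarrow> x = y"
    proof
      assume "word_dist G S x y = 0"
      hence "word_bound G S 0 (inv x \<otimes> y)" using att[of "inv x \<otimes> y"] xy by (simp add: word_dist_def)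
      hence "inv x \<otimes> y = \<one>" by (simp add: word_bound_def)
      thus "x = y" using xy by (metis inv_closed inv_equality inv_inv)
    next
      assume "x = y"
      thus "word_dist G S x y = 0" using xy word_length_le[OF word_bound_one[of S 0]] by (simp add: word_dist_def)
    qed
  next
    fix x y z assume xyz: "x \<in> carrier G" "y \<in> carrier G" "z \<in> carrier G"
    have "inv x \<otimes> z = (inv x \<otimes> y) \<otimes> (inv y \<otimes> z)" using xyz by (simp add: m_assoc[symmetric]) (simp add: m_assoc)
    hence "word_length G S (inv x \<otimes> z) \<le> word_length G S (inv x \<otimes> y) + word_length G S (inv y \<otimes> z)"
      using word_length_le[OF word_bound_mult[OF S(1) att att]] xyz by simp
    thus "word_dist G S x z \<le> word_dist G S x y + word_dist G S y z"
      using xyz by (simp add: word_dist_def flip: of_nat_add)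
  qed
qed

end

section \<open>Word length and pole orders\<close>

text \<open>Bounds on the matrix entries, which are additive under products; \<open>NB\<close> bounds the
  components of the triple.\<close>

definition MB :: "place \<Rightarrow> int \<Rightarrow> 'k::field poly fract tri \<Rightarrow> bool" where
  "MB w m x \<longleftrightarrow> (\<forall>i<4. \<forall>j<4. tmat x $$ (i, j) \<in> BB w m)"

fun NB :: "place \<Rightarrow> int \<Rightarrow> 'k::field poly fract tri \<Rightarrow> bool" where
  "NB w m (u, P, Q) \<longleftrightarrow> u12 u \<in> BB w m \<and> u13 u \<in> BB w m \<and> u14 u \<in> BB w m \<and> u23 u \<in> BB w m
     \<and> u24 u \<in> BB w m \<and> u34 u \<in> BB w m
     \<and> P \<in> BB w m \<and> inverse P \<in> BB w m \<and> Q \<in> BB w m \<and> inverse Q \<in> BB w m"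

lemma MB_mult:
  assumes "inG x" "MB w m x" "MB w n y" shows "MB w (m + n) (tmul x y)"
  unfolding MB_def
proof (intro allI impI)
  fix i j :: nat assume ij: "i < 4" "j < 4"
  have "tmat (tmul x y) $$ (i, j) = (tmat x * tmat y) $$ (i, j)"
    using tmat_mult[of x y] inG_nonzero[OF assms(1)] by simp
  also have "\<dots> = (\<Sum>k<4. tmat x $$ (i, k) * tmat y $$ (k, j))"
    using ij by (simp add: scalar_prod_def atLeast0LessThan)
  also have "\<dots> \<in> BB w (m + n)"
    using assms(2,3) ij unfolding MB_def by (intro BB_sum BB_mult) auto
  finally show "tmat (tmul x y) $$ (i, j) \<in> BB w (m + n)" .
qed

lemma MB_mono: "MB w m x \<Longrightarrow> m \<le> n \<Longrightarrow> MB w n x"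
  unfolding MB_def using BB_mono by blast

lemma MB_tone: "MB w 0 tone"
  unfolding MB_def tmat_one using BB_one[of 0 w] by auto

lemma NB_mono: "NB w m x \<Longrightarrow> m \<le> n \<Longrightarrow> NB w n x"
  using BB_mono[of m n _ w] by (cases x) auto

lemma NB_if_MB:
  fixes u :: "'k::field poly fract ut"
  assumes "MB w m (u, P, Q)" "MB w m (tinv (u, P, Q))" "0 \<le> m" "P \<noteq> 0" "Q \<noteq> 0"
  shows "NB w (2 * m) (u, P, Q)"
proof -
  have e: "tmat (u, P, Q) $$ (i, j) \<in> BB w m" "tmat (tinv (u, P, Q)) $$ (i, j) \<in> BB w m" if "i < 4" "j < 4" for i j
    using assms(1,2) that unfolding MB_def by blast+
  have a: "u12 u * P \<in> BB w m" "u13 u * Q \<in> BB w m" "u14 u \<in> BB w m" "P \<in> BB w m" "u23 u * Q \<in> BB w m"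
     "u24 u \<in> BB w m" "Q \<in> BB w m" "u34 u \<in> BB w m"
    using e(1)[of 0 1] e(1)[of 0 2] e(1)[of 0 3] e(1)[of 1 1] e(1)[of 1 2] e(1)[of 1 3] e(1)[of 2 2] e(1)[of 2 3]
    by (simp_all add: tmat_index del: tmat.simps)
  have b: "inverse P \<in> BB w m" "inverse Q \<in> BB w m"
    using e(2)[of 1 1] e(2)[of 2 2] by (simp_all add: tmat_index del: tmat.simps)
  have cancel: "x \<in> BB w (2 * m)" if "x * y \<in> BB w m" "inverse y \<in> BB w m" "y \<noteq> 0" for x y :: "'k poly fract"
    using BB_mult[OF that(1,2)] by (simp only: mult_2 mult.assoc right_inverse[OF that(3)] mult_1_right)
  have up: "x \<in> BB w (2 * m)" if "x \<in> BB w m" for x :: "'k poly fract"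
    using BB_mono[OF _ that, of "2 * m"] assms(3) by simp
  show ?thesis unfolding NB.simps
    by (intro conjI cancel[OF a(1) b(1) assms(4)] cancel[OF a(2) b(2) assms(5)] cancel[OF a(5) b(2) assms(5)] up a b)
qed

lemma inG_MB_bounded:
  fixes x :: "'k::field poly fract tri"
  assumes "inG x" shows "\<exists>m::nat. \<forall>w. MB w (int m) x"
proof -
  have "\<exists>m::nat. \<forall>w. tmat x $$ (i, j) \<in> BB w (int m)" if "i < 4" "j < 4" for i j
  proof -
    have "tmat x \<in> carrier (A4 RR)" using A4_I[OF assms] .
    hence "tmat x $$ (i, j) \<in> RR" using that by (simp add: A4_def)
    thus ?thesis by (rule RR_bounded)
  qed
  then obtain b :: "nat \<Rightarrow> nat \<Rightarrow> nat" where b: "\<And>i j w. i < 4 \<Longrightarrow> j < 4 \<Longrightarrow> tmat x $$ (i, j) \<in> BB w (int (b i j))" by metis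
  define m where "m = (\<Sum>i<4. \<Sum>j<4. b i j)"
  have le: "b i j \<le> m" if "i < 4" "j < 4" for i j
  proof -
    have "b i j \<le> (\<Sum>j<4. b i j)" using that by (intro member_le_sum) auto
    also have "\<dots> \<le> m" unfolding m_def using that by (intro member_le_sum[of i "{..<4}" "\<lambda>i. \<Sum>j<4. b i j"]) auto
    finally show ?thesis .
  qed
  have "tmat x $$ (i, j) \<in> BB w (int m)" if "i < 4" "j < 4" for i j w
    by (rule BB_mono[OF _ b[OF that]]) (simp add: le[OF that])
  thus ?thesis unfolding MB_def by blast
qed

text \<open>The quotient by the central elements whose $(1,4)$ entry lies in a given group of polynomials.\<close>

locale central_quotient =
  fixes ZP :: "'k::field poly set"
  assumes finite_field: "finite (UNIV :: 'k set)"
    and ZP_zero: "0 \<in> ZP" and ZP_diff: "f \<in> ZP \<Longrightarrow> g \<in> ZP \<Longrightarrow> f - g \<in> ZP"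
begin

lemma ZP_neg: "f \<in> ZP \<Longrightarrow> - f \<in> ZP" using ZP_diff[OF ZP_zero] by simp
lemma ZP_add: "f \<in> ZP \<Longrightarrow> g \<in> ZP \<Longrightarrow> f + g \<in> ZP" using ZP_diff[OF _ ZP_neg] by fastforce

definition zt :: "'k poly \<Rightarrow> 'k poly fract tri" where "zt f = (E14 (to_fract f), 1, 1)"

definition ZM :: "'k poly fract mat set" where "ZM = (\<lambda>f. tmat (zt f)) ` ZP"

definition Gam :: "'k poly fract mat set monoid" where "Gam = A4 RR Mod ZM"

abbreviation gmul (infixl "\<cdot>" 70) where "x \<cdot> y \<equiv> x \<otimes>\<^bsub>Gam\<^esub> y"

definition proj :: "'k poly fract tri \<Rightarrow> 'k poly fract mat set" where
  "proj x = ZM #>\<^bsub>A4 RR\<^esub> tmat x"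

lemma zt_inG: "inG (zt f)"
  by (simp add: zt_def inRR_def RR_zero RR_poly unitRR_one)

lemma zt_mul: "tmul (zt f) (u, P, Q) = (u + E14 (to_fract f), P, Q)" "tmul (u, P, Q) (zt f) = (u + E14 (to_fract f), P, Q)"
  by (simp_all add: zt_def plus_ut_def add.commute)

lemma zt_central: "tmul (zt f) x = tmul x (zt f)"
  by (cases x) (simp only: zt_mul)

lemma zt_add: "tmul (zt f) (zt g) = zt (f + g)"
  by (simp add: zt_def plus_ut_def)

lemma zt_zero: "zt 0 = tone" by (simp add: zt_def zero_ut_def)

lemma zt_tinv: "tinv (zt f) = zt (- f)"
  by (simp add: zt_def uminus_ut_def)

lemma ZM_subgroup: "subgroup ZM (A4 RR)"
proof (rule group.subgroupI[OF A4_group])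
  show "ZM \<subseteq> carrier (A4 RR)" unfolding ZM_def using A4_I[OF zt_inG] by blast
  show "ZM \<noteq> {}" unfolding ZM_def using ZP_zero by blast
next
  fix a assume "a \<in> ZM"
  then obtain f where f: "f \<in> ZP" "a = tmat (zt f)" unfolding ZM_def by blast
  show "inv\<^bsub>A4 RR\<^esub> a \<in> ZM" unfolding f(2) A4_inv[OF zt_inG] zt_tinv ZM_def using ZP_neg[OF f(1)] by blast
next
  fix a b assume "a \<in> ZM" "b \<in> ZM"
  then obtain f g where f: "f \<in> ZP" "a = tmat (zt f)" "g \<in> ZP" "b = tmat (zt g)" unfolding ZM_def by blast
  show "a \<otimes>\<^bsub>A4 RR\<^esub> b \<in> ZM" unfolding f(2,4) A4_mult[OF zt_inG] zt_add ZM_def using ZP_add[OF f(1,3)] by blast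
qed

lemma ZM_central: "central_subgroup ZM (A4 RR)"
  unfolding central_subgroup_def
proof (intro conjI ballI)
  show "subgroup ZM (A4 RR)" by (rule ZM_subgroup)
  fix z g assume "z \<in> ZM" "g \<in> carrier (A4 (RR :: 'k poly fract set))"
  then obtain f x where "z = tmat (zt f)" "inG x" "g = tmat x" unfolding ZM_def by (auto elim: A4_E)
  thus "z \<otimes>\<^bsub>A4 RR\<^esub> g = g \<otimes>\<^bsub>A4 RR\<^esub> z" by (simp only: A4_mult zt_inG zt_central)
qed

sublocale ZN: normal ZM "A4 RR"
proof (rule group.normal_invI[OF A4_group ZM_subgroup])
  interpret group "A4 (RR :: 'k poly fract set)" by (rule A4_group)
  fix x h assume x: "x \<in> carrier (A4 (RR :: 'k poly fract set))" and h: "h \<in> ZM"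
  have hc: "h \<in> carrier (A4 RR)" using subgroup.subset[OF ZM_subgroup] h by blast
  have "x \<otimes>\<^bsub>A4 RR\<^esub> h = h \<otimes>\<^bsub>A4 RR\<^esub> x" using ZM_central x h unfolding central_subgroup_def by metis
  hence "x \<otimes>\<^bsub>A4 RR\<^esub> h \<otimes>\<^bsub>A4 RR\<^esub> inv\<^bsub>A4 RR\<^esub> x = h" using x hc by (simp add: m_assoc)
  thus "x \<otimes>\<^bsub>A4 RR\<^esub> h \<otimes>\<^bsub>A4 RR\<^esub> inv\<^bsub>A4 RR\<^esub> x \<in> ZM" using h by simp
qed

sublocale GG: group Gam
  unfolding Gam_def by (rule ZN.factorgroup_is_group)

lemma proj_carrier: assumes "inG x" shows "proj x \<in> carrier Gam"
  unfolding Gam_def FactGroup_def RCOSETS_def proj_def using A4_I[OF assms] by auto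

lemma Gam_E:
  assumes "g \<in> carrier Gam" obtains x where "inG x" "g = proj x"
  using assms unfolding Gam_def FactGroup_def RCOSETS_def proj_def A4_carrier by auto

lemma proj_mult:
  assumes "inG x" "inG y" shows "proj x \<cdot> proj y = proj (tmul x y)"
  using ZN.rcos_sum[OF A4_I[OF assms(1)] A4_I[OF assms(2)]]
  by (simp add: Gam_def FactGroup_def proj_def A4_mult[OF assms(1)] del: tmat.simps)

lemma proj_one: "proj tone = \<one>\<^bsub>Gam\<^esub>"
  unfolding proj_def Gam_def FactGroup_def A4_one[symmetric]
  using subgroup.subset[OF ZM_subgroup] by (simp add: ZN.coset_mult_one)

lemma proj_inv:
  assumes "inG x" shows "inv\<^bsub>Gam\<^esub> (proj x) = proj (tinv x)"
  by (rule GG.inv_equality)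
     (simp_all add: proj_mult inG_tinv assms tinv_left proj_one proj_carrier del: tinv.simps)

lemma proj_eq_iff:
  assumes "inG x" "inG y"
  shows "proj x = proj y \<longleftrightarrow> (\<exists>f\<in>ZP. y = tmul x (zt f))"
proof
  assume "proj x = proj y"
  have "tmat y \<in> ZM #>\<^bsub>A4 RR\<^esub> tmat y" using ZN.rcos_self[OF A4_I[OF assms(2)] ZM_subgroup] .
  hence "tmat y \<in> ZM #>\<^bsub>A4 RR\<^esub> tmat x" using \<open>proj x = proj y\<close> by (simp add: proj_def)
  then obtain f where f: "f \<in> ZP" "tmat y = tmat (zt f) \<otimes>\<^bsub>A4 RR\<^esub> tmat x" unfolding r_coset_def ZM_def by blast
  hence "tmat y = tmat (tmul x (zt f))" by (simp only: A4_mult zt_inG zt_central)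
  moreover obtain u P Q where y: "y = (u, P, Q)" by (cases y)
  moreover obtain u' P' Q' where y': "tmul x (zt f) = (u', P', Q')" by (cases "tmul x (zt f)")
  ultimately have "y = tmul x (zt f)" using tmat_inj[of u P Q u' P' Q'] inG_nonzero[OF assms(2)] by simp
  thus "\<exists>f\<in>ZP. y = tmul x (zt f)" using f(1) by blast
next
  assume "\<exists>f\<in>ZP. y = tmul x (zt f)"
  then obtain f where f: "f \<in> ZP" "y = tmul x (zt f)" by blast
  have "tmat y \<in> ZM #>\<^bsub>A4 RR\<^esub> tmat x"
    unfolding r_coset_def ZM_def f(2) zt_central[symmetric] A4_mult[OF zt_inG, symmetric] using f(1) by blast
  thus "proj x = proj y" unfolding proj_def
    by (rule ZN.repr_independence[OF _ A4_I[OF assms(1)] ZM_subgroup])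
qed

text \<open>A product of $n$ matrices has pole orders at most $n$ times those of the factors. Only some
  preimage of the group element is bounded.\<close>

lemma word_length_lower:
  assumes S: "finite S" "S \<subseteq> carrier Gam"
  shows "\<exists>c::nat. \<forall>n g. word_bound Gam S n g \<longrightarrow> (\<exists>x. inG x \<and> g = proj x \<and> (\<forall>w. NB w (int (c * n)) x))"
proof -
  let ?S = "S \<union> m_inv Gam ` S"
  have "\<exists>x c. inG x \<and> s = proj x \<and> (\<forall>w. MB w (int c) x \<and> MB w (int c) (tinv x))" if s: "s \<in> ?S" for s
  proof -
    have "s \<in> carrier Gam" using s S(2) by auto
    then obtain x where x: "inG x" "s = proj x" by (rule Gam_E)
    obtain m where m: "\<forall>w. MB w (int m) x" using inG_MB_bounded[OF x(1)] by blast
    obtain n where n: "\<forall>w. MB w (int n) (tinv x)" using inG_MB_bounded[OF inG_tinv[OF x(1)]] by blast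
    have "MB w (int (m + n)) x \<and> MB w (int (m + n)) (tinv x)" for w
      using MB_mono[of w "int m" x "int (m + n)"] MB_mono[of w "int n" "tinv x" "int (m + n)"] m n by simp
    thus ?thesis using x by blast
  qed
  then obtain X c where Xc: "\<And>s. s \<in> ?S \<Longrightarrow> inG (X s) \<and> s = proj (X s) \<and>
      (\<forall>w. MB w (int (c s)) (X s) \<and> MB w (int (c s)) (tinv (X s)))" by metis
  define C where "C = sum c ?S"
  have fin: "finite ?S" using S(1) by simp
  have XC: "inG (X s)" "s = proj (X s)" "MB w (int C) (X s)" "MB w (int C) (tinv (X s))" if "s \<in> ?S" for s w
  proof -
    have "c s \<le> C" unfolding C_def by (rule member_le_sum[OF that _ fin]) simp
    thus "MB w (int C) (X s)" "MB w (int C) (tinv (X s))"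
      using MB_mono[of w "int (c s)" "X s" "int C"] MB_mono[of w "int (c s)" "tinv (X s)" "int C"] Xc[OF that] by auto
    show "inG (X s)" "s = proj (X s)" using Xc[OF that] by blast+
  qed
  have words: "\<exists>x. inG x \<and> foldr (\<cdot>) v \<one>\<^bsub>Gam\<^esub> = proj x \<and>
      (\<forall>w. MB w (int (C * length v)) x \<and> MB w (int (C * length v)) (tinv x))" if "set v \<subseteq> ?S" for v
    using that
  proof (induction v)
    case Nil
    have "tinv (tone :: 'k poly fract tri) = tone" by (simp add: zero_ut_def act_def uminus_ut_def)
    thus ?case by (intro exI[of _ tone]) (simp del: tinv.simps inG.simps add: MB_tone inG_tone proj_one)
  next
    case (Cons s v)
    then obtain x where x: "inG x" "foldr (\<cdot>) v \<one>\<^bsub>Gam\<^esub> = proj x"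
      "\<And>w. MB w (int (C * length v)) x" "\<And>w. MB w (int (C * length v)) (tinv x)" by auto
    have s: "s \<in> ?S" using Cons.prems by simp
    note Xs = XC[OF s]
    have ti: "tinv (tmul (X s) x) = tmul (tinv x) (tinv (X s))"
    proof -
      have "tmul (tinv (tmul (X s) x)) (tmul (X s) x) = tmul (tmul (tinv x) (tinv (X s))) (tmul (X s) x)"
        unfolding tinv_left(1)[OF inG_tmul[OF Xs(1) x(1)]]
        by (simp only: tmul_assoc inG_tinv inG_tmul Xs(1) x(1) tmul_assoc[OF inG_tinv[OF Xs(1)] Xs(1), symmetric] tinv_left tmul_tone)
      hence "tmul (tmul (tinv (tmul (X s) x)) (tmul (X s) x)) (tinv (tmul (X s) x)) =
         tmul (tmul (tmul (tinv x) (tinv (X s))) (tmul (X s) x)) (tinv (tmul (X s) x))" by simp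
      thus ?thesis
        by (simp only: tmul_assoc inG_tinv inG_tmul Xs(1) x(1) tinv_left tmul_tone)
    qed
    have "MB w (int C + int (C * length v)) (tmul (X s) x)" for w
      by (rule MB_mult[OF Xs(1) Xs(3) x(3)])
    moreover have "MB w (int (C * length v) + int C) (tinv (tmul (X s) x))" for w
      unfolding ti by (rule MB_mult[OF inG_tinv[OF x(1)] x(4) Xs(4)])
    moreover have "foldr (\<cdot>) (s # v) \<one>\<^bsub>Gam\<^esub> = proj (tmul (X s) x)"
      using x(2) Xs(2) proj_mult[OF Xs(1) x(1)] by simp
    ultimately show ?case using inG_tmul[OF Xs(1) x(1)]
      by (intro exI[of _ "tmul (X s) x"]) (simp add: add.commute)
  qed
  show ?thesis
  proof (intro exI[of _ "2 * C"] allI impI)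
    fix n g assume "word_bound Gam S n g"
    then obtain v where v: "length v \<le> n" "set v \<subseteq> ?S" "foldr (\<cdot>) v \<one>\<^bsub>Gam\<^esub> = g"
      unfolding word_bound_def by blast
    then obtain x where x: "inG x" "g = proj x" "\<And>w. MB w (int (C * length v)) x" "\<And>w. MB w (int (C * length v)) (tinv x)"
      using words[OF v(2)] by auto
    obtain u P Q where xx: "x = (u, P, Q)" by (cases x)
    have "NB w (2 * int (C * length v)) x" for w
      using NB_if_MB[of w "int (C * length v)" u P Q] x(3,4) inG_nonzero[OF x(1)] unfolding xx by simp
    moreover have "2 * int (C * length v) \<le> int (2 * C * n)"
      using v(1) by (simp only: of_nat_mult of_nat_numeral mult.assoc) (intro mult_left_mono; simp)
    ultimately show "\<exists>x. inG x \<and> g = proj x \<and> (\<forall>w. NB w (int (2 * C * n)) x)"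
      using NB_mono x(1,2) by blast
  qed
qed

text \<open>Conjugation by \<open>D\<close> multiplies the root element by \<open>s\<close>; a polynomial in
  \<open>s\<close> is built by alternating these conjugations with the addition of constants.\<close>

lemma horner_word:
  assumes S: "S \<subseteq> carrier Gam" and e: "\<And>x. x \<in> RR \<Longrightarrow> e x \<in> carrier Gam"
    and e_add: "\<And>x y. x \<in> RR \<Longrightarrow> y \<in> RR \<Longrightarrow> e (x + y) = e x \<cdot> e y"
    and D: "word_bound Gam S c D" and conj: "\<And>x. x \<in> RR \<Longrightarrow> D \<cdot> e x \<cdot> inv\<^bsub>Gam\<^esub> D = e (s * x)"
    and s: "s \<in> RR" and const: "\<And>a. word_bound Gam S c (e (cst a))"
  shows "word_bound Gam S (3 * c * m) (e (\<Sum>i=1..m. cst (a i) * s ^ i))"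
proof (induction m arbitrary: a)
  case 0
  have "e 0 = e 0 \<cdot> e 0" using e_add[OF RR_zero RR_zero] by simp
  hence "e 0 = \<one>\<^bsub>Gam\<^esub>" using e[OF RR_zero] by (metis GG.l_cancel_one)
  thus ?case using GG.word_bound_one by simp
next
  case (Suc m)
  let ?x = "\<Sum>i=1..m. cst (a (Suc i)) * s ^ i"
  have x: "?x \<in> RR" by (intro RR_sum RR_mult RR_cst RR_power s)
  have "(\<Sum>i=1..Suc m. cst (a i) * s ^ i) = (\<Sum>i\<in>{0..m}. cst (a (Suc i)) * s ^ Suc i)"
    using sum.shift_bounds_cl_Suc_ivl[of "\<lambda>i. cst (a i) * s ^ i" 0 m] by simp
  also have "\<dots> = cst (a (Suc 0)) * s + (\<Sum>i=1..m. cst (a (Suc i)) * s ^ Suc i)"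
    by (simp add: sum.atLeast_Suc_atMost)
  also have "\<dots> = s * (cst (a 1) + ?x)"
    by (simp add: sum_distrib_left distrib_left mult_ac)
  finally have eq: "(\<Sum>i=1..Suc m. cst (a i) * s ^ i) = s * (cst (a 1) + ?x)" .
  have "word_bound Gam S (c + 3 * c * m) (e (cst (a 1)) \<cdot> e ?x)"
    using Suc.IH const by (intro GG.word_bound_mult[OF S])
  hence "word_bound Gam S (c + 3 * c * m) (e (cst (a 1) + ?x))" using e_add[OF RR_cst x] by simp
  hence "word_bound Gam S (c + (c + 3 * c * m) + c) (D \<cdot> e (cst (a 1) + ?x) \<cdot> inv\<^bsub>Gam\<^esub> D)"
    using D by (intro GG.word_bound_mult[OF S] GG.word_bound_inv[OF S])
  thus ?case unfolding eq conj[OF RR_add[OF RR_cst x]] by (rule GG.word_bound_mono) simp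
qed

text \<open>By partial fractions an element is a sum of three polynomials, each in the inverse of one
  uniformizer.\<close>

lemma root_word:
  assumes S: "S \<subseteq> carrier Gam" and e: "\<And>x. x \<in> RR \<Longrightarrow> e x \<in> carrier Gam"
    and e_add: "\<And>x y. x \<in> RR \<Longrightarrow> y \<in> RR \<Longrightarrow> e (x + y) = e x \<cdot> e y"
    and D: "\<And>w. \<exists>D. word_bound Gam S c D \<and> (\<forall>x\<in>RR. D \<cdot> e x \<cdot> inv\<^bsub>Gam\<^esub> D = e (inverse (unif w) * x))"
    and const: "\<And>a. word_bound Gam S c (e (cst a))"
    and x: "x \<in> RR" "\<And>w. x \<in> BB w (int m)"
  shows "word_bound Gam S (c * (9 * m + 1)) (e x)"
proof -
  have h: "word_bound Gam S (3 * c * m) (e (\<Sum>i=1..m. cst (a i) * inverse (unif w) ^ i))" for a w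
  proof -
    obtain D where "word_bound Gam S c D" "\<forall>x\<in>RR. D \<cdot> e x \<cdot> inv\<^bsub>Gam\<^esub> D = e (inverse (unif w) * x)"
      using D by blast
    thus ?thesis using horner_word[OF S e e_add _ _ unif_in_RR(2) const] by blast
  qed
  obtain b a where ba: "x = cst b + (\<Sum>i=1..m. cst (a Place0 i) * inverse (unif Place0) ^ i)
     + (\<Sum>i=1..m. cst (a Place1 i) * inverse (unif Place1) ^ i)
     + (\<Sum>i=1..m. cst (a PlaceInf i) * inverse (unif PlaceInf) ^ i)"
    using partial_fractions[OF x] by blast
  have "word_bound Gam S (c + 3 * c * m + 3 * c * m + 3 * c * m) (e x)"
    unfolding ba
    by (simp only: e_add RR_add RR_cst principal_part_RR) (intro GG.word_bound_mult[OF S] const h)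
  thus ?thesis by (rule GG.word_bound_mono) (simp add: algebra_simps)
qed

lemma generator_bound:
  assumes S: "S \<subseteq> carrier Gam" and F: "finite F" "\<And>x. x \<in> F \<Longrightarrow> inG x \<and> proj x \<in> generate Gam S"
  shows "\<exists>c. \<forall>x\<in>F. word_bound Gam S c (proj x)"
proof -
  have "\<exists>n. word_bound Gam S n (proj x)" if "x \<in> F" for x
    using GG.generate_word_bound[OF S] F(2)[OF that] by blast
  then obtain n where n: "\<And>x. x \<in> F \<Longrightarrow> word_bound Gam S (n x) (proj x)" by metis
  have "word_bound Gam S (sum n F) (proj x)" if "x \<in> F" for x
    by (rule GG.word_bound_mono[OF n[OF that]], rule member_le_sum[OF that _ F(1)]) simp
  thus ?thesis by blast
qed

text \<open>For the finite coefficient field these are finitely many generators.\<close>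

definition basic_elements :: "'k poly fract tri set" where
  "basic_elements = (\<Union>a. {(E12 (cst a), 1, 1), (E13 (cst a), 1, 1), (E23 (cst a), 1, 1), (E24 (cst a), 1, 1),
       (E34 (cst a), 1, 1)}) \<union> (\<Union>a\<in>-{0}. {(0, cst a, 1), (0, 1, cst a)})
     \<union> {(0, tt, 1), (0, tt - 1, 1), (0, 1, tt), (0, 1, tt - 1)}"

lemma unitRR_cst: "(a :: 'k) \<noteq> 0 \<Longrightarrow> unitRR (cst a)"
proof -
  assume a: "a \<noteq> 0"
  have "cst a * cst (inverse a) = 1" using a by (simp only: cst_simps(6)[symmetric]) simp
  hence "inverse (cst a) = cst (inverse a)" by (simp add: inverse_unique)
  thus ?thesis using a RR_cst[of a] RR_cst[of "inverse a"] by (simp add: unitRR_def)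
qed

lemma unitRR_tt: "unitRR (tt :: 'k poly fract)" "unitRR (tt - 1 :: 'k poly fract)"
  using RR_tt by (simp_all add: unitRR_def)

lemma basic_elements: "finite basic_elements" "x \<in> basic_elements \<Longrightarrow> inG x"
proof -
  show "finite basic_elements"
    unfolding basic_elements_def using finite_field finite_subset[OF subset_UNIV finite_field] by simp
  show "x \<in> basic_elements \<Longrightarrow> inG x"
    unfolding basic_elements_def
    by (auto simp: inRR_def RR_zero RR_cst unitRR_one unitRR_cst unitRR_tt intro: ccontr)
qed

lemma unit_word:
  assumes S: "S \<subseteq> carrier Gam"
    and hom: "\<And>P P'. unitRR P \<Longrightarrow> unitRR P' \<Longrightarrow> e (P * P') = e P \<cdot> e P'"
    and e: "\<And>P. unitRR P \<Longrightarrow> e P \<in> carrier Gam"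
    and const: "\<And>a. a \<noteq> 0 \<Longrightarrow> word_bound Gam S c (e (cst a))"
    and t: "word_bound Gam S c (e tt)" "word_bound Gam S c (e (tt - 1))"
    and P: "unitRR (P :: 'k poly fract)" "\<And>w. P \<in> BB w (int m)" "\<And>w. inverse P \<in> BB w (int m)"
  shows "word_bound Gam S (c * (2 * m + 1)) (e P)"
proof -
  obtain a i j where a: "a \<noteq> 0" "P = cst a * tt powi i * (tt - 1) powi j"
    using RR_unit_form[of P "inverse P"] P(1) unfolding unitRR_def by auto
  have ij: "\<bar>i\<bar> \<le> int m" "\<bar>j\<bar> \<le> int m"
    using unit_exponents_bounded[OF a(2,1)] P(2,3) by blast+
  have e1: "e 1 = \<one>\<^bsub>Gam\<^esub>"
  proof -
    have "e 1 = e 1 \<cdot> e 1" using hom[OF unitRR_one unitRR_one] by simp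
    thus ?thesis using e[OF unitRR_one] by (metis GG.l_cancel_one)
  qed
  have einv: "e (inverse Q) = inv\<^bsub>Gam\<^esub> (e Q)" if "unitRR Q" for Q
  proof (rule GG.inv_equality[symmetric])
    have "inverse Q * Q = 1" using that by (simp add: unitRR_def)
    thus "e (inverse Q) \<cdot> e Q = \<one>\<^bsub>Gam\<^esub>" using hom[OF unitRR_inverse[OF that] that] e1 by simp
  qed (use e that unitRR_inverse in auto)
  have unit_power: "unitRR (Q ^ n)" if "unitRR Q" for Q :: "'k poly fract" and n
    using that by (induction n) (auto intro: unitRR_one unitRR_mult)
  have pw: "word_bound Gam S (c * n) (e (Q ^ n))" if "unitRR Q" "word_bound Gam S c (e Q)" for Q n
  proof (induction n)
    case 0 thus ?case using e1 GG.word_bound_one by simp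
  next
    case (Suc n)
    have "word_bound Gam S (c + c * n) (e Q \<cdot> e (Q ^ n))"
      using Suc that(2) by (intro GG.word_bound_mult[OF S])
    thus ?case using hom[OF that(1) unit_power[OF that(1)]] by simp
  qed
  have pwi: "unitRR (Q powi k) \<and> word_bound Gam S (c * m) (e (Q powi k))"
    if "unitRR Q" "word_bound Gam S c (e Q)" "\<bar>k\<bar> \<le> int m" for Q k
  proof (cases "0 \<le> k")
    case True
    hence "Q powi k = Q ^ nat k" by (simp add: power_int_def)
    moreover have "c * nat k \<le> c * m" using that(3) True by (intro mult_left_mono) auto
    ultimately show ?thesis using GG.word_bound_mono[OF pw[OF that(1,2)]] unit_power[OF that(1)] by simp
  next
    case False
    hence q: "Q powi k = inverse Q ^ nat (- k)" by (simp add: power_int_def)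
    have "c * nat (- k) \<le> c * m" using that(3) False by (intro mult_left_mono) auto
    moreover have "word_bound Gam S c (e (inverse Q))"
      unfolding einv[OF that(1)] by (rule GG.word_bound_inv[OF S that(2)])
    ultimately show ?thesis unfolding q
      using GG.word_bound_mono[OF pw[OF unitRR_inverse[OF that(1)]]] unit_power[OF unitRR_inverse[OF that(1)]] by simp
  qed
  have 1: "unitRR (tt powi i :: 'k poly fract)" "word_bound Gam S (c * m) (e (tt powi i))" using pwi[OF unitRR_tt(1) t(1) ij(1)] by auto
  have 2: "unitRR ((tt - 1) powi j :: 'k poly fract)" "word_bound Gam S (c * m) (e ((tt - 1) powi j))" using pwi[OF unitRR_tt(2) t(2) ij(2)] by auto
  have "word_bound Gam S (c + c * m + c * m) (e (cst a) \<cdot> e (tt powi i) \<cdot> e ((tt - 1) powi j))"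
    by (intro GG.word_bound_mult[OF S] 1 2 const a(1))
  moreover have "e P = e (cst a) \<cdot> e (tt powi i) \<cdot> e ((tt - 1) powi j)"
    unfolding a(2) by (simp only: hom unitRR_mult unitRR_cst[OF a(1)] 1 2)
  ultimately have "word_bound Gam S (c + c * m + c * m) (e P)" by simp
  thus ?thesis by (rule GG.word_bound_mono) (simp add: algebra_simps)
qed

text \<open>The root elements other than \<open>E14\<close> are handled by Horner schemes, since the torus
  acts on each of them through a nontrivial character; \<open>E14\<close> is a commutator of two
  of them.\<close>

lemma word_bound_upper:
  assumes S: "S \<subseteq> carrier Gam" and c: "\<And>x. x \<in> basic_elements \<Longrightarrow> word_bound Gam S c (proj x)"
    and x: "inG x" "\<And>w. NB w (int m) x"
  shows "word_bound Gam S (100 * c * (m + 1)) (proj x)"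
proof -
  obtain u P Q where xx: "x = (u, P, Q)" by (cases x)
  have G: "inRR u" "unitRR P" "unitRR Q" using x(1) xx by auto
  have N: "u12 u \<in> BB w (int m)" "u13 u \<in> BB w (int m)" "u14 u \<in> BB w (int m)" "u23 u \<in> BB w (int m)" "u24 u \<in> BB w (int m)"
     "u34 u \<in> BB w (int m)" "P \<in> BB w (int m)" "inverse P \<in> BB w (int m)" "Q \<in> BB w (int m)" "inverse Q \<in> BB w (int m)" for w
    using x(2)[of w] xx by auto
  have act0: "act P Q 0 = 0" for P Q :: "'k poly fract" by (rule ut_eqI) simp_all
  have zero: "inG (0, P, Q)" if "unitRR P" "unitRR Q" for P Q :: "'k poly fract"
    using that by (simp add: inRR_zero)
  have basic: "word_bound Gam S c (proj (0, tt, 1))" "word_bound Gam S c (proj (0, tt - 1, 1))"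
    "word_bound Gam S c (proj (0, 1, tt))" "word_bound Gam S c (proj (0, 1, tt - 1))"
    "a \<noteq> 0 \<Longrightarrow> word_bound Gam S c (proj (0, cst a, 1))" "a \<noteq> 0 \<Longrightarrow> word_bound Gam S c (proj (0, 1, cst a))" for a
    by (rule c, auto simp: basic_elements_def)+
  have wP: "word_bound Gam S (c * (2 * m + 1)) (proj (0, P, 1))"
    by (rule unit_word[OF S, of "\<lambda>P. proj (0, P, 1)"])
       (use G N basic in \<open>simp_all add: proj_mult zero unitRR_one proj_carrier act0 del: inG.simps\<close>)
  have wQ: "word_bound Gam S (c * (2 * m + 1)) (proj (0, 1, Q))"
    by (rule unit_word[OF S, of "\<lambda>Q. proj (0, 1, Q)"])
       (use G N basic in \<open>simp_all add: proj_mult zero unitRR_one proj_carrier act0 del: inG.simps\<close>)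
  have tor: "\<exists>P Q. unitRR P \<and> unitRR Q \<and> word_bound Gam S c (proj (0, P, Q)) \<and> h P Q = inverse (unif w)"
    if h: "(\<forall>P. h P 1 = P) \<or> (\<forall>P. h P 1 = inverse P) \<or> (\<forall>Q. h 1 Q = Q) \<or> (\<forall>Q. h 1 Q = inverse Q)" for h and w :: place
  proof -
    define d :: "'k poly fract" where "d = (case w of Place0 \<Rightarrow> tt | Place1 \<Rightarrow> tt - 1 | PlaceInf \<Rightarrow> tt)"
    have d: "unitRR d" "inverse (unif w) = d \<or> inverse (unif w) = inverse d"
      by (cases w; simp add: d_def unitRR_tt)+
    have w1: "word_bound Gam S c (proj (0, d, 1))" "word_bound Gam S c (proj (0, 1, d))"
      using c by (cases w; simp add: d_def basic_elements_def)+
    have inv1: "inv\<^bsub>Gam\<^esub> (proj (0, d, 1)) = proj (0, inverse d, 1)" "inv\<^bsub>Gam\<^esub> (proj (0, 1, d)) = proj (0, 1, inverse d)"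
      using d(1) by (simp_all add: proj_inv zero unitRR_one act0 del: inG.simps)
    have w2: "word_bound Gam S c (proj (0, inverse d, 1))" "word_bound Gam S c (proj (0, 1, inverse d))"
      using GG.word_bound_inv[OF S w1(1)] GG.word_bound_inv[OF S w1(2)] unfolding inv1 .
    define d' where "d' = inverse d"
    have d': "unitRR d'" "inverse d = d'" "inverse d' = d" using unitRR_inverse[OF d(1)] by (simp_all add: d'_def)
    note wd = w1 w2[unfolded d'(2)]
    have u1: "unitRR (1 :: 'k poly fract)" by (rule unitRR_one)
    define s :: "'k poly fract" where "s = inverse (unif w)"
    have s: "s = d \<or> s = d'" using d(2) d'(2) by (simp add: s_def)
    have i: "inverse s = d \<or> inverse s = d'" "inverse (inverse s) = s" using s d'(2,3) by auto
    have k1: "\<exists>P Q. unitRR P \<and> unitRR Q \<and> word_bound Gam S c (proj (0, P, Q)) \<and> h P Q = s" if "h x 1 = s" "x = d \<or> x = d'" for x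
      using that d(1) d'(1) wd u1 by (intro exI[of _ x] exI[of _ 1]) auto
    have k2: "\<exists>P Q. unitRR P \<and> unitRR Q \<and> word_bound Gam S c (proj (0, P, Q)) \<and> h P Q = s" if "h 1 x = s" "x = d \<or> x = d'" for x
      using that d(1) d'(1) wd u1 by (intro exI[of _ 1] exI[of _ x]) auto
    have "\<exists>P Q. unitRR P \<and> unitRR Q \<and> word_bound Gam S c (proj (0, P, Q)) \<and> h P Q = s"
      using h
    proof (elim disjE)
      assume "\<forall>P. h P 1 = P" thus ?thesis by (intro k1[of s]) (use s in auto)
    next
      assume "\<forall>P. h P 1 = inverse P" thus ?thesis by (intro k1[of "inverse s"]) (use i in auto)
    next
      assume "\<forall>Q. h 1 Q = Q" thus ?thesis by (intro k2[of s]) (use s in auto)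
    next
      assume "\<forall>Q. h 1 Q = inverse Q" thus ?thesis by (intro k2[of "inverse s"]) (use i in auto)
    qed
    thus ?thesis by (simp only: s_def)
  qed
  have conj: "proj (0, P, Q) \<cdot> proj (v, 1, 1) \<cdot> inv\<^bsub>Gam\<^esub> (proj (0, P, Q)) = proj (act P Q v, 1, 1)"
    if "unitRR P" "unitRR Q" "inRR v" for P Q v
  proof -
    have g: "inG (v, 1, 1)" "inG (act P Q v, P, Q)" "inG (0, inverse P, inverse Q)"
      using that by (simp_all add: unitRR_one inRR_act unitRR_inverse inRR_zero)
    show ?thesis using that
      by (simp add: proj_inv proj_mult zero g act0 del: inG.simps) (simp add: unitRR_def)
  qed
  have root: "word_bound Gam S (c * (9 * m + 1)) (proj (E y, 1, 1))"
    if E: "\<And>x. x \<in> RR \<Longrightarrow> inRR (E x)" "\<And>x y. E (x + y) = E x + E y"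
      and h: "\<And>P Q x. P \<noteq> 0 \<Longrightarrow> Q \<noteq> 0 \<Longrightarrow> act P Q (E x) = E (h P Q * x)"
         "(\<forall>P. h P 1 = P) \<or> (\<forall>P. h P 1 = inverse P) \<or> (\<forall>Q. h 1 Q = Q) \<or> (\<forall>Q. h 1 Q = inverse Q)"
      and cc: "\<And>a. (E (cst a), 1, 1) \<in> basic_elements"
      and y: "y \<in> RR" "\<And>w. y \<in> BB w (int m)" for E h y
  proof (rule root_word[OF S, of "\<lambda>x. proj (E x, 1, 1)"])
    fix w
    obtain P Q where PQ: "unitRR P" "unitRR Q" "word_bound Gam S c (proj (0, P, Q))" "h P Q = inverse (unif w)"
      using tor[OF h(2)] by blast
    have "proj (0, P, Q) \<cdot> proj (E x, 1, 1) \<cdot> inv\<^bsub>Gam\<^esub> (proj (0, P, Q)) = proj (E (inverse (unif w) * x), 1, 1)"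
      if "x \<in> RR" for x
      using conj[OF PQ(1,2) E(1)[OF that]] h(1)[of P Q x] PQ(1,2,4) by (simp add: unitRR_def)
    thus "\<exists>D. word_bound Gam S c D \<and> (\<forall>x\<in>RR. D \<cdot> proj (E x, 1, 1) \<cdot> inv\<^bsub>Gam\<^esub> D = proj (E (inverse (unif w) * x), 1, 1))"
      using PQ(3) by blast
  qed (use E cc c y in \<open>auto simp: proj_mult unitRR_one proj_carrier\<close>)
  have R: "u12 u \<in> RR" "u13 u \<in> RR" "u14 u \<in> RR" "u23 u \<in> RR" "u24 u \<in> RR" "u34 u \<in> RR" using G(1) by (auto simp: inRR_def)
  have w12: "word_bound Gam S (c * (9 * m + 1)) (proj (E12 y, 1, 1))" if "y \<in> RR" "\<And>w. y \<in> BB w (int m)" for y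
    by (rule root[of E12 "\<lambda>P Q. inverse P"])
       (use that in \<open>auto simp: inRR_def RR_zero plus_ut_def act_def divide_inverse mult.commute basic_elements_def\<close>)
  have w13: "word_bound Gam S (c * (9 * m + 1)) (proj (E13 y, 1, 1))" if "y \<in> RR" "\<And>w. y \<in> BB w (int m)" for y
    by (rule root[of E13 "\<lambda>P Q. inverse Q"])
       (use that in \<open>auto simp: inRR_def RR_zero plus_ut_def act_def divide_inverse mult.commute basic_elements_def\<close>)
  have w23: "word_bound Gam S (c * (9 * m + 1)) (proj (E23 y, 1, 1))" if "y \<in> RR" "\<And>w. y \<in> BB w (int m)" for y
    by (rule root[of E23 "\<lambda>P Q. P / Q"])
       (use that in \<open>auto simp: inRR_def RR_zero plus_ut_def act_def mult.commute basic_elements_def\<close>)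
  have w24: "word_bound Gam S (c * (9 * m + 1)) (proj (E24 y, 1, 1))" if "y \<in> RR" "\<And>w. y \<in> BB w (int m)" for y
    by (rule root[of E24 "\<lambda>P Q. P"])
       (use that in \<open>auto simp: inRR_def RR_zero plus_ut_def act_def mult.commute basic_elements_def\<close>)
  have w34: "word_bound Gam S (c * (9 * m + 1)) (proj (E34 y, 1, 1))" if "y \<in> RR" "\<And>w. y \<in> BB w (int m)" for y
    by (rule root[of E34 "\<lambda>P Q. Q"])
       (use that in \<open>auto simp: inRR_def RR_zero plus_ut_def act_def mult.commute basic_elements_def\<close>)
  let ?n = "c * (9 * m + 1)"
  have one: "1 \<in> BB w (int m)" for w :: place by (rule BB_one) simp
  have w14: "word_bound Gam S (?n + ?n + ?n + ?n) (proj (E14 (u14 u), 1, 1))"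
  proof -
    have "proj (E12 (u14 u), 1, 1) \<cdot> proj (E24 1, 1, 1) \<cdot> inv\<^bsub>Gam\<^esub> (proj (E12 (u14 u), 1, 1)) \<cdot> inv\<^bsub>Gam\<^esub> (proj (E24 1, 1, 1))
      = proj (E14 (u14 u), 1, 1)"
      using R by (simp add: proj_inv proj_mult inRR_def RR_zero RR_one RR_neg unitRR_one plus_ut_def uminus_ut_def)
    moreover have "word_bound Gam S (?n + ?n + ?n + ?n) (proj (E12 (u14 u), 1, 1) \<cdot> proj (E24 1, 1, 1) \<cdot> inv\<^bsub>Gam\<^esub> (proj (E12 (u14 u), 1, 1)) \<cdot> inv\<^bsub>Gam\<^esub> (proj (E24 1, 1, 1)))"
      using R N one by (intro GG.word_bound_mult[OF S] GG.word_bound_inv[OF S] w12 w24 RR_one)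
    ultimately show ?thesis by simp
  qed
  have "proj x = proj (E34 (u34 u), 1, 1) \<cdot> proj (E23 (u23 u), 1, 1) \<cdot> proj (E24 (u24 u), 1, 1)
     \<cdot> proj (E12 (u12 u), 1, 1) \<cdot> proj (E13 (u13 u), 1, 1) \<cdot> proj (E14 (u14 u), 1, 1)
     \<cdot> proj (0, P, 1) \<cdot> proj (0, 1, Q)"
  proof -
    have m: "inRR (E34 (u34 u))" "inRR (E23 (u23 u))" "inRR (E24 (u24 u))" "inRR (E12 (u12 u))" "inRR (E13 (u13 u))" "inRR (E14 (u14 u))"
      using R by (auto simp: inRR_def RR_zero)
    have "x = (E34 (u34 u) + E23 (u23 u) + E24 (u24 u) + E12 (u12 u) + E13 (u13 u) + E14 (u14 u), P, Q)"
      using ut_elementary_decomposition[of u] xx by simp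
    moreover have "act P Q 0 = 0" for P Q :: "'k poly fract" by (simp add: act_def zero_ut_def)
    ultimately show ?thesis
      using m G by (simp add: proj_mult inRR_add inRR_zero unitRR_one unitRR_mult)
  qed
  moreover have "word_bound Gam S (?n + ?n + ?n + ?n + ?n + (?n + ?n + ?n + ?n) + c * (2 * m + 1) + c * (2 * m + 1))
    (proj (E34 (u34 u), 1, 1) \<cdot> proj (E23 (u23 u), 1, 1) \<cdot> proj (E24 (u24 u), 1, 1)
     \<cdot> proj (E12 (u12 u), 1, 1) \<cdot> proj (E13 (u13 u), 1, 1) \<cdot> proj (E14 (u14 u), 1, 1)
     \<cdot> proj (0, P, 1) \<cdot> proj (0, 1, Q))"
    using R N by (intro GG.word_bound_mult[OF S] w12 w13 w23 w24 w34 w14 wP wQ)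
  ultimately show ?thesis using GG.word_bound_mono by (auto simp: algebra_simps)
qed

lemma inG_NB_bounded:
  assumes "inG x" shows "\<exists>m::nat. \<forall>w. NB w (int m) x"
proof -
  obtain u P Q where x: "x = (u, P, Q)" by (cases x)
  obtain m where m: "\<forall>w. MB w (int m) x" using inG_MB_bounded[OF assms] by blast
  obtain n where n: "\<forall>w. MB w (int n) (tinv x)" using inG_MB_bounded[OF inG_tinv[OF assms]] by blast
  have "NB w (2 * int (m + n)) x" for w
    using NB_if_MB[of w "int (m + n)" u P Q] MB_mono[of w "int m" x "int (m + n)"] MB_mono[of w "int n" "tinv x" "int (m + n)"]
      m n inG_nonzero[OF assms] unfolding x by simp
  thus ?thesis by (intro exI[of _ "2 * (m + n)"]) simp
qed

lemma Gam_finitely_generated: "finite_generating_set Gam (proj ` basic_elements)"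
proof -
  let ?S = "proj ` basic_elements"
  have S: "?S \<subseteq> carrier Gam" using basic_elements(2) proj_carrier by blast
  have "g \<in> generate Gam ?S" if g: "g \<in> carrier Gam" for g
  proof -
    obtain x where x: "inG x" "g = proj x" using Gam_E[OF g] .
    obtain m where "\<forall>w. NB w (int m) x" using inG_NB_bounded[OF x(1)] by blast
    hence "word_bound Gam ?S (100 * 1 * (m + 1)) (proj x)"
      using word_bound_upper[OF S, of 1 x m] GG.word_bound_gen[OF S] x(1) by blast
    thus ?thesis using GG.word_bound_generate[OF S] x(2) by blast
  qed
  thus ?thesis
    using basic_elements(1) S GG.generate_incl[OF S] by (auto simp: finite_generating_set_def)
qed

theorem word_length_estimates:
  assumes "finite_generating_set Gam S"
  obtains C :: nat where "C \<ge> 1"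
    and "\<And>x m. inG x \<Longrightarrow> (\<And>w. NB w (int m) x) \<Longrightarrow> word_length Gam S (proj x) \<le> C * (m + 1)"
    and "\<And>x n. inG x \<Longrightarrow> word_length Gam S (proj x) \<le> n \<Longrightarrow>
       \<exists>f\<in>ZP. \<forall>w. NB w (int (C * n)) (tmul x (zt f))"
proof -
  have S: "finite S" "S \<subseteq> carrier Gam" "generate Gam S = carrier Gam"
    using assms by (auto simp: finite_generating_set_def)
  obtain c where c: "\<forall>x\<in>basic_elements. word_bound Gam S c (proj x)"
    using generator_bound[OF S(2) basic_elements(1)] basic_elements(2) proj_carrier S(3) by metis
  obtain c' where c': "\<And>n g. word_bound Gam S n g \<Longrightarrow> \<exists>x. inG x \<and> g = proj x \<and> (\<forall>w. NB w (int (c' * n)) x)"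
    using word_length_lower[OF S(1,2)] by metis
  let ?C = "100 * c + c' + 1"
  show ?thesis
  proof (rule that[of ?C])
    fix x :: "'k poly fract tri" and m assume x: "inG x" "\<And>w. NB w (int m) x"
    have "word_length Gam S (proj x) \<le> 100 * c * (m + 1)"
      using word_bound_upper[OF S(2) _ x] c GG.word_length_le by blast
    also have "\<dots> \<le> ?C * (m + 1)" by (intro mult_right_mono) auto
    finally show "word_length Gam S (proj x) \<le> ?C * (m + 1)" .
  next
    fix x :: "'k poly fract tri" and n assume x: "inG x" "word_length Gam S (proj x) \<le> n"
    have "word_bound Gam S n (proj x)"
      using GG.word_bound_mono[OF GG.word_length_attained[OF S(2)] x(2)] S(3) proj_carrier[OF x(1)] by simp
    then obtain y where y: "inG y" "proj x = proj y" "\<forall>w. NB w (int (c' * n)) y" using c' by blast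
    then obtain f where f: "f \<in> ZP" "y = tmul x (zt f)" using proj_eq_iff[OF x(1) y(1)] by blast
    have "c' * n \<le> ?C * n" by (intro mult_right_mono) auto
    hence le: "int (c' * n) \<le> int (?C * n)" by (simp only: of_nat_le_iff)
    have "NB w (int (?C * n)) y" for w by (rule NB_mono[OF y(3)[rule_format] le])
    thus "\<exists>f\<in>ZP. \<forall>w. NB w (int (?C * n)) (tmul x (zt f))" using f by blast
  qed simp
qed

end

context central_quotient
begin

section \<open>Nilpotency\<close>

text \<open>The unipotent elements form a normal subgroup with abelian quotient, the torus.\<close>

definition unip :: "'k poly fract ut \<Rightarrow> 'k poly fract mat set" where "unip u = proj (u, 1, 1)"

lemma unip_inG: "inRR u \<Longrightarrow> inG (u, 1, 1)" by (simp add: unitRR_one)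

lemma unip_mult: "inRR u \<Longrightarrow> inRR v \<Longrightarrow> unip u \<cdot> unip v = unip (u + v)"
  unfolding unip_def by (simp add: proj_mult unip_inG del: inG.simps)

lemma unip_inv: "inRR u \<Longrightarrow> inv\<^bsub>Gam\<^esub> (unip u) = unip (- u)"
  unfolding unip_def by (simp add: proj_inv unip_inG del: inG.simps)

lemma unip_zero: "unip 0 = \<one>\<^bsub>Gam\<^esub>" unfolding unip_def by (rule proj_one)

lemma unip_subgroup:
  assumes "\<And>u. u \<in> U \<Longrightarrow> inRR u" "0 \<in> U" "\<And>u. u \<in> U \<Longrightarrow> - u \<in> U" "\<And>u v. u \<in> U \<Longrightarrow> v \<in> U \<Longrightarrow> u + v \<in> U"
  shows "subgroup (unip ` U) Gam"
proof (rule GG.subgroupI)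
  show "unip ` U \<subseteq> carrier Gam" unfolding unip_def using proj_carrier unip_inG assms(1) by blast
  show "unip ` U \<noteq> {}" using assms(2) by blast
  show "inv\<^bsub>Gam\<^esub> a \<in> unip ` U" if "a \<in> unip ` U" for a
    using that unip_inv assms(1,3) by auto
  show "a \<cdot> b \<in> unip ` U" if "a \<in> unip ` U" "b \<in> unip ` U" for a b
    using that unip_mult assms(1,4) by auto
qed

definition NU :: "'k poly fract mat set set" where "NU = unip ` {u. inRR u}"

lemma NU_subgroup: "subgroup NU Gam"
  unfolding NU_def by (rule unip_subgroup) (auto intro: inRR_zero inRR_uminus inRR_add)

lemma NU_normal: "NU \<lhd> Gam"
proof (rule GG.normal_invI[OF NU_subgroup])
  fix x h assume "x \<in> carrier Gam" "h \<in> NU"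
  then obtain y v where y: "inG y" "x = proj y" and v: "inRR v" "h = unip v"
    unfolding NU_def by (auto elim: Gam_E)
  obtain u P Q where yy: "y = (u, P, Q)" by (cases y)
  have g: "inRR u" "unitRR P" "unitRR Q" using y(1) yy by auto
  hence nz: "P \<noteq> 0" "Q \<noteq> 0" by (auto simp: unitRR_def)
  have gs: "inG (u, P, Q)" "inG (u + act P Q v, P, Q)" "inG (tinv (u, P, Q))"
    using y(1) yy g v inG_tinv[of "(u, P, Q)"] by (auto simp: inRR_add inRR_act)
  have "x \<cdot> h \<cdot> inv\<^bsub>Gam\<^esub> x = proj (tmul (u + act P Q v, P, Q) (tinv (u, P, Q)))"
    unfolding y(2) v(2) unip_def yy
    using gs unip_inG[OF v(1)] by (simp add: proj_inv proj_mult del: inG.simps tinv.simps)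
  also have "tmul (u + act P Q v, P, Q) (tinv (u, P, Q)) = (u + act P Q v - u, 1, 1)"
    using nz by (simp add: act_act)
  finally show "x \<cdot> h \<cdot> inv\<^bsub>Gam\<^esub> x \<in> NU"
    unfolding NU_def unip_def using g v
    by (auto simp: diff_conv_add_uminus simp del: add_uminus_conv_diff intro!: imageI inRR_add inRR_act inRR_uminus)
qed

text \<open>Vanishing of the first superdiagonals: the lower central series of the unipotent group.\<close>

fun lev :: "nat \<Rightarrow> 'k poly fract ut \<Rightarrow> bool" where
  "lev 0 u = True"
| "lev (Suc 0) u = (u12 u = 0 \<and> u23 u = 0 \<and> u34 u = 0)"
| "lev (Suc (Suc 0)) u = (u12 u = 0 \<and> u23 u = 0 \<and> u34 u = 0 \<and> u13 u = 0 \<and> u24 u = 0)"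
| "lev n u = (u = 0)"

lemma lower_central_NU:
  "n \<le> 3 \<Longrightarrow> lower_central (Gam\<lparr>carrier := NU\<rparr>) n \<subseteq> unip ` {u. inRR u \<and> lev n u}"
proof (induction n)
  case 0 thus ?case by (auto simp: NU_def)
next
  case (Suc n)
  let ?H = "Gam\<lparr>carrier := NU\<rparr>"
  interpret H: group ?H by (rule GG.subgroup_imp_group[OF NU_subgroup])
  have n: "n = 0 \<or> n = Suc 0 \<or> n = Suc (Suc 0)" using Suc.prems by linarith
  have "subgroup (unip ` {u. inRR u \<and> lev (Suc n) u}) Gam"
    by (rule unip_subgroup) (use n in \<open>auto intro: inRR_zero inRR_uminus inRR_add\<close>)
  hence sub: "subgroup (unip ` {u. inRR u \<and> lev (Suc n) u}) ?H"
    by (rule GG.subgroup_incl[OF _ NU_subgroup]) (auto simp: NU_def)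
  show ?case unfolding lower_central.simps
  proof (rule H.generate_subgroup_incl[OF _ sub], clarify)
    fix x y assume "x \<in> carrier ?H" "y \<in> lower_central ?H n"
    hence xN: "x \<in> NU" and "y \<in> unip ` {u. inRR u \<and> lev n u}" using Suc by auto
    then obtain u v where u: "inRR u" "x = unip u" and v: "inRR v" "lev n v" "y = unip v"
      unfolding NU_def by auto
    have yN: "y \<in> NU" using v unfolding NU_def by blast
    have "x \<cdot> y \<cdot> inv\<^bsub>Gam\<^esub> x \<cdot> inv\<^bsub>Gam\<^esub> y = unip (u + v + - u + - v)"
      using u v by (simp add: unip_mult unip_inv inRR_add inRR_uminus del: add_uminus_conv_diff)
    hence e: "x \<otimes>\<^bsub>?H\<^esub> y \<otimes>\<^bsub>?H\<^esub> inv\<^bsub>?H\<^esub> x \<otimes>\<^bsub>?H\<^esub> inv\<^bsub>?H\<^esub> y = unip (u + v + - u + - v)"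
      using GG.m_inv_consistent[OF NU_subgroup xN] GG.m_inv_consistent[OF NU_subgroup yN] by simp
    have "lev (Suc n) (u + v + - u + - v)"
      using n v(2) by (auto intro!: ut_eqI simp: algebra_simps simp del: add_uminus_conv_diff)
    moreover have "inRR (u + v + - u + - v)" by (intro inRR_add inRR_uminus u v)
    ultimately show "x \<otimes>\<^bsub>?H\<^esub> y \<otimes>\<^bsub>?H\<^esub> inv\<^bsub>?H\<^esub> x \<otimes>\<^bsub>?H\<^esub> inv\<^bsub>?H\<^esub> y \<in> unip ` {u. inRR u \<and> lev (Suc n) u}"
      unfolding e by blast
  qed
qed

theorem Gam_nilpotent_by_abelian: "nilpotent_by_abelian 3 Gam"
  unfolding nilpotent_by_abelian_def nilpotent_of_class_at_most_def
proof (intro exI[of _ NU] conjI)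
  show "NU \<lhd> Gam" by (rule NU_normal)
  let ?H = "Gam\<lparr>carrier := NU\<rparr>"
  show gH: "group ?H" by (rule GG.subgroup_imp_group[OF NU_subgroup])
  have "lower_central ?H 3 \<subseteq> {\<one>\<^bsub>Gam\<^esub>}"
    using lower_central_NU[of 3] by (auto simp: numeral_eq_Suc unip_zero)
  moreover have "\<one>\<^bsub>Gam\<^esub> \<in> lower_central ?H 3"
    using generate.one[of ?H] by (simp add: numeral_eq_Suc)
  ultimately show "lower_central ?H 3 = {\<one>\<^bsub>?H\<^esub>}" by auto
  interpret N: normal NU Gam by (rule NU_normal)
  interpret Q: group "Gam Mod NU" by (rule N.factorgroup_is_group)
  show "comm_group (Gam Mod NU)"
  proof (rule Q.group_comm_groupI)
    have half: "NU #>\<^bsub>Gam\<^esub> (proj x \<cdot> proj y) = NU #>\<^bsub>Gam\<^esub> (proj y \<cdot> proj x)" if xy: "inG x" "inG y" for x y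
    proof -
      obtain u P Q where x: "x = (u, P, Q)" by (cases x)
      obtain u' P' Q' where y: "y = (u', P', Q')" by (cases y)
      define k where "k = (u + act P Q u') + - (u' + act P' Q' u)"
      have k: "inRR k" using xy x y by (auto simp: k_def simp del: add_uminus_conv_diff intro!: inRR_add inRR_uminus inRR_act)
      have "unip k \<cdot> (proj y \<cdot> proj x) = proj (tmul (k, 1, 1) (tmul y x))"
        unfolding unip_def by (simp add: proj_mult xy unip_inG[OF k] inG_tmul del: inG.simps tmul.simps)
      also have "tmul (k, 1, 1) (tmul y x) = tmul x y"
        unfolding x y k_def by (simp add: add.assoc mult.commute)
      finally have "proj x \<cdot> proj y = unip k \<cdot> (proj y \<cdot> proj x)"
        by (simp add: proj_mult xy)
      hence "proj x \<cdot> proj y \<in> NU #>\<^bsub>Gam\<^esub> (proj y \<cdot> proj x)"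
        unfolding r_coset_def NU_def using k by blast
      thus ?thesis
        using GG.repr_independence[OF _ _ NU_subgroup] proj_carrier[OF xy(1)] proj_carrier[OF xy(2)] by fastforce
    qed
    fix X Y assume "X \<in> carrier (Gam Mod NU)" "Y \<in> carrier (Gam Mod NU)"
    then obtain x y where "inG x" "X = NU #>\<^bsub>Gam\<^esub> proj x" "inG y" "Y = NU #>\<^bsub>Gam\<^esub> proj y"
      unfolding FactGroup_def RCOSETS_def by (auto elim!: Gam_E)
    thus "X \<otimes>\<^bsub>Gam Mod NU\<^esub> Y = Y \<otimes>\<^bsub>Gam Mod NU\<^esub> X"
      using half by (simp add: FactGroup_def N.rcos_sum proj_carrier)
  qed
qed

end

section \<open>Ultralimits of a metric space\<close>

lemma ultrafilter_large:
  assumes "nonprincipal_ultrafilter_on {0<..} \<omega>" shows "eventually (\<lambda>n. real n \<ge> c) \<omega>"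
proof -
  have "eventually (\<lambda>n. real n \<ge> c) sequentially"
    by (rule eventually_sequentiallyI[of "nat \<lceil>c\<rceil>"]) linarith
  thus ?thesis using ultrafilter_le_sequentially[OF assms] by (rule filter_leD[rotated])
qed

text \<open>Distances in a cone computed on representing sequences.\<close>

locale ultra_cone = Metric_space M d for M :: "'a set" and d +
  fixes x0 :: 'a and \<omega> :: "nat filter"
  assumes base: "x0 \<in> M" and ultra: "nonprincipal_ultrafilter_on {0<..} \<omega>"
begin

abbreviation "PC \<equiv> precone M d x0"
abbreviation "od \<equiv> omega_dist d \<omega>"

lemma omega_nontrivial: "\<omega> \<noteq> bot" and omega_pos: "eventually (\<lambda>n. n > 0) \<omega>"
  and omega_ultra: "eventually P \<omega> \<or> eventually (\<lambda>n. \<not> P n) \<omega>"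
  using ultra by (auto simp: nonprincipal_ultrafilter_on_def)

lemma omega_large: "eventually (\<lambda>n. real n \<ge> c) \<omega>"
  by (rule ultrafilter_large[OF ultra])

lemma precone_mem: "x \<in> PC \<Longrightarrow> n > 0 \<Longrightarrow> x n \<in> M"
  by (auto simp: precone_def PiE_iff)

lemma precone_bounded:
  assumes "x \<in> PC" shows "\<exists>K::nat. \<forall>n>0. d (x n) x0 \<le> real (K * n)"
proof -
  have "limsup (\<lambda>n. ereal (d (x n) x0 / real n)) < \<infinity>" using assms by (simp add: precone_def)
  then obtain c where "limsup (\<lambda>n. ereal (d (x n) x0 / real n)) < ereal c"
    using less_PInf_Ex_of_nat by fastforce
  hence "eventually (\<lambda>n. ereal (d (x n) x0 / real n) < ereal c) sequentially"
    by (rule Limsup_lessD)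
  then obtain N where N: "\<And>n. n \<ge> N \<Longrightarrow> d (x n) x0 / real n < c"
    unfolding eventually_sequentially by auto
  define K where "K = nat \<lceil>c\<rceil> + (\<Sum>n<N. nat \<lceil>d (x n) x0\<rceil>)"
  have "d (x n) x0 \<le> real (K * n)" if n: "n > 0" for n
  proof (cases "n \<ge> N")
    case True
    hence "d (x n) x0 \<le> c * real n" using N[OF True] n by (simp add: field_simps)
    also have "\<dots> \<le> real (nat \<lceil>c\<rceil>) * real n" by (intro mult_right_mono) linarith+
    also have "\<dots> \<le> real K * real n" by (intro mult_right_mono, simp only: of_nat_le_iff K_def le_add1) simp
    finally show ?thesis by simp
  next
    case False
    have "d (x n) x0 \<le> real (nat \<lceil>d (x n) x0\<rceil>)" by linarith
    also have "nat \<lceil>d (x n) x0\<rceil> \<le> (\<Sum>n<N. nat \<lceil>d (x n) x0\<rceil>)"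
      using False by (intro member_le_sum[of n _ "\<lambda>n. nat \<lceil>d (x n) x0\<rceil>"]) auto
    also have "\<dots> \<le> K * n" using n unfolding K_def by (cases n) auto
    finally show ?thesis by simp
  qed
  thus ?thesis by blast
qed

lemma preconeI:
  assumes "\<And>n. n > 0 \<Longrightarrow> x n \<in> M" "\<And>n. n > 0 \<Longrightarrow> d (x n) x0 \<le> real (K * n)"
  shows "restrict x {0<..} \<in> PC"
proof -
  let ?x = "restrict x {0<..}"
  have "eventually (\<lambda>n. ereal (d (?x n) x0 / real n) \<le> ereal (real K)) sequentially"
    using eventually_gt_at_top[of 0] by eventually_elim (use assms(2) in \<open>simp add: field_simps\<close>)
  hence "limsup (\<lambda>n. ereal (d (?x n) x0 / real n)) \<le> ereal (real K)" by (rule Limsup_bounded)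
  hence "limsup (\<lambda>n. ereal (d (?x n) x0 / real n)) < \<infinity>" using le_less_trans by fastforce
  thus ?thesis using assms(1) by (auto simp: precone_def)
qed

lemma precone_lim:
  assumes "x \<in> PC" "y \<in> PC" shows "((\<lambda>n. d (x n) (y n) / real n) \<longlongrightarrow> od x y) \<omega>"
proof -
  obtain K :: nat where K: "\<forall>n>0. d (x n) x0 \<le> real (K * n)" using precone_bounded[OF assms(1)] ..
  obtain L :: nat where L: "\<forall>n>0. d (y n) x0 \<le> real (L * n)" using precone_bounded[OF assms(2)] ..
  have "eventually (\<lambda>n. \<bar>d (x n) (y n) / real n\<bar> \<le> real (K + L)) \<omega>"
    using omega_pos
  proof eventually_elim
    case (elim n)
    have "d (x n) (y n) \<le> d (x n) x0 + d x0 (y n)"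
      using precone_mem[OF assms(1) elim] precone_mem[OF assms(2) elim] base by (intro triangle)
    moreover have "d (x n) x0 \<le> real (K * n)" using K elim by blast
    moreover have "d x0 (y n) \<le> real (L * n)" unfolding commute[of x0 "y n"] using L elim by blast
    ultimately have "d (x n) (y n) \<le> real (K + L) * real n"
      by (simp add: distrib_right)
    hence "d (x n) (y n) / real n \<le> real (K + L)" using elim by (simp add: pos_divide_le_eq)
    thus ?case by (simp only: abs_of_nonneg divide_nonneg_nonneg nonneg of_nat_0_le_iff)
  qed
  from ultrafilter_bounded_convergent[OF ultra this] show ?thesis
    using tendsto_Lim[OF omega_nontrivial] by (auto simp: omega_dist_def)
qed

lemma od_le:
  assumes "x \<in> PC" "y \<in> PC" "\<And>e. e > 0 \<Longrightarrow> eventually (\<lambda>n. d (x n) (y n) \<le> (c + e) * real n) \<omega>"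
  shows "od x y \<le> c"
proof (rule field_le_epsilon)
  fix e :: real assume "e > 0"
  have "eventually (\<lambda>n. d (x n) (y n) / real n \<le> c + e) \<omega>"
    using assms(3)[OF \<open>e > 0\<close>] omega_pos by eventually_elim (simp add: field_simps)
  thus "od x y \<le> c + e"
    by (rule tendsto_upperbound[OF precone_lim[OF assms(1,2)] _ omega_nontrivial])
qed

lemma od_less_D:
  assumes "x \<in> PC" "y \<in> PC" "od x y < r"
  shows "eventually (\<lambda>n. d (x n) (y n) < r * real n) \<omega>"
  using order_tendstoD(2)[OF precone_lim[OF assms(1,2)] assms(3)] omega_pos
  by eventually_elim (simp add: field_simps)

lemma od_nonneg: "x \<in> PC \<Longrightarrow> y \<in> PC \<Longrightarrow> 0 \<le> od x y"
  by (rule tendsto_lowerbound[OF precone_lim _ omega_nontrivial]) (simp_all add: eventually_mono)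

lemma od_commute: "od x y = od y x" by (simp add: omega_dist_def commute)

lemma od_refl: "x \<in> PC \<Longrightarrow> od x x = 0"
proof -
  assume x: "x \<in> PC"
  have "eventually (\<lambda>n. d (x n) (x n) \<le> (0 + e) * real n) \<omega>" if "e > 0" for e
    using omega_pos by eventually_elim (use that precone_mem[OF x] in auto)
  thus ?thesis using od_le[OF x x, of 0] od_nonneg[OF x x] by simp
qed

lemma od_triangle:
  assumes "x \<in> PC" "y \<in> PC" "z \<in> PC" shows "od x z \<le> od x y + od y z"
proof (rule tendsto_le[OF omega_nontrivial tendsto_add[OF precone_lim precone_lim] precone_lim])
  show "eventually (\<lambda>n. d (x n) (z n) / real n \<le> d (x n) (y n) / real n + d (y n) (z n) / real n) \<omega>"
    using omega_pos
  proof eventually_elim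
    case (elim n)
    have "d (x n) (z n) \<le> d (x n) (y n) + d (y n) (z n)"
      using precone_mem[OF assms(1) elim] precone_mem[OF assms(2) elim] precone_mem[OF assms(3) elim] by (rule triangle)
    thus ?case unfolding add_divide_distrib[symmetric] by (rule divide_right_mono) simp
  qed
qed (use assms in auto)

definition cls where "cls x = {y \<in> PC. od x y = 0}"

abbreviation "Cone \<equiv> asymptotic_cone M d x0 \<omega>"
abbreviation "cd \<equiv> asymptotic_cone_dist M d x0 \<omega>"

lemma cls_image: "{(x, y). x \<in> PC \<and> y \<in> PC \<and> od x y = 0} `` {x} = cls x" if "x \<in> PC"
  using that by (auto simp: cls_def)

lemma cls_in: "x \<in> PC \<Longrightarrow> cls x \<in> Cone"
  unfolding asymptotic_cone_def quotient_def using cls_image by blast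

lemma cone_E:
  assumes "X \<in> Cone" obtains x where "x \<in> PC" "X = cls x"
  using assms cls_image unfolding asymptotic_cone_def quotient_def by auto

lemma cone_dist_cls:
  assumes "x \<in> PC" "y \<in> PC" shows "cd (cls x) (cls y) = od x y"
proof -
  have eq: "od x' y' = od x y" if "x' \<in> cls x" "y' \<in> cls y" for x' y'
  proof -
    have h: "x' \<in> PC" "od x x' = 0" "y' \<in> PC" "od y y' = 0" using that by (auto simp: cls_def)
    have h': "od x' x = 0" "od y' y = 0" using h od_commute by metis+
    show ?thesis
      using od_triangle[OF assms(1) h(1) assms(2)] od_triangle[OF h(1,3) assms(2)] od_triangle[OF h(1) assms(1) h(3)]
        od_triangle[OF assms h(3)] h(2,4) h' by linarith
  qed
  have self: "x \<in> cls x" "y \<in> cls y" using assms by (auto simp: cls_def od_refl)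
  have "(THE r. \<forall>x'\<in>cls x. \<forall>y'\<in>cls y. od x' y' = r) = od x y"
  proof (rule the_equality)
    show "\<forall>x'\<in>cls x. \<forall>y'\<in>cls y. od x' y' = od x y" using eq by blast
    show "r = od x y" if "\<forall>x'\<in>cls x. \<forall>y'\<in>cls y. od x' y' = r" for r using that self by auto
  qed
  thus ?thesis by (simp add: asymptotic_cone_dist_def cls_in assms)
qed

lemma cone_metric: "Metric_space Cone cd"
  by (rule Metric_space_asymptotic_cone[OF Metric_space_axioms base ultra])

lemma cls_eq:
  assumes "x \<in> PC" "y \<in> PC" "od x y = 0" shows "cls x = cls y"
proof -
  interpret K: Metric_space Cone cd by (rule cone_metric)
  show ?thesis using K.zero[OF cls_in[OF assms(1)] cls_in[OF assms(2)]] cone_dist_cls[OF assms(1,2)] assms(3) by simp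
qed

end

section \<open>Approximation and growth of sequences\<close>

definition ubd :: "place \<Rightarrow> int \<Rightarrow> 'k::field poly fract ut \<Rightarrow> bool" where
  "ubd w m u \<longleftrightarrow> u12 u \<in> BB w m \<and> u13 u \<in> BB w m \<and> u14 u \<in> BB w m \<and> u23 u \<in> BB w m
     \<and> u24 u \<in> BB w m \<and> u34 u \<in> BB w m"

definition tbd :: "place \<Rightarrow> int \<Rightarrow> 'k::field poly fract \<Rightarrow> 'k poly fract \<Rightarrow> bool" where
  "tbd w m P Q \<longleftrightarrow> P \<in> BB w m \<and> inverse P \<in> BB w m \<and> Q \<in> BB w m \<and> inverse Q \<in> BB w m"

lemma NB_iff: "NB w m (u, P, Q) \<longleftrightarrow> ubd w m u \<and> tbd w m P Q"
  by (auto simp: ubd_def tbd_def)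

lemma BB_mult': "x \<in> BB w m \<Longrightarrow> y \<in> BB w n \<Longrightarrow> m + n \<le> k \<Longrightarrow> x * y \<in> BB w k"
  using BB_mult BB_mono by blast

lemma BB_mono': "x \<in> BB w m \<Longrightarrow> m \<le> n \<Longrightarrow> x \<in> BB w n"
  by (rule BB_mono)

lemma ubd_mono: "ubd w m u \<Longrightarrow> m \<le> n \<Longrightarrow> ubd w n u"
  unfolding ubd_def using BB_mono by blast

lemma tbd_mono: "tbd w m P Q \<Longrightarrow> m \<le> n \<Longrightarrow> tbd w n P Q"
  unfolding tbd_def using BB_mono by blast

lemma ubd_add:
  assumes "ubd w m u" "ubd w n v" "0 \<le> m" "0 \<le> n" shows "ubd w (m + n) (u + v)"
  using assms unfolding ubd_def ut_plus_sel
  by (elim conjE, intro conjI BB_add) ((erule BB_mono', simp) | (erule (1) BB_mult', simp))+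

lemma ubd_neg:
  assumes "ubd w m u" "0 \<le> m" shows "ubd w (3 * m) (- u)"
proof -
  have "u12 u * u23 u \<in> BB w (2 * m)" using assms(1) by (auto simp: ubd_def elim!: BB_mult')
  moreover have "u34 u \<in> BB w m" using assms(1) by (auto simp: ubd_def)
  ultimately have "u12 u * u23 u * u34 u \<in> BB w (3 * m)" by (rule BB_mult') simp
  thus ?thesis
    using assms unfolding ubd_def ut_uminus_sel
    by (elim conjE, intro conjI BB_add BB_diff BB_neg) ((erule BB_mono', simp) | (erule (1) BB_mult', simp) | assumption)+
qed

lemma tbd_mult: "tbd w m P Q \<Longrightarrow> tbd w n P' Q' \<Longrightarrow> tbd w (m + n) (P * P') (Q * Q')"
  unfolding tbd_def inverse_mult_distrib by (auto intro: BB_mult)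

lemma ubd_act:
  assumes "ubd w m u" "tbd w n P Q" "0 \<le> n" shows "ubd w (m + 2 * n) (act P Q u)"
proof -
  have "u12 u * inverse P \<in> BB w (m + n)" "u13 u * inverse Q \<in> BB w (m + n)"
    "u23 u * P * inverse Q \<in> BB w (m + n + n)" "u24 u * P \<in> BB w (m + n)" "u34 u * Q \<in> BB w (m + n)"
    using assms(1,2) unfolding ubd_def tbd_def by (intro BB_mult; blast)+
  hence "u12 u * inverse P \<in> BB w (m + 2 * n)" "u13 u * inverse Q \<in> BB w (m + 2 * n)"
    "u23 u * P * inverse Q \<in> BB w (m + 2 * n)" "u24 u * P \<in> BB w (m + 2 * n)" "u34 u * Q \<in> BB w (m + 2 * n)"
    using assms(3) by (auto elim!: BB_mono')
  moreover have "u14 u \<in> BB w (m + 2 * n)" using assms(1,3) unfolding ubd_def by (auto elim!: BB_mono')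
  ultimately show ?thesis by (simp add: ubd_def divide_inverse)
qed

text \<open>Strong approximation for the unipotent group, one superdiagonal after the other: the product of
  a chosen entry with a small error may have poles, so it is moved into the next approximation.\<close>

lemma approximate_unipotent:
  fixes y :: "place \<Rightarrow> 'k::field poly fract ut"
  assumes y: "\<And>w. inRR (y w)"
  shows "\<exists>g. inRR g \<and> (\<forall>w. ubd w 0 (- g + y w))"
proof -
  have R: "u12 (y w) \<in> RR" "u13 (y w) \<in> RR" "u14 (y w) \<in> RR" "u23 (y w) \<in> RR" "u24 (y w) \<in> RR" "u34 (y w) \<in> RR" for w
    using y[of w] by (auto simp: inRR_def)
  obtain g12 where g12: "g12 \<in> RR" "\<And>w. u12 (y w) - g12 \<in> Ow w" using strong_approximation[of "\<lambda>w. u12 (y w)"] R by blast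
  obtain g23 where g23: "g23 \<in> RR" "\<And>w. u23 (y w) - g23 \<in> Ow w" using strong_approximation[of "\<lambda>w. u23 (y w)"] R by blast
  obtain g34 where g34: "g34 \<in> RR" "\<And>w. u34 (y w) - g34 \<in> Ow w" using strong_approximation[of "\<lambda>w. u34 (y w)"] R by blast
  have "u13 (y w) - g12 * (u23 (y w) - g23) \<in> RR" for w by (intro RR_diff RR_mult R g12(1) g23(1))
  then obtain g13 where g13: "g13 \<in> RR" "\<And>w. u13 (y w) - g12 * (u23 (y w) - g23) - g13 \<in> Ow w"
    using strong_approximation[of "\<lambda>w. u13 (y w) - g12 * (u23 (y w) - g23)"] by blast
  have "u24 (y w) - g23 * (u34 (y w) - g34) \<in> RR" for w by (intro RR_diff RR_mult R g23(1) g34(1))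
  then obtain g24 where g24: "g24 \<in> RR" "\<And>w. u24 (y w) - g23 * (u34 (y w) - g34) - g24 \<in> Ow w"
    using strong_approximation[of "\<lambda>w. u24 (y w) - g23 * (u34 (y w) - g34)"] by blast
  let ?h = "UT g12 g13 0 g23 g24 g34"
  have "inRR (- ?h + y w)" for w
    using g12 g13 g23 g24 g34 y RR_zero by (intro inRR_add inRR_uminus) (auto simp: inRR_def)
  hence "u14 (- ?h + y w) \<in> RR" for w unfolding inRR_def by blast
  then obtain g14 where g14: "g14 \<in> RR" "\<And>w. u14 (- ?h + y w) - g14 \<in> Ow w"
    using strong_approximation[of "\<lambda>w. u14 (- ?h + y w)"] by blast
  let ?g = "UT g12 g13 g14 g23 g24 g34"
  have "ubd w 0 (- ?g + y w)" for w
    using g12(2)[of w] g13(2)[of w] g14(2)[of w] g23(2)[of w] g24(2)[of w] g34(2)[of w]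
    by (simp add: ubd_def BB_zero algebra_simps)
  moreover have "inRR ?g" using g12 g13 g14 g23 g24 g34 by (simp add: inRR_def)
  ultimately show ?thesis by blast
qed

lemma approximate_twisted:
  fixes y :: "place \<Rightarrow> 'k::field poly fract ut"
  assumes y: "\<And>w. inRR (y w)" and PQ: "unitRR P" "unitRR Q"
  shows "\<exists>g. inRR g \<and> (\<forall>w. ubd w 0 (act (inverse P) (inverse Q) (- g + y w)))"
proof -
  have nz: "P \<noteq> 0" "Q \<noteq> 0" using PQ by (auto simp: unitRR_def)
  obtain g where g: "inRR g" "\<And>w. ubd w 0 (- g + act (inverse P) (inverse Q) (y w))"
    using approximate_unipotent[of "\<lambda>w. act (inverse P) (inverse Q) (y w)"] inRR_act[OF y unitRR_inverse[OF PQ(1)] unitRR_inverse[OF PQ(2)]] by blast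
  have "act (inverse P) (inverse Q) (- act P Q g + y w) = - g + act (inverse P) (inverse Q) (y w)" for w
    using nz by (simp add: act_add act_uminus act_act)
  thus ?thesis using g inRR_act[OF g(1) PQ] by (intro exI[of _ "act P Q g"]) simp
qed

text \<open>Up to constants, the units of the ring.\<close>

definition mono_ts :: "int \<Rightarrow> int \<Rightarrow> 'k::field poly fract" where "mono_ts i j = tt powi i * (tt - 1) powi j"

lemma mono_ts_simps:
  "mono_ts i j \<noteq> 0" "inverse (mono_ts i j) = mono_ts (- i) (- j)" "mono_ts i j * mono_ts k l = mono_ts (i + k) (j + l)"
  by (simp_all add: mono_ts_def power_int_minus power_int_add mult_ac)

lemma unitRR_mono_ts: "unitRR (mono_ts i j)"
  unfolding unitRR_def mono_ts_simps(2) using mono_ts_simps(1) by (auto simp: mono_ts_def intro: RR_mult RR_powi)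

lemma mono_ts_BB: "i * pole_t w + j * pole_s w \<le> m \<Longrightarrow> mono_ts i j \<in> BB w m"
  unfolding mono_ts_def by (rule BB_mult'[OF BB_tt_powi BB_ss_powi])

lemma mono_ts_tbd:
  assumes "\<bar>i\<bar> \<le> m" "\<bar>j\<bar> \<le> m" "\<bar>k\<bar> \<le> m" "\<bar>l\<bar> \<le> m" shows "tbd w (2 * m) (mono_ts i j) (mono_ts k l)"
  unfolding tbd_def mono_ts_simps(2)
  by (intro conjI mono_ts_BB; cases w) (use assms in auto)

text \<open>With \<open>TB\<close>, the diagonal entries of a torus element close to the point $v$ of the
  flat at scale $n$.\<close>

definition TA :: "nat \<Rightarrow> flat \<Rightarrow> 'k::field poly fract" where
  "TA n v = mono_ts \<lfloor>real n * fst (fst v)\<rfloor> \<lfloor>real n * snd (fst v)\<rfloor>"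
definition TB :: "nat \<Rightarrow> flat \<Rightarrow> 'k::field poly fract" where
  "TB n v = mono_ts \<lfloor>real n * fst (snd v)\<rfloor> \<lfloor>real n * snd (snd v)\<rfloor>"

abbreviation untwist :: "nat \<Rightarrow> flat \<Rightarrow> 'k::field poly fract ut \<Rightarrow> 'k poly fract ut" where
  "untwist n v \<equiv> act (inverse (TA n v)) (inverse (TB n v))"

lemma T_nonzero [simp]: "TA n v \<noteq> 0" "TB n v \<noteq> 0"
  by (simp_all add: TA_def TB_def mono_ts_simps)

lemma unitRR_T: "unitRR (TA n v)" "unitRR (TB n v)"
  by (simp_all add: TA_def TB_def unitRR_mono_ts)

lemma T_BB:
  "- real n * cA w v + 2 \<le> real_of_int m \<Longrightarrow> TA n v \<in> BB w m"
  "real n * cA w v + 2 \<le> real_of_int m \<Longrightarrow> inverse (TA n v) \<in> BB w m"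
  "- real n * cB w v + 2 \<le> real_of_int m \<Longrightarrow> TB n v \<in> BB w m"
  "real n * cB w v + 2 \<le> real_of_int m \<Longrightarrow> inverse (TB n v) \<in> BB w m"
  unfolding TA_def TB_def mono_ts_simps(2)
  by (rule mono_ts_BB; cases w; simp add: algebra_simps; linarith)+

lemma flat_norm:
  fixes v :: flat
  shows "\<bar>fst (fst v)\<bar> \<le> norm v" "\<bar>snd (fst v)\<bar> \<le> norm v" "\<bar>fst (snd v)\<bar> \<le> norm v" "\<bar>snd (snd v)\<bar> \<le> norm v"
    "norm v \<le> \<bar>fst (fst v)\<bar> + \<bar>snd (fst v)\<bar> + (\<bar>fst (snd v)\<bar> + \<bar>snd (snd v)\<bar>)"
  using norm_fst_le[of "fst v" "snd v"] norm_snd_le[of "snd v" "fst v"]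
    norm_fst_le[of "fst (fst v)" "snd (fst v)"] norm_snd_le[of "snd (fst v)" "fst (fst v)"]
    norm_fst_le[of "fst (snd v)" "snd (snd v)"] norm_snd_le[of "snd (snd v)" "fst (snd v)"]
    norm_Pair_le[of "fst v" "snd v"] norm_Pair_le[of "fst (fst v)" "snd (fst v)"] norm_Pair_le[of "fst (snd v)" "snd (snd v)"]
  by simp_all

lemma T_ratio_tbd:
  assumes "norm (v' - v) \<le> r"
  shows "tbd w (2 * (\<lceil>real n * r\<rceil> + 1)) (inverse (TA n v) * TA n v') (inverse (TB n v) * TB n v')"
proof -
  have c: "\<bar>fst (fst v') - fst (fst v)\<bar> \<le> r" "\<bar>snd (fst v') - snd (fst v)\<bar> \<le> r"
     "\<bar>fst (snd v') - fst (snd v)\<bar> \<le> r" "\<bar>snd (snd v') - snd (snd v)\<bar> \<le> r"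
    using assms order_trans[OF flat_norm(1) assms] order_trans[OF flat_norm(2) assms]
      order_trans[OF flat_norm(3) assms] order_trans[OF flat_norm(4) assms]
    by (simp_all only: fst_diff snd_diff)
  have f: "\<bar>- \<lfloor>real n * a\<rfloor> + \<lfloor>real n * b\<rfloor>\<bar> \<le> \<lceil>real n * r\<rceil> + 1" if "\<bar>b - a\<bar> \<le> r" for a b
  proof -
    have "\<bar>real n * b - real n * a\<bar> \<le> real n * r"
      using mult_left_mono[OF that, of "real n"] by (simp add: abs_mult right_diff_distrib[symmetric])
    thus ?thesis by linarith
  qed
  show ?thesis unfolding TA_def TB_def mono_ts_simps(2,3)
    by (rule mono_ts_tbd) (use f c in blast)+
qed

lemma T_ratio_exponents:
  assumes "tbd Place0 m (inverse (TA n v) * TA n v' :: 'k::field poly fract) (inverse (TB n v) * TB n v')"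
    "tbd Place1 m (inverse (TA n v) * TA n v' :: 'k::field poly fract) (inverse (TB n v) * TB n v')"
  shows "real n * norm (v' - v) \<le> 4 * (real_of_int m + 1)"
proof -
  have e: "\<bar>i\<bar> \<le> m \<and> \<bar>j\<bar> \<le> m" if "mono_ts i j = (x :: 'k poly fract)" "x \<in> BB Place0 m" "inverse x \<in> BB Place0 m" "x \<in> BB Place1 m" "inverse x \<in> BB Place1 m" for i j x
    using unit_exponents_bounded[of x 1 i j m, OF _ _ that(2-5)] that(1) unfolding mono_ts_def by simp
  have f: "\<bar>real n * b - real n * a\<bar> \<le> real_of_int m + 1" if "\<bar>- \<lfloor>real n * a\<rfloor> + \<lfloor>real n * b\<rfloor>\<bar> \<le> m" for a b
    using that by linarith
  have *: "\<bar>real n * fst (fst v') - real n * fst (fst v)\<bar> \<le> real_of_int m + 1"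
    "\<bar>real n * snd (fst v') - real n * snd (fst v)\<bar> \<le> real_of_int m + 1"
    "\<bar>real n * fst (snd v') - real n * fst (snd v)\<bar> \<le> real_of_int m + 1"
    "\<bar>real n * snd (snd v') - real n * snd (snd v)\<bar> \<le> real_of_int m + 1"
    using e[of "- \<lfloor>real n * fst (fst v)\<rfloor> + \<lfloor>real n * fst (fst v')\<rfloor>" "- \<lfloor>real n * snd (fst v)\<rfloor> + \<lfloor>real n * snd (fst v')\<rfloor>"
        "inverse (TA n v) * TA n v'"]
      e[of "- \<lfloor>real n * fst (snd v)\<rfloor> + \<lfloor>real n * fst (snd v')\<rfloor>" "- \<lfloor>real n * snd (snd v)\<rfloor> + \<lfloor>real n * snd (snd v')\<rfloor>"
        "inverse (TB n v) * TB n v'"] assms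
    unfolding tbd_def by (simp_all add: TA_def TB_def mono_ts_simps f)
  have "norm (v' - v) \<le> (\<bar>fst (fst v') - fst (fst v)\<bar> + \<bar>snd (fst v') - snd (fst v)\<bar>) + (\<bar>fst (snd v') - fst (snd v)\<bar> + \<bar>snd (snd v') - snd (snd v)\<bar>)"
    using flat_norm(5)[of "v' - v"] by (simp only: fst_diff snd_diff)
  hence "real n * norm (v' - v) \<le> real n * ((\<bar>fst (fst v') - fst (fst v)\<bar> + \<bar>snd (fst v') - snd (fst v)\<bar>) + (\<bar>fst (snd v') - fst (snd v)\<bar> + \<bar>snd (snd v') - snd (snd v)\<bar>))"
    by (intro mult_left_mono) auto
  also have "\<dots> = \<bar>real n * fst (fst v') - real n * fst (fst v)\<bar> + \<bar>real n * snd (fst v') - real n * snd (fst v)\<bar>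
     + \<bar>real n * fst (snd v') - real n * fst (snd v)\<bar> + \<bar>real n * snd (snd v') - real n * snd (snd v)\<bar>"
    by (simp add: distrib_left abs_mult right_diff_distrib[symmetric])
  also have "\<dots> \<le> 4 * (real_of_int m + 1)"
  proof -
    have "a + b + c + d \<le> 4 * k" if "a \<le> k" "b \<le> k" "c \<le> k" "d \<le> k" for a b c d k :: real
      using that by linarith
    thus ?thesis using * by blast
  qed
  finally show ?thesis .
qed

text \<open>The bound is required for every larger rate, so that it only depends on the limiting rate.\<close>

definition growth :: "nat filter \<Rightarrow> place \<Rightarrow> real \<Rightarrow> (nat \<Rightarrow> 'k::field poly fract) \<Rightarrow> bool" where
  "growth \<omega> w r x \<longleftrightarrow> (\<forall>e>0. eventually (\<lambda>n. \<exists>m. x n \<in> BB w m \<and> real_of_int m \<le> (r + e) * real n) \<omega>)"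

text \<open>The linear bound for every positive $n$, and not only almost everywhere, is what the definition
  of the precone asks for.\<close>

definition cone_Lam :: "nat filter \<Rightarrow> place \<Rightarrow> real \<Rightarrow> (nat \<Rightarrow> 'k::field poly fract) set" where
  "cone_Lam \<omega> w r = {x. (\<forall>n. x n \<in> RR) \<and> (\<exists>K::nat. \<forall>n>0. x n \<in> BB w (int (K * n))) \<and> growth \<omega> w r x}"

definition ut_growth :: "nat filter \<Rightarrow> place \<Rightarrow> real \<Rightarrow> (nat \<Rightarrow> 'k::field poly fract ut) \<Rightarrow> bool" where
  "ut_growth \<omega> w r U \<longleftrightarrow> (\<forall>e>0. eventually (\<lambda>n. \<exists>m. ubd w m (U n) \<and> real_of_int m \<le> (r + e) * real n) \<omega>)"

text \<open>The matrix at the index $n$ of a matrix of sequences.\<close>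

definition ev :: "nat \<Rightarrow> (nat \<Rightarrow> 'a) ut \<Rightarrow> 'a ut" where
  "ev n u = UT (u12 u n) (u13 u n) (u14 u n) (u23 u n) (u24 u n) (u34 u n)"

lemma ev_sel [simp]:
  "u12 (ev n u) = u12 u n" "u13 (ev n u) = u13 u n" "u14 (ev n u) = u14 u n" "u23 (ev n u) = u23 u n"
  "u24 (ev n u) = u24 u n" "u34 (ev n u) = u34 u n"
  by (simp_all add: ev_def)

lemma ev_add: "ev n (u + v) = ev n u + ev n v" by (rule ut_eqI) simp_all
lemma ev_neg: "ev n (- u) = - ev n u" by (rule ut_eqI) simp_all
lemma ev_central: "ev n (central_elt z w) = E14 (z n)" by (rule ut_eqI) (simp_all add: central_elt_def)

lemma ut_growth_iff:
  "ut_growth \<omega> w r U \<longleftrightarrow> growth \<omega> w r (\<lambda>n. u12 (U n)) \<and> growth \<omega> w r (\<lambda>n. u13 (U n)) \<and> growth \<omega> w r (\<lambda>n. u14 (U n))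
     \<and> growth \<omega> w r (\<lambda>n. u23 (U n)) \<and> growth \<omega> w r (\<lambda>n. u24 (U n)) \<and> growth \<omega> w r (\<lambda>n. u34 (U n))"
proof -
  have fl: "(\<exists>m. x \<in> BB w m \<and> real_of_int m \<le> c) \<longleftrightarrow> x \<in> BB w \<lfloor>c\<rfloor>" for x :: "'a poly fract" and c
  proof
    assume "\<exists>m. x \<in> BB w m \<and> real_of_int m \<le> c"
    then obtain m where "x \<in> BB w m" "m \<le> \<lfloor>c\<rfloor>" by (auto simp: le_floor_iff)
    thus "x \<in> BB w \<lfloor>c\<rfloor>" by (rule BB_mono')
  next
    assume "x \<in> BB w \<lfloor>c\<rfloor>"
    thus "\<exists>m. x \<in> BB w m \<and> real_of_int m \<le> c" by (intro exI[of _ "\<lfloor>c\<rfloor>"]) simp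
  qed
  have fl': "(\<exists>m. ubd w m u \<and> real_of_int m \<le> c) \<longleftrightarrow> ubd w \<lfloor>c\<rfloor> u" for u :: "'a poly fract ut" and c
  proof
    assume "\<exists>m. ubd w m u \<and> real_of_int m \<le> c"
    then obtain m where "ubd w m u" "m \<le> \<lfloor>c\<rfloor>" by (auto simp: le_floor_iff)
    thus "ubd w \<lfloor>c\<rfloor> u" by (rule ubd_mono)
  next
    assume "ubd w \<lfloor>c\<rfloor> u"
    thus "\<exists>m. ubd w m u \<and> real_of_int m \<le> c" by (intro exI[of _ "\<lfloor>c\<rfloor>"]) simp
  qed
  show ?thesis unfolding ut_growth_def growth_def fl fl' unfolding ubd_def eventually_conj_iff by (simp only: imp_conjR all_conj_distrib)
qed

context
  fixes \<omega> :: "nat filter"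
  assumes ultra: "nonprincipal_ultrafilter_on {0<..} \<omega>"
begin

lemma om_large: "eventually (\<lambda>n. real n \<ge> c) \<omega>"
  by (rule ultrafilter_large[OF ultra])

lemma om_absorb:
  assumes "\<And>e. e > 0 \<Longrightarrow> eventually (\<lambda>n. \<exists>m. Q n m \<and> real_of_int m \<le> (r + e) * real n + c) \<omega>" "e > 0"
  shows "eventually (\<lambda>n. \<exists>m. Q n m \<and> real_of_int m \<le> (r + e) * real n) \<omega>"
proof -
  have "e / 2 > 0" using assms(2) by simp
  from assms(1)[OF this] om_large[of "2 * c / e"] show ?thesis
  proof eventually_elim
    fix n assume h: "\<exists>m. Q n m \<and> real_of_int m \<le> (r + e / 2) * real n + c" "2 * c / e \<le> real n"
    then obtain m where m: "Q n m" "real_of_int m \<le> (r + e / 2) * real n + c" by blast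
    have "c \<le> e / 2 * real n" using h(2) assms(2) by (simp add: field_simps)
    hence "real_of_int m \<le> (r + e) * real n" using m(2) by (simp add: algebra_simps)
    thus "\<exists>m. Q n m \<and> real_of_int m \<le> (r + e) * real n" using m(1) by blast
  qed
qed

lemma growthI:
  assumes "\<And>e. e > 0 \<Longrightarrow> eventually (\<lambda>n. \<exists>m. x n \<in> BB w m \<and> real_of_int m \<le> (r + e) * real n + c) \<omega>"
  shows "growth \<omega> w r x"
  unfolding growth_def by (intro allI impI om_absorb[of "\<lambda>n m. x n \<in> BB w m", OF assms])

lemma ut_growthI:
  assumes "\<And>e. e > 0 \<Longrightarrow> eventually (\<lambda>n. \<exists>m. ubd w m (U n) \<and> real_of_int m \<le> (r + e) * real n + c) \<omega>"
  shows "ut_growth \<omega> w r U"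
  unfolding ut_growth_def by (intro allI impI om_absorb[of "\<lambda>n m. ubd w m (U n)", OF assms])

lemma growth_pointwise:
  assumes "\<And>n. n > 0 \<Longrightarrow> \<exists>m. x n \<in> BB w m \<and> real_of_int m \<le> r * real n + c" shows "growth \<omega> w r x"
proof (rule growthI[of _ _ _ c])
  fix e :: real assume "e > 0"
  have "eventually (\<lambda>n. real n \<ge> 1) \<omega>" by (rule om_large)
  thus "eventually (\<lambda>n. \<exists>m. x n \<in> BB w m \<and> real_of_int m \<le> (r + e) * real n + c) \<omega>"
  proof eventually_elim
    case (elim n)
    then obtain m where "x n \<in> BB w m" "real_of_int m \<le> r * real n + c" using assms[of n] by auto
    moreover have "0 \<le> e * real n" using \<open>e > 0\<close> by simp
    ultimately show ?case by (intro exI[of _ m]) (simp add: distrib_right)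
  qed
qed

lemma growth_D: "growth \<omega> w r x \<Longrightarrow> e > 0 \<Longrightarrow> eventually (\<lambda>n. \<exists>m. x n \<in> BB w m \<and> real_of_int m \<le> (r + e) * real n) \<omega>"
  unfolding growth_def by blast

lemma growth_mono:
  assumes "growth \<omega> w r x" "r \<le> s" shows "growth \<omega> w s x"
proof (rule growthI[of _ _ _ 0])
  fix e :: real assume "e > 0"
  from growth_D[OF assms(1) this]
  show "eventually (\<lambda>n. \<exists>m. x n \<in> BB w m \<and> real_of_int m \<le> (s + e) * real n + 0) \<omega>"
  proof eventually_elim
    case (elim n)
    have "(r + e) * real n \<le> (s + e) * real n" using assms(2) by (intro mult_right_mono) auto
    thus ?case using elim by force
  qed
qed

lemma growth_neg:
  assumes "growth \<omega> w r x" shows "growth \<omega> w r (\<lambda>n. - x n)"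
proof (rule growthI[of _ _ _ 0])
  fix e :: real assume "e > 0"
  from growth_D[OF assms(1) this]
  show "eventually (\<lambda>n. \<exists>m. - x n \<in> BB w m \<and> real_of_int m \<le> (r + e) * real n + 0) \<omega>"
    by eventually_elim (auto intro: BB_neg)
qed

lemma growth_mult:
  assumes "growth \<omega> w r x" "growth \<omega> w s y" shows "growth \<omega> w (r + s) (\<lambda>n. x n * y n)"
proof (rule growthI[of _ _ _ 0])
  fix e :: real assume "e > 0"
  hence e2: "e / 2 > 0" by simp
  have "eventually (\<lambda>n. \<exists>m. x n \<in> BB w m \<and> real_of_int m \<le> (r + e / 2) * real n) \<omega>"
    "eventually (\<lambda>n. \<exists>m. y n \<in> BB w m \<and> real_of_int m \<le> (s + e / 2) * real n) \<omega>"
    using assms e2 unfolding growth_def by blast+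
  thus "eventually (\<lambda>n. \<exists>m. x n * y n \<in> BB w m \<and> real_of_int m \<le> (r + s + e) * real n + 0) \<omega>"
  proof eventually_elim
    case (elim n)
    then obtain m m' where m: "x n \<in> BB w m" "real_of_int m \<le> (r + e / 2) * real n"
      "y n \<in> BB w m'" "real_of_int m' \<le> (s + e / 2) * real n" by blast
    have "(r + e / 2) * real n + (s + e / 2) * real n = (r + s + e) * real n" by (simp add: field_simps)
    thus ?case using m BB_mult[OF m(1,3)] by (intro exI[of _ "m + m'"]) simp
  qed
qed

lemma growth_add:
  assumes "growth \<omega> w r x" "growth \<omega> w r y" shows "growth \<omega> w r (\<lambda>n. x n + y n)"
proof (rule growthI[of _ _ _ 0])
  fix e :: real assume "e > 0"
  have "eventually (\<lambda>n. \<exists>m. x n \<in> BB w m \<and> real_of_int m \<le> (r + e) * real n) \<omega>"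
    "eventually (\<lambda>n. \<exists>m. y n \<in> BB w m \<and> real_of_int m \<le> (r + e) * real n) \<omega>"
    using assms \<open>e > 0\<close> unfolding growth_def by blast+
  thus "eventually (\<lambda>n. \<exists>m. x n + y n \<in> BB w m \<and> real_of_int m \<le> (r + e) * real n + 0) \<omega>"
  proof eventually_elim
    case (elim n)
    then obtain m m' where m: "x n \<in> BB w m" "real_of_int m \<le> (r + e) * real n"
      "y n \<in> BB w m'" "real_of_int m' \<le> (r + e) * real n" by blast
    have "x n + y n \<in> BB w (max m m')"
      using BB_mono[of m "max m m'" "x n" w] BB_mono[of m' "max m m'" "y n" w] m by (intro BB_add) auto
    thus ?case using m by (intro exI[of _ "max m m'"]) auto
  qed
qed

lemma cone_Lam_filtration: "ring_filtration (cone_Lam \<omega> w :: real \<Rightarrow> (nat \<Rightarrow> 'k::field poly fract) set)"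
proof
  fix r s :: real and x y :: "nat \<Rightarrow> 'k poly fract"
  show "(0 :: nat \<Rightarrow> 'k poly fract) \<in> cone_Lam \<omega> w r"
  proof -
    have "growth \<omega> w r (\<lambda>n. 0 :: 'k poly fract)"
      by (rule growth_pointwise[of _ _ _ 0], rule exI, rule conjI, rule BB_0, simp, rule of_int_floor_le)
    thus ?thesis by (auto simp: cone_Lam_def RR_zero zero_fun_def)
  qed
  show "- x \<in> cone_Lam \<omega> w r" if "x \<in> cone_Lam \<omega> w r"
  proof -
    have "(\<exists>K::nat. \<forall>n>0. - x n \<in> BB w (int (K * n)))" using that BB_neg unfolding cone_Lam_def by blast
    moreover have "growth \<omega> w r (\<lambda>n. - x n)" using that growth_neg unfolding cone_Lam_def by blast
    ultimately show ?thesis using that by (auto simp: cone_Lam_def RR_neg fun_Compl_def)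
  qed
  show "x + y \<in> cone_Lam \<omega> w r" if xy: "x \<in> cone_Lam \<omega> w r" "y \<in> cone_Lam \<omega> w r"
  proof -
    obtain K where K: "\<And>n. n > 0 \<Longrightarrow> x n \<in> BB w (int (K * n))" using xy unfolding cone_Lam_def by auto
    obtain L where L: "\<And>n. n > 0 \<Longrightarrow> y n \<in> BB w (int (L * n))" using xy unfolding cone_Lam_def by auto
    have "x n + y n \<in> BB w (int ((K + L) * n))" if "n > 0" for n
      using K[OF that] L[OF that] by (intro BB_add) (auto elim!: BB_mono' intro!: mult_right_mono)
    hence "\<exists>K::nat. \<forall>n>0. x n + y n \<in> BB w (int (K * n))" by blast
    thus ?thesis using xy growth_add[of w r x y] by (auto simp: cone_Lam_def RR_add plus_fun_def)
  qed
  show "x \<in> cone_Lam \<omega> w s" if "r \<le> s" "x \<in> cone_Lam \<omega> w r"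
    using that growth_mono by (auto simp: cone_Lam_def)
  show "x * y \<in> cone_Lam \<omega> w (r + s)" if xy: "x \<in> cone_Lam \<omega> w r" "y \<in> cone_Lam \<omega> w s"
  proof -
    obtain K where K: "\<And>n. n > 0 \<Longrightarrow> x n \<in> BB w (int (K * n))" using xy unfolding cone_Lam_def by auto
    obtain L where L: "\<And>n. n > 0 \<Longrightarrow> y n \<in> BB w (int (L * n))" using xy unfolding cone_Lam_def by auto
    have "x n * y n \<in> BB w (int ((K + L) * n))" if "n > 0" for n
      using K[OF that] L[OF that] by (rule BB_mult') (simp add: algebra_simps)
    hence "\<exists>K::nat. \<forall>n>0. x n * y n \<in> BB w (int (K * n))" by blast
    thus ?thesis using xy growth_mult[of w r x s y] by (auto simp: cone_Lam_def RR_mult times_fun_def)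
  qed
  show "1 \<in> cone_Lam \<omega> w 0"
    by (auto simp: cone_Lam_def RR_one BB_one intro!: growth_pointwise[of _ _ _ 0] exI[of _ 0])
qed

lemma cone_Lam_unit: "\<exists>t\<in>cone_Lam \<omega> w (- a). \<exists>t'\<in>cone_Lam \<omega> w a. t * t' = (1 :: nat \<Rightarrow> 'k::field poly fract)"
proof -
  let ?t = "\<lambda>n. unif w powi \<lfloor>a * real n\<rfloor> :: 'k poly fract" and ?t' = "\<lambda>n. unif w powi (- \<lfloor>a * real n\<rfloor>) :: 'k poly fract"
  define K where "K = nat (\<lceil>\<bar>a\<bar>\<rceil> + 1)"
  have K: "\<bar>\<lfloor>a * real n\<rfloor>\<bar> \<le> int (K * n)" if "n > 0" for n
  proof -
    have "\<bar>a\<bar> + 1 \<le> real K" unfolding K_def by linarith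
    hence "(\<bar>a\<bar> + 1) * real n \<le> real K * real n" by (intro mult_right_mono) auto
    moreover have "\<bar>a * real n\<bar> = \<bar>a\<bar> * real n" by (simp add: abs_mult)
    moreover have "real n \<ge> 1" using that by simp
    ultimately have "\<bar>a * real n\<bar> + 1 \<le> real (K * n)" by (simp add: distrib_right)
    thus ?thesis by linarith
  qed
  have RRp: "unif w powi k \<in> (RR :: 'k poly fract set)" for k
    by (cases w) (simp_all add: RR_powi power_int_inverse power_int_minus[symmetric])
  have "?t \<in> cone_Lam \<omega> w (- a)"
    unfolding cone_Lam_def mem_Collect_eq
  proof (intro conjI allI exI[of _ K] impI RRp growth_pointwise[of _ _ _ 1])
    show "?t n \<in> BB w (int (K * n))" if "n > 0" for n using K[OF that] by (simp only: BB_unif_powi)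
    show "\<exists>m. ?t n \<in> BB w m \<and> real_of_int m \<le> - a * real n + 1" if "n > 0" for n
      by (intro exI[of _ "- \<lfloor>a * real n\<rfloor>"] conjI, simp only: BB_unif_powi order_refl, simp, linarith)
  qed
  moreover have "?t' \<in> cone_Lam \<omega> w a"
    unfolding cone_Lam_def mem_Collect_eq
  proof (intro conjI allI exI[of _ K] impI RRp growth_pointwise[of _ _ _ 1])
    show "?t' n \<in> BB w (int (K * n))" if "n > 0" for n using K[OF that] by (simp only: BB_unif_powi)
    show "\<exists>m. ?t' n \<in> BB w m \<and> real_of_int m \<le> a * real n + 1" if "n > 0" for n
      by (intro exI[of _ "\<lfloor>a * real n\<rfloor>"] conjI, simp add: BB_unif_powi, linarith)
  qed
  moreover have "?t * ?t' = 1"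
    by (rule ext) (simp add: power_int_minus)
  ultimately show ?thesis by blast
qed

lemma three_places_cone_Lam: "three_places (cone_Lam \<omega> :: place \<Rightarrow> real \<Rightarrow> (nat \<Rightarrow> 'k::field poly fract) set)"
  unfolding three_places_def using cone_Lam_filtration cone_Lam_unit by blast

lemma growth_T:
  "growth \<omega> w (- cA w v) (\<lambda>n. TA n v)" "growth \<omega> w (cA w v) (\<lambda>n. inverse (TA n v))"
  "growth \<omega> w (- cB w v) (\<lambda>n. TB n v)" "growth \<omega> w (cB w v) (\<lambda>n. inverse (TB n v))"
  by (rule growth_pointwise[of _ _ _ 3]; rule exI; rule conjI, rule T_BB, rule le_of_int_ceiling; simp add: mult.commute; linarith)+

text \<open>Multiplication by $P$ or $Q$ shifts the growth rate by exactly the coordinates of $v$.\<close>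

lemma ut_growth_twisted_iff:
  "ut_growth \<omega> w r (\<lambda>n. untwist n v (ev n k)) \<longleftrightarrow>
     growth \<omega> w (cA w v + r) (u12 k) \<and> growth \<omega> w (cB w v + r) (u13 k) \<and> growth \<omega> w r (u14 k)
     \<and> growth \<omega> w (cB w v - cA w v + r) (u23 k) \<and> growth \<omega> w (- cA w v + r) (u24 k) \<and> growth \<omega> w (- cB w v + r) (u34 k)"
proof -
  have scale: "growth \<omega> w r (\<lambda>n. x n * y n) \<longleftrightarrow> growth \<omega> w s x"
    if "growth \<omega> w a y" "growth \<omega> w (- a) (\<lambda>n. inverse (y n))" "\<And>n. y n \<noteq> 0" "r = s + a" for x y r s a
    using growth_mult[OF _ that(1), of s x] growth_mult[OF _ that(2), of r "\<lambda>n. x n * y n"] that(3,4)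
    by (auto simp: mult.assoc)
  note TT = growth_T[of w v]
  have 1: "growth \<omega> w r (\<lambda>n. u12 k n * TA n v) \<longleftrightarrow> growth \<omega> w (cA w v + r) (u12 k)"
    by (rule scale[OF TT(1)]) (use TT in auto)
  have 2: "growth \<omega> w r (\<lambda>n. u13 k n * TB n v) \<longleftrightarrow> growth \<omega> w (cB w v + r) (u13 k)"
    by (rule scale[OF TT(3)]) (use TT in auto)
  have 3: "growth \<omega> w r (\<lambda>n. u24 k n * inverse (TA n v)) \<longleftrightarrow> growth \<omega> w (- cA w v + r) (u24 k)"
    by (rule scale[OF TT(2)]) (use TT in auto)
  have 4: "growth \<omega> w r (\<lambda>n. u34 k n * inverse (TB n v)) \<longleftrightarrow> growth \<omega> w (- cB w v + r) (u34 k)"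
    by (rule scale[OF TT(4)]) (use TT in auto)
  have 5: "growth \<omega> w r (\<lambda>n. u23 k n * inverse (TA n v) * TB n v) \<longleftrightarrow> growth \<omega> w (r + cB w v) (\<lambda>n. u23 k n * inverse (TA n v))"
    by (rule scale[OF TT(3)]) (use TT in auto)
  have 6: "growth \<omega> w (r + cB w v) (\<lambda>n. u23 k n * inverse (TA n v)) \<longleftrightarrow> growth \<omega> w (cB w v - cA w v + r) (u23 k)"
    by (rule scale[OF TT(2)]) (use TT in auto)
  show ?thesis
    unfolding ut_growth_iff act_sel ev_sel divide_inverse inverse_inverse_eq 1 2 3 4 5 6 by simp
qed

end

section \<open>Cones of the quotient\<close>

text \<open>Compares two representatives $g$, $g'$ with the elements $u$, $u'$ that they approximate; in the
  use below the outer terms have no poles.\<close>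

lemma act_telescope:
  fixes g g' u u' :: "'a::field ut"
  assumes "P \<noteq> 0" "Q \<noteq> 0" "P' \<noteq> 0" "Q' \<noteq> 0"
  shows "act (inverse P) (inverse Q) (- g + g') =
     act (inverse P) (inverse Q) (- g + u) + act (inverse P) (inverse Q) (- u + u')
     + act (inverse P * P') (inverse Q * Q') (- act (inverse P') (inverse Q') (- g' + u'))"
proof -
  have "- g + g' = (- g + u) + (- u + u') + - (- g' + u')" by (simp add: add.assoc minus_add)
  moreover have "act (inverse P * P') (inverse Q * Q') (- act (inverse P') (inverse Q') (- g' + u')) =
     act (inverse P) (inverse Q) (- (- g' + u'))"
    using assms by (simp add: act_act act_uminus mult.assoc)
  ultimately show ?thesis using assms by (simp only: act_add nonzero_imp_inverse_nonzero not_False_eq_True)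
qed

lemma cst_inverse: "inverse (cst a) = cst (inverse (a :: 'k::field))"
proof (cases "a = 0")
  case False
  hence "cst a * cst (inverse a) = 1" by (simp only: cst_simps(6)[symmetric]) simp
  thus ?thesis by (simp add: inverse_unique)
qed simp

text \<open>The word metric enters only through the two estimates with the constant \<open>B\<close>.\<close>

locale quotient_cone = central_quotient ZP for ZP :: "'k::field poly set" +
  fixes S :: "'k poly fract mat set set" and \<omega> :: "nat filter" and B :: nat
  assumes gen: "finite_generating_set Gam S" and ultra: "nonprincipal_ultrafilter_on {0<..} \<omega>"
    and length_upper: "inG x \<Longrightarrow> (\<And>w. NB w (int m) x) \<Longrightarrow> word_length Gam S (proj x) \<le> B * (m + 1)"
    and length_lower: "inG x \<Longrightarrow> word_length Gam S (proj x) \<le> n \<Longrightarrow>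
       \<exists>f\<in>ZP. \<forall>w. NB w (int (B * n)) (tmul x (zt f))"
    and B_pos: "B \<ge> 1"
begin

sublocale ultra_cone "carrier Gam" "word_dist Gam S" "\<one>\<^bsub>Gam\<^esub>" \<omega>
proof -
  have "Metric_space (carrier Gam) (word_dist Gam S)"
    using gen by (intro GG.Metric_space_word_dist) (auto simp: finite_generating_set_def)
  thus "ultra_cone (carrier Gam) (word_dist Gam S) \<one>\<^bsub>Gam\<^esub> \<omega>"
    using ultra by (simp add: ultra_cone_def ultra_cone_axioms_def)
qed

sublocale TP: three_places "cone_Lam \<omega> :: place \<Rightarrow> real \<Rightarrow> (nat \<Rightarrow> 'k poly fract) set"
  by (rule three_places_cone_Lam[OF ultra])

lemma dist_proj:
  assumes "inG x" "inG y" shows "word_dist Gam S (proj x) (proj y) = real (word_length Gam S (proj (tmul (tinv x) y)))"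
  using assms by (simp add: word_dist_def proj_carrier proj_inv proj_mult inG_tinv)

lemma od_le_bounds:
  assumes "\<And>n. inG (X n)" "\<And>n. inG (Y n)" "x \<in> PC" "y \<in> PC"
    "\<And>n. n > 0 \<Longrightarrow> x n = proj (X n)" "\<And>n. n > 0 \<Longrightarrow> y n = proj (Y n)" "0 \<le> s"
    and e: "\<And>e. e > 0 \<Longrightarrow> eventually (\<lambda>n. \<forall>w. \<exists>m. NB w m (tmul (tinv (X n)) (Y n)) \<and> real_of_int m \<le> (s + e) * real n + c) \<omega>"
  shows "od x y \<le> real B * s"
proof (rule od_le[OF assms(3,4)])
  fix e :: real assume "e > 0"
  define \<eta> where "\<eta> = e / (2 * real B)"
  have \<eta>: "\<eta> > 0" "real B * \<eta> = e / 2" using \<open>e > 0\<close> B_pos by (simp_all add: \<eta>_def)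
  from e[OF \<eta>(1)] omega_large[of "2 * real B * (\<bar>c\<bar> + 1) / e"] omega_pos
  show "eventually (\<lambda>n. word_dist Gam S (x n) (y n) \<le> (real B * s + e) * real n) \<omega>"
  proof eventually_elim
    case (elim n)
    let ?r = "(s + \<eta>) * real n + \<bar>c\<bar>"
    have r: "?r \<ge> 0" using assms(7) \<eta>(1) by simp
    have "NB w (int (nat \<lfloor>?r\<rfloor>)) (tmul (tinv (X n)) (Y n))" for w
    proof -
      obtain m where m: "NB w m (tmul (tinv (X n)) (Y n))" "real_of_int m \<le> (s + \<eta>) * real n + c" using elim(1) by blast
      have "m \<le> int (nat \<lfloor>?r\<rfloor>)" using m(2) r by linarith
      thus ?thesis by (rule NB_mono[OF m(1)])
    qed
    hence "word_length Gam S (proj (tmul (tinv (X n)) (Y n))) \<le> B * (nat \<lfloor>?r\<rfloor> + 1)"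
      by (intro length_upper inG_tmul inG_tinv assms(1,2))
    hence "real (word_length Gam S (proj (tmul (tinv (X n)) (Y n)))) \<le> real (B * (nat \<lfloor>?r\<rfloor> + 1))" by (simp only: of_nat_le_iff)
    also have "\<dots> \<le> real B * (?r + 1)"
    proof -
      have "real (nat \<lfloor>?r\<rfloor> + 1) \<le> ?r + 1" using r by linarith
      thus ?thesis unfolding of_nat_mult by (intro mult_left_mono) auto
    qed
    also have "\<dots> = (real B * s) * real n + (real B * \<eta>) * real n + real B * (\<bar>c\<bar> + 1)" by (simp add: algebra_simps)
    also have "\<dots> \<le> (real B * s + e) * real n"
      using elim(2) \<open>e > 0\<close> unfolding \<eta>(2) by (simp add: field_simps)
    finally show ?case using elim(3) assms(1,2,5,6) by (simp add: dist_proj)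
  qed
qed

text \<open>One element of the ring-valued unipotent group that approximates the triple \<open>u\<close> at
  all places at once, up to errors that the torus element $v$ makes integral.\<close>

definition rep :: "(place \<Rightarrow> (nat \<Rightarrow> 'k poly fract) ut) \<Rightarrow> flat \<Rightarrow> nat \<Rightarrow> 'k poly fract ut" where
  "rep u v n = (SOME g. inRR g \<and> (\<forall>w. ubd w 0 (untwist n v (- g + ev n (u w)))))"

definition rept where "rept u v n = (rep u v n, TA n v, TB n v)"

definition seq where "seq u v = restrict (\<lambda>n. proj (rept u v n)) {0<..}"

definition pt where "pt u v = cls (seq u v)"

lemma Uhat_iff: "u \<in> TP.Uhat \<longleftrightarrow> (\<forall>w. u12 (u w) \<in> ring_filtration.A (cone_Lam \<omega> w) \<and> u13 (u w) \<in> ring_filtration.A (cone_Lam \<omega> w)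
    \<and> u14 (u w) \<in> ring_filtration.A (cone_Lam \<omega> w) \<and> u23 (u w) \<in> ring_filtration.A (cone_Lam \<omega> w)
    \<and> u24 (u w) \<in> ring_filtration.A (cone_Lam \<omega> w) \<and> u34 (u w) \<in> ring_filtration.A (cone_Lam \<omega> w))"
  unfolding TP.Uhat_def TP.UAw_def ring_filtration.UA_def[OF cone_Lam_filtration[OF ultra]] by simp

lemma A_iff: "x \<in> ring_filtration.A (cone_Lam \<omega> w) \<longleftrightarrow> (\<forall>n. x n \<in> RR) \<and> (\<exists>K::nat. \<forall>n>0. x n \<in> BB w (int (K * n)))"
proof
  assume "x \<in> ring_filtration.A (cone_Lam \<omega> w)"
  thus "(\<forall>n. x n \<in> RR) \<and> (\<exists>K::nat. \<forall>n>0. x n \<in> BB w (int (K * n)))"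
    unfolding ring_filtration.A_def[OF cone_Lam_filtration[OF ultra]] by (auto simp: cone_Lam_def)
next
  assume h: "(\<forall>n. x n \<in> RR) \<and> (\<exists>K::nat. \<forall>n>0. x n \<in> BB w (int (K * n)))"
  then obtain K :: nat where K: "\<forall>n>0. x n \<in> BB w (int (K * n))" by blast
  have "growth \<omega> w (real K) x"
    by (rule growth_pointwise[OF ultra, of _ _ _ 0], rule exI, rule conjI, rule K[rule_format]) simp_all
  hence "x \<in> cone_Lam \<omega> w (real K)" using h by (simp add: cone_Lam_def)
  thus "x \<in> ring_filtration.A (cone_Lam \<omega> w)" unfolding ring_filtration.A_def[OF cone_Lam_filtration[OF ultra]] by blast
qed

lemma Uhat_inRR: "u \<in> TP.Uhat \<Longrightarrow> inRR (ev n (u w))"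
  by (simp add: Uhat_iff A_iff inRR_def)

lemma place_all: "(\<forall>w. P w) \<longleftrightarrow> P Place0 \<and> P Place1 \<and> P PlaceInf"
  by (metis place.exhaust)

lemma common_bound:
  fixes P :: "place \<Rightarrow> int \<Rightarrow> nat \<Rightarrow> bool"
  assumes "\<And>w. \<exists>K::nat. \<forall>n>0. P w (int (K * n)) n" "\<And>w a b n. P w a n \<Longrightarrow> a \<le> b \<Longrightarrow> P w b n"
  shows "\<exists>K::nat. \<forall>n>0. \<forall>w. P w (int (K * n)) n"
proof -
  obtain K :: "place \<Rightarrow> nat" where K: "\<And>w n. n > 0 \<Longrightarrow> P w (int (K w * n)) n" using assms(1) by metis
  let ?K = "K Place0 + K Place1 + K PlaceInf"
  have "K w \<le> ?K" for w by (cases w) auto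
  hence le: "int (K w * n) \<le> int (?K * n)" for w n unfolding of_nat_le_iff by (rule mult_right_mono) simp
  show ?thesis by (intro exI[of _ ?K] allI impI, rule assms(2)[OF K le])
qed

lemma ubd_I6:
  assumes "\<exists>K::nat. \<forall>n>0. u12 (U n) \<in> BB w (int (K * n))" "\<exists>K::nat. \<forall>n>0. u13 (U n) \<in> BB w (int (K * n))"
    "\<exists>K::nat. \<forall>n>0. u14 (U n) \<in> BB w (int (K * n))" "\<exists>K::nat. \<forall>n>0. u23 (U n) \<in> BB w (int (K * n))"
    "\<exists>K::nat. \<forall>n>0. u24 (U n) \<in> BB w (int (K * n))" "\<exists>K::nat. \<forall>n>0. u34 (U n) \<in> BB w (int (K * n))"
  shows "\<exists>K::nat. \<forall>n>0. ubd w (int (K * n)) (U n)"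
proof -
  obtain a :: nat where ha: "\<forall>n>0. u12 (U n) \<in> BB w (int (a * n))" using assms(1) ..
  obtain b :: nat where hb: "\<forall>n>0. u13 (U n) \<in> BB w (int (b * n))" using assms(2) ..
  obtain c :: nat where hc: "\<forall>n>0. u14 (U n) \<in> BB w (int (c * n))" using assms(3) ..
  obtain d :: nat where hd: "\<forall>n>0. u23 (U n) \<in> BB w (int (d * n))" using assms(4) ..
  obtain e :: nat where he: "\<forall>n>0. u24 (U n) \<in> BB w (int (e * n))" using assms(5) ..
  obtain f :: nat where hf: "\<forall>n>0. u34 (U n) \<in> BB w (int (f * n))" using assms(6) ..
  let ?K = "a + b + c + d + e + f"
  have l: "int (k * n) \<le> int (?K * n)" if "k \<le> ?K" for k n
    using that unfolding of_nat_le_iff by (rule mult_right_mono) simp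
  have "ubd w (int (?K * n)) (U n)" if "n > 0" for n
    unfolding ubd_def
    using BB_mono[OF l[of a] ha[rule_format, OF that]] BB_mono[OF l[of b] hb[rule_format, OF that]]
      BB_mono[OF l[of c] hc[rule_format, OF that]] BB_mono[OF l[of d] hd[rule_format, OF that]]
      BB_mono[OF l[of e] he[rule_format, OF that]] BB_mono[OF l[of f] hf[rule_format, OF that]]
    by (simp del: of_nat_mult of_nat_add)
  thus ?thesis by blast
qed

lemma Uhat_bounded:
  assumes "u \<in> TP.Uhat" shows "\<exists>K::nat. \<forall>n>0. \<forall>w. ubd w (int (K * n)) (ev n (u w))"
proof (rule common_bound)
  show "\<exists>K::nat. \<forall>n>0. ubd w (int (K * n)) (ev n (u w))" for w
    using assms by (intro ubd_I6) (simp_all add: Uhat_iff A_iff)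
qed (rule ubd_mono)

lemma UhatI:
  assumes "\<And>n w. inRR (ev n (u w))" "\<And>n w. n > 0 \<Longrightarrow> ubd w (int (K * n)) (ev n (u w))"
  shows "u \<in> TP.Uhat"
  using assms unfolding Uhat_iff A_iff inRR_def ubd_def ev_sel by blast

lemma rep: assumes "u \<in> TP.Uhat"
  shows "inRR (rep u v n)" "ubd w 0 (untwist n v (- rep u v n + ev n (u w)))"
  using someI_ex[OF approximate_twisted[of "\<lambda>w. ev n (u w)", OF Uhat_inRR[OF assms] unitRR_T, of n v n v]]
  unfolding rep_def by blast+

lemma rept_inG: "u \<in> TP.Uhat \<Longrightarrow> inG (rept u v n)"
  by (simp add: rept_def rep unitRR_T)

lemma T_bounded: "\<exists>K::nat. \<forall>n>0. \<forall>w. tbd w (int (K * n)) (TA n v :: 'k poly fract) (TB n v)"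
proof -
  define K where "K = nat \<lceil>norm v\<rceil> + 1"
  have b: "\<bar>\<lfloor>real n * a\<rfloor>\<bar> \<le> int (K * n)" if "n > 0" "\<bar>a\<bar> \<le> norm v" for n a
  proof -
    have "\<bar>a\<bar> + 1 \<le> real K" unfolding K_def using that(2) by linarith
    hence "(\<bar>a\<bar> + 1) * real n \<le> real K * real n" by (intro mult_right_mono) auto
    moreover have "\<bar>real n * a\<bar> = \<bar>a\<bar> * real n" by (simp add: abs_mult)
    moreover have "real n \<ge> 1" using that by simp
    ultimately have "\<bar>real n * a\<bar> + 1 \<le> real (K * n)" by (simp add: distrib_right)
    thus ?thesis by linarith
  qed
  have "tbd w (int (2 * K * n)) (TA n v :: 'k poly fract) (TB n v)" if "n > 0" for n w
    using mono_ts_tbd[OF b[OF that flat_norm(1)] b[OF that flat_norm(2)] b[OF that flat_norm(3)] b[OF that flat_norm(4)]]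
    unfolding TA_def TB_def by (simp add: mult.assoc)
  thus ?thesis by blast
qed

lemma rept_bounded:
  assumes "u \<in> TP.Uhat" shows "\<exists>K::nat. \<forall>n>0. \<forall>w. NB w (int (K * n)) (rept u v n)"
proof -
  obtain K where K: "\<And>n w. n > 0 \<Longrightarrow> ubd w (int (K * n)) (ev n (u w))" using Uhat_bounded[OF assms] by blast
  obtain L where L: "\<And>n w. n > 0 \<Longrightarrow> tbd w (int (L * n)) (TA n v :: 'k poly fract) (TB n v)" using T_bounded by blast
  have "NB w (int ((K + 6 * L) * n)) (rept u v n)" if n: "n > 0" for n w
  proof -
    let ?a = "untwist n v (- rep u v n + ev n (u w))"
    have "act (TA n v) (TB n v) ?a = - rep u v n + ev n (u w)" by (simp add: act_act)
    hence g: "rep u v n = ev n (u w) + - act (TA n v) (TB n v) ?a" by (simp add: minus_add)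
    have "ubd w (3 * (2 * int (L * n))) (- act (TA n v) (TB n v) ?a)"
      using ubd_neg[OF ubd_act[OF rep(2)[OF assms] L[OF n]]] by simp
    hence "ubd w (int (K * n) + 3 * (2 * int (L * n))) (rep u v n)"
      by (subst g) (rule ubd_add[OF K[OF n]], simp_all)
    moreover have "tbd w (int (K * n) + 3 * (2 * int (L * n))) (TA n v :: 'k poly fract) (TB n v)"
      by (rule tbd_mono[OF L[OF n]]) simp
    ultimately show ?thesis unfolding rept_def NB_iff by (simp add: algebra_simps)
  qed
  thus ?thesis by blast
qed

lemma in_PC:
  assumes "\<And>n. inG (X n)" "\<And>n w. n > 0 \<Longrightarrow> NB w (int (K * n)) (X n)"
  shows "restrict (\<lambda>n. proj (X n)) {0<..} \<in> PC"
proof (rule preconeI[of _ "B * (K + 1)"])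
  show "proj (X n) \<in> carrier Gam" for n using assms(1) proj_carrier by blast
  fix n :: nat assume n: "n > 0"
  have "word_length Gam S (proj (X n)) \<le> B * (K * n + 1)" by (rule length_upper[OF assms(1) assms(2)[OF n]])
  also have "\<dots> \<le> B * (K + 1) * n" using n by (cases n) (auto simp: algebra_simps)
  finally have l: "real (word_length Gam S (proj (X n))) \<le> real (B * (K + 1) * n)" by (simp only: of_nat_le_iff)
  have "word_dist Gam S (proj (X n)) \<one>\<^bsub>Gam\<^esub> = word_dist Gam S (proj tone) (proj (X n))"
    unfolding proj_one by (rule commute)
  also have "\<dots> = real (word_length Gam S (proj (tmul (tinv tone) (X n))))" by (rule dist_proj[OF inG_tone assms(1)])
  also have "tinv tone = (tone :: 'k poly fract tri)" using zt_tinv[of 0] zt_zero by simp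
  finally show "word_dist Gam S (proj (X n)) \<one>\<^bsub>Gam\<^esub> \<le> real (B * (K + 1) * n)" using l by simp
qed

lemma seq_PC: "u \<in> TP.Uhat \<Longrightarrow> seq u v \<in> PC"
  unfolding seq_def using rept_bounded[of u v] in_PC[of "rept u v"] rept_inG[of u v] by blast

lemma seq_at: "n > 0 \<Longrightarrow> seq u v n = proj (rept u v n)" by (simp add: seq_def)

lemma pt_in_cone: "u \<in> TP.Uhat \<Longrightarrow> pt u v \<in> Cone"
  unfolding pt_def by (rule cls_in[OF seq_PC])

lemma rept_difference:
  "tmul (tinv (rept u v n)) (rept u' v' n) =
     (untwist n v (- rep u v n + rep u' v' n), inverse (TA n v) * TA n v', inverse (TB n v) * TB n v')"
  unfolding rept_def by (simp add: act_add)

lemma rept_telescope: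
  "untwist n v (- rep u v n + rep u' v' n) =
     untwist n v (- rep u v n + ev n (u w))
     + untwist n v (- ev n (u w) + ev n (u' w))
     + act (inverse (TA n v) * TA n v') (inverse (TB n v) * TB n v')
       (- untwist n v' (- rep u' v' n + ev n (u' w)))"
  by (rule act_telescope) simp_all

lemma Uv_ut_growth:
  assumes "k \<in> TP.Uv v r" shows "ut_growth \<omega> w r (\<lambda>n. untwist n v (ev n (k w)))"
  using assms unfolding TP.Uv_def TP.Ubw_def ring_filtration.Ub_def[OF cone_Lam_filtration[OF ultra]] ut_growth_twisted_iff[OF ultra]
  by (simp add: cone_Lam_def)

lemma ut_growth_Uv:
  assumes "k \<in> TP.Uhat" "\<And>w. ut_growth \<omega> w r (\<lambda>n. untwist n v (ev n (k w)))"
  shows "k \<in> TP.Uv v r"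
  using assms(1) assms(2)[unfolded ut_growth_twisted_iff[OF ultra]]
  unfolding TP.Uv_def TP.Ubw_def ring_filtration.Ub_def[OF cone_Lam_filtration[OF ultra]] Uhat_iff A_iff
  by (simp add: cone_Lam_def)

text \<open>The difference of representatives is bounded by that of \<open>u\<close> and \<open>u +
  k\<close> at $v$, and the quotient of the two torus elements by the displacement in the flat.\<close>

lemma pt_distance:
  assumes u: "u \<in> TP.Uhat" and k: "k \<in> TP.Uv v r" and r: "0 \<le> r" "norm (v' - v) \<le> r"
  shows "cd (pt u v) (pt (u + k) v') \<le> real B * (5 * r)"
proof -
  have uk: "u + k \<in> TP.Uhat" using u k TP.Uhat_add TP.Uv_subset by blast
  have "od (seq u v) (seq (u + k) v') \<le> real B * (5 * r)"
  proof (rule od_le_bounds[where X = "rept u v" and Y = "rept (u + k) v'" and c = 8])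
    fix e :: real assume e: "e > 0"
    let ?a = "\<lambda>n w. untwist n v (ev n (k w))"
    let ?t = "\<lambda>n. 2 * (\<lceil>real n * r\<rceil> + 1)"
    have "eventually (\<lambda>n. \<exists>m. ubd w m (?a n w) \<and> real_of_int m \<le> (r + e) * real n) \<omega>" for w
      using Uv_ut_growth[OF k, of w] e unfolding ut_growth_def by blast
    hence "eventually (\<lambda>n. \<forall>w. \<exists>m. ubd w m (?a n w) \<and> real_of_int m \<le> (r + e) * real n) \<omega>"
      unfolding place_all eventually_conj_iff by blast
    thus "eventually (\<lambda>n. \<forall>w. \<exists>m. NB w m (tmul (tinv (rept u v n)) (rept (u + k) v' n)) \<and> real_of_int m \<le> (5 * r + e) * real n + 8) \<omega>"
    proof eventually_elim
      case (elim n)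
      show ?case
      proof
        fix w
        obtain m where m: "ubd w m (?a n w)" "real_of_int m \<le> (r + e) * real n" using elim by blast
        have m': "ubd w (max 0 m) (?a n w)" by (rule ubd_mono[OF m(1)]) simp
        have t: "tbd w (?t n) (inverse (TA n v) * TA n v') (inverse (TB n v) * TB n v' :: 'k poly fract)"
          by (rule T_ratio_tbd[OF r(2)])
        have t0: "0 \<le> ?t n" using r(1) ceiling_mono[of 0 "real n * r"] by simp
        have "- ev n (u w) + ev n ((u + k) w) = ev n (k w)" by (simp add: ev_add)
        hence eq: "untwist n v (- rep u v n + rep (u + k) v' n) =
           untwist n v (- rep u v n + ev n (u w)) + ?a n w
           + act (inverse (TA n v) * TA n v') (inverse (TB n v) * TB n v')
             (- untwist n v' (- rep (u + k) v' n + ev n ((u + k) w)))"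
          using rept_telescope[of n v u "u + k" v' w] by simp
        have "ubd w (0 + max 0 m + (3 * 0 + 2 * ?t n)) (untwist n v (- rep u v n + rep (u + k) v' n))"
          unfolding eq by (intro ubd_add ubd_act ubd_neg rep(2) u uk m' t) (use t0 in simp_all)
        hence "NB w (max 0 m + 2 * ?t n) (tmul (tinv (rept u v n)) (rept (u + k) v' n))"
          unfolding rept_difference NB_iff using tbd_mono[OF t] t0 by (simp del: tmul.simps)
        moreover have "real_of_int (max 0 m + 2 * ?t n) \<le> (5 * r + e) * real n + 8"
        proof -
          have "0 \<le> (r + e) * real n" using r(1) e by simp
          hence "real_of_int (max 0 m) \<le> (r + e) * real n" using m(2) by simp
          moreover have "real_of_int \<lceil>real n * r\<rceil> \<le> real n * r + 1" by linarith
          ultimately show ?thesis by (simp add: algebra_simps)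
        qed
        ultimately show "\<exists>m. NB w m (tmul (tinv (rept u v n)) (rept (u + k) v' n)) \<and> real_of_int m \<le> (5 * r + e) * real n + 8" by blast
      qed
    qed
  qed (use u uk r in \<open>auto intro: rept_inG seq_PC simp: seq_at\<close>)
  thus ?thesis unfolding pt_def by (simp add: cone_dist_cls seq_PC u uk)
qed

lemma E14_commute: "E14 z + u = u + E14 (z :: 'k poly fract)"
  by (rule ut_eqI) (simp_all add: add.commute)

text \<open>Sequences in the central subgroup of at most linear degree.\<close>

definition ZZ :: "(nat \<Rightarrow> 'k poly fract) set" where
  "ZZ = {z. (\<forall>n. \<exists>f\<in>ZP. z n = to_fract f) \<and> central_elt z \<in> TP.Uhat}"

lemma proj_zt: "inG x \<Longrightarrow> f \<in> ZP \<Longrightarrow> proj (tmul x (zt f)) = proj x"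
  using proj_eq_iff[of x "tmul x (zt f)"] inG_tmul[OF _ zt_inG] by blast

lemma pt_translate:
  assumes u: "u \<in> TP.Uhat" and z: "z \<in> ZZ" shows "pt (u + central_elt z) v = pt u v"
proof -
  let ?u = "u + central_elt z"
  have u': "?u \<in> TP.Uhat" using u z TP.Uhat_add by (auto simp: ZZ_def)
  have "\<exists>f. \<forall>n. f n \<in> ZP \<and> z n = to_fract (f n)" using z unfolding ZZ_def by (intro choice) blast
  then obtain f where f: "\<And>n. f n \<in> ZP" "\<And>n. z n = to_fract (f n)" by blast
  define Y where "Y n = tmul (rept ?u v n) (zt (- f n))" for n
  have Y: "inG (Y n)" "proj (Y n) = proj (rept ?u v n)" for n
    unfolding Y_def using rept_inG[OF u'] f(1) by (simp_all add: inG_tmul zt_inG proj_zt ZP_neg del: tmul.simps)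
  have "od (seq u v) (seq ?u v) \<le> real B * 0"
  proof (rule od_le_bounds[where X = "rept u v" and Y = Y and c = 0])
    fix e :: real assume e: "e > 0"
    have "NB w 0 (tmul (tinv (rept u v n)) (Y n))" for n w
    proof -
      let ?a = "untwist n v (- rep u v n + ev n (u w))"
      let ?a' = "untwist n v (- rep ?u v n + ev n (?u w))"
      have "- ev n (u w) + ev n (?u w) = E14 (z n)" by (simp add: ev_add ev_central)
      hence "untwist n v (- rep u v n + rep ?u v n) = ?a + E14 (z n) + - ?a'"
        using rept_telescope[of n v u ?u v w] by simp
      hence "untwist n v (- rep u v n + rep ?u v n) + E14 (- z n) = ?a + (E14 (z n) + (- ?a' + E14 (- z n)))"
        by (simp only: add.assoc)
      also have "\<dots> = ?a + - ?a'"
        unfolding E14_commute[of "- z n", symmetric] by (simp add: add.assoc[symmetric] plus_ut_def zero_ut_def)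
      finally have eq: "untwist n v (- rep u v n + rep ?u v n) + E14 (- z n) = ?a + - ?a'" .
      have "ubd w (0 + 3 * 0) (?a + - ?a')"
        by (intro ubd_add ubd_neg rep(2) u u') simp_all
      moreover have "tmul (tinv (rept u v n)) (Y n) = (?a + - ?a', 1, 1)"
        unfolding Y_def tmul_assoc[OF inG_tinv[OF rept_inG[OF u]] rept_inG[OF u'], symmetric] rept_difference
        by (simp add: zt_mul f(2)[symmetric] eq)
      ultimately show ?thesis by (simp only: NB_iff) (simp add: tbd_def BB_one)
    qed
    hence "\<exists>m. NB w m (tmul (tinv (rept u v n)) (Y n)) \<and> real_of_int m \<le> (0 + e) * real n + 0" for n w
      using e by (intro exI[of _ 0]) simp
    thus "eventually (\<lambda>n. \<forall>w. \<exists>m. NB w m (tmul (tinv (rept u v n)) (Y n)) \<and> real_of_int m \<le> (0 + e) * real n + 0) \<omega>"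
      by (intro always_eventually allI)
  qed (use u u' Y in \<open>auto intro: rept_inG seq_PC simp: seq_at\<close>)
  hence "od (seq u v) (seq ?u v) = 0" using od_nonneg[OF seq_PC[OF u] seq_PC[OF u'], of v v] by simp
  thus ?thesis unfolding pt_def using cls_eq[OF seq_PC[OF u] seq_PC[OF u']] by simp
qed

lemma seq_dist: "u \<in> TP.Uhat \<Longrightarrow> u' \<in> TP.Uhat \<Longrightarrow> n > 0 \<Longrightarrow>
    word_dist Gam S (seq u v n) (seq u' v' n) = real (word_length Gam S (proj (tmul (tinv (rept u v n)) (rept u' v' n))))"
  by (simp add: seq_at dist_proj rept_inG)

text \<open>A short word for the difference gives, by the lower estimate, a preimage with small pole orders;
  the central sequence is the correction needed for that.\<close>

lemma pt_lifting:
  assumes u: "u \<in> TP.Uhat" and u': "u' \<in> TP.Uhat" and r: "cd (pt u v) (pt u' v') < r"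
  shows "\<exists>z\<in>ZZ. - u + (u' + central_elt z) \<in> TP.Uv v (real (5 * B) * r) \<and> norm (v' - v) \<le> real (5 * B) * r"
proof -
  have od: "od (seq u v) (seq u' v') < r" using r unfolding pt_def by (simp add: cone_dist_cls seq_PC u u')
  hence r0: "r > 0" using od_nonneg[OF seq_PC[OF u] seq_PC[OF u'], of v v'] by simp
  let ?D = "\<lambda>n. tmul (tinv (rept u v n)) (rept u' v' n)"
  define l where "l n = word_length Gam S (proj (?D n))" for n
  have D: "inG (?D n)" for n by (intro inG_tmul inG_tinv rept_inG u u')
  have l_small: "eventually (\<lambda>n. real (l n) < r * real n) \<omega>"
    using od_less_D[OF seq_PC[OF u] seq_PC[OF u'] od] omega_pos
    by eventually_elim (simp add: seq_dist u u' l_def)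
  have "\<exists>f. \<forall>n. f n \<in> ZP \<and> (\<forall>w. NB w (int (B * l n)) (tmul (?D n) (zt (f n))))"
  proof (intro choice allI)
    fix n
    show "\<exists>f. f \<in> ZP \<and> (\<forall>w. NB w (int (B * l n)) (tmul (?D n) (zt f)))"
      using length_lower[OF D, of n "l n"] unfolding l_def by blast
  qed
  then obtain f where f: "\<And>n. f n \<in> ZP" "\<And>n w. NB w (int (B * l n)) (tmul (?D n) (zt (f n)))" by blast
  obtain K where K: "\<And>n. n > 0 \<Longrightarrow> l n \<le> K * n"
  proof -
    obtain K1 where K1: "\<forall>n>0. word_dist Gam S (seq u v n) \<one>\<^bsub>Gam\<^esub> \<le> real (K1 * n)" using precone_bounded[OF seq_PC[OF u]] ..
    obtain K2 where K2: "\<forall>n>0. word_dist Gam S (seq u' v' n) \<one>\<^bsub>Gam\<^esub> \<le> real (K2 * n)" using precone_bounded[OF seq_PC[OF u']] ..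
    have "l n \<le> (K1 + K2) * n" if n: "n > 0" for n
    proof -
      have "word_dist Gam S (seq u v n) (seq u' v' n) \<le> word_dist Gam S (seq u v n) \<one>\<^bsub>Gam\<^esub> + word_dist Gam S \<one>\<^bsub>Gam\<^esub> (seq u' v' n)"
        by (rule triangle) (use n base precone_mem seq_PC u u' in auto)
      also have "\<dots> \<le> real (K1 * n) + real (K2 * n)"
        using K1 K2 n commute[of "\<one>\<^bsub>Gam\<^esub>" "seq u' v' n"] by (intro add_mono) simp_all
      finally have "real (l n) \<le> real ((K1 + K2) * n)" unfolding seq_dist[OF u u' n] l_def by (simp add: distrib_right)
      thus ?thesis by (simp only: of_nat_le_iff)
    qed
    thus ?thesis using that by blast
  qed
  define z where "z n = to_fract (f n)" for n
  define k where "k = - u + (u' + central_elt z)"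
  have ratio: "tbd w (int (B * l n)) (inverse (TA n v) * TA n v' :: 'k poly fract) (inverse (TB n v) * TB n v')" for n w
    using f(2)[of w n] unfolding rept_difference zt_mul NB_iff by blast
  have twisted: "ubd w (3 * int (B * l n)) (untwist n v (ev n (k w)))" for n w
  proof -
    let ?A = "untwist n v"
    let ?a = "?A (- rep u v n + ev n (u w))" and ?X = "?A (- rep u v n + rep u' v' n)"
      and ?\<kappa> = "?A (- ev n (u w) + ev n (u' w))"
    let ?t = "act (inverse (TA n v) * TA n v') (inverse (TB n v) * TB n v') (- untwist n v' (- rep u' v' n + ev n (u' w)))"
    have ntz: "(inverse (TA n v) * TA n v' :: 'k poly fract) \<noteq> 0" "(inverse (TB n v) * TB n v' :: 'k poly fract) \<noteq> 0" by simp_all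
    have "?X = ?a + ?\<kappa> + ?t" by (rule rept_telescope)
    hence "?\<kappa> = - ?a + ?X + - ?t" by (simp add: add.assoc)
    hence "?\<kappa> + E14 (z n) = - ?a + (?X + E14 (z n)) + - ?t"
      by (simp only: add.assoc E14_commute)
    moreover have "ev n (k w) = (- ev n (u w) + ev n (u' w)) + E14 (z n)" by (simp add: k_def ev_add ev_neg ev_central add.assoc)
    hence "?A (ev n (k w)) = ?\<kappa> + E14 (z n)" by (simp add: act_add)
    moreover have "- ?t = act (inverse (TA n v) * TA n v') (inverse (TB n v) * TB n v') (untwist n v' (- rep u' v' n + ev n (u' w)))"
      unfolding act_uminus[OF ntz] by simp
    moreover have "ubd w (int (B * l n)) (?X + E14 (z n))"
      using f(2)[of w n] unfolding rept_difference zt_mul NB_iff z_def by blast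
    ultimately have eq: "?A (ev n (k w)) = - ?a + (?X + E14 (z n)) + act (inverse (TA n v) * TA n v') (inverse (TB n v) * TB n v') (untwist n v' (- rep u' v' n + ev n (u' w)))"
      and X: "ubd w (int (B * l n)) (?X + E14 (z n))" by simp_all
    have "ubd w (3 * 0 + int (B * l n) + (0 + 2 * int (B * l n))) (?A (ev n (k w)))"
      unfolding eq by (intro ubd_add ubd_neg ubd_act ratio X rep(2) u u') simp_all
    thus ?thesis by simp
  qed
  have kU: "k \<in> TP.Uhat"
  proof -
    obtain L where L: "\<And>n w. n > 0 \<Longrightarrow> tbd w (int (L * n)) (TA n v :: 'k poly fract) (TB n v)" using T_bounded by blast
    show ?thesis
    proof (rule UhatI[where K = "3 * B * K + 2 * L"])
      show "inRR (ev n (k w))" for n w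
      proof -
        have "inRR (E14 (z n))" by (simp add: inRR_def z_def RR_poly RR_zero)
        hence "inRR (- ev n (u w) + (ev n (u' w) + E14 (z n)))"
          by (intro inRR_add inRR_uminus Uhat_inRR u u')
        thus ?thesis by (simp add: k_def ev_add ev_neg ev_central)
      qed
      fix n w assume n: "n > (0::nat)"
      have "ubd w (3 * int (B * l n) + 2 * int (L * n)) (act (TA n v) (TB n v) (untwist n v (ev n (k w))))"
        by (rule ubd_act[OF twisted L[OF n]]) simp
      moreover have "3 * int (B * l n) + 2 * int (L * n) \<le> int ((3 * B * K + 2 * L) * n)"
      proof -
        have "B * l n \<le> B * (K * n)" using K[OF n] by (rule mult_left_mono) simp
        hence "3 * (B * l n) + 2 * (L * n) \<le> (3 * B * K + 2 * L) * n"
          by (simp only: distrib_right mult.assoc)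
        hence "int (3 * (B * l n) + 2 * (L * n)) \<le> int ((3 * B * K + 2 * L) * n)" by (simp only: of_nat_le_iff)
        thus ?thesis by simp
      qed
      ultimately show "ubd w (int ((3 * B * K + 2 * L) * n)) (ev n (k w))"
        by (simp add: act_act ubd_mono del: of_nat_mult of_nat_add)
    qed
  qed
  have "ut_growth \<omega> w (real (5 * B) * r) (\<lambda>n. untwist n v (ev n (k w)))" for w
  proof (rule ut_growthI[OF ultra, of _ _ _ 0])
    fix e :: real assume e: "e > 0"
    show "eventually (\<lambda>n. \<exists>m. ubd w m (untwist n v (ev n (k w))) \<and> real_of_int m \<le> (real (5 * B) * r + e) * real n + 0) \<omega>"
      using l_small
    proof eventually_elim
      case (elim n)
      have "3 * (real B * real (l n)) \<le> 5 * (real B * (r * real n))" using elim by (intro mult_mono) auto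
      also have "\<dots> \<le> (real (5 * B) * r + e) * real n" using e by (simp add: algebra_simps)
      finally show ?case using twisted by (intro exI[of _ "3 * int (B * l n)"]) simp
    qed
  qed
  hence "k \<in> TP.Uv v (real (5 * B) * r)" by (rule ut_growth_Uv[OF kU])
  moreover have "z \<in> ZZ"
  proof -
    have "central_elt z = - u' + (u + k)" by (simp add: k_def add.assoc[symmetric])
    hence "central_elt z \<in> TP.Uhat" using TP.Uhat_add TP.Uhat_neg u u' kU by simp
    thus ?thesis using f(1) by (auto simp: ZZ_def z_def)
  qed
  moreover have "norm (v' - v) \<le> real (5 * B) * r"
  proof -
    have "eventually (\<lambda>n. norm (v' - v) \<le> real (5 * B) * r) \<omega>"
      using l_small omega_large[of "4 / (real B * r)"] omega_pos
    proof eventually_elim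
      case (elim n)
      have "real n * norm (v' - v) \<le> 4 * (real_of_int (int (B * l n)) + 1)"
        by (rule T_ratio_exponents[OF ratio ratio])
      also have "\<dots> \<le> 4 * (real B * (r * real n)) + 4" using elim(1) by (simp add: mult_left_mono)
      finally have "real n * norm (v' - v) \<le> 4 * (real B * (r * real n)) + 4" .
      moreover have "4 \<le> real B * (r * real n)" using elim(2) r0 B_pos by (simp add: field_simps)
      ultimately have "real n * norm (v' - v) \<le> 5 * (real B * (r * real n))" by linarith
      hence "real n * norm (v' - v) \<le> real n * (real (5 * B) * r)" by (simp add: mult_ac)
      thus ?case using elim(3) by simp
    qed
    thus ?thesis using omega_nontrivial eventually_happens'[of \<omega>] by blast
  qed
  ultimately show ?thesis unfolding k_def by blast
qed

lemma cone_representatives: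
  assumes "x \<in> PC"
  obtains Y K where "\<And>n. inG (Y n)" "\<And>n. n > 0 \<Longrightarrow> x n = proj (Y n)" "\<And>n w. n > 0 \<Longrightarrow> NB w (int (K * n)) (Y n)"
proof -
  obtain K where K: "\<forall>n>0. word_dist Gam S (x n) \<one>\<^bsub>Gam\<^esub> \<le> real (K * n)" using precone_bounded[OF assms] ..
  have "\<exists>y. inG y \<and> (n > 0 \<longrightarrow> x n = proj y \<and> (\<forall>w. NB w (int (B * K * n)) y))" for n
  proof (cases "n > 0")
    case True
    then obtain y where y: "inG y" "x n = proj y" using Gam_E[OF precone_mem[OF assms True]] by blast
    have "word_dist Gam S \<one>\<^bsub>Gam\<^esub> (x n) \<le> real (K * n)" using K True commute[of "\<one>\<^bsub>Gam\<^esub>" "x n"] by simp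
    also have "word_dist Gam S \<one>\<^bsub>Gam\<^esub> (x n) = word_dist Gam S (proj tone) (proj y)" by (simp only: proj_one y(2))
    also have "\<dots> = real (word_length Gam S (proj (tmul (tinv tone) y)))" by (rule dist_proj[OF inG_tone y(1)])
    also have "tinv tone = (tone :: 'k poly fract tri)" using zt_tinv[of 0] zt_zero by simp
    finally have "word_length Gam S (proj y) \<le> K * n" unfolding tmul_tone of_nat_le_iff .
    then obtain f where f: "f \<in> ZP" "\<forall>w. NB w (int (B * (K * n))) (tmul y (zt f))" using length_lower[OF y(1)] by blast
    have "inG (tmul y (zt f))" "proj (tmul y (zt f)) = proj y" using y(1) f(1) by (simp_all add: inG_tmul zt_inG proj_zt del: tmul.simps)
    thus ?thesis using f(2) y(2) by (intro exI[of _ "tmul y (zt f)"]) (simp add: mult.assoc)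
  qed (use inG_tone in blast)
  then obtain Y where "\<forall>n. inG (Y n) \<and> (n > 0 \<longrightarrow> x n = proj (Y n) \<and> (\<forall>w. NB w (int (B * K * n)) (Y n)))" by metis
  thus ?thesis using that[of Y "B * K"] by blast
qed

text \<open>Exponents of linear growth converge after rescaling, along the ultrafilter.\<close>

lemma rescaled_limit:
  assumes "\<And>n. n > 0 \<Longrightarrow> \<bar>i n\<bar> \<le> int (K * n)"
  shows "\<exists>a. \<forall>e>0. eventually (\<lambda>n. \<bar>- i n + \<lfloor>real n * a\<rfloor>\<bar> \<le> \<lceil>e * real n\<rceil> + 1) \<omega>"
proof -
  have "eventually (\<lambda>n. \<bar>real_of_int (i n) / real n\<bar> \<le> real K) \<omega>"
    using omega_pos
  proof eventually_elim
    case (elim n)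
    have "real_of_int \<bar>i n\<bar> \<le> real_of_int (int (K * n))" using assms[OF elim] by (simp only: of_int_le_iff)
    thus ?case using elim by (simp add: field_simps)
  qed
  from ultrafilter_bounded_convergent[OF ultra this]
  obtain a where a: "((\<lambda>n. real_of_int (i n) / real n) \<longlongrightarrow> a) \<omega>" ..
  have "eventually (\<lambda>n. \<bar>- i n + \<lfloor>real n * a\<rfloor>\<bar> \<le> \<lceil>e * real n\<rceil> + 1) \<omega>" if "e > 0" for e
    using tendstoD[OF a that] omega_pos
  proof eventually_elim
    case (elim n)
    have "\<bar>real_of_int (i n) / real n - a\<bar> * real n \<le> e * real n"
      using elim by (intro mult_right_mono) (auto simp: dist_real_def)
    also have "\<bar>real_of_int (i n) / real n - a\<bar> * real n = \<bar>(real_of_int (i n) / real n - a) * real n\<bar>" by (simp add: abs_mult)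
    also have "(real_of_int (i n) / real n - a) * real n = real_of_int (i n) - real n * a" using elim(2) by (simp add: field_simps)
    finally show ?case by linarith
  qed
  thus ?thesis by blast
qed

text \<open>The unipotent parts of representatives give $u$, the same at each place, and the exponents of
  the diagonal parts give $v$ in the limit.\<close>

lemma pt_surjective:
  assumes "X \<in> Cone" shows "\<exists>u\<in>TP.Uhat. \<exists>v. X = pt u v"
proof -
  obtain x where x: "x \<in> PC" "X = cls x" using cone_E[OF assms] .
  obtain Y K where Y: "\<And>n. inG (Y n)" "\<And>n. n > 0 \<Longrightarrow> x n = proj (Y n)" "\<And>n w. n > 0 \<Longrightarrow> NB w (int (K * n)) (Y n)"
    using cone_representatives[OF x(1)] by metis
  define g P Q where "g n = fst (Y n)" and "P n = fst (snd (Y n))" and "Q n = snd (snd (Y n))" for n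
  have Yn: "Y n = (g n, P n, Q n)" for n by (simp add: g_def P_def Q_def)
  have G: "inRR (g n)" "unitRR (P n)" "unitRR (Q n)" for n using Y(1)[of n] by (simp_all add: Yn)
  have B: "ubd w (int (K * n)) (g n)" "tbd w (int (K * n)) (P n) (Q n)" if "n > 0" for n w
    using Y(3)[OF that, of w] unfolding Yn NB_iff by blast+
  have nz: "P n \<noteq> 0" "Q n \<noteq> 0" for n using G unfolding unitRR_def by blast+
  have form: "\<exists>a i j. a \<noteq> 0 \<and> R = cst a * mono_ts i j" if "unitRR R" for R :: "'k poly fract"
    using RR_unit_form[of R "inverse R"] that unfolding unitRR_def mono_ts_def by (auto simp: mult.assoc)
  obtain a i j where P: "\<And>n. a n \<noteq> 0" "\<And>n. P n = cst (a n) * mono_ts (i n) (j n)" using form[OF G(2)] by metis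
  obtain b k l where Q: "\<And>n. b n \<noteq> 0" "\<And>n. Q n = cst (b n) * mono_ts (k n) (l n)" using form[OF G(3)] by metis
  have exps: "\<bar>i n\<bar> \<le> int (K * n)" "\<bar>j n\<bar> \<le> int (K * n)" "\<bar>k n\<bar> \<le> int (K * n)" "\<bar>l n\<bar> \<le> int (K * n)" if "n > 0" for n
    using unit_exponents_bounded[of "P n" "a n" "i n" "j n" "int (K * n)"] unit_exponents_bounded[of "Q n" "b n" "k n" "l n" "int (K * n)"]
      P[of n] Q[of n] B(2)[OF that, of Place0] B(2)[OF that, of Place1]
    unfolding tbd_def mono_ts_def by (simp_all del: of_nat_mult add: mult.assoc)
  obtain va where va: "\<And>e. e > 0 \<Longrightarrow> eventually (\<lambda>n. \<bar>- i n + \<lfloor>real n * va\<rfloor>\<bar> \<le> \<lceil>e * real n\<rceil> + 1) \<omega>" using rescaled_limit[OF exps(1)] by blast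
  obtain vb where vb: "\<And>e. e > 0 \<Longrightarrow> eventually (\<lambda>n. \<bar>- j n + \<lfloor>real n * vb\<rfloor>\<bar> \<le> \<lceil>e * real n\<rceil> + 1) \<omega>" using rescaled_limit[OF exps(2)] by blast
  obtain vc where vc: "\<And>e. e > 0 \<Longrightarrow> eventually (\<lambda>n. \<bar>- k n + \<lfloor>real n * vc\<rfloor>\<bar> \<le> \<lceil>e * real n\<rceil> + 1) \<omega>" using rescaled_limit[OF exps(3)] by blast
  obtain vd where vd: "\<And>e. e > 0 \<Longrightarrow> eventually (\<lambda>n. \<bar>- l n + \<lfloor>real n * vd\<rfloor>\<bar> \<le> \<lceil>e * real n\<rceil> + 1) \<omega>" using rescaled_limit[OF exps(4)] by blast
  define v :: flat where "v = ((va, vb), (vc, vd))"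
  define u :: "place \<Rightarrow> (nat \<Rightarrow> 'k poly fract) ut" where
    "u = (\<lambda>w. UT (\<lambda>n. u12 (g n)) (\<lambda>n. u13 (g n)) (\<lambda>n. u14 (g n)) (\<lambda>n. u23 (g n)) (\<lambda>n. u24 (g n)) (\<lambda>n. u34 (g n)))"
  have evu: "ev n (u w) = g n" for n w by (rule ut_eqI) (simp_all add: u_def)
  have u: "u \<in> TP.Uhat" by (rule UhatI[of _ K]) (simp_all only: evu G B)
  have "od x (seq u v) \<le> real B * 0"
  proof (rule od_le_bounds[where X = Y and Y = "rept u v" and c = 12])
    fix e :: real assume e: "e > 0"
    hence e6: "e / 6 > 0" by simp
    show "eventually (\<lambda>n. \<forall>w. \<exists>m. NB w m (tmul (tinv (Y n)) (rept u v n)) \<and> real_of_int m \<le> (0 + e) * real n + 12) \<omega>"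
      using va[OF e6] vb[OF e6] vc[OF e6] vd[OF e6]
    proof eventually_elim
      case (elim n)
      let ?m = "2 * (\<lceil>e / 6 * real n\<rceil> + 1)"
      have m0: "0 \<le> ?m" using e ceiling_mono[of 0 "e / 6 * real n"] by simp
      have eqP: "inverse (P n) * TA n v = cst (inverse (a n)) * mono_ts (- i n + \<lfloor>real n * va\<rfloor>) (- j n + \<lfloor>real n * vb\<rfloor>)"
        and eqQ: "inverse (Q n) * TB n v = cst (inverse (b n)) * mono_ts (- k n + \<lfloor>real n * vc\<rfloor>) (- l n + \<lfloor>real n * vd\<rfloor>)"
        using P(1)[of n] Q(1)[of n]
        by (simp_all only: P(2) Q(2) inverse_mult_distrib mono_ts_simps(2) mono_ts_simps(3)[symmetric] TA_def TB_def v_def fst_conv snd_conv cst_inverse mult.assoc)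
      have t: "tbd w ?m (inverse (P n) * TA n v) (inverse (Q n) * TB n v)" for w
      proof -
        have "tbd w 0 (cst (inverse (a n))) (cst (inverse (b n)))"
          by (simp add: tbd_def cst_inverse BB_cst)
        from tbd_mult[OF this mono_ts_tbd[OF elim]] show ?thesis unfolding eqP eqQ by simp
      qed
      show ?case
      proof
        fix w
        let ?a = "untwist n v (- rep u v n + ev n (u w))"
        have "- g n + rep u v n = - (- rep u v n + ev n (u w))" by (simp add: evu minus_add)
        hence "act (inverse (P n)) (inverse (Q n)) (- g n + rep u v n) = act (inverse (P n) * TA n v) (inverse (Q n) * TB n v) (- ?a)"
          using nz by (simp add: act_uminus act_act mult.assoc)
        moreover have "ubd w (3 * 0 + 2 * ?m) (act (inverse (P n) * TA n v) (inverse (Q n) * TB n v) (- ?a))"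
          by (intro ubd_act ubd_neg rep(2) u t m0) simp
        moreover have "tbd w (3 * 0 + 2 * ?m) (inverse (P n) * TA n v) (inverse (Q n) * TB n v)"
          by (rule tbd_mono[OF t]) (use m0 in simp)
        ultimately have "NB w (2 * ?m) (tmul (tinv (Y n)) (rept u v n))"
          using nz[of n] by (simp add: Yn rept_def NB_iff act_add del: NB.simps)
        moreover have "real_of_int (2 * ?m) \<le> (0 + e) * real n + 12"
        proof -
          have "real_of_int \<lceil>e / 6 * real n\<rceil> \<le> e / 6 * real n + 1" by linarith
          moreover have "(0 + e) * real n = 6 * (e / 6 * real n)" by simp
          moreover have "0 \<le> e / 6 * real n" using e by simp
          moreover have "2 * (2 * (c + 1)) \<le> 6 * y + 12" if "c \<le> y + 1" "0 \<le> y" for c y :: real using that by simp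
          ultimately show ?thesis by (simp only: of_int_mult of_int_add of_int_numeral of_int_1)
        qed
        ultimately show "\<exists>m. NB w m (tmul (tinv (Y n)) (rept u v n)) \<and> real_of_int m \<le> (0 + e) * real n + 12" by blast
      qed
    qed
  qed (use u Y x(1) in \<open>auto intro: rept_inG seq_PC simp: seq_at\<close>)
  hence "od x (seq u v) = 0" using od_nonneg[OF x(1) seq_PC[OF u], of v] by simp
  hence "X = pt u v" unfolding x(2) pt_def by (rule cls_eq[OF x(1) seq_PC[OF u]])
  thus ?thesis using u by blast
qed

lemma ZZ_group:
  "0 \<in> ZZ" "y \<in> ZZ \<Longrightarrow> z \<in> ZZ \<Longrightarrow> y + z \<in> ZZ" "z \<in> ZZ \<Longrightarrow> - z \<in> ZZ"
proof -
  have "central_elt 0 = (0 :: place \<Rightarrow> (nat \<Rightarrow> 'k poly fract) ut)"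
    by (simp add: central_elt_def fun_eq_iff zero_ut_def)
  moreover have "\<exists>f\<in>ZP. (0 :: nat \<Rightarrow> 'k poly fract) n = to_fract f" for n
    by (intro bexI[of _ 0] ZP_zero) simp
  ultimately show "0 \<in> ZZ" using TP.Uhat_zero by (simp add: ZZ_def del: zero_fun_apply)
  show "y + z \<in> ZZ" if "y \<in> ZZ" "z \<in> ZZ"
  proof -
    have "\<exists>f\<in>ZP. (y + z) n = to_fract f" for n
    proof -
      have "\<exists>f\<in>ZP. y n = to_fract f" "\<exists>f\<in>ZP. z n = to_fract f" using that by (simp_all add: ZZ_def)
      then obtain f g where "f \<in> ZP" "y n = to_fract f" "g \<in> ZP" "z n = to_fract g" by blast
      thus ?thesis using ZP_add[of f g] by (intro bexI[of _ "f + g"]) simp_all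
    qed
    thus ?thesis using that TP.Uhat_add by (simp add: ZZ_def central_elt_add del: plus_fun_apply)
  qed
  show "- z \<in> ZZ" if "z \<in> ZZ"
  proof -
    have "\<exists>f\<in>ZP. (- z) n = to_fract f" for n
    proof -
      have "\<exists>f\<in>ZP. z n = to_fract f" using that by (simp add: ZZ_def)
      then obtain f where "f \<in> ZP" "z n = to_fract f" by blast
      thus ?thesis using ZP_neg[of f] by (intro bexI[of _ "- f"]) simp_all
    qed
    thus ?thesis using that TP.Uhat_neg by (simp add: ZZ_def central_elt_minus)
  qed
qed

sublocale CM: cone_model "cone_Lam \<omega> :: place \<Rightarrow> real \<Rightarrow> (nat \<Rightarrow> 'k poly fract) set" Cone cd pt ZZ "real (5 * B)"
proof -
  interpret MS: Metric_space Cone cd by (rule cone_metric)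
  show "cone_model (cone_Lam \<omega> :: place \<Rightarrow> real \<Rightarrow> (nat \<Rightarrow> 'k poly fract) set) Cone cd pt ZZ (real (5 * B))"
  proof
    show "real (5 * B) \<ge> 1" using B_pos by simp
    show "z \<in> ZZ \<Longrightarrow> central_elt z \<in> TP.Uhat" for z by (simp add: ZZ_def)
    show "cd (pt u v) (pt (u + k) v') \<le> real (5 * B) * r"
      if "u \<in> TP.Uhat" "0 \<le> r" "k \<in> TP.Uv v r" "norm (v' - v) \<le> r" for u r k v v'
      using pt_distance[OF that(1,3,2,4)] by (simp add: mult_ac)
  qed (fact pt_in_cone pt_surjective ZZ_group pt_translate pt_lifting)+
qed

end

section \<open>Sparse exponents and ultrafilters\<close>

lemma finite_chain_least:
  fixes X :: "'a::preorder set"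
  assumes "finite X" "X \<noteq> {}" "\<And>x y. x \<in> X \<Longrightarrow> y \<in> X \<Longrightarrow> x \<le> y \<or> y \<le> x"
  shows "\<exists>m\<in>X. \<forall>a\<in>X. m \<le> a"
  using assms
proof (induction X rule: finite_ne_induct)
  case (insert x X)
  hence "\<exists>m\<in>X. \<forall>a\<in>X. m \<le> a" by blast
  then obtain m where m: "m \<in> X" "\<forall>a\<in>X. m \<le> a" ..
  consider "x \<le> m" | "m \<le> x" using insert.prems m(1) by blast
  thus ?case
  proof cases
    case 1
    hence "\<forall>a\<in>insert x X. x \<le> a" using m(2) order_trans[OF 1] by blast
    thus ?thesis by blast
  next
    case 2 thus ?thesis using m by blast
  qed
qed simp

text \<open>A minimal proper filter below \<open>sequentially\<close>, by Zorn's lemma.\<close>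

lemma exists_ultrafilter:
  "\<exists>F :: nat filter. F \<noteq> bot \<and> F \<le> sequentially \<and> (\<forall>P. eventually P F \<or> eventually (\<lambda>n. \<not> P n) F)"
proof -
  let ?A = "{F :: nat filter. F \<noteq> bot \<and> F \<le> sequentially}"
  have "\<exists>m\<in>?A. \<forall>a\<in>?A. a \<le> m \<longrightarrow> a = m"
  proof (rule predicate_Zorn[where P = "\<lambda>x y. y \<le> x"])
    show "partial_order_on ?A (relation_of (\<lambda>x y. y \<le> x) ?A)"
      by (rule partial_order_on_relation_ofI) auto
  next
    fix C assume C: "C \<in> Chains (relation_of (\<lambda>x y. y \<le> x) ?A)"
    hence CA: "C \<subseteq> ?A" and ch: "\<And>x y. x \<in> C \<Longrightarrow> y \<in> C \<Longrightarrow> x \<le> y \<or> y \<le> x"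
      unfolding Chains_def relation_of_def by auto
    show "\<exists>u\<in>?A. \<forall>a\<in>C. u \<le> a"
    proof (cases "C = {}")
      case True
      have "sequentially \<in> ?A" by simp
      thus ?thesis using True by blast
    next
      case False
      have nonbot: "Inf X \<noteq> bot" if fin: "finite X" "X \<subseteq> C" for X
      proof -
        have "\<exists>m\<in>?A. m \<le> Inf X"
        proof (cases "X = {}")
          case True
          have "sequentially \<in> ?A" by simp
          thus ?thesis unfolding True Inf_empty using top_greatest by blast
        next
          case False
          have "\<exists>m\<in>X. \<forall>a\<in>X. m \<le> a" using fin(2) by (intro finite_chain_least[OF fin(1) False] ch) blast+
          then obtain m where m: "m \<in> X" "\<forall>a\<in>X. m \<le> a" ..
          thus ?thesis using CA fin(2) by (intro bexI[of _ m] Inf_greatest) blast+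
        qed
        then obtain m where "m \<noteq> bot" "m \<le> Inf X" by blast
        thus ?thesis by (metis bot_unique)
      qed
      have "Inf C \<noteq> bot" by (rule Inf_filter_not_bot) (rule nonbot)
      moreover have "Inf C \<le> sequentially"
      proof -
        obtain c where "c \<in> C" using False by blast
        hence "Inf C \<le> c" "c \<le> sequentially" using CA by (blast intro: Inf_lower)+
        thus ?thesis by (rule order_trans)
      qed
      ultimately have "Inf C \<in> ?A" by blast
      thus ?thesis by (rule bexI[rotated]) (intro ballI Inf_lower)
    qed
  qed
  then obtain F :: "nat filter" where "F \<in> ?A" "\<forall>a\<in>?A. a \<le> F \<longrightarrow> a = F" ..
  hence F: "F \<noteq> bot" "F \<le> sequentially" and max: "\<And>G. G \<noteq> bot \<Longrightarrow> G \<le> sequentially \<Longrightarrow> G \<le> F \<Longrightarrow> G = F"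
    by blast+
  have "eventually P F" if "\<not> eventually (\<lambda>n. \<not> P n) F" for P
  proof -
    let ?G = "inf F (principal {n. P n})"
    have 1: "?G \<noteq> bot" using that unfolding trivial_limit_def by (simp add: eventually_inf_principal)
    have "?G = F" by (rule max[OF 1 le_infI1[OF F(2)] inf_le1])
    moreover have "eventually P ?G" by (simp add: eventually_inf_principal)
    ultimately show ?thesis by simp
  qed
  thus ?thesis using F by blast
qed

definition base_ultrafilter :: "nat filter" where
  "base_ultrafilter = (SOME F. F \<noteq> bot \<and> F \<le> sequentially \<and> (\<forall>P. eventually P F \<or> eventually (\<lambda>n. \<not> P n) F))"

lemma base_ultrafilter:
  "base_ultrafilter \<noteq> bot" "base_ultrafilter \<le> sequentially"
  "eventually P base_ultrafilter \<or> eventually (\<lambda>n. \<not> P n) base_ultrafilter"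
  using someI_ex[OF exists_ultrafilter] unfolding base_ultrafilter_def by blast+

text \<open>Every value exceeds all exponents of lower level by a factor that tends to infinity, see
  \<open>scale_gap\<close>.\<close>

fun scale :: "nat \<Rightarrow> nat" where
  "scale 0 = 1"
| "scale (Suc j) = Suc j * fact (Suc (Suc j)) * scale j"

lemma scale_pos: "scale j > 0" by (induction j) auto

lemma scale_mono: "i \<le> j \<Longrightarrow> scale i \<le> scale j"
proof (induction j)
  case (Suc j)
  have "1 * 1 * scale j \<le> scale (Suc j)" unfolding scale.simps by (intro mult_mono fact_ge_1) auto
  hence "scale j \<le> scale (Suc j)" by (simp only: mult_1)
  thus ?case using Suc by (cases "i = Suc j") (auto simp del: scale.simps)
qed simp

lemma scale_gap: "i < j \<Longrightarrow> j * fact (i + 1) * scale i \<le> scale j"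
proof -
  assume "i < j"
  then obtain m where m: "j = Suc m" "i \<le> m" by (cases j) auto
  have "fact (i + 1) \<le> (fact (Suc (Suc m)) :: nat)" using m by (intro fact_mono) auto
  thus ?thesis unfolding m(1) scale.simps using scale_mono[OF m(2)] by (intro mult_mono) auto
qed

lemma scale_ge: "j \<le> scale j"
proof (cases j)
  case (Suc m)
  have "Suc m * 1 * 1 \<le> Suc m * fact (Suc (Suc m)) * scale m" using scale_pos[of m] by (intro mult_mono fact_ge_1) auto
  thus ?thesis using Suc by (simp del: fact_Suc)
qed simp

text \<open>Each finite set is the window of infinitely many levels.\<close>

definition window :: "nat \<Rightarrow> nat set" where "window j = set_decode (fst (prod_decode j))"

lemma window_bounded: "i \<in> window j \<Longrightarrow> i < j + 1"
proof -
  have "fst (prod_decode j) \<le> j" using le_prod_encode_1[of "fst (prod_decode j)" "snd (prod_decode j)"] by simp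
  moreover assume "i \<in> window j"
  hence "i < 2 ^ i \<and> 2 ^ i \<le> fst (prod_decode j)"
    unfolding window_def set_decode_def by (cases "2 ^ i \<le> fst (prod_decode j)") auto
  ultimately show ?thesis by linarith
qed

definition sparse_exponents :: "nat set" where
  "sparse_exponents = {scale j * fact (i + 1) | i j. i \<in> window j}"

definition sparse_polys :: "'k::field poly set" where
  "sparse_polys = {f. \<forall>d. coeff f d \<noteq> 0 \<longrightarrow> d \<in> sparse_exponents}"

text \<open>The second component makes the levels tend to infinity.\<close>

definition code :: "nat set \<Rightarrow> nat \<Rightarrow> nat" where
  "code A N = prod_encode (set_encode (A \<inter> {..<N}), N)"

lemma window_code: "window (code A N) = A \<inter> {..<N}"
  by (simp add: window_def code_def)

lemma code_ge: "N \<le> code A N"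
  unfolding code_def by (rule le_prod_encode_2)

text \<open>The ultrafilter sees only scales whose windows are initial parts of $A$.\<close>

definition omega :: "nat set \<Rightarrow> nat filter" where
  "omega A = filtermap (\<lambda>N. scale (code A N)) base_ultrafilter"

lemma eventually_omega: "eventually P (omega A) \<longleftrightarrow> eventually (\<lambda>N. P (scale (code A N))) base_ultrafilter"
  by (simp add: omega_def eventually_filtermap)

lemma omega_level: "eventually (\<lambda>n. \<exists>j\<ge>N. n = scale j \<and> window j \<subseteq> A \<and> (\<forall>i\<in>A. i < N \<longrightarrow> i \<in> window j)) (omega A)"
  unfolding eventually_omega
proof -
  have "eventually (\<lambda>M. N \<le> M) base_ultrafilter" using base_ultrafilter(2) eventually_ge_at_top filter_leD by blast
  thus "eventually (\<lambda>M. \<exists>j\<ge>N. scale (code A M) = scale j \<and> window j \<subseteq> A \<and> (\<forall>i\<in>A. i < N \<longrightarrow> i \<in> window j)) base_ultrafilter"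
  proof eventually_elim
    case (elim M)
    thus ?case using code_ge[of M A] by (intro exI[of _ "code A M"]) (auto simp: window_code)
  qed
qed

lemma omega_ultrafilter: "nonprincipal_ultrafilter_on {0<..} (omega A)"
proof -
  have large: "eventually (\<lambda>n. n > a) (omega A)" for a
    using omega_level[of "Suc a" A] by eventually_elim (use scale_ge in \<open>fastforce intro: le_trans simp: less_eq_Suc_le\<close>)
  have nb: "omega A \<noteq> bot" by (simp add: omega_def filtermap_bot_iff base_ultrafilter(1))
  have "omega A \<noteq> principal {a}" for a
  proof
    assume "omega A = principal {a}"
    thus False using large[of a] by (simp add: eventually_principal)
  qed
  thus ?thesis
    unfolding nonprincipal_ultrafilter_on_def
    using nb large[of 0] base_ultrafilter(3) by (auto simp: eventually_omega)
qed

text \<open>Up to a multiple of the scale, an exponent belongs to the level of that scale or is negligible.\<close>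

lemma sparse_gap:
  assumes "d \<in> sparse_exponents" "d \<le> K * scale j" "K < j"
  obtains i where "i \<in> window j" "d = scale j * fact (i + 1)" | "j * d \<le> scale j"
proof -
  obtain i j' where d: "d = scale j' * fact (i + 1)" "i \<in> window j'" using assms(1) unfolding sparse_exponents_def by blast
  consider "j' < j" | "j' = j" | "j < j'" by linarith
  thus ?thesis
  proof cases
    case 1
    have f: "fact (i + 1) \<le> (fact (j' + 1) :: nat)" using window_bounded[OF d(2)] by (intro fact_mono) auto
    have "d \<le> fact (j' + 1) * scale j'" unfolding d(1) mult.commute[of "scale j'"] by (rule mult_right_mono[OF f]) simp
    hence "j * d \<le> j * (fact (j' + 1) * scale j')" by (rule mult_left_mono) simp
    also have "\<dots> \<le> scale j" unfolding mult.assoc[symmetric] by (rule scale_gap[OF 1])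
    finally show ?thesis by (rule that(2))
  next
    case 2 thus ?thesis using d that(1) by simp
  next
    case 3
    have "K * scale j < j' * fact (j + 1) * scale j" using assms(3) 3 scale_pos[of j] fact_ge_1[of "j + 1", where 'a = nat]
      by (intro mult_strict_right_mono) (auto intro: less_le_trans[of K j'] simp del: fact_ge_1)
    also have "\<dots> \<le> scale j'" by (rule scale_gap[OF 3])
    also have "\<dots> \<le> d" unfolding d(1) using mult_le_mono2[OF fact_ge_1[of "i + 1", where 'a = nat], of "scale j'"] by simp
    finally show ?thesis using assms(2) by simp
  qed
qed

lemma sparse_polys_zero: "0 \<in> sparse_polys" by (simp add: sparse_polys_def)

lemma sparse_polys_diff: "f \<in> sparse_polys \<Longrightarrow> g \<in> sparse_polys \<Longrightarrow> f - g \<in> sparse_polys"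
  unfolding sparse_polys_def mem_Collect_eq coeff_diff by (metis diff_zero)

section \<open>Characters of the central sequences\<close>

locale sparse_cone = quotient_cone sparse_polys S "omega A" B for S :: "'k::field poly fract mat set set" and A B +
  assumes prime_card: "prime CARD('k)"
begin

definition pol :: "(nat \<Rightarrow> 'k poly fract) \<Rightarrow> nat \<Rightarrow> 'k poly" where "pol z n = inv_into UNIV to_fract (z n)"

lemma inj_to_fract: "inj (to_fract :: 'k poly \<Rightarrow> _)" by (rule injI) simp

lemma pol_to_fract [simp]: "pol (\<lambda>n. to_fract (f n)) n = f n"
  unfolding pol_def by (rule inv_f_f[OF inj_to_fract])

lemma ZZ_pol:
  assumes "z \<in> ZZ" shows "to_fract (pol z n) = z n" "pol z n \<in> sparse_polys"
proof -
  obtain f where f: "f \<in> sparse_polys" "z n = to_fract f" using assms unfolding ZZ_def by blast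
  hence "pol z n = f" unfolding pol_def by (simp add: inv_f_f[OF inj_to_fract])
  thus "to_fract (pol z n) = z n" "pol z n \<in> sparse_polys" using f by simp_all
qed

lemma pol_add: "y \<in> ZZ \<Longrightarrow> z \<in> ZZ \<Longrightarrow> pol (y + z) n = pol y n + pol z n"
  using ZZ_pol(1)[OF ZZ_group(2), of y z n] ZZ_pol(1)[of y n] ZZ_pol(1)[of z n]
  by (intro injD[OF inj_to_fract]) (simp only: to_fract_add plus_fun_apply)

lemma ZZ_degree:
  assumes "z \<in> ZZ" shows "\<exists>K. \<forall>n>0. degree (pol z n) \<le> K * n"
proof -
  have "z \<in> ring_filtration.A (cone_Lam (omega A) PlaceInf)"
    using assms unfolding ZZ_def Uhat_iff by (simp add: central_elt_def)
  then obtain K :: nat where K: "\<forall>n>0. z n \<in> BB PlaceInf (int (K * n))" unfolding A_iff by blast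
  have "degree (pol z n) \<le> K * n" if n: "n > 0" for n
  proof -
    have "to_fract (pol z n) \<in> BB PlaceInf (int (K * n))" unfolding ZZ_pol(1)[OF assms] using K n by blast
    hence "pol z n = 0 \<or> degree (pol z n) \<le> K * n" by (simp only: poly_at_infinity)
    thus ?thesis by auto
  qed
  thus ?thesis by blast
qed

lemma poly_finite_bound: "w \<noteq> PlaceInf \<Longrightarrow> 0 \<le> m \<Longrightarrow> to_fract f \<in> BB w m"
  using poly_finite_places[of w f] BB_mono[of 0 m "to_fract f" w] by (simp add: BB_zero)

lemma ZZ_I:
  assumes "\<And>n. f n \<in> sparse_polys" "\<And>n. degree (f n) \<le> K * n"
  shows "(\<lambda>n. to_fract (f n)) \<in> ZZ"
proof -
  have b: "to_fract (f n) \<in> BB w (int (K * n))" for n w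
  proof (cases "w = PlaceInf")
    case True thus ?thesis using poly_at_infinity[of "f n" "K * n"] assms(2)[of n] by simp
  qed (rule poly_finite_bound, simp_all)
  have "central_elt (\<lambda>n. to_fract (f n)) \<in> TP.Uhat"
  proof (rule UhatI[of _ K])
    show "inRR (ev n (central_elt (\<lambda>n. to_fract (f n)) w))" for n w by (simp add: ev_central inRR_def RR_zero RR_poly)
    show "ubd w (int (K * n)) (ev n (central_elt (\<lambda>n. to_fract (f n)) w))" for n w
      using b[of n w] by (simp add: ev_central ubd_def)
  qed
  thus ?thesis using assms(1) by (auto simp: ZZ_def)
qed

lemma Lam_iff:
  assumes z: "z \<in> ZZ" and r: "0 \<le> r"
  shows "(\<forall>w. z \<in> cone_Lam (omega A) w r) \<longleftrightarrow> (\<forall>e>0. eventually (\<lambda>n. real (degree (pol z n)) \<le> (r + e) * real n) (omega A))"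
proof
  assume l: "\<forall>w. z \<in> cone_Lam (omega A) w r"
  show "\<forall>e>0. eventually (\<lambda>n. real (degree (pol z n)) \<le> (r + e) * real n) (omega A)"
  proof (intro allI impI)
    fix e :: real assume e: "e > 0"
    have "growth (omega A) PlaceInf r z" using l by (simp add: cone_Lam_def)
    from growth_D[OF ultra this e] show "eventually (\<lambda>n. real (degree (pol z n)) \<le> (r + e) * real n) (omega A)"
    proof eventually_elim
      case (elim n)
      then obtain m where m: "z n \<in> BB PlaceInf m" "real_of_int m \<le> (r + e) * real n" by blast
      have "to_fract (pol z n) \<in> BB PlaceInf (int (nat m))" unfolding ZZ_pol(1)[OF z] by (rule BB_mono[OF _ m(1)]) simp
      hence "degree (pol z n) \<le> nat m" unfolding poly_at_infinity by auto
      moreover have "real (nat m) \<le> (r + e) * real n" using m(2) r e by (cases "m \<ge> 0") auto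
      ultimately show ?case by linarith
    qed
  qed
next
  assume d: "\<forall>e>0. eventually (\<lambda>n. real (degree (pol z n)) \<le> (r + e) * real n) (omega A)"
  show "\<forall>w. z \<in> cone_Lam (omega A) w r"
  proof
    fix w
    have a: "z \<in> ring_filtration.A (cone_Lam (omega A) w)"
      using z unfolding ZZ_def Uhat_iff by (simp add: central_elt_def)
    have "growth (omega A) w r z"
    proof (rule growthI[OF ultra, of _ _ _ 0])
      fix e :: real assume "e > 0"
      from d[rule_format, OF this] show "eventually (\<lambda>n. \<exists>m. z n \<in> BB w m \<and> real_of_int m \<le> (r + e) * real n + 0) (omega A)"
      proof (rule eventually_mono)
        fix n assume n: "real (degree (pol z n)) \<le> (r + e) * real n"
        have "to_fract (pol z n) \<in> BB w (int (degree (pol z n)))"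
        proof (cases "w = PlaceInf")
          case True thus ?thesis using poly_at_infinity[of "pol z n" "degree (pol z n)"] by simp
        qed (rule poly_finite_bound, simp_all)
        thus "\<exists>m. z n \<in> BB w m \<and> real_of_int m \<le> (r + e) * real n + 0"
          unfolding ZZ_pol(1)[OF z] using n by (intro exI[of _ "int (degree (pol z n))"]) simp
      qed
    qed
    thus "z \<in> cone_Lam (omega A) w r" using a unfolding A_iff by (simp add: cone_Lam_def)
  qed
qed

lemma eventually_constant:
  fixes g :: "nat \<Rightarrow> 'k"
  shows "\<exists>c. eventually (\<lambda>n. g n = c) (omega A)"
proof (rule ccontr)
  assume "\<not> ?thesis"
  hence "eventually (\<lambda>n. g n \<noteq> c) (omega A)" for c using omega_ultra by blast
  hence "eventually (\<lambda>n. \<forall>c\<in>UNIV. g n \<noteq> c) (omega A)" by (intro eventually_ball_finite finite_field ballI)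
  thus False using omega_nontrivial by (simp add: trivial_limit_def)
qed

text \<open>The value taken almost everywhere by a sequence of coefficients in a finite field.\<close>

definition coef :: "nat \<Rightarrow> (nat \<Rightarrow> 'k poly fract) \<Rightarrow> 'k" where
  "coef i z = (SOME c. eventually (\<lambda>n. coeff (pol z n) (n * fact (i + 1)) = c) (omega A))"

lemma coef_eventually: "eventually (\<lambda>n. coeff (pol z n) (n * fact (i + 1)) = coef i z) (omega A)"
  unfolding coef_def by (rule someI_ex[OF eventually_constant])

lemma coef_eqI:
  assumes "eventually (\<lambda>n. coeff (pol z n) (n * fact (i + 1)) = c) (omega A)" shows "coef i z = c"
proof -
  have "eventually (\<lambda>n. coef i z = c) (omega A)"
    using coef_eventually[of z i] assms by eventually_elim simp
  thus ?thesis using omega_nontrivial by (simp add: eventually_const_iff)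
qed

lemma coef_add: "y \<in> ZZ \<Longrightarrow> z \<in> ZZ \<Longrightarrow> coef i (y + z) = coef i y + coef i z"
  by (rule coef_eqI, use coef_eventually[of y i] coef_eventually[of z i] in eventually_elim) (simp only: pol_add coeff_add)

lemma coef_zero_if_small:
  assumes z: "z \<in> ZZ" "\<And>w. z \<in> cone_Lam (omega A) w r" and r: "0 \<le> r" "r < fact (i + 1)"
  shows "coef i z = 0"
proof (rule coef_eqI)
  let ?e = "(fact (i + 1) - r) / 2"
  have e: "?e > 0" using r by simp
  have "eventually (\<lambda>n. real (degree (pol z n)) \<le> (r + ?e) * real n) (omega A)"
    using Lam_iff[OF z(1) r(1)] z(2) e by blast
  thus "eventually (\<lambda>n. coeff (pol z n) (n * fact (i + 1)) = 0) (omega A)"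
    using omega_pos
  proof eventually_elim
    case (elim n)
    have "(r + ?e) * real n < fact (i + 1) * real n" using r elim(2) by (intro mult_strict_right_mono) (auto simp: field_simps)
    hence "real (degree (pol z n)) < real (n * fact (i + 1))" using elim(1) by (simp add: mult.commute del: fact_Suc)
    hence "degree (pol z n) < n * fact (i + 1)" by (simp only: of_nat_less_iff)
    thus ?case by (rule coeff_eq_0)
  qed
qed

definition zeta_pol :: "'k \<Rightarrow> nat \<Rightarrow> nat \<Rightarrow> 'k poly" where
  "zeta_pol c i n = (if n * fact (i + 1) \<in> sparse_exponents then monom c (n * fact (i + 1)) else 0)"

text \<open>The sequence $c\,t^{n(i+1)!}$, cut off where the exponent is not available; for $i \in A$ this
  happens almost nowhere.\<close>

definition zeta :: "'k \<Rightarrow> nat \<Rightarrow> nat \<Rightarrow> 'k poly fract" where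
  "zeta c i n = to_fract (zeta_pol c i n)"

lemma zeta_pol_sparse: "zeta_pol c i n \<in> sparse_polys" "degree (zeta_pol c i n) \<le> fact (i + 1) * n"
  using degree_monom_le[of c "n * fact (i + 1)"] by (auto simp: zeta_pol_def sparse_polys_def mult.commute)

lemma pol_zeta: "pol (zeta c i) n = zeta_pol c i n"
  using pol_to_fract[of "zeta_pol c i" n] by (simp add: zeta_def[abs_def])

lemma zeta_ZZ: "zeta c i \<in> ZZ"
  using ZZ_I[of "zeta_pol c i" "fact (i + 1)"] zeta_pol_sparse by (simp add: zeta_def[abs_def] del: fact_Suc)

lemma zeta_add: "zeta (c + c') i = zeta c i + zeta c' i"
  by (rule ext) (simp add: zeta_def zeta_pol_def add_monom[symmetric])

lemma zeta_zero: "zeta 0 i = 0"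
  by (rule ext) (simp add: zeta_def zeta_pol_def)

lemma zeta_small: "\<forall>w. zeta c i \<in> cone_Lam (omega A) w (fact (i + 1))"
proof (subst Lam_iff[OF zeta_ZZ])
  show "\<forall>e>0. eventually (\<lambda>n. real (degree (pol (zeta c i) n)) \<le> (fact (i + 1) + e) * real n) (omega A)"
  proof (intro allI impI always_eventually)
    fix e :: real and n assume "e > 0"
    have "real (degree (pol (zeta c i) n)) \<le> real (fact (i + 1) * n)"
      unfolding pol_zeta of_nat_le_iff by (rule zeta_pol_sparse)
    also have "\<dots> \<le> (fact (i + 1) + e) * real n" using \<open>e > 0\<close> by (simp add: distrib_right)
    finally show "real (degree (pol (zeta c i) n)) \<le> (fact (i + 1) + e) * real n" .
  qed
qed simp

lemma eventually_in_sparse: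
  assumes "i \<in> A" shows "eventually (\<lambda>n. n * fact (i + 1) \<in> sparse_exponents) (omega A)"
  using omega_level[of "i + 1" A]
proof eventually_elim
  case (elim n)
  then obtain j where "n = scale j" "i \<in> window j" using assms by auto
  thus ?case unfolding sparse_exponents_def by blast
qed

lemma fact_Suc_inj: "fact (i + 1) = (fact (j + 1) :: nat) \<Longrightarrow> i = j"
  using fact_less_mono[of "i + 1" "j + 1", where 'a = nat] fact_less_mono[of "j + 1" "i + 1", where 'a = nat]
  by (cases i j rule: linorder_cases) auto

lemma coef_zeta:
  assumes "i \<in> A" shows "coef i (zeta c j) = (if i = j then c else 0)"
proof (rule coef_eqI, use eventually_in_sparse[OF assms] omega_pos in eventually_elim)
  case (elim n)
  show ?case
  proof (cases "i = j")
    case True thus ?thesis using elim by (simp add: pol_zeta zeta_pol_def del: fact_Suc)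
  next
    case False
    hence "n * fact (i + 1) \<noteq> n * fact (j + 1)" using elim(2) fact_Suc_inj[of i j] by auto
    thus ?thesis using False by (simp add: pol_zeta zeta_pol_def del: fact_Suc)
  qed
qed

end

context sparse_cone
begin

lemma ZZ_diff: "y \<in> ZZ \<Longrightarrow> z \<in> ZZ \<Longrightarrow> y - z \<in> ZZ"
  using ZZ_group(2)[OF _ ZZ_group(3), of y z] by (simp only: diff_conv_add_uminus)

lemma ZZ_sum: "finite I \<Longrightarrow> (\<And>i. i \<in> I \<Longrightarrow> f i \<in> ZZ) \<Longrightarrow> sum f I \<in> ZZ"
  by (induction I rule: finite_induct) (simp_all only: sum.empty sum.insert ZZ_group insert_iff simp_thms)

lemma pol_zero: "pol 0 n = 0"
  using pol_to_fract[of "\<lambda>_. 0" n] by (simp add: zero_fun_def)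

lemma pol_diff: "y \<in> ZZ \<Longrightarrow> z \<in> ZZ \<Longrightarrow> pol (y - z) n = pol y n - pol z n"
  using pol_add[OF ZZ_diff, of y z z n] by (simp only: diff_add_cancel) simp

lemma pol_sum: "finite I \<Longrightarrow> (\<And>i. i \<in> I \<Longrightarrow> f i \<in> ZZ) \<Longrightarrow> pol (sum f I) n = (\<Sum>i\<in>I. pol (f i) n)"
proof (induction I rule: finite_induct)
  case (insert x I)
  hence "pol (f x + sum f I) n = pol (f x) n + pol (sum f I) n" by (intro pol_add ZZ_sum) auto
  thus ?case unfolding sum.insert[OF insert.hyps] by (simp only: insert.IH insert.prems insertI2)
qed (simp only: sum.empty pol_zero sum.empty)

text \<open>Central sequences modulo those of norm $0$ have the \<open>zeta\<close> with index in $A$ as a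
  basis: by \<open>sparse_gap\<close> no other exponents of size comparable to $n$ exist.\<close>

lemma decomposition:
  assumes z: "z \<in> ZZ"
  obtains I where "finite I" "I \<subseteq> A" "\<And>w. z - (\<Sum>i\<in>I. zeta (coef i z) i) \<in> cone_Lam (omega A) w 0"
proof -
  obtain K where K: "\<And>n. n > 0 \<Longrightarrow> degree (pol z n) \<le> K * n" using ZZ_degree[OF z] by blast
  define I where "I = {i \<in> A. fact (i + 1) \<le> K}"
  have le_K: "i < K" if "fact (Suc i) \<le> K" for i using fact_ge_self[of "Suc i"] that by linarith
  have fin: "finite I" by (rule finite_subset[of _ "{..<K}"]) (auto simp: I_def dest: le_K simp del: fact_Suc)
  let ?y = "z - (\<Sum>i\<in>I. zeta (coef i z) i)"
  have sumZ: "(\<Sum>i\<in>I. zeta (coef i z) i) \<in> ZZ" by (intro ZZ_sum fin zeta_ZZ)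
  have y: "?y \<in> ZZ" by (rule ZZ_diff[OF z sumZ])
  have pol_y: "pol ?y n = pol z n - (\<Sum>i\<in>I. zeta_pol (coef i z) i n)" for n
    by (simp only: pol_diff[OF z sumZ] pol_sum[OF fin zeta_ZZ] pol_zeta)
  have "\<forall>e>0. eventually (\<lambda>n. real (degree (pol ?y n)) \<le> (0 + e) * real n) (omega A)"
  proof (intro allI impI)
    fix e :: real assume e: "e > 0"
    \<comment> \<open>Beyond this level \<open>sparse_gap\<close> covers the degree bound, and its negligible
      exponents are below $e n$.\<close>
    define N where "N = nat \<lceil>1 / e\<rceil> + K + 1"
    have "eventually (\<lambda>n. \<forall>i\<in>I. coeff (pol z n) (n * fact (i + 1)) = coef i z) (omega A)"
      by (intro eventually_ball_finite fin ballI coef_eventually)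
    thus "eventually (\<lambda>n. real (degree (pol ?y n)) \<le> (0 + e) * real n) (omega A)"
      using omega_level[of N A] omega_pos
    proof eventually_elim
      case (elim n)
      then obtain j where j: "j \<ge> N" "n = scale j" "window j \<subseteq> A" "\<forall>i\<in>A. i < N \<longrightarrow> i \<in> window j" by blast
      have inE: "n * fact (i + 1) \<in> sparse_exponents" if "i \<in> I" for i
      proof -
        have "i < N" "i \<in> A" using that le_K[of i] by (auto simp: I_def N_def simp del: fact_Suc)
        hence "i \<in> window j" using j(4) by blast
        thus ?thesis unfolding j(2) sparse_exponents_def by blast
      qed
      have co: "coeff (pol ?y n) d = coeff (pol z n) d - (\<Sum>i\<in>I. if d = n * fact (i + 1) then coef i z else 0)" for d
      proof -
        have "(\<Sum>i\<in>I. coeff (zeta_pol (coef i z) i n) d) = (\<Sum>i\<in>I. if d = n * fact (i + 1) then coef i z else 0)"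
          by (rule sum.cong[OF refl]) (simp add: zeta_pol_def inE[unfolded Suc_eq_plus1[symmetric]] del: fact_Suc)
        thus ?thesis by (simp only: pol_y coeff_diff coeff_sum)
      qed
      have supp: "d \<le> n div j" if d: "coeff (pol ?y n) d \<noteq> 0" for d
      proof -
        have dE: "d \<in> sparse_exponents" using ZZ_pol(2)[OF y, of n] d unfolding sparse_polys_def by blast
        have dK: "d \<le> K * n"
        proof (rule ccontr)
          assume "\<not> d \<le> K * n"
          hence "coeff (pol z n) d = 0" using K[OF elim(3)] by (intro coeff_eq_0) linarith
          moreover have "(\<Sum>i\<in>I. if d = n * fact (i + 1) then coef i z else 0) = 0"
          proof (rule sum.neutral, rule ballI)
            fix i assume "i \<in> I"
            hence "fact (i + 1) \<le> K" unfolding I_def by blast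
            hence "n * fact (i + 1) \<le> n * K" by (rule mult_left_mono) simp
            hence "n * fact (i + 1) \<le> K * n" unfolding mult.commute[of K n] .
            hence "d \<noteq> n * fact (i + 1)" using \<open>\<not> d \<le> K * n\<close> by blast
            thus "(if d = n * fact (i + 1) then coef i z else 0) = 0" by (simp only: if_False)
          qed
          ultimately have "coeff (pol ?y n) d = 0" unfolding co by (simp only: diff_zero)
          thus False using d by blast
        qed
        have "K < j" using j(1) unfolding N_def by linarith
        thus ?thesis
        proof (rule sparse_gap[OF dE dK[unfolded j(2)]])
          fix i assume i: "i \<in> window j" "d = scale j * fact (i + 1)"
          hence di: "d = n * fact (i + 1)" unfolding j(2) by blast
          have "n * fact (i + 1) \<le> n * K" using dK unfolding di mult.commute[of K n] .
          hence "fact (i + 1) \<le> K" using elim(3) by (simp only: mult_le_cancel1)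
          hence iI: "i \<in> I" using i(1) j(3) unfolding I_def by blast
          have "(d = n * fact (i' + 1)) = (i' = i)" for i'
          proof
            assume "d = n * fact (i' + 1)"
            hence "fact (i + 1) = (fact (i' + 1) :: nat)" using elim(3) unfolding di by (simp only: mult_cancel1) auto
            thus "i' = i" using fact_Suc_inj by blast
          qed (simp only: di)
          hence "(\<Sum>i'\<in>I. if d = n * fact (i' + 1) then coef i' z else 0) = (\<Sum>i'\<in>I. if i' = i then coef i' z else 0)"
            by (simp only:)
          also have "\<dots> = coef i z" using iI fin by simp
          also have "\<dots> = coeff (pol z n) d" using elim(1) iI unfolding di by simp
          finally have "coeff (pol ?y n) d = 0" unfolding co by simp
          thus ?thesis using d by blast
        next
          assume "j * d \<le> scale j"
          moreover have "j > 0" using j(1) unfolding N_def by linarith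
          ultimately show ?thesis unfolding j(2) by (simp add: less_eq_div_iff_mult_less_eq mult.commute)
        qed
      qed
      have dd: "degree (pol ?y n) \<le> n div j"
      proof (rule degree_le, intro allI impI, rule ccontr)
        fix d assume "n div j < d" "coeff (pol ?y n) d \<noteq> 0"
        thus False using supp[of d] by simp
      qed
      have "1 / e \<le> real j" using j(1) unfolding N_def by linarith
      hence "1 \<le> e * real j" using e by (simp add: field_simps)
      have "real (n div j) * 1 \<le> real (n div j) * (e * real j)" using \<open>1 \<le> e * real j\<close> by (intro mult_left_mono) auto
      also have "\<dots> = e * real (n div j * j)" by simp
      also have "\<dots> \<le> e * real n" using e by (intro mult_left_mono) (simp_all only: of_nat_le_iff div_times_less_eq_dividend less_imp_le)
      finally show ?case using dd by simp
    qed
  qed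
  hence small: "\<forall>w. ?y \<in> cone_Lam (omega A) w 0" by (simp only: Lam_iff[OF y order_refl])
  show ?thesis
  proof (rule that[OF fin])
    show "I \<subseteq> A" by (auto simp: I_def)
    show "?y \<in> cone_Lam (omega A) w 0" for w using small by blast
  qed
qed

lemma chi_norm_zero:
  assumes P: "CM.Pot c \<Psi>" and z: "z \<in> ZZ" "\<And>w. z \<in> cone_Lam (omega A) w 0"
  shows "CM.chi \<Psi> z = (0 :: 'c::ab_group_add)"
proof -
  have "central_elt z \<in> TP.Uv 0 0" using CM.central_mem[OF z(1)] z(2) by blast
  hence "\<Psi> (0 + central_elt z) 0 = \<Psi> 0 0" using P TP.Uhat_zero unfolding CM.Pot_def by blast
  thus ?thesis by (simp add: CM.chi_def)
qed

lemma chi_zero: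
  assumes P: "CM.Pot c \<Psi>" shows "CM.chi \<Psi> 0 = (0 :: 'c::ab_group_add)"
  using CM.chi_add[OF P ZZ_group(1) ZZ_group(1)] by (simp only: add_0_left) (metis add_cancel_right_right)

lemma chi_sum:
  assumes P: "CM.Pot c \<Psi>" and "finite I" "\<And>i. i \<in> I \<Longrightarrow> f i \<in> ZZ"
  shows "CM.chi \<Psi> (sum f I) = (\<Sum>i\<in>I. CM.chi \<Psi> (f i) :: 'c::ab_group_add)"
  using assms(2,3)
proof (induction I rule: finite_induct)
  case (insert x I)
  hence "CM.chi \<Psi> (f x + sum f I) = CM.chi \<Psi> (f x) + CM.chi \<Psi> (sum f I)" by (intro CM.chi_add[OF P] ZZ_sum) auto
  thus ?case unfolding sum.insert[OF insert.hyps] by (simp only: insert.IH insert.prems insertI2)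
qed (simp only: sum.empty chi_zero[OF P])

text \<open>By Lagrange's theorem, as the order of the field is prime. Hence additive maps are determined by
  the values at coefficient $1$.\<close>

lemma prime_field_of_nat: "\<exists>m. (a :: 'k) = of_nat m"
proof -
  let ?f = "of_nat :: nat \<Rightarrow> 'k"
  let ?G = "\<lparr>carrier = UNIV, monoid.mult = (+), one = (0 :: 'k)\<rparr>"
  interpret G: group ?G
    by (rule groupI) (auto simp: add.assoc intro: exI[of _ "- x" for x])
  have pos: "CHAR('k) > 0" by (rule finite_imp_CHAR_pos) (rule finite_field)
  have sub: "subgroup (range ?f) ?G"
  proof (rule G.subgroupI)
    fix a assume "a \<in> range ?f"
    then obtain m where m: "a = of_nat m" by blast
    have "inv\<^bsub>?G\<^esub> a = of_nat (m * (CHAR('k) - 1))"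
    proof (rule G.inv_equality)
      have "of_nat (m * (CHAR('k) - 1)) + a = of_nat (m * (CHAR('k) - 1) + m)" unfolding m by simp
      also have "m * (CHAR('k) - 1) + m = m * CHAR('k)" using pos by (cases "CHAR('k)") auto
      also have "of_nat (m * CHAR('k)) = (0 :: 'k)" by simp
      finally show "of_nat (m * (CHAR('k) - 1)) \<otimes>\<^bsub>?G\<^esub> a = \<one>\<^bsub>?G\<^esub>" by simp
    qed auto
    thus "inv\<^bsub>?G\<^esub> a \<in> range ?f" by blast
  next
    fix a b assume "a \<in> range ?f" "b \<in> range ?f"
    thus "a \<otimes>\<^bsub>?G\<^esub> b \<in> range ?f" by (auto simp: of_nat_add[symmetric] simp del: of_nat_add)
  qed auto
  have "card (rcosets\<^bsub>?G\<^esub> (range ?f)) * card (range ?f) = CARD('k)"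
    using G.lagrange[OF sub] by (simp add: Coset.order_def)
  hence "card (range ?f) dvd CARD('k)" by (metis dvd_triv_right)
  moreover have "card (range ?f) \<noteq> 1"
  proof
    assume "card (range ?f) = 1"
    then obtain a where "range ?f = {a}" by (auto simp: card_1_singleton_iff)
    hence "?f 0 = a" "?f 1 = a" by blast+
    thus False by simp
  qed
  ultimately have "card (range ?f) = CARD('k)" using prime_card unfolding prime_nat_iff by blast
  hence "range ?f = UNIV" by (intro card_subset_eq finite_field) auto
  thus ?thesis by (metis UNIV_I imageE)
qed

lemma chi_zeta:
  assumes P: "CM.Pot c \<Psi>" and "CM.chi \<Psi> (zeta 1 i) = (0 :: 'c::ab_group_add)"
  shows "CM.chi \<Psi> (zeta a i) = 0"
proof -
  obtain m where m: "a = of_nat m" using prime_field_of_nat by blast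
  have "CM.chi \<Psi> (zeta (of_nat m) i) = 0" for m
  proof (induction m)
    case 0 show ?case by (simp only: of_nat_0 zeta_zero chi_zero[OF P])
  next
    case (Suc m)
    have "zeta (of_nat (Suc m)) i = zeta 1 i + zeta (of_nat m) i" unfolding zeta_add[symmetric] by simp
    thus ?case using CM.chi_add[OF P zeta_ZZ zeta_ZZ, of 1 i "of_nat m" i] Suc assms(2) by (simp only: add_0_left)
  qed
  thus ?thesis by (simp only: m)
qed

lemma chi_zero_if_zero_on_zeta:
  assumes P: "CM.Pot c \<Psi>" and z: "z \<in> ZZ"
    and van: "\<And>i. i \<in> A \<Longrightarrow> coef i z \<noteq> 0 \<Longrightarrow> CM.chi \<Psi> (zeta 1 i) = 0"
  shows "CM.chi \<Psi> z = (0 :: 'c::ab_group_add)"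
proof -
  obtain I where I: "finite I" "I \<subseteq> A" "\<And>w. z - (\<Sum>i\<in>I. zeta (coef i z) i) \<in> cone_Lam (omega A) w 0"
    using decomposition[OF z] by blast
  let ?s = "\<Sum>i\<in>I. zeta (coef i z) i"
  have s: "?s \<in> ZZ" by (intro ZZ_sum I zeta_ZZ)
  have "CM.chi \<Psi> (z - ?s) = 0" by (rule chi_norm_zero[OF P ZZ_diff[OF z s] I(3)])
  moreover have "CM.chi \<Psi> ?s = 0"
  proof -
    have "CM.chi \<Psi> (zeta (coef i z) i) = 0" if "i \<in> I" for i
    proof (cases "coef i z = 0")
      case True thus ?thesis by (simp only: zeta_zero chi_zero[OF P])
    next
      case False
      thus ?thesis using chi_zeta[OF P van] that I(2) by blast
    qed
    thus ?thesis by (simp add: chi_sum[OF P I(1) zeta_ZZ])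
  qed
  ultimately show ?thesis using CM.chi_add[OF P ZZ_diff[OF z s] s] by (simp only: diff_add_cancel add_0_left)
qed

end

section \<open>Counting cocycles\<close>

type_synonym 'k cone_point = "(nat \<Rightarrow> 'k poly fract mat set) set"

lemma exact_on_cong:
  assumes "exact_on X c S" "\<And>x y. x \<in> S \<Longrightarrow> y \<in> S \<Longrightarrow> c x y = c' x y"
  shows "exact_on X c' S"
proof -
  obtain g where g: "\<And>x. x \<in> S \<Longrightarrow> \<exists>U. openin X U \<and> x \<in> U \<and> (\<forall>y\<in>U \<inter> S. c x y = g y - g x)"
    using assms(1) unfolding exact_on_def by blast
  show ?thesis unfolding exact_on_def
  proof (intro exI[of _ g] ballI)
    fix x assume x: "x \<in> S"
    obtain U where U: "openin X U" "x \<in> U" "\<forall>y\<in>U \<inter> S. c x y = g y - g x" using g[OF x] by blast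
    have "c' x y = g y - g x" if "y \<in> U \<inter> S" for y
      using U(3) that assms(2)[OF x, of y] by (metis Int_iff)
    thus "\<exists>U. openin X U \<and> x \<in> U \<and> (\<forall>y\<in>U \<inter> S. c' x y = g y - g x)" using U by blast
  qed
qed

lemma exact_on_subset:
  assumes "exact_on X c S" "T \<subseteq> S" shows "exact_on X c T"
proof -
  obtain g where g: "\<And>x. x \<in> S \<Longrightarrow> \<exists>U. openin X U \<and> x \<in> U \<and> (\<forall>y\<in>U \<inter> S. c x y = g y - g x)"
    using assms(1) unfolding exact_on_def by blast
  show ?thesis unfolding exact_on_def
  proof (intro exI[of _ g] ballI)
    fix x assume "x \<in> T"
    hence "x \<in> S" using assms(2) by blast
    from g[OF this] obtain U where U: "openin X U" "x \<in> U" "\<forall>y\<in>U \<inter> S. c x y = g y - g x" by blast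
    have "\<forall>y\<in>U \<inter> T. c x y = g y - g x" using U(3) assms(2) by blast
    thus "\<exists>U. openin X U \<and> x \<in> U \<and> (\<forall>y\<in>U \<inter> T. c x y = g y - g x)" using U(1,2) by blast
  qed
qed

context sparse_cone
begin

lemma card_functions: "finite I \<Longrightarrow> card (PiE I (\<lambda>_. UNIV :: 'k set)) = CARD('k) ^ card I"
  by (simp add: card_PiE)

text \<open>The coordinate functions \<open>coef\<close> are characters that are trivial near $0$, and on a
  ball that is large enough for the corresponding \<open>zeta\<close> no nontrivial combination
  is exact.\<close>

lemma independent_cocycles:
  assumes I: "finite I" "I \<subseteq> A" "\<And>i. i \<in> I \<Longrightarrow> 60 * real (5 * B) * fact (i + 1) < r"
  obtains c :: "(nat \<Rightarrow> 'k) \<Rightarrow> 'k cone_point \<Rightarrow> 'k cone_point \<Rightarrow> 'k"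
  where "\<And>\<kappa>. local_cocycle CM.mtopology (c \<kappa>)"
    "\<And>\<kappa> \<kappa>'. \<kappa> \<in> PiE I (\<lambda>_. UNIV) \<Longrightarrow> \<kappa>' \<in> PiE I (\<lambda>_. UNIV) \<Longrightarrow> \<kappa> \<noteq> \<kappa>' \<Longrightarrow>
       \<not> exact_on CM.mtopology (\<lambda>x y. c \<kappa> x y - c \<kappa>' x y) (CM.mball (pt 0 0) r)"
proof -
  define ch where "ch \<kappa> z = (\<Sum>i\<in>I. \<kappa> i * coef i z)" for \<kappa> z
  have "\<exists>c \<Psi>. local_cocycle CM.mtopology c \<and> CM.Pot c \<Psi> \<and> (\<forall>z\<in>ZZ. CM.chi \<Psi> z = ch \<kappa> z)" for \<kappa>
  proof (rule CM.cocycle_from_character[of "1 / 2"])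
    show "ch \<kappa> (y + z) = ch \<kappa> y + ch \<kappa> z" if "y \<in> ZZ" "z \<in> ZZ" for y z
      unfolding ch_def coef_add[OF that] distrib_left sum.distrib ..
    show "ch \<kappa> z = 0" if "z \<in> ZZ" "\<And>w. z \<in> cone_Lam (omega A) w (1 / 2)" for z
    proof -
      have "coef i z = 0" for i
        by (rule coef_zero_if_small[OF that]) (use fact_ge_1[of "i + 1", where 'a = real] in linarith)+
      thus ?thesis by (simp only: ch_def mult_zero_right sum.neutral_const)
    qed
  qed simp
  hence "\<forall>\<kappa>. \<exists>c \<Psi>. local_cocycle CM.mtopology c \<and> CM.Pot c \<Psi> \<and> (\<forall>z\<in>ZZ. CM.chi \<Psi> z = ch \<kappa> z)" by (rule allI)
  from choice[OF this] obtain c where "\<forall>\<kappa>. \<exists>\<Psi>. local_cocycle CM.mtopology (c \<kappa>) \<and> CM.Pot (c \<kappa>) \<Psi> \<and> (\<forall>z\<in>ZZ. CM.chi \<Psi> z = ch \<kappa> z)" ..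
  from choice[OF this] obtain \<Psi> where "\<forall>\<kappa>. local_cocycle CM.mtopology (c \<kappa>) \<and> CM.Pot (c \<kappa>) (\<Psi> \<kappa>) \<and> (\<forall>z\<in>ZZ. CM.chi (\<Psi> \<kappa>) z = ch \<kappa> z)" ..
  hence c: "\<And>\<kappa>. local_cocycle CM.mtopology (c \<kappa>)" "\<And>\<kappa>. CM.Pot (c \<kappa>) (\<Psi> \<kappa>)"
    "\<And>\<kappa> z. z \<in> ZZ \<Longrightarrow> CM.chi (\<Psi> \<kappa>) z = ch \<kappa> z" by blast+
  show ?thesis
  proof (rule that[OF c(1)], rule notI)
    fix \<kappa> \<kappa>' assume \<kappa>: "\<kappa> \<in> PiE I (\<lambda>_. UNIV)" "\<kappa>' \<in> PiE I (\<lambda>_. UNIV)" "\<kappa> \<noteq> \<kappa>'"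
      and ex: "exact_on CM.mtopology (\<lambda>x y. c \<kappa> x y - c \<kappa>' x y) (CM.mball (pt 0 0) r)"
    have "\<not> (\<forall>i\<in>I. \<kappa> i = \<kappa>' i)" using PiE_ext[OF \<kappa>(1,2)] \<kappa>(3) by blast
    then obtain i where i: "i \<in> I" "\<kappa> i \<noteq> \<kappa>' i" by blast
    have ch: "ch \<mu> (zeta 1 i) = \<mu> i" for \<mu>
    proof -
      have "ch \<mu> (zeta 1 i) = (\<Sum>j\<in>I. if j = i then \<mu> j else 0)"
        unfolding ch_def using I(2) by (intro sum.cong refl) (auto simp: coef_zeta)
      thus ?thesis using I(1) i(1) by simp
    qed
    have "CM.chi (\<lambda>u v. \<Psi> \<kappa> u v - \<Psi> \<kappa>' u v) (zeta 1 i) = 0"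
    proof (rule CM.chi_zero_if_exact[OF CM.Pot_diff[OF c(2) c(2)] ex zeta_ZZ])
      show "zeta 1 i \<in> cone_Lam (omega A) w (fact (i + 1))" for w using zeta_small by blast
      show "60 * real (5 * B) * fact (i + 1) < r" by (rule I(3)[OF i(1)])
    qed simp
    thus False unfolding CM.chi_diff c(3)[OF zeta_ZZ] ch using i(2) by simp
  qed
qed

text \<open>Pigeonhole: there are only so many restrictions of a character to the \<open>zeta\<close> with
  index in $J$.\<close>

lemma dependent_cocycles:
  fixes c :: "'i \<Rightarrow> 'k cone_point \<Rightarrow> 'k cone_point \<Rightarrow> 'k"
  assumes c: "\<And>\<kappa>. \<kappa> \<in> F \<Longrightarrow> local_cocycle CM.mtopology (c \<kappa>)" and J: "finite J" and F: "CARD('k) ^ card J < card F"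
  obtains \<kappa> \<kappa>' \<Psi> where "\<kappa> \<in> F" "\<kappa>' \<in> F" "\<kappa> \<noteq> \<kappa>'" "CM.Pot (\<lambda>x y. c \<kappa> x y - c \<kappa>' x y) \<Psi>"
    "\<And>i. i \<in> J \<Longrightarrow> CM.chi \<Psi> (zeta 1 i) = 0"
proof -
  have "\<forall>\<kappa>\<in>F. \<exists>\<Psi>. CM.Pot (c \<kappa>) \<Psi>" using CM.Pot_exists[OF c] by blast
  from bchoice[OF this] obtain \<Psi> where \<Psi>: "\<And>\<kappa>. \<kappa> \<in> F \<Longrightarrow> CM.Pot (c \<kappa>) (\<Psi> \<kappa>)" by blast
  define h where "h \<kappa> = restrict (\<lambda>i. CM.chi (\<Psi> \<kappa>) (zeta 1 i)) J" for \<kappa>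
  have "h ` F \<subseteq> PiE J (\<lambda>_. UNIV)" by (auto simp: h_def)
  hence "card (h ` F) \<le> CARD('k) ^ card J"
    using card_mono[of "PiE J (\<lambda>_. UNIV :: 'k set)" "h ` F"] J finite_field by (simp add: card_functions finite_PiE)
  hence "\<not> inj_on h F" using F by (intro pigeonhole) simp
  then obtain \<kappa> \<kappa>' where \<kappa>: "\<kappa> \<in> F" "\<kappa>' \<in> F" "\<kappa> \<noteq> \<kappa>'" "h \<kappa> = h \<kappa>'" unfolding inj_on_def by blast
  have "CM.chi (\<lambda>u v. \<Psi> \<kappa> u v - \<Psi> \<kappa>' u v) (zeta 1 i) = 0" if "i \<in> J" for i
    using fun_cong[OF \<kappa>(4), of i] that by (simp add: h_def CM.chi_diff)
  thus ?thesis using that[OF \<kappa>(1-3) CM.Pot_diff[OF \<Psi>[OF \<kappa>(1)] \<Psi>[OF \<kappa>(2)]]] by blast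
qed

lemma exact_difference_on_balls:
  fixes c :: "'i \<Rightarrow> 'k cone_point \<Rightarrow> 'k cone_point \<Rightarrow> 'k"
  assumes c: "\<And>\<kappa>. local_cocycle CM.mtopology (c \<kappa>)" and r: "r > 0" and x0: "x0 \<in> Cone"
    and J: "finite {i \<in> A. fact (i + 1) \<le> 100 * real (5 * B) * r}"
    and F: "CARD('k) ^ card {i \<in> A. fact (i + 1) \<le> 100 * real (5 * B) * r} < card F"
  shows "\<exists>\<kappa>\<in>F. \<exists>\<kappa>'\<in>F. \<kappa> \<noteq> \<kappa>' \<and> exact_on CM.mtopology (\<lambda>x y. c \<kappa> x y - c \<kappa>' x y) (CM.mball x0 r)"
proof -
  obtain \<kappa> \<kappa>' \<Psi> where \<kappa>: "\<kappa> \<in> F" "\<kappa>' \<in> F" "\<kappa> \<noteq> \<kappa>'" and P: "CM.Pot (\<lambda>x y. c \<kappa> x y - c \<kappa>' x y) \<Psi>"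
    and van: "\<And>i. i \<in> {i \<in> A. fact (i + 1) \<le> 100 * real (5 * B) * r} \<Longrightarrow> CM.chi \<Psi> (zeta 1 i) = 0"
    using dependent_cocycles[of F c, OF c J F] by blast
  have "exact_on CM.mtopology (\<lambda>x y. c \<kappa> x y - c \<kappa>' x y) (CM.mball x0 r)"
  proof (rule CM.exact_on_ball[OF local_cocycle_diff[OF c c] P r x0])
    fix z assume z: "z \<in> ZZ" "\<And>w. z \<in> cone_Lam (omega A) w (100 * real (5 * B) * r)"
    show "CM.chi \<Psi> z = 0"
    proof (rule chi_zero_if_zero_on_zeta[OF P z(1)])
      fix i assume i: "i \<in> A" "coef i z \<noteq> 0"
      have "fact (i + 1) \<le> 100 * real (5 * B) * r"
      proof (rule ccontr)
        assume "\<not> ?thesis"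
        hence "100 * real (5 * B) * r < fact (i + 1)" by (simp only: not_le)
        moreover have "0 \<le> 100 * real (5 * B) * r" using r by simp
        ultimately have "coef i z = 0" by (intro coef_zero_if_small[OF z])
        thus False using i(2) by contradiction
      qed
      thus "CM.chi \<Psi> (zeta 1 i) = 0" using van i(1) by blast
    qed
  qed
  thus ?thesis using \<kappa> by blast
qed

lemma exact_difference_globally:
  fixes c :: "'i \<Rightarrow> 'k cone_point \<Rightarrow> 'k cone_point \<Rightarrow> 'k"
  assumes c: "\<And>\<kappa>. local_cocycle CM.mtopology (c \<kappa>)" and A: "finite A" and F: "CARD('k) ^ card A < card F"
  shows "\<exists>\<kappa>\<in>F. \<exists>\<kappa>'\<in>F. \<kappa> \<noteq> \<kappa>' \<and> exact_on CM.mtopology (\<lambda>x y. c \<kappa> x y - c \<kappa>' x y) Cone"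
proof -
  obtain \<kappa> \<kappa>' \<Psi> where \<kappa>: "\<kappa> \<in> F" "\<kappa>' \<in> F" "\<kappa> \<noteq> \<kappa>'" and P: "CM.Pot (\<lambda>x y. c \<kappa> x y - c \<kappa>' x y) \<Psi>"
    and van: "\<And>i. i \<in> A \<Longrightarrow> CM.chi \<Psi> (zeta 1 i) = 0"
    using dependent_cocycles[of F c, OF c A F] by blast
  have "exact_on CM.mtopology (\<lambda>x y. c \<kappa> x y - c \<kappa>' x y) Cone"
    by (rule CM.exact_global[OF local_cocycle_diff[OF c c] P chi_zero_if_zero_on_zeta[OF P _ van]])
  thus ?thesis using \<kappa> by blast
qed

lemma pt_base: "pt 0 0 \<in> Cone" by (rule pt_in_cone[OF TP.Uhat_zero])

end

abbreviation (input) "Gam_sparse \<equiv> central_quotient.Gam sparse_polys"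

text \<open>Independent cocycles on a ball of the second cone pull back to cocycles that remain independent
  on a larger ball of the first, whose number is bounded by the count for that radius.\<close>

lemma card_le_if_bilipschitz:
  fixes S :: "'k::field poly fract mat set set" and f g :: "'k cone_point \<Rightarrow> 'k cone_point"
  assumes X: "sparse_cone S A B" and Y: "sparse_cone S A' B"
    and f: "\<And>x. x \<in> group_cone Gam_sparse S (omega A) \<Longrightarrow> f x \<in> group_cone Gam_sparse S (omega A')"
    and g: "\<And>y. y \<in> group_cone Gam_sparse S (omega A') \<Longrightarrow> g y \<in> group_cone Gam_sparse S (omega A) \<and> f (g y) = y"
    and L: "L \<ge> 1"
    and fL: "\<And>x x'. x \<in> group_cone Gam_sparse S (omega A) \<Longrightarrow> x' \<in> group_cone Gam_sparse S (omega A) \<Longrightarrow>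
      group_cone_dist Gam_sparse S (omega A') (f x) (f x') \<le> L * group_cone_dist Gam_sparse S (omega A) x x'"
    and gL: "\<And>y y'. y \<in> group_cone Gam_sparse S (omega A') \<Longrightarrow> y' \<in> group_cone Gam_sparse S (omega A') \<Longrightarrow>
      group_cone_dist Gam_sparse S (omega A) (g y) (g y') \<le> L * group_cone_dist Gam_sparse S (omega A') y y'"
  shows "\<exists>K>0. \<forall>\<rho>>0. card {i \<in> A'. fact (i + 1) \<le> \<rho>} \<le> card {i \<in> A. fact (i + 1) \<le> K * (\<rho> + 1 :: real)}"
proof -
  interpret X: sparse_cone S A B by (rule X)
  interpret Y: sparse_cone S A' B by (rule Y)
  note cones = group_cone_def group_cone_dist_def
  have f: "f x \<in> Y.Cone" if "x \<in> X.Cone" for x using f that unfolding cones .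
  have g: "g y \<in> X.Cone" "f (g y) = y" if "y \<in> Y.Cone" for y using g that unfolding cones by blast+
  have fL: "Y.cd (f x) (f x') \<le> L * X.cd x x'" if "x \<in> X.Cone" "x' \<in> X.Cone" for x x'
    using fL that unfolding cones .
  have gL: "X.cd (g y) (g y') \<le> L * Y.cd y y'" if "y \<in> Y.Cone" "y' \<in> Y.Cone" for y y'
    using gL that unfolding cones .
  have small: "L * t < e" if "t < e / L" for t e using that L by (simp add: field_simps)
  have cont_f: "continuous_map X.CM.mtopology Y.CM.mtopology f"
    unfolding X.CM.metric_continuous_map[OF Y.CM.Metric_space_axioms]
  proof (intro conjI ballI allI impI)
    fix a and e :: real assume a: "a \<in> X.Cone" "e > 0"
    have "Y.cd (f a) (f x) < e" if "x \<in> X.Cone \<and> X.cd a x < e / L" for x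
      using le_less_trans[OF fL[OF a(1), of x] small] that by blast
    moreover have "e / L > 0" using a(2) L by simp
    ultimately show "\<exists>\<delta>>0. \<forall>x. x \<in> X.Cone \<and> X.cd a x < \<delta> \<longrightarrow> Y.cd (f a) (f x) < e" by blast
  qed (use f in blast)
  have cont_g: "continuous_map Y.CM.mtopology X.CM.mtopology g"
    unfolding Y.CM.metric_continuous_map[OF X.CM.Metric_space_axioms]
  proof (intro conjI ballI allI impI)
    fix a and e :: real assume a: "a \<in> Y.Cone" "e > 0"
    have "X.cd (g a) (g x) < e" if "x \<in> Y.Cone \<and> Y.cd a x < e / L" for x
      using le_less_trans[OF gL[OF a(1), of x] small] that by blast
    moreover have "e / L > 0" using a(2) L by simp
    ultimately show "\<exists>\<delta>>0. \<forall>x. x \<in> Y.Cone \<and> Y.cd a x < \<delta> \<longrightarrow> X.cd (g a) (g x) < e" by blast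
  qed (use g in blast)
  define C where "C = real (5 * B)"
  have C: "C \<ge> 1" using X.B_pos by (simp add: C_def)
  define K where "K = 100 * C * L * (60 * C)"
  have K: "K > 0" using C L by (simp add: K_def)
  have fin: "finite {i \<in> A0. fact (i + 1) \<le> t}" for A0 and t :: real
  proof (rule finite_subset)
    show "{i \<in> A0. fact (i + 1) \<le> t} \<subseteq> {..nat \<lceil>t\<rceil>}"
    proof clarify
      fix i assume "fact (i + 1) \<le> t"
      moreover have "real (i + 1) \<le> fact (i + 1)" using fact_ge_self[of "i + 1"] by (metis of_nat_fact of_nat_le_iff)
      ultimately show "i \<le> nat \<lceil>t\<rceil>" by linarith
    qed
  qed simp
  have "card {i \<in> A'. fact (i + 1) \<le> \<rho>} \<le> card {i \<in> A. fact (i + 1) \<le> K * (\<rho> + 1)}" if \<rho>: "\<rho> > 0" for \<rho> :: real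
  proof (rule ccontr)
    assume neg: "\<not> ?thesis"
    \<comment> \<open>The strict inequality in \<open>independent_cocycles\<close> needs more than $60 C \rho$.\<close>
    define r where "r = 60 * C * (\<rho> + 1)"
    have r: "r > 0" "60 * C * \<rho> < r" using C \<rho> by (auto simp: r_def)
    let ?I = "{i \<in> A'. fact (i + 1) \<le> \<rho>}" and ?J = "{i \<in> A. fact (i + 1) \<le> 100 * real (5 * B) * (L * r)}"
    have KJ: "100 * real (5 * B) * (L * r) = K * (\<rho> + 1)" by (simp add: K_def r_def C_def)
    have I: "60 * real (5 * B) * fact (i + 1) < r" if "i \<in> ?I" for i
    proof -
      have "60 * C * fact (i + 1) \<le> 60 * C * \<rho>" using that C by (intro mult_left_mono) (auto simp del: fact_Suc)
      thus ?thesis using r(2) unfolding C_def[symmetric] by linarith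
    qed
    obtain c :: "(nat \<Rightarrow> 'k) \<Rightarrow> 'k cone_point \<Rightarrow> 'k cone_point \<Rightarrow> 'k"
      where c: "\<And>\<kappa>. local_cocycle Y.CM.mtopology (c \<kappa>)"
        "\<And>\<kappa> \<kappa>'. \<kappa> \<in> PiE ?I (\<lambda>_. UNIV) \<Longrightarrow> \<kappa>' \<in> PiE ?I (\<lambda>_. UNIV) \<Longrightarrow> \<kappa> \<noteq> \<kappa>' \<Longrightarrow>
           \<not> exact_on Y.CM.mtopology (\<lambda>x y. c \<kappa> x y - c \<kappa>' x y) (Y.CM.mball (Y.pt 0 0) r)"
      using Y.independent_cocycles[OF fin _ I] by blast
    have card: "CARD('k) ^ card ?J < card (PiE ?I (\<lambda>_. UNIV :: 'k set))"
      unfolding Y.card_functions[OF fin] KJ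
      using neg prime_gt_1_nat[OF X.prime_card] by (intro power_strict_increasing) auto
    have "L * r > 0" using L r by simp
    from X.exact_difference_on_balls[of "\<lambda>\<kappa> x y. c \<kappa> (f x) (f y)", OF local_cocycle_pullback[OF cont_f c(1)] this g(1)[OF Y.pt_base] fin card]
    obtain \<kappa> \<kappa>' where \<kappa>: "\<kappa> \<in> PiE ?I (\<lambda>_. UNIV)" "\<kappa>' \<in> PiE ?I (\<lambda>_. UNIV)" "\<kappa> \<noteq> \<kappa>'"
      and ex: "exact_on X.CM.mtopology (\<lambda>x y. c \<kappa> (f x) (f y) - c \<kappa>' (f x) (f y)) (X.CM.mball (g (Y.pt 0 0)) (L * r))" by blast
    have "exact_on Y.CM.mtopology (\<lambda>x y. c \<kappa> (f (g x)) (f (g y)) - c \<kappa>' (f (g x)) (f (g y))) (Y.CM.mball (Y.pt 0 0) r)"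
    proof (rule exact_on_pullback[OF cont_g ex])
      fix y assume "y \<in> Y.CM.mball (Y.pt 0 0) r"
      hence y: "y \<in> Y.Cone" "Y.cd (Y.pt 0 0) y < r" by (auto simp: Y.CM.in_mball)
      have "X.cd (g (Y.pt 0 0)) (g y) \<le> L * Y.cd (Y.pt 0 0) y" by (rule gL[OF Y.pt_base y(1)])
      also have "\<dots> < L * r" using y(2) L by simp
      finally show "g y \<in> X.CM.mball (g (Y.pt 0 0)) (L * r)" using g(1) y(1) Y.pt_base by (simp add: X.CM.in_mball)
    qed (simp add: Y.CM.mball_subset_mspace)
    hence "exact_on Y.CM.mtopology (\<lambda>x y. c \<kappa> x y - c \<kappa>' x y) (Y.CM.mball (Y.pt 0 0) r)"
      by (rule exact_on_cong) (simp add: Y.CM.in_mball g(2))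
    thus False using c(2)[OF \<kappa>] by blast
  qed
  thus ?thesis using K by blast
qed

text \<open>The same with whole cones: a finite set $A$ gives only finitely many classes.\<close>

lemma card_le_if_homeomorphic:
  fixes S :: "'k::field poly fract mat set set"
  assumes X: "sparse_cone S A B" and Y: "sparse_cone S A' B" and fin: "finite A" "finite A'"
    and hom: "group_cones_homeomorphic Gam_sparse S (omega A) (omega A')"
  shows "card A' \<le> card A"
proof (rule ccontr)
  assume neg: "\<not> ?thesis"
  interpret X: sparse_cone S A B by (rule X)
  interpret Y: sparse_cone S A' B by (rule Y)
  obtain f g where fg: "homeomorphic_maps X.CM.mtopology Y.CM.mtopology f g"
    using hom unfolding group_cones_homeomorphic_def group_cone_def group_cone_dist_def homeomorphic_space_def by blast
  hence cont: "continuous_map X.CM.mtopology Y.CM.mtopology f" "continuous_map Y.CM.mtopology X.CM.mtopology g"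
    and inv: "\<And>y. y \<in> Y.Cone \<Longrightarrow> f (g y) = y"
    by (auto simp: homeomorphic_maps_def)
  have gM: "g y \<in> X.Cone" if "y \<in> Y.Cone" for y using cont(2) that by (auto simp: continuous_map_def)
  define r where "r = 60 * real (5 * B) * (\<Sum>i\<in>A'. fact (i + 1)) + 1"
  have I: "60 * real (5 * B) * fact (i + 1) < r" if "i \<in> A'" for i
  proof -
    have "fact (i + 1) \<le> (\<Sum>i\<in>A'. fact (i + 1) :: real)" using that fin(2) by (intro member_le_sum) auto
    hence "60 * real (5 * B) * fact (i + 1) \<le> 60 * real (5 * B) * (\<Sum>i\<in>A'. fact (i + 1))" by (intro mult_left_mono) auto
    thus ?thesis unfolding r_def by linarith
  qed
  obtain c :: "(nat \<Rightarrow> 'k) \<Rightarrow> 'k cone_point \<Rightarrow> 'k cone_point \<Rightarrow> 'k"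
    where c: "\<And>\<kappa>. local_cocycle Y.CM.mtopology (c \<kappa>)"
      "\<And>\<kappa> \<kappa>'. \<kappa> \<in> PiE A' (\<lambda>_. UNIV) \<Longrightarrow> \<kappa>' \<in> PiE A' (\<lambda>_. UNIV) \<Longrightarrow> \<kappa> \<noteq> \<kappa>' \<Longrightarrow>
         \<not> exact_on Y.CM.mtopology (\<lambda>x y. c \<kappa> x y - c \<kappa>' x y) (Y.CM.mball (Y.pt 0 0) r)"
    using Y.independent_cocycles[OF fin(2) order_refl I] by blast
  have card: "CARD('k) ^ card A < card (PiE A' (\<lambda>_. UNIV :: 'k set))"
    unfolding Y.card_functions[OF fin(2)]
    using neg prime_gt_1_nat[OF X.prime_card] by (intro power_strict_increasing) auto
  from X.exact_difference_globally[of "\<lambda>\<kappa> x y. c \<kappa> (f x) (f y)", OF local_cocycle_pullback[OF cont(1) c(1)] fin(1) card]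
  obtain \<kappa> \<kappa>' where \<kappa>: "\<kappa> \<in> PiE A' (\<lambda>_. UNIV)" "\<kappa>' \<in> PiE A' (\<lambda>_. UNIV)" "\<kappa> \<noteq> \<kappa>'"
    and ex: "exact_on X.CM.mtopology (\<lambda>x y. c \<kappa> (f x) (f y) - c \<kappa>' (f x) (f y)) X.Cone" by blast
  have "exact_on Y.CM.mtopology (\<lambda>x y. c \<kappa> (f (g x)) (f (g y)) - c \<kappa>' (f (g x)) (f (g y))) Y.Cone"
    by (rule exact_on_pullback[OF cont(2) ex gM]) simp_all
  hence "exact_on Y.CM.mtopology (\<lambda>x y. c \<kappa> x y - c \<kappa>' x y) Y.Cone"
    by (rule exact_on_cong) (simp add: inv)
  hence "exact_on Y.CM.mtopology (\<lambda>x y. c \<kappa> x y - c \<kappa>' x y) (Y.CM.mball (Y.pt 0 0) r)"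
    by (rule exact_on_subset) (rule Y.CM.mball_subset_mspace)
  thus False using c(2)[OF \<kappa>] by blast
qed

section \<open>Non-equivalent cones\<close>

lemma central_quotient_sparse: "finite (UNIV :: 'k::field set) \<Longrightarrow> central_quotient (sparse_polys :: 'k poly set)"
  by unfold_locales (rule sparse_polys_zero sparse_polys_diff | assumption)+

lemma sparse_cone_exists:
  fixes S :: "'k::field poly fract mat set set"
  assumes p: "prime CARD('k)" and S: "finite_generating_set (central_quotient.Gam (sparse_polys :: 'k poly set)) S"
  shows "\<exists>B. \<forall>A. sparse_cone S A B"
proof -
  have fin: "finite (UNIV :: 'k set)" using p by (metis card.infinite not_prime_0)
  interpret C: central_quotient "sparse_polys :: 'k poly set" by (rule central_quotient_sparse[OF fin])
  show ?thesis
  proof (rule C.word_length_estimates[OF S])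
    fix B assume B: "B \<ge> 1"
      "\<And>x m. inG x \<Longrightarrow> (\<And>w. NB w (int m) x) \<Longrightarrow> word_length C.Gam S (C.proj x) \<le> B * (m + 1)"
      "\<And>x n. inG x \<Longrightarrow> word_length C.Gam S (C.proj x) \<le> n \<Longrightarrow> \<exists>f\<in>sparse_polys. \<forall>w. NB w (int (B * n)) (tmul x (C.zt f))"
    have "sparse_cone S A B" for A
    proof -
      have "quotient_cone sparse_polys S (omega A) B"
        by unfold_locales (fact S omega_ultrafilter B)+
      thus ?thesis using p by (simp add: sparse_cone_def sparse_cone_axioms_def)
    qed
    thus ?thesis by blast
  qed
qed

lemma bilipschitz_inverse:
  assumes "bilipschitz_homeomorphic M d M' d'"
  obtains f g L where "L \<ge> (1 :: real)" "\<And>x. x \<in> M \<Longrightarrow> f x \<in> M' \<and> g (f x) = x" "\<And>y. y \<in> M' \<Longrightarrow> g y \<in> M \<and> f (g y) = y"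
    "\<And>x x'. x \<in> M \<Longrightarrow> x' \<in> M \<Longrightarrow> d' (f x) (f x') \<le> L * d x x'"
    "\<And>y y'. y \<in> M' \<Longrightarrow> y' \<in> M' \<Longrightarrow> d (g y) (g y') \<le> L * d' y y'"
proof -
  obtain f L where f: "bij_betw f M M'" and L: "L \<ge> 1"
    and D: "\<And>x y. x \<in> M \<Longrightarrow> y \<in> M \<Longrightarrow> d x y / L \<le> d' (f x) (f y) \<and> d' (f x) (f y) \<le> L * d x y"
    using assms unfolding bilipschitz_homeomorphic_def by blast
  let ?g = "inv_into M f"
  have fg: "?g y \<in> M \<and> f (?g y) = y" if "y \<in> M'" for y
    using that f by (auto simp: bij_betw_def inv_into_into f_inv_into_f)
  show ?thesis
  proof (rule that[OF L, of f ?g])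
    show "f x \<in> M' \<and> ?g (f x) = x" if "x \<in> M" for x using that f by (auto simp: bij_betw_def)
    show "?g y \<in> M \<and> f (?g y) = y" if "y \<in> M'" for y by (rule fg[OF that])
    show "d' (f x) (f x') \<le> L * d x x'" if "x \<in> M" "x' \<in> M" for x x' using D[OF that] by blast
    show "d (?g y) (?g y') \<le> L * d' y y'" if "y \<in> M'" "y' \<in> M'" for y y'
    proof -
      have "d (?g y) (?g y') / L \<le> d' (f (?g y)) (f (?g y'))" using D fg that by blast
      thus ?thesis using fg[OF that(1)] fg[OF that(2)] L by (simp add: field_simps)
    qed
  qed
qed

text \<open>Once $i$ is large compared with $K$, the factor $K$ no longer reaches the next factorial.\<close>

lemma bounded_counts:
  assumes K: "\<And>\<rho>. \<rho> > 0 \<Longrightarrow> card {i \<in> A'. fact (i + 1) \<le> \<rho>} \<le> card {i \<in> A. fact (i + 1) \<le> K * (\<rho> + 1 :: real)}"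
    and i: "real i \<ge> 2 * K" "K > 0"
  shows "card (A' \<inter> {..i}) \<le> card (A \<inter> {..i})"
proof -
  have f: "fact (j + 1) \<le> (fact (i + 1) :: real)" if "j \<le> i" for j using that by (intro fact_mono) auto
  have "{j \<in> A. fact (j + 1) \<le> K * (fact (i + 1) + 1)} \<subseteq> A \<inter> {..i}"
  proof
    fix j assume j: "j \<in> {j \<in> A. fact (j + 1) \<le> K * (fact (i + 1) + 1 :: real)}"
    have "j \<le> i"
    proof (rule ccontr)
      assume "\<not> j \<le> i"
      hence "fact (i + 2) \<le> (fact (j + 1) :: real)" by (intro fact_mono) auto
      also have "\<dots> \<le> K * (fact (i + 1) + 1)" using j by blast
      also have "\<dots> \<le> K * (2 * fact (i + 1))" using i(2) fact_ge_1[of "i + 1", where 'a = real] by (intro mult_left_mono) linarith+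
      also have "\<dots> = 2 * K * fact (i + 1)" by simp
      also have "\<dots> < real (i + 2) * fact (i + 1)" using i(1) by (intro mult_strict_right_mono) (linarith, rule fact_gt_zero)
      also have "\<dots> = fact (i + 2)" by (simp add: numeral_2_eq_2)
      finally show False by simp
    qed
    thus "j \<in> A \<inter> {..i}" using j by blast
  qed
  moreover have "A' \<inter> {..i} \<subseteq> {j \<in> A'. fact (j + 1) \<le> (fact (i + 1) :: real)}" using f by blast
  moreover have "finite {j \<in> A'. fact (j + 1) \<le> (fact (i + 1) :: real)}"
  proof (rule finite_subset)
    show "{j \<in> A'. fact (j + 1) \<le> (fact (i + 1) :: real)} \<subseteq> {..i}"
    proof
      fix j assume "j \<in> {j \<in> A'. fact (j + 1) \<le> (fact (i + 1) :: real)}"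
      hence "\<not> fact (i + 1) < (fact (j + 1) :: real)" by simp
      hence "\<not> i + 1 < j + 1" using fact_less_mono[of "i + 1" "j + 1", where 'a = real] by auto
      thus "j \<in> {..i}" by simp
    qed
  qed simp
  ultimately have "card (A' \<inter> {..i}) \<le> card {j \<in> A'. fact (j + 1) \<le> (fact (i + 1) :: real)}"
    "card {j \<in> A. fact (j + 1) \<le> K * (fact (i + 1) + 1)} \<le> card (A \<inter> {..i})"
    by (auto intro!: card_mono simp del: fact_Suc)
  thus ?thesis using K[of "fact (i + 1)"] fact_gt_zero[of "i + 1", where 'a = real] by linarith
qed

lemma same_counts_eventually_equal:
  assumes "\<And>i. i \<ge> n \<Longrightarrow> card (A \<inter> {..i}) = card (A' \<inter> {..i :: nat})" "i > n"
  shows "i \<in> A \<longleftrightarrow> i \<in> A'"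
proof -
  obtain j where j: "i = Suc j" "j \<ge> n" using assms(2) by (cases i) auto
  have "card (C \<inter> {..Suc j}) = card (C \<inter> {..j}) + (if Suc j \<in> C then 1 else 0)" for C :: "nat set"
  proof -
    have "C \<inter> {..Suc j} = (if Suc j \<in> C then insert (Suc j) (C \<inter> {..j}) else C \<inter> {..j})"
      by (auto simp: le_Suc_eq)
    thus ?thesis by (simp split: if_splits)
  qed
  thus ?thesis using assms(1)[of j] assms(1)[of "Suc j"] j by (auto split: if_splits)
qed

text \<open>Distinct sets become sets with infinite symmetric difference.\<close>

definition spread :: "nat set \<Rightarrow> nat set" where
  "spread X = {prod_encode (a, l) | a l. a \<in> X}"

lemma spread_inj:
  assumes "\<And>i. i > n \<Longrightarrow> i \<in> spread X \<longleftrightarrow> i \<in> spread Y" shows "X = Y"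
proof -
  have "a \<in> X \<longleftrightarrow> a \<in> Y" for a
  proof -
    have "prod_encode (a, Suc n) > n" using le_prod_encode_2[of "Suc n" a] by simp
    moreover have "prod_encode (a, Suc n) \<in> spread Z \<longleftrightarrow> a \<in> Z" for Z by (auto simp: spread_def)
    ultimately show ?thesis using assms by blast
  qed
  thus ?thesis by blast
qed

lemma not_bilipschitz:
  fixes S :: "'k::field poly fract mat set set"
  assumes cone: "\<And>A. sparse_cone S A B" and bil: "group_cones_bilipschitz (central_quotient.Gam sparse_polys) S (omega (spread X)) (omega (spread Y))"
  shows "X = Y"
proof (rule bilipschitz_inverse[OF bil[unfolded group_cones_bilipschitz_def]])
  fix f g and L :: real
  assume L: "L \<ge> 1"
    and f: "\<And>x. x \<in> group_cone Gam_sparse S (omega (spread X)) \<Longrightarrow> f x \<in> group_cone Gam_sparse S (omega (spread Y)) \<and> g (f x) = x"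
    and g: "\<And>y. y \<in> group_cone Gam_sparse S (omega (spread Y)) \<Longrightarrow> g y \<in> group_cone Gam_sparse S (omega (spread X)) \<and> f (g y) = y"
    and fL: "\<And>x x'. x \<in> group_cone Gam_sparse S (omega (spread X)) \<Longrightarrow> x' \<in> group_cone Gam_sparse S (omega (spread X)) \<Longrightarrow>
       group_cone_dist Gam_sparse S (omega (spread Y)) (f x) (f x') \<le> L * group_cone_dist Gam_sparse S (omega (spread X)) x x'"
    and gL: "\<And>y y'. y \<in> group_cone Gam_sparse S (omega (spread Y)) \<Longrightarrow> y' \<in> group_cone Gam_sparse S (omega (spread Y)) \<Longrightarrow>
       group_cone_dist Gam_sparse S (omega (spread X)) (g y) (g y') \<le> L * group_cone_dist Gam_sparse S (omega (spread Y)) y y'"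
  have "\<exists>K>0. \<forall>\<rho>>0. card {i \<in> spread Y. fact (i + 1) \<le> \<rho>} \<le> card {i \<in> spread X. fact (i + 1) \<le> K * (\<rho> + 1 :: real)}"
    by (rule card_le_if_bilipschitz[OF cone cone conjunct1[OF f] g L fL gL])
  then obtain K where K: "K > 0" "\<And>\<rho>. \<rho> > 0 \<Longrightarrow> card {i \<in> spread Y. fact (i + 1) \<le> \<rho>} \<le> card {i \<in> spread X. fact (i + 1) \<le> K * (\<rho> + 1 :: real)}"
    by blast
  have "\<exists>K>0. \<forall>\<rho>>0. card {i \<in> spread X. fact (i + 1) \<le> \<rho>} \<le> card {i \<in> spread Y. fact (i + 1) \<le> K * (\<rho> + 1 :: real)}"
    by (rule card_le_if_bilipschitz[OF cone cone conjunct1[OF g] f L gL fL])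
  then obtain K' where K': "K' > 0" "\<And>\<rho>. \<rho> > 0 \<Longrightarrow> card {i \<in> spread X. fact (i + 1) \<le> \<rho>} \<le> card {i \<in> spread Y. fact (i + 1) \<le> K' * (\<rho> + 1 :: real)}"
    by blast
  define n where "n = nat \<lceil>2 * (K + K')\<rceil>"
  have counts: "card (spread X \<inter> {..i}) = card (spread Y \<inter> {..i})" if "i \<ge> n" for i
  proof -
    have "2 * (K + K') \<le> real n" unfolding n_def by (rule real_nat_ceiling_ge)
    also have "real n \<le> real i" using that by simp
    finally have i: "real i \<ge> 2 * K" "real i \<ge> 2 * K'" using K(1) K'(1) by simp_all
    show ?thesis
      by (rule antisym[OF bounded_counts[OF K'(2) i(2) K'(1)] bounded_counts[OF K(2) i(1) K(1)]])
  qed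
  have "i \<in> spread X \<longleftrightarrow> i \<in> spread Y" if "i > n" for i
    using counts that by (rule same_counts_eventually_equal)
  thus ?thesis by (rule spread_inj)
qed

lemma distinct_images:
  fixes h :: "'a \<Rightarrow> 'b"
  assumes sep: "\<And>x y. R (h x) (h y) \<Longrightarrow> x = y" and refl: "\<And>x. R (h x) (h x)"
  shows "(UNIV :: 'a set) \<lesssim> range h \<and> pairwise (\<lambda>u v. \<not> R u v) (range h)"
proof
  have "inj h"
  proof (rule injI)
    fix x y assume "h x = h y"
    hence "R (h x) (h y)" using refl[of x] by simp
    thus "x = y" by (rule sep)
  qed
  thus "(UNIV :: 'a set) \<lesssim> range h" unfolding lepoll_def by blast
  show "pairwise (\<lambda>u v. \<not> R u v) (range h)" unfolding pairwise_def using sep by blast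
qed

theorem corollary1p10:
  fixes p :: nat
  assumes "prime p" and "CARD('k::field) = p"
  shows "\<exists>Z \<Gamma>. central_subgroup Z (A4 (laurent_ring :: 'k poly fract set))
    \<and> \<Gamma> = A4 (laurent_ring :: 'k poly fract set) Mod Z
    \<and> finitely_generated_group \<Gamma>
    \<and> nilpotent_by_abelian 3 \<Gamma>
    \<and> (\<forall>S. finite_generating_set \<Gamma> S \<longrightarrow>
        (\<exists>W. (\<forall>\<omega>\<in>W. nonprincipal_ultrafilter_on {0<..} \<omega>)
             \<and> (UNIV :: nat set set) \<lesssim> W
             \<and> pairwise (\<lambda>\<omega> \<omega>'. \<not> group_cones_bilipschitz \<Gamma> S \<omega> \<omega>') W)
      \<and> (\<exists>W. (\<forall>\<omega>\<in>W. nonprincipal_ultrafilter_on {0<..} \<omega>)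
             \<and> (UNIV :: nat set) \<lesssim> W
             \<and> pairwise (\<lambda>\<omega> \<omega>'. \<not> group_cones_homeomorphic \<Gamma> S \<omega> \<omega>') W))"
proof -
  have prime: "prime CARD('k)" using assms by simp
  hence fin: "finite (UNIV :: 'k set)" by (metis card.infinite not_prime_0)
  interpret C: central_quotient "sparse_polys :: 'k poly set" by (rule central_quotient_sparse[OF fin])
  have cones: "(\<exists>W. (\<forall>\<omega>\<in>W. nonprincipal_ultrafilter_on {0<..} \<omega>) \<and> (UNIV :: nat set set) \<lesssim> W
             \<and> pairwise (\<lambda>\<omega> \<omega>'. \<not> group_cones_bilipschitz C.Gam S \<omega> \<omega>') W)
      \<and> (\<exists>W. (\<forall>\<omega>\<in>W. nonprincipal_ultrafilter_on {0<..} \<omega>) \<and> (UNIV :: nat set) \<lesssim> W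
             \<and> pairwise (\<lambda>\<omega> \<omega>'. \<not> group_cones_homeomorphic C.Gam S \<omega> \<omega>') W)"
    if S: "finite_generating_set C.Gam S" for S
  proof -
    obtain B where B: "\<And>A. sparse_cone S A B" using sparse_cone_exists[OF prime S] by blast
    have 1: "(UNIV :: nat set set) \<lesssim> range (\<lambda>X. omega (spread X)) \<and>
      pairwise (\<lambda>\<omega> \<omega>'. \<not> group_cones_bilipschitz C.Gam S \<omega> \<omega>') (range (\<lambda>X. omega (spread X)))"
    proof (rule distinct_images)
      show "X = Y" if "group_cones_bilipschitz C.Gam S (omega (spread X)) (omega (spread Y))" for X Y
        by (rule not_bilipschitz[OF B that])
      show "group_cones_bilipschitz C.Gam S (omega (spread X)) (omega (spread X))" for X
        unfolding group_cones_bilipschitz_def bilipschitz_homeomorphic_def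
        by (rule exI[of _ id], rule exI[of _ 1]) simp
    qed
    have hom: "k = l" if "group_cones_homeomorphic C.Gam S (omega {..<k}) (omega {..<l})" for k l :: nat
    proof -
      have "group_cones_homeomorphic C.Gam S (omega {..<l}) (omega {..<k})"
        using that unfolding group_cones_homeomorphic_def by (rule homeomorphic_space_sym[THEN iffD1])
      hence "card {..<k} \<le> card {..<l}" by (rule card_le_if_homeomorphic[OF B B finite_lessThan finite_lessThan])
      moreover have "card {..<l} \<le> card {..<k}" by (rule card_le_if_homeomorphic[OF B B finite_lessThan finite_lessThan that])
      ultimately show ?thesis by simp
    qed
    have 2: "(UNIV :: nat set) \<lesssim> range (\<lambda>k. omega {..<k}) \<and>
      pairwise (\<lambda>\<omega> \<omega>'. \<not> group_cones_homeomorphic C.Gam S \<omega> \<omega>') (range (\<lambda>k. omega {..<k}))"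
    proof (rule distinct_images)
      show "k = l" if "group_cones_homeomorphic C.Gam S (omega {..<k}) (omega {..<l})" for k l by (rule hom[OF that])
      show "group_cones_homeomorphic C.Gam S (omega {..<k}) (omega {..<k})" for k
        unfolding group_cones_homeomorphic_def by (rule homeomorphic_space_refl)
    qed
    have nonprincipal: "\<forall>\<omega>\<in>range (\<lambda>x. omega (h x)). nonprincipal_ultrafilter_on {0<..} \<omega>" for h :: "'a \<Rightarrow> nat set"
      using omega_ultrafilter by blast
    show ?thesis
    proof (rule conjI)
      show "\<exists>W. (\<forall>\<omega>\<in>W. nonprincipal_ultrafilter_on {0<..} \<omega>) \<and> (UNIV :: nat set set) \<lesssim> W
             \<and> pairwise (\<lambda>\<omega> \<omega>'. \<not> group_cones_bilipschitz C.Gam S \<omega> \<omega>') W"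
        by (rule exI, rule conjI[OF nonprincipal 1])
      show "\<exists>W. (\<forall>\<omega>\<in>W. nonprincipal_ultrafilter_on {0<..} \<omega>) \<and> (UNIV :: nat set) \<lesssim> W
             \<and> pairwise (\<lambda>\<omega> \<omega>'. \<not> group_cones_homeomorphic C.Gam S \<omega> \<omega>') W"
        by (rule exI, rule conjI[OF nonprincipal 2])
    qed
  qed
  have all: "\<forall>S. finite_generating_set C.Gam S \<longrightarrow> (\<exists>W. (\<forall>\<omega>\<in>W. nonprincipal_ultrafilter_on {0<..} \<omega>) \<and> (UNIV :: nat set set) \<lesssim> W
             \<and> pairwise (\<lambda>\<omega> \<omega>'. \<not> group_cones_bilipschitz C.Gam S \<omega> \<omega>') W)
      \<and> (\<exists>W. (\<forall>\<omega>\<in>W. nonprincipal_ultrafilter_on {0<..} \<omega>) \<and> (UNIV :: nat set) \<lesssim> W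
             \<and> pairwise (\<lambda>\<omega> \<omega>'. \<not> group_cones_homeomorphic C.Gam S \<omega> \<omega>') W)"
    by (rule allI, rule impI, rule cones)
  have fg: "finitely_generated_group C.Gam"
    using C.Gam_finitely_generated C.GG.group_axioms unfolding finitely_generated_group_def by blast
  show ?thesis
    by (rule exI[of _ C.ZM], rule exI[of _ C.Gam],
        rule conjI[OF C.ZM_central conjI[OF C.Gam_def conjI[OF fg conjI[OF C.Gam_nilpotent_by_abelian all]]]])
qed

end
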